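(* Let $N\ge2$, let $\mathbf k=(k_1,\dots,k_N)$ be positive integers, let $F\subseteq\mathcal E_N$, and suppose $\mathcal T_F(\mathbf k)\cap\mathbb R_{>0}^F\neq\varnothing$. (i) The capacity has the entropy representation $$\log\operatorname{cap}_{\mathbf k}(F)=\max_{p\in\mathcal T_F(\mathbf k)}\sum_{i=1}^Nk_iH(q_i(p)).$$ The maximizing flow $p^*$ is unique and positive on every edge of $F$. The infimum defining $\operatorname{cap}_{\mathbf k}(F)$ is attained at a vector $z^*>0$, unique up to multiplication by an independent positive scalar on the right vertex set of each connected component of $\mathcal B(F)$, and $$p^*_{ji}=\frac{k_iz^*_j}{L_i^F(z^* )}\qquad(j\to i\in F).$$ (ii) The reduced covariance matrix $\widehat\Sigma=\widehat\Sigma(p^* )$ is positive definite, its determinant is independent of the deleted right vertices, and, as $m\to\infty$, $$\mathcal D_{m\mathbf k}(F)\sim\frac{\operatorname{cap}_{\mathbf k}(F)^m}{(2\pi m)^{(N-c(F))/2}\sqrt{\det\widehat\Sigma}}.$$ (iii) Exact-support factors asymptotically carry the entire degree: as $m\to\infty$, $$\frac{\mu_{m\mathbf k}(F)}{\mathcal D_{m\mathbf k}(F)}\longrightarrow1.$$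
   Context: Let $[N]=\{1,\dots,N\}$ and $\mathcal E_N=\{(j,i):1\le i,j\le N,\ j\ne i\}$, with $(j,i)$ written $j\to i$; $B_i(F)=\{j:j\to i\in F\}$. $\mathcal T_F(\mathbf k)=\{a\in\mathbb R_{\ge0}^F:\ \sum_{j:j\to i\in F}a_{ji}=k_i\ \forall i,\ \sum_{i:j\to i\in F}a_{ji}=k_j\ \forall j\}$. $\mathcal B(F)$ is the bipartite graph with left vertices $i_L$, right vertices $j_R$ ($i,j\in[N]$) and an edge $i_Lj_R$ for each $j\to i\in F$; $c(F)$ is its number of connected components. $L_i^F(z)=\sum_{j:j\to i\in F}z_j$ and $\operatorname{cap}_{\mathbf k}(F)=\inf_{z\in\mathbb R_{>0}^N}\prod_{i=1}^NL_i^F(z)^{k_i}\big/\prod_{j=1}^Nz_j^{k_j}$. For $p\in\mathcal T_F(\mathbf k)$: $q_{ji}(p)=p_{ji}/k_i$, $H(q_i(p))=-\sum_{j:j\to i\in F}q_{ji}(p)\log q_{ji}(p)$ with $0\log0=0$. Extend $q_i(p)$ by zero to a vector in $\mathbb R^N$ and set $\Sigma(p)=\sum_{i=1}^Nk_i\bigl(\operatorname{Diag}(q_i(p))-q_i(p)q_i(p)^{\mathsf T}\bigr)$. Choose one right vertex in each connected component of $\mathcal B(F)$; $\widehat\Sigma(p)$ is the principal submatrix of $\Sigma(p)$ obtained by deleting the rows and columns of the chosen indices. The determinant of the empty matrix is $1$. Balanced factors: $a\in\mathbb Z_{\ge0}^{\mathcal E_N}$ with $\sum_{j\ne i}a_{ji}=k_i$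 for all $i$ and $\sum_{i\ne j}a_{ji}=k_j$ for all $j$; $\mu_{\mathbf k}(F)$ is the sum of $w_{\mathbf k}(a)=\prod_{i=1}^N\frac{k_i!}{\prod_{j\ne i}a_{ji}!}$ over those $a$ with $\{(j,i):a_{ji}>0\}=F$. Algebraic degree. For the graph $([N],F)$, player $i$ has pure strategies $S_i=\{0,\ldots,k_i\}$ and payoff table $u_i(s,\alpha)$, $s\in S_i$, $\alpha\in\prod_{q\in B_i(F)}S_q$. With $d=\sum_ik_i$ variables $x_{q,t}$ ($1\le t\le k_q$) and $x_{q,0}=1-\sum_{t\ge1}x_{q,t}$, the indifference system is $f_{i,s}(x)=\sum_\alpha(u_i(s,\alpha)-u_i(0,\alpha))\prod_{q\in B_i(F)}x_{q,\alpha_q}=0$ ($1\le i\le N$, $1\le s\le k_i$). $\mathcal D_{\mathbf k}(F)$ is the number of isolated solutions in $(\mathbb C^* )^d$, counted with multiplicity, for generic coefficients (a nonempty Zariski-open set of payoff tables). It equals $[z^{\mathbf k}]\prod_{i=1}^N L_i^F(z)^{k_i}$, the coefficient of $z_1^{k_1}\cdots z_N^{k_N}$. *)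

theory Defs
  imports
    "HOL-Analysis.Analysis"
    "HOL-Library.Landau_Symbols"
    "Jordan_Normal_Form.Determinant"
begin

text \<open>Vertices are the naturals in \<open>{1..N}\<close>; the arc \<open>j \<rightarrow> i\<close> is the pair \<open>(j, i)\<close>.
  Vectors over \<open>[N]\<close> that only occur through their entries on \<open>[N]\<close> (such as \<open>k\<close> and \<open>z\<close>)
  are arbitrary functions on \<open>nat\<close>; whenever equality of vectors matters, extensional
  functions on the index set are used.\<close>

definition arcs :: "nat \<Rightarrow> (nat \<times> nat) set" where
  "arcs N = {(j, i). j \<in> {1..N} \<and> i \<in> {1..N} \<and> j \<noteq> i}"

definition in_nbrs :: "(nat \<times> nat) set \<Rightarrow> nat \<Rightarrow> nat set" where
  "in_nbrs F i = {j. (j, i) \<in> F}"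

definition out_nbrs :: "(nat \<times> nat) set \<Rightarrow> nat \<Rightarrow> nat set" where
  "out_nbrs F j = {i. (j, i) \<in> F}"

section \<open>Flows, entropy and covariance\<close>

definition flow_polytope :: "nat \<Rightarrow> (nat \<Rightarrow> nat) \<Rightarrow> (nat \<times> nat) set \<Rightarrow> (nat \<times> nat \<Rightarrow> real) set" where
  "flow_polytope N k F = {a \<in> F \<rightarrow>\<^sub>E {0..}.
     (\<forall>i\<in>{1..N}. (\<Sum>j\<in>in_nbrs F i. a (j, i)) = real (k i)) \<and>
     (\<forall>j\<in>{1..N}. (\<Sum>i\<in>out_nbrs F j. a (j, i)) = real (k j))}"

text \<open>The vector \<open>q\<^sub>i(p)\<close>, extended by zero off the in-neighbours of \<open>i\<close>.\<close>

definition flow_row :: "(nat \<Rightarrow> nat) \<Rightarrow> (nat \<times> nat) set \<Rightarrow> (nat \<times> nat \<Rightarrow> real) \<Rightarrow> nat \<Rightarrow> nat \<Rightarrow> real" where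
  "flow_row k F p i j = (if (j, i) \<in> F then p (j, i) / real (k i) else 0)"

text \<open>The convention \<open>0 log 0 = 0\<close> holds because the summand has the factor \<open>0\<close>.\<close>

definition row_entropy :: "(nat \<Rightarrow> nat) \<Rightarrow> (nat \<times> nat) set \<Rightarrow> (nat \<times> nat \<Rightarrow> real) \<Rightarrow> nat \<Rightarrow> real" where
  "row_entropy k F p i = - (\<Sum>j\<in>in_nbrs F i. flow_row k F p i j * ln (flow_row k F p i j))"

definition flow_entropy :: "nat \<Rightarrow> (nat \<Rightarrow> nat) \<Rightarrow> (nat \<times> nat) set \<Rightarrow> (nat \<times> nat \<Rightarrow> real) \<Rightarrow> real" where
  "flow_entropy N k F p = (\<Sum>i\<in>{1..N}. real (k i) * row_entropy k F p i)"

definition flow_cov :: "nat \<Rightarrow> (nat \<Rightarrow> nat) \<Rightarrow> (nat \<times> nat) set \<Rightarrow> (nat \<times> nat \<Rightarrow> real) \<Rightarrow> nat \<Rightarrow> nat \<Rightarrow> real" where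
  "flow_cov N k F p a b = (\<Sum>i\<in>{1..N}. real (k i) *
     ((if a = b then flow_row k F p i a else 0) - flow_row k F p i a * flow_row k F p i b))"

definition principal_submatrix :: "(nat \<Rightarrow> nat \<Rightarrow> real) \<Rightarrow> nat set \<Rightarrow> real Matrix.mat" where
  "principal_submatrix A S = Matrix.mat (card S) (card S)
     (\<lambda>(a, b). A (sorted_list_of_set S ! a) (sorted_list_of_set S ! b))"

definition reduced_cov ::
  "nat \<Rightarrow> (nat \<Rightarrow> nat) \<Rightarrow> (nat \<times> nat) set \<Rightarrow> (nat \<times> nat \<Rightarrow> real) \<Rightarrow> nat set \<Rightarrow> real Matrix.mat" where
  "reduced_cov N k F p R = principal_submatrix (flow_cov N k F p) ({1..N} - R)"

definition reduced_cov_det ::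
  "nat \<Rightarrow> (nat \<Rightarrow> nat) \<Rightarrow> (nat \<times> nat) set \<Rightarrow> (nat \<times> nat \<Rightarrow> real) \<Rightarrow> nat set \<Rightarrow> real" where
  "reduced_cov_det N k F p R = Determinant.det (reduced_cov N k F p R)"

definition pos_definite :: "real Matrix.mat \<Rightarrow> bool" where
  "pos_definite A \<longleftrightarrow> square_mat A \<and> transpose_mat A = A \<and>
     (\<forall>v\<in>carrier_vec (dim_row A). v \<noteq> 0\<^sub>v (dim_row A) \<longrightarrow> 0 < scalar_prod v (A *\<^sub>v v))"

section \<open>The bipartite graph\<close>

text \<open>\<open>Inl i\<close> is the left vertex \<open>i\<^sub>L\<close> and \<open>Inr j\<close> the right vertex \<open>j\<^sub>R\<close>.\<close>

definition bip_vertices :: "nat \<Rightarrow> (nat + nat) set" where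
  "bip_vertices N = Inl ` {1..N} \<union> Inr ` {1..N}"

definition bip_adj :: "(nat \<times> nat) set \<Rightarrow> ((nat + nat) \<times> (nat + nat)) set" where
  "bip_adj F = {(Inl i, Inr j) | i j. (j, i) \<in> F} \<union> {(Inr j, Inl i) | i j. (j, i) \<in> F}"

definition bip_components :: "nat \<Rightarrow> (nat \<times> nat) set \<Rightarrow> (nat + nat) set set" where
  "bip_components N F =
     bip_vertices N // ((bip_adj F)\<^sup>* \<inter> bip_vertices N \<times> bip_vertices N)"

definition num_components :: "nat \<Rightarrow> (nat \<times> nat) set \<Rightarrow> nat" where
  "num_components N F = card (bip_components N F)"

definition right_transversal :: "nat \<Rightarrow> (nat \<times> nat) set \<Rightarrow> nat set \<Rightarrow> bool" where
  "right_transversal N F R \<longleftrightarrow>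
     R \<subseteq> {1..N} \<and> (\<forall>C\<in>bip_components N F. \<exists>!j. j \<in> R \<and> Inr j \<in> C)"

section \<open>Capacity\<close>

definition lin_form :: "(nat \<times> nat) set \<Rightarrow> (nat \<Rightarrow> real) \<Rightarrow> nat \<Rightarrow> real" where
  "lin_form F z i = (\<Sum>j\<in>in_nbrs F i. z j)"

definition pos_vectors :: "nat \<Rightarrow> (nat \<Rightarrow> real) set" where
  "pos_vectors N = {z. \<forall>j\<in>{1..N}. 0 < z j}"

definition cap_quotient :: "nat \<Rightarrow> (nat \<Rightarrow> nat) \<Rightarrow> (nat \<times> nat) set \<Rightarrow> (nat \<Rightarrow> real) \<Rightarrow> real" where
  "cap_quotient N k F z = (\<Prod>i\<in>{1..N}. lin_form F z i ^ k i) / (\<Prod>j\<in>{1..N}. z j ^ k j)"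

definition capacity :: "nat \<Rightarrow> (nat \<Rightarrow> nat) \<Rightarrow> (nat \<times> nat) set \<Rightarrow> real" where
  "capacity N k F = (INF z\<in>pos_vectors N. cap_quotient N k F z)"

definition cap_minimizer :: "nat \<Rightarrow> (nat \<Rightarrow> nat) \<Rightarrow> (nat \<times> nat) set \<Rightarrow> (nat \<Rightarrow> real) \<Rightarrow> bool" where
  "cap_minimizer N k F z \<longleftrightarrow> z \<in> pos_vectors N \<and> cap_quotient N k F z = capacity N k F"

definition component_rescaling :: "nat \<Rightarrow> (nat \<times> nat) set \<Rightarrow> (nat \<Rightarrow> real) \<Rightarrow> (nat \<Rightarrow> real) \<Rightarrow> bool" where
  "component_rescaling N F z z' \<longleftrightarrow>
     (\<exists>c. \<forall>C\<in>bip_components N F. (0::real) < c C \<and>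
        (\<forall>j\<in>{1..N}. Inr j \<in> C \<longrightarrow> z' j = c C * z j))"

section \<open>Balanced factors\<close>

definition balanced_factors :: "nat \<Rightarrow> (nat \<Rightarrow> nat) \<Rightarrow> (nat \<times> nat \<Rightarrow> nat) set" where
  "balanced_factors N k = {a \<in> arcs N \<rightarrow>\<^sub>E UNIV.
     (\<forall>i\<in>{1..N}. (\<Sum>j\<in>{1..N} - {i}. a (j, i)) = k i) \<and>
     (\<forall>j\<in>{1..N}. (\<Sum>i\<in>{1..N} - {j}. a (j, i)) = k j)}"

definition factor_weight :: "nat \<Rightarrow> (nat \<Rightarrow> nat) \<Rightarrow> (nat \<times> nat \<Rightarrow> nat) \<Rightarrow> real" where
  "factor_weight N k a = (\<Prod>i\<in>{1..N}. fact (k i) / (\<Prod>j\<in>{1..N} - {i}. fact (a (j, i))))"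

definition exact_support_weight :: "nat \<Rightarrow> (nat \<Rightarrow> nat) \<Rightarrow> (nat \<times> nat) set \<Rightarrow> real" where
  "exact_support_weight N k F =
     (\<Sum>a \<in> {a \<in> balanced_factors N k. {e \<in> arcs N. 0 < a e} = F}. factor_weight N k a)"

section \<open>Polynomial functions, Zariski-open sets, local multiplicity\<close>

text \<open>Complex polynomials in the variables \<open>X\<^sub>v\<close>, \<open>v \<in> V\<close>, represented by the functions they
  induce (faithfully, the field being infinite).\<close>

inductive_set poly_funs :: "'v set \<Rightarrow> (('v \<Rightarrow> complex) \<Rightarrow> complex) set" for V :: "'v set" where
  const: "(\<lambda>_. c) \<in> poly_funs V"
| var: "v \<in> V \<Longrightarrow> (\<lambda>x. x v) \<in> poly_funs V"
| add: "f \<in> poly_funs V \<Longrightarrow> g \<in> poly_funs V \<Longrightarrow> (\<lambda>x. f x + g x) \<in> poly_funs V"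
| mult: "f \<in> poly_funs V \<Longrightarrow> g \<in> poly_funs V \<Longrightarrow> (\<lambda>x. f x * g x) \<in> poly_funs V"

text \<open>Zariski-open subsets of the affine space of extensional functions on \<open>V\<close>: complements
  of common zero sets.\<close>

definition zariski_open :: "'v set \<Rightarrow> ('v \<Rightarrow> complex) set \<Rightarrow> bool" where
  "zariski_open V U \<longleftrightarrow>
     (\<exists>P\<subseteq>poly_funs V. U = {u \<in> V \<rightarrow>\<^sub>E UNIV. \<exists>f\<in>P. f u \<noteq> 0})"

definition poly_ideal ::
  "'v set \<Rightarrow> 'e set \<Rightarrow> ('e \<Rightarrow> ('v \<Rightarrow> complex) \<Rightarrow> complex) \<Rightarrow> (('v \<Rightarrow> complex) \<Rightarrow> complex) set" where
  "poly_ideal V E f =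
     {g. \<exists>c. (\<forall>e\<in>E. c e \<in> poly_funs V) \<and> g = (\<lambda>x. \<Sum>e\<in>E. c e x * f e x)}"

text \<open>The polynomials lying in the ideal generated by the system in the local ring at \<open>p\<close>.\<close>

definition local_ideal ::
  "'v set \<Rightarrow> 'e set \<Rightarrow> ('e \<Rightarrow> ('v \<Rightarrow> complex) \<Rightarrow> complex) \<Rightarrow> ('v \<Rightarrow> complex)
    \<Rightarrow> (('v \<Rightarrow> complex) \<Rightarrow> complex) set" where
  "local_ideal V E f p = {g \<in> poly_funs V.
     \<exists>h\<in>poly_funs V. h p \<noteq> 0 \<and> (\<lambda>x. h x * g x) \<in> poly_ideal V E f}"

text \<open>The intersection multiplicity at \<open>p\<close>: the complex dimension of the local ring at \<open>p\<close>
  modulo the ideal generated by the system. Elements of the local ring are fractions \<open>g/h\<close> with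
  \<open>h p \<noteq> 0\<close>; after multiplication by a common denominator, which is a unit, a finite family is
  linearly independent modulo the ideal iff its numerators are.\<close>

definition local_multiplicity ::
  "'v set \<Rightarrow> 'e set \<Rightarrow> ('e \<Rightarrow> ('v \<Rightarrow> complex) \<Rightarrow> complex) \<Rightarrow> ('v \<Rightarrow> complex) \<Rightarrow> enat" where
  "local_multiplicity V E f p = Sup {enat n | n. \<exists>g. (\<forall>l<n. g l \<in> poly_funs V) \<and>
     (\<forall>c. (\<lambda>x. \<Sum>l<n. c l * g l x) \<in> local_ideal V E f p \<longrightarrow> (\<forall>l<n. c l = 0))}"

section \<open>The indifference system and the algebraic degree\<close>

definition profiles :: "(nat \<Rightarrow> nat) \<Rightarrow> (nat \<times> nat) set \<Rightarrow> nat \<Rightarrow> (nat \<Rightarrow> nat) set" where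
  "profiles k F i = (\<Pi>\<^sub>E q\<in>in_nbrs F i. {0..k q})"

text \<open>A payoff table is a point \<open>u\<close> of \<open>payoff_index N k F \<rightarrow>\<^sub>E UNIV\<close>, with
  \<open>u (i, s, \<alpha>)\<close> the payoff \<open>u\<^sub>i(s, \<alpha>)\<close>.\<close>

definition payoff_index :: "nat \<Rightarrow> (nat \<Rightarrow> nat) \<Rightarrow> (nat \<times> nat) set \<Rightarrow> (nat \<times> nat \<times> (nat \<Rightarrow> nat)) set" where
  "payoff_index N k F = {(i, s, \<alpha>). i \<in> {1..N} \<and> s \<in> {0..k i} \<and> \<alpha> \<in> profiles k F i}"

text \<open>This set indexes both the unknowns \<open>x\<^bsub>q,t\<^esub>\<close> and the equations \<open>f\<^bsub>i,s\<^esub> = 0\<close>.\<close>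

definition unknowns :: "nat \<Rightarrow> (nat \<Rightarrow> nat) \<Rightarrow> (nat \<times> nat) set" where
  "unknowns N k = {(q, t). q \<in> {1..N} \<and> t \<in> {1..k q}}"

definition strategy_prob :: "(nat \<Rightarrow> nat) \<Rightarrow> (nat \<times> nat \<Rightarrow> complex) \<Rightarrow> nat \<Rightarrow> nat \<Rightarrow> complex" where
  "strategy_prob k x q t = (if t = 0 then 1 - (\<Sum>t'\<in>{1..k q}. x (q, t')) else x (q, t))"

definition indifference ::
  "(nat \<Rightarrow> nat) \<Rightarrow> (nat \<times> nat) set \<Rightarrow> (nat \<times> nat \<times> (nat \<Rightarrow> nat) \<Rightarrow> complex)
    \<Rightarrow> nat \<times> nat \<Rightarrow> (nat \<times> nat \<Rightarrow> complex) \<Rightarrow> complex" where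
  "indifference k F u = (\<lambda>(i, s) x. \<Sum>\<alpha>\<in>profiles k F i.
     (u (i, s, \<alpha>) - u (i, 0, \<alpha>)) * (\<Prod>q\<in>in_nbrs F i. strategy_prob k x q (\<alpha> q)))"

definition torus_solutions ::
  "nat \<Rightarrow> (nat \<Rightarrow> nat) \<Rightarrow> (nat \<times> nat) set \<Rightarrow> (nat \<times> nat \<times> (nat \<Rightarrow> nat) \<Rightarrow> complex)
    \<Rightarrow> (nat \<times> nat \<Rightarrow> complex) set" where
  "torus_solutions N k F u =
     {x \<in> unknowns N k \<rightarrow>\<^sub>E (UNIV - {0}). \<forall>e\<in>unknowns N k. indifference k F u e x = 0}"

definition isolated_solutions ::
  "nat \<Rightarrow> (nat \<Rightarrow> nat) \<Rightarrow> (nat \<times> nat) set \<Rightarrow> (nat \<times> nat \<times> (nat \<Rightarrow> nat) \<Rightarrow> complex)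
    \<Rightarrow> (nat \<times> nat \<Rightarrow> complex) set" where
  "isolated_solutions N k F u =
     {x \<in> torus_solutions N k F u. x isolated_in torus_solutions N k F u}"

definition has_isolated_count ::
  "nat \<Rightarrow> (nat \<Rightarrow> nat) \<Rightarrow> (nat \<times> nat) set \<Rightarrow> (nat \<times> nat \<times> (nat \<Rightarrow> nat) \<Rightarrow> complex) \<Rightarrow> nat \<Rightarrow> bool" where
  "has_isolated_count N k F u n \<longleftrightarrow>
     finite (isolated_solutions N k F u) \<and>
     (\<Sum>x\<in>isolated_solutions N k F u.
        local_multiplicity (unknowns N k) (unknowns N k) (indifference k F u) x) = enat n"

text \<open>The value is unique because two nonempty Zariski-open sets of payoff tables meet.\<close>

definition algebraic_degree :: "nat \<Rightarrow> (nat \<Rightarrow> nat) \<Rightarrow> (nat \<times> nat) set \<Rightarrow> nat" where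
  "algebraic_degree N k F = (THE n. \<exists>U. zariski_open (payoff_index N k F) U \<and> U \<noteq> {} \<and>
     (\<forall>u\<in>U. has_isolated_count N k F u n))"

end

theory Submission
  imports
    Defs
    "HOL-Probability.Characteristic_Functions"
    "HOL-Real_Asymp.Real_Asymp"
begin

text \<open>
  Part (i) is a duality. For a flow \<open>a\<close> the logarithm \<open>G z\<close> of the quotient defining the capacity
  equals \<open>\<Sum> a\<^sub>j\<^sub>i (log L\<^sub>i(z) - log z\<^sub>j)\<close>, a sum of nonnegative terms. If \<open>a\<close> is positive on every
  arc, a bound on \<open>G z\<close> therefore bounds the variation of \<open>log z\<close> on each component of the
  bipartite graph; \<open>G\<close> does not change when a component is rescaled, so the infimum may be taken
  over a compact box and is attained (\<open>G_minimum_exists\<close>). At a minimizer the stationarity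
  equations say that \<open>p\<^sub>j\<^sub>i = k\<^sub>i z\<^sub>j / L\<^sub>i(z)\<close> is a flow. For every flow and every \<open>z\<close>, \<open>G z\<close> minus
  the entropy is a weighted sum of terms \<open>x log (x/y) - x + y \<ge> 0\<close>, which vanish only for \<open>x = y\<close>
  (\<open>entropy_gap\<close>). So the entropy is at most \<open>G z\<close>, with equality at a minimizer exactly for the
  flow \<open>p\<close>.

  For parts (ii) and (iii) the degree is turned into a count: it is the number of
  \<^emph>\<open>balanced assignments\<close>, the ways to choose one variable from every factor of \<open>\<Prod> L\<^sub>i(z)\<^bsup>k\<^sub>i\<^esup>\<close> such
  that each \<open>z\<^sub>j\<close> is chosen \<open>k\<^sub>j\<close> times (\<open>algebraic_degree_eq_card_balanced\<close>). There is a payoff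
  table \<open>u0\<close> for which every equation is a product of affine forms, one in the unknowns of each
  in-neighbour, and the forms are in general position: they are the values of a generic monic
  polynomial at distinct nodes. A solution then kills one factor of every equation, each balanced
  choice of factors has exactly one solution and no other choice has any. To reach generic tables,
  no solution may collide with another one or escape to infinity. Modulo the system of \<open>u0\<close>, every
  function of a fixed multidegree is a combination of explicit products \<open>b \<sigma>\<close>, one for each
  balanced assignment (\<open>product_system_certificate\<close>). By Cramer's rule this remains true, after
  multiplication by a polynomial \<open>\<Delta>\<close> in the table, for all other tables (\<open>spanning_near_u0\<close>). So
  multiplication by a coordinate acts on the vector of the \<open>b \<sigma>\<close>, evaluated at a solution, through
  a matrix that depends polynomially on the table; this bounds the solutions where \<open>\<Delta> \<noteq> 0\<close>, and a
  second determinant excludes degenerate solutions and solutions with a vanishing coordinate. On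
  the complex line through two good tables the bad parameters form a finite set, its complement is
  connected, and there the number of solutions is locally constant (\<open>conservation_of_number\<close>).
  Nondegenerate solutions have multiplicity one.

  Now let every factor \<open>L\<^sub>i\<close> choose its variable independently, \<open>z\<^sub>j\<close> with probability \<open>z\<^sub>j / L\<^sub>i(z)\<close>,
  where \<open>z\<close> is a minimizer. Every balanced assignment for \<open>m k\<close> has the same probability \<open>cap\<^bsup>-m\<^esup>\<close>,
  hence the degree divided by \<open>cap\<^bsup>m\<^esup>\<close> is the probability that all variables are chosen exactly as
  often as expected. The number of choices falling into a component is fixed, so one variable of
  each component may be left out. Fourier inversion writes the probability as an integral of the
  \<open>m\<close>-th power of a characteristic function \<open>\<phi>\<close>. After rescaling by \<open>\<surd>m\<close> these powers converge to
  \<open>exp (- \<theta> \<bullet> \<Sigma>\<theta> / 2)\<close>, and they are dominated by a Gaussian because \<open>|\<phi>(\<theta>)| \<le> exp (- c |\<theta>|\<^sup>2)\<close> on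
  the whole period cube; the Gaussian integral gives the asymptotics (\<open>local_limit\<close>). The
  probability does not depend on the omitted variables, so neither does the determinant.

  Finally, grouping assignments by their table of multiplicities shows that the exact-support
  weight counts the balanced assignments that use every arc (\<open>exact_support_weight_eq\<close>). A given
  arc is missed with probability at most \<open>(1 - q)\<^bsup>m\<^esup>\<close> for some \<open>q > 0\<close>, which is negligible against
  a power of \<open>m\<close>.
\<close>

section \<open>Polynomial functions\<close>

lemma poly_funs_sum:
  assumes "\<And>i. i \<in> I \<Longrightarrow> f i \<in> poly_funs V"
  shows "(\<lambda>x. \<Sum>i\<in>I. f i x) \<in> poly_funs V"
  using assms by (induction I rule: infinite_finite_induct) (auto intro: poly_funs.intros)

lemma poly_funs_prod:
  assumes "\<And>i. i \<in> I \<Longrightarrow> f i \<in> poly_funs V"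
  shows "(\<lambda>x. \<Prod>i\<in>I. f i x) \<in> poly_funs V"
  using assms by (induction I rule: infinite_finite_induct) (auto intro: poly_funs.intros)

lemma poly_funs_power: "f \<in> poly_funs V \<Longrightarrow> (\<lambda>x. f x ^ n) \<in> poly_funs V"
  by (induction n) (auto intro: poly_funs.intros)

lemma poly_funs_cmult: "f \<in> poly_funs V \<Longrightarrow> (\<lambda>x. c * f x) \<in> poly_funs V"
  by (rule poly_funs.mult[OF poly_funs.const])

lemma poly_funs_uminus: "f \<in> poly_funs V \<Longrightarrow> (\<lambda>x. - f x) \<in> poly_funs V"
  using poly_funs_cmult[of f V "-1"] by simp

lemma poly_funs_diff: "f \<in> poly_funs V \<Longrightarrow> g \<in> poly_funs V \<Longrightarrow> (\<lambda>x. f x - g x) \<in> poly_funs V"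
  using poly_funs.add[OF _ poly_funs_uminus, of f V g] by simp

lemmas poly_funs_intros =
  poly_funs.intros poly_funs_sum poly_funs_prod poly_funs_power poly_funs_uminus poly_funs_diff

lemma poly_funs_substitute:
  assumes "f \<in> poly_funs X" "\<And>v. v \<in> X \<Longrightarrow> (\<lambda>y. s y v) \<in> poly_funs Y"
  shows "(\<lambda>y. f (s y)) \<in> poly_funs Y"
  using assms by (induction rule: poly_funs.induct) (auto intro: poly_funs.intros)

lemma poly_funs_continuous: "f \<in> poly_funs X \<Longrightarrow> continuous_on UNIV f"
proof (induction rule: poly_funs.induct)
  case (var v)
  show ?case by (rule continuous_on_product_coordinates)
qed (auto intro: continuous_intros)

lemma poly_funs_on_line:
  assumes "f \<in> poly_funs X"
  shows "\<exists>p. \<forall>t. f (\<lambda>v. a v + t * b v) = poly p t"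
  using assms
proof (induction rule: poly_funs.induct)
  case (const c)
  show ?case by (rule exI[of _ "[:c:]"]) simp
next
  case (var v)
  show ?case by (rule exI[of _ "[:a v, b v:]"]) (simp add: mult.commute)
next
  case (add f g)
  then obtain p q where "\<forall>t. f (\<lambda>v. a v + t * b v) = poly p t" "\<forall>t. g (\<lambda>v. a v + t * b v) = poly q t"
    by blast
  then show ?case by (intro exI[of _ "p + q"]) simp
next
  case (mult f g)
  then obtain p q where "\<forall>t. f (\<lambda>v. a v + t * b v) = poly p t" "\<forall>t. g (\<lambda>v. a v + t * b v) = poly q t"
    by blast
  then show ?case by (intro exI[of _ "p * q"]) simp
qed

text \<open>The multivariate difference quotient, with parameters \<open>u\<close>; on the diagonal \<open>x = y\<close> the
  functions \<open>A v\<close> are the partial derivatives. Products follow the Leibniz rule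
  \<open>f(x) g(x) - f(y) g(y) = f(x) (g(x) - g(y)) + g(y) (f(x) - f(y))\<close>. Comparing \<open>f\<close> at two points
  algebraically avoids derivatives throughout.\<close>

lemma poly_funs_difference_quotient:
  assumes "f \<in> poly_funs (L <+> V)" "finite V"
  shows "\<exists>A. (\<forall>v\<in>V. A v \<in> poly_funs (L <+> (V <+> V))) \<and>
    (\<forall>u x y. f (case_sum u x) - f (case_sum u y) =
      (\<Sum>v\<in>V. A v (case_sum u (case_sum x y)) * (x v - y v)))"
  using assms(1)
proof (induction rule: poly_funs.induct)
  case (const c)
  show ?case by (rule exI[of _ "\<lambda>v w. 0"]) (auto intro: poly_funs.intros)
next
  case (var w)
  show ?case
  proof (cases w)
    case (Inl l)
    then show ?thesis by (intro exI[of _ "\<lambda>v w. 0"]) (auto intro: poly_funs.intros)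
  next
    case (Inr w')
    with var have "w' \<in> V" by auto
    have "(\<Sum>v\<in>V. (if v = w' then 1 else 0) * (x v - y v)) = x w' - y w'" for x y :: "'b \<Rightarrow> complex"
      using \<open>w' \<in> V\<close> assms(2) by (simp add: if_distrib[of "\<lambda>c. c * _"] sum.delta cong: if_cong)
    then show ?thesis
      using Inr by (intro exI[of _ "\<lambda>v w. if v = w' then 1 else 0"]) (auto intro: poly_funs.intros)
  qed
next
  case (add f g)
  from add.IH(1) obtain A where A: "\<forall>v\<in>V. A v \<in> poly_funs (L <+> (V <+> V))"
      "\<forall>u x y. f (case_sum u x) - f (case_sum u y) =
        (\<Sum>v\<in>V. A v (case_sum u (case_sum x y)) * (x v - y v))"
    by (elim exE conjE)
  from add.IH(2) obtain B where B: "\<forall>v\<in>V. B v \<in> poly_funs (L <+> (V <+> V))"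
      "\<forall>u x y. g (case_sum u x) - g (case_sum u y) =
        (\<Sum>v\<in>V. B v (case_sum u (case_sum x y)) * (x v - y v))"
    by (elim exE conjE)
  have "f (case_sum u x) + g (case_sum u x) - (f (case_sum u y) + g (case_sum u y)) =
      (\<Sum>v\<in>V. (A v (case_sum u (case_sum x y)) + B v (case_sum u (case_sum x y))) * (x v - y v))"
    for u x y
  proof -
    have "f (case_sum u x) + g (case_sum u x) - (f (case_sum u y) + g (case_sum u y)) =
        (f (case_sum u x) - f (case_sum u y)) + (g (case_sum u x) - g (case_sum u y))"
      by simp
    then show ?thesis using A(2) B(2) by (simp add: distrib_right sum.distrib)
  qed
  then show ?case
    using A(1) B(1)
    by (intro exI[of _ "\<lambda>v w. A v w + B v w"] conjI ballI allI poly_funs.add) simp_all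
next
  case (mult f g)
  from mult.IH(1) obtain A where A: "\<forall>v\<in>V. A v \<in> poly_funs (L <+> (V <+> V))"
      "\<forall>u x y. f (case_sum u x) - f (case_sum u y) =
        (\<Sum>v\<in>V. A v (case_sum u (case_sum x y)) * (x v - y v))"
    by (elim exE conjE)
  from mult.IH(2) obtain B where B: "\<forall>v\<in>V. B v \<in> poly_funs (L <+> (V <+> V))"
      "\<forall>u x y. g (case_sum u x) - g (case_sum u y) =
        (\<Sum>v\<in>V. B v (case_sum u (case_sum x y)) * (x v - y v))"
    by (elim exE conjE)
  let ?F = "\<lambda>w. f (case_sum (w \<circ> Inl) (w \<circ> Inr \<circ> Inl))"
  let ?G = "\<lambda>w. g (case_sum (w \<circ> Inl) (w \<circ> Inr \<circ> Inr))"
  have F: "?F \<in> poly_funs (L <+> (V <+> V))"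
    by (rule poly_funs_substitute[OF mult.hyps(1)]) (auto intro: poly_funs.intros)
  have G: "?G \<in> poly_funs (L <+> (V <+> V))"
    by (rule poly_funs_substitute[OF mult.hyps(2)]) (auto intro: poly_funs.intros)
  have [simp]: "case_sum u z \<circ> Inl = u" "case_sum u z \<circ> Inr = z" for u z
    by auto
  have "f (case_sum u x) * g (case_sum u x) - f (case_sum u y) * g (case_sum u y)
    = (\<Sum>v\<in>V. (f (case_sum u x) * B v (case_sum u (case_sum x y))
         + g (case_sum u y) * A v (case_sum u (case_sum x y))) * (x v - y v))" for u x y
  proof -
    have "f (case_sum u x) * g (case_sum u x) - f (case_sum u y) * g (case_sum u y)
      = f (case_sum u x) * (g (case_sum u x) - g (case_sum u y))
        + g (case_sum u y) * (f (case_sum u x) - f (case_sum u y))"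
      by (simp add: algebra_simps)
    also have "\<dots> = (\<Sum>v\<in>V. f (case_sum u x) * (B v (case_sum u (case_sum x y)) * (x v - y v)))
        + (\<Sum>v\<in>V. g (case_sum u y) * (A v (case_sum u (case_sum x y)) * (x v - y v)))"
      by (simp add: A(2) B(2) sum_distrib_left)
    finally show ?thesis by (simp add: distrib_right sum.distrib mult.assoc)
  qed
  moreover have "(\<lambda>w. ?F w * B v w + ?G w * A v w) \<in> poly_funs (L <+> (V <+> V))" if "v \<in> V" for v
    using F G A(1) B(1) that by (intro poly_funs.add poly_funs.mult) auto
  ultimately show ?case
    by (intro exI[of _ "\<lambda>v w. ?F w * B v w + ?G w * A v w"] conjI) (auto simp only: case_sum_o_inj comp_assoc sum.case)
qed

section \<open>Determinants over finite index sets\<close>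

text \<open>Matrices of the matrix library have rows and columns numbered from \<open>0\<close>; a fixed enumeration
  transports determinants and adjugates to arbitrary finite index sets.\<close>

definition enumeration :: "'i set \<Rightarrow> nat \<Rightarrow> 'i" where
  "enumeration I = (SOME h. bij_betw h {0..<card I} I)"

definition indexed_mat :: "'i set \<Rightarrow> ('i \<Rightarrow> 'i \<Rightarrow> 'a) \<Rightarrow> 'a Matrix.mat" where
  "indexed_mat I A = Matrix.mat (card I) (card I) (\<lambda>(a, b). A (enumeration I a) (enumeration I b))"

definition indexed_det :: "'i set \<Rightarrow> ('i \<Rightarrow> 'i \<Rightarrow> 'a :: comm_ring_1) \<Rightarrow> 'a" where
  "indexed_det I A = Determinant.det (indexed_mat I A)"

definition indexed_adj :: "'i set \<Rightarrow> ('i \<Rightarrow> 'i \<Rightarrow> 'a :: comm_ring_1) \<Rightarrow> 'i \<Rightarrow> 'i \<Rightarrow> 'a" where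
  "indexed_adj I A i j = adj_mat (indexed_mat I A) $$
     (the_inv_into {0..<card I} (enumeration I) i, the_inv_into {0..<card I} (enumeration I) j)"

lemma enumeration_bij: "finite I \<Longrightarrow> bij_betw (enumeration I) {0..<card I} I"
  unfolding enumeration_def using ex_bij_betw_nat_finite by (rule someI_ex)

lemma indexed_mat_carrier [simp]: "indexed_mat I A \<in> carrier_mat (card I) (card I)"
  by (simp add: indexed_mat_def)

lemma sum_enumeration:
  "finite I \<Longrightarrow> (\<Sum>i\<in>I. g i) = (\<Sum>a\<in>{0..<card I}. g (enumeration I a))"
  by (rule sum.reindex_bij_betw[OF enumeration_bij, symmetric])

lemma inv_enumeration:
  assumes "finite I" "i \<in> I"
  obtains a where "a < card I" "enumeration I a = i"
    "the_inv_into {0..<card I} (enumeration I) i = a"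
proof -
  have b: "bij_betw (enumeration I) {0..<card I} I" by (rule enumeration_bij[OF assms(1)])
  then obtain a where a: "a \<in> {0..<card I}" "i = enumeration I a"
    using assms(2) unfolding bij_betw_def by blast
  then have "the_inv_into {0..<card I} (enumeration I) i = a"
    using b by (auto simp: bij_betw_def the_inv_into_f_f)
  then show ?thesis using a that by auto
qed

lemma enumeration_eq_iff:
  assumes "finite I" "a < card I" "b < card I"
  shows "enumeration I a = enumeration I b \<longleftrightarrow> a = b"
  using enumeration_bij[OF assms(1)] assms by (auto simp: bij_betw_def inj_on_def)

lemma indexed_adj_mult:
  assumes "finite I" "i \<in> I" "k \<in> I"
  shows "(\<Sum>j\<in>I. indexed_adj I A i j * A j k) = (if i = k then indexed_det I A else 0)"
proof -
  let ?M = "indexed_mat I A"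
  obtain a where a: "a < card I" "enumeration I a = i"
      "the_inv_into {0..<card I} (enumeration I) i = a"
    by (rule inv_enumeration[OF assms(1,2)])
  obtain c where c: "c < card I" "enumeration I c = k"
      "the_inv_into {0..<card I} (enumeration I) k = c"
    by (rule inv_enumeration[OF assms(1,3)])
  have adj: "adj_mat ?M \<in> carrier_mat (card I) (card I)" by (rule adj_mat) simp
  have dims: "dim_row (adj_mat ?M) = card I" "dim_col (adj_mat ?M) = card I"
      "dim_row ?M = card I" "dim_col ?M = card I"
    using carrier_matD[OF adj] by (simp_all add: indexed_mat_def)
  have "(adj_mat ?M * ?M) $$ (a, c) = (\<Sum>b\<in>{0..<card I}. adj_mat ?M $$ (a, b) * ?M $$ (b, c))"
    using a(1) c(1) by (simp add: scalar_prod_def dims)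
  also have "\<dots> = (\<Sum>b\<in>{0..<card I}. indexed_adj I A i (enumeration I b) * A (enumeration I b) k)"
  proof (rule sum.cong[OF refl])
    fix b assume b: "b \<in> {0..<card I}"
    have "the_inv_into {0..<card I} (enumeration I) (enumeration I b) = b"
      using enumeration_bij[OF assms(1)] b by (auto simp: bij_betw_def the_inv_into_f_f)
    then show "adj_mat ?M $$ (a, b) * ?M $$ (b, c) =
        indexed_adj I A i (enumeration I b) * A (enumeration I b) k"
      using a b c by (simp add: indexed_adj_def indexed_mat_def)
  qed
  also have "\<dots> = (\<Sum>j\<in>I. indexed_adj I A i j * A j k)"
    by (rule sum_enumeration[OF assms(1), symmetric])
  finally have "(\<Sum>j\<in>I. indexed_adj I A i j * A j k) = (Determinant.det ?M \<cdot>\<^sub>m 1\<^sub>m (card I)) $$ (a, c)"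
    using adj_mat(3)[OF indexed_mat_carrier, of I A] by simp
  also have "\<dots> = (if i = k then indexed_det I A else 0)"
    using a c enumeration_eq_iff[OF assms(1), of a c] by (auto simp: indexed_det_def)
  finally show ?thesis .
qed

text \<open>Cramer's rule without division: the linear forms \<open>\<Sum>A j k c k\<close> determine \<open>c\<close> up to the factor
  \<open>indexed_det I A\<close>, with coefficients polynomial in the entries of \<open>A\<close>.\<close>

lemma indexed_det_cramer:
  assumes "finite I" "i \<in> I"
  shows "(\<Sum>j\<in>I. indexed_adj I A i j * (\<Sum>k\<in>I. A j k * c k)) = indexed_det I A * c i"
proof -
  have "(\<Sum>j\<in>I. indexed_adj I A i j * (\<Sum>k\<in>I. A j k * c k)) =
      (\<Sum>k\<in>I. (\<Sum>j\<in>I. indexed_adj I A i j * A j k) * c k)"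
    unfolding sum_distrib_left sum_distrib_right by (subst sum.swap) (simp add: mult.assoc)
  also have "\<dots> = (\<Sum>k\<in>I. (if i = k then indexed_det I A else 0) * c k)"
    using assms by (intro sum.cong) (auto simp: indexed_adj_mult)
  finally show ?thesis using assms by (simp add: if_distrib[of "\<lambda>c. c * _"] cong: if_cong)
qed

lemma indexed_det_zero_imp_left_null:
  fixes A :: "'i \<Rightarrow> 'i \<Rightarrow> complex"
  assumes "finite I" "indexed_det I A = 0"
  shows "\<exists>c. (\<exists>i\<in>I. c i \<noteq> 0) \<and> (\<forall>k\<in>I. (\<Sum>i\<in>I. c i * A i k) = 0)"
proof -
  let ?M = "indexed_mat I A" and ?n = "card I"
  have "Determinant.det (transpose_mat ?M) = 0"
    using assms(2) by (simp add: indexed_det_def det_transpose[of _ ?n])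
  then obtain v where v: "v \<in> carrier_vec ?n" "v \<noteq> 0\<^sub>v ?n" "transpose_mat ?M *\<^sub>v v = 0\<^sub>v ?n"
    using det_0_iff_vec_prod_zero_field[of "transpose_mat ?M" ?n] by auto
  define c where "c i = v $ the_inv_into {0..<card I} (enumeration I) i" for i
  have ce: "c (enumeration I a) = v $ a" if "a < ?n" for a
    using enumeration_bij[OF assms(1)] that
    by (auto simp: bij_betw_def the_inv_into_f_f c_def)
  obtain a where a: "a < ?n" "v $ a \<noteq> 0"
    using v by (metis carrier_vecD eq_vecI index_zero_vec(1) index_zero_vec(2))
  have "enumeration I a \<in> I" using enumeration_bij[OF assms(1)] a by (auto simp: bij_betw_def)
  moreover have "(\<Sum>i\<in>I. c i * A i k) = 0" if "k \<in> I" for k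
  proof -
    obtain b where b: "b < card I" "enumeration I b = k"
      using inv_enumeration[OF assms(1) \<open>k \<in> I\<close>] by auto
    have "(transpose_mat ?M *\<^sub>v v) $ b = (\<Sum>a\<in>{0..<?n}. ?M $$ (a, b) * v $ a)"
      using b v(1) by (simp add: scalar_prod_def indexed_mat_def)
    also have "\<dots> = (\<Sum>a\<in>{0..<?n}. c (enumeration I a) * A (enumeration I a) k)"
      using b by (intro sum.cong) (auto simp: ce indexed_mat_def)
    also have "\<dots> = (\<Sum>i\<in>I. c i * A i k)" by (rule sum_enumeration[OF assms(1), symmetric])
    finally show ?thesis using v(3) b(1) by (metis index_zero_vec(1))
  qed
  moreover have "c (enumeration I a) \<noteq> 0" using a ce by simp
  ultimately show ?thesis by blast
qed

lemma indexed_det_right_null_imp_zero: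
  fixes A :: "'i \<Rightarrow> 'i \<Rightarrow> complex"
  assumes "finite I" "i \<in> I" "c i \<noteq> 0" "\<And>j. j \<in> I \<Longrightarrow> (\<Sum>k\<in>I. A j k * c k) = 0"
  shows "indexed_det I A = 0"
  using indexed_det_cramer[OF assms(1,2), of A c] assms(3,4) by simp

lemma indexed_det_identity:
  assumes "finite I" "\<And>i j. i \<in> I \<Longrightarrow> j \<in> I \<Longrightarrow> A i j = (if i = j then 1 else 0)"
  shows "indexed_det I A = 1"
proof -
  have "enumeration I a \<in> I" if "a < card I" for a
    using enumeration_bij[OF assms(1)] that by (auto simp: bij_betw_def)
  then have "indexed_mat I A = 1\<^sub>m (card I)"
    using assms enumeration_eq_iff[OF assms(1)] by (intro eq_matI) (auto simp: indexed_mat_def)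
  then show ?thesis by (simp add: indexed_det_def)
qed

text \<open>The Leibniz formula exhibits the determinant as a polynomial in the entries.\<close>

lemma det_poly_funs:
  assumes "\<And>a b. a < n \<Longrightarrow> b < n \<Longrightarrow> (\<lambda>u. M u $$ (a, b)) \<in> poly_funs L"
    "\<And>u. M u \<in> carrier_mat n n"
  shows "(\<lambda>u. Determinant.det (M u)) \<in> poly_funs L"
proof -
  have "(\<lambda>u. \<Sum>p\<in>{p. p permutes {0..<n}}. signof p * (\<Prod>i=0..<n. M u $$ (i, p i))) \<in> poly_funs L"
    by (intro poly_funs_sum poly_funs_cmult poly_funs_prod assms(1))
      (auto dest: permutes_in_image)
  then show ?thesis using det_def'[OF assms(2)] by simp
qed

lemma indexed_det_poly_funs:
  assumes "finite I" "\<And>i j. i \<in> I \<Longrightarrow> j \<in> I \<Longrightarrow> (\<lambda>u. A u i j) \<in> poly_funs L"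
  shows "(\<lambda>u. indexed_det I (A u)) \<in> poly_funs L"
proof -
  have "enumeration I a \<in> I" if "a < card I" for a
    using enumeration_bij[OF assms(1)] that by (auto simp: bij_betw_def)
  then show ?thesis unfolding indexed_det_def
    by (intro det_poly_funs[of "card I"]) (auto simp: indexed_mat_def intro!: assms(2))
qed

lemma indexed_adj_poly_funs:
  assumes "finite I" "\<And>i j. i \<in> I \<Longrightarrow> j \<in> I \<Longrightarrow> (\<lambda>u. A u i j) \<in> poly_funs L" "i \<in> I" "j \<in> I"
  shows "(\<lambda>u. indexed_adj I (A u) i j) \<in> poly_funs L"
proof -
  have e: "enumeration I a \<in> I" if "a < card I" for a
    using enumeration_bij[OF assms(1)] that by (auto simp: bij_betw_def)
  obtain a where a: "a < card I" "the_inv_into {0..<card I} (enumeration I) i = a"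
    by (rule inv_enumeration[OF assms(1,3)])
  obtain b where b: "b < card I" "the_inv_into {0..<card I} (enumeration I) j = b"
    by (rule inv_enumeration[OF assms(1,4)])
  have "(\<lambda>u. (-1) ^ (b + a) * Determinant.det (mat_delete (indexed_mat I (A u)) b a)) \<in> poly_funs L"
  proof (intro poly_funs_cmult det_poly_funs[of "card I - 1"])
    fix a' b' assume "a' < card I - 1" "b' < card I - 1"
    then show "(\<lambda>u. mat_delete (indexed_mat I (A u)) b a $$ (a', b')) \<in> poly_funs L"
      using a b by (auto simp: mat_delete_def indexed_mat_def intro!: assms(2) e)
  qed (auto simp: mat_delete_def indexed_mat_def)
  then show ?thesis using a b
    by (simp add: indexed_adj_def adj_mat_def cofactor_def indexed_mat_def)
qed

lemma indexed_adj_mult_right: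
  assumes "finite I" "i \<in> I" "k \<in> I"
  shows "(\<Sum>j\<in>I. A i j * indexed_adj I A j k) = (if i = k then indexed_det I A else 0)"
proof -
  let ?M = "indexed_mat I A"
  obtain a where a: "a < card I" "enumeration I a = i"
      "the_inv_into {0..<card I} (enumeration I) i = a"
    by (rule inv_enumeration[OF assms(1,2)])
  obtain c where c: "c < card I" "enumeration I c = k"
      "the_inv_into {0..<card I} (enumeration I) k = c"
    by (rule inv_enumeration[OF assms(1,3)])
  have adj: "adj_mat ?M \<in> carrier_mat (card I) (card I)" by (rule adj_mat) simp
  have dims: "dim_row (adj_mat ?M) = card I" "dim_col (adj_mat ?M) = card I"
      "dim_row ?M = card I" "dim_col ?M = card I"
    using carrier_matD[OF adj] by (simp_all add: indexed_mat_def)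
  have "(?M * adj_mat ?M) $$ (a, c) = (\<Sum>b\<in>{0..<card I}. ?M $$ (a, b) * adj_mat ?M $$ (b, c))"
    using a(1) c(1) by (simp add: scalar_prod_def dims)
  also have "\<dots> = (\<Sum>b\<in>{0..<card I}. A i (enumeration I b) * indexed_adj I A (enumeration I b) k)"
  proof (rule sum.cong[OF refl])
    fix b assume b: "b \<in> {0..<card I}"
    have "the_inv_into {0..<card I} (enumeration I) (enumeration I b) = b"
      using enumeration_bij[OF assms(1)] b by (auto simp: bij_betw_def the_inv_into_f_f)
    then show "?M $$ (a, b) * adj_mat ?M $$ (b, c) =
        A i (enumeration I b) * indexed_adj I A (enumeration I b) k"
      using a b c by (simp add: indexed_adj_def indexed_mat_def)
  qed
  also have "\<dots> = (\<Sum>j\<in>I. A i j * indexed_adj I A j k)"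
    by (rule sum_enumeration[OF assms(1), symmetric])
  finally have "(\<Sum>j\<in>I. A i j * indexed_adj I A j k) = (Determinant.det ?M \<cdot>\<^sub>m 1\<^sub>m (card I)) $$ (a, c)"
    using adj_mat(2)[OF indexed_mat_carrier, of I A] by simp
  also have "\<dots> = (if i = k then indexed_det I A else 0)"
    using a c enumeration_eq_iff[OF assms(1), of a c] by (auto simp: indexed_det_def)
  finally show ?thesis .
qed

lemma indexed_det_transpose: "indexed_det I (\<lambda>i j. A j i) = indexed_det I A"
proof -
  have "indexed_mat I (\<lambda>i j. A j i) = transpose_mat (indexed_mat I A)"
    by (intro eq_matI) (auto simp: indexed_mat_def)
  then show ?thesis by (simp add: indexed_det_def det_transpose[OF indexed_mat_carrier])
qed

lemma indexed_det_zero_imp_right_null: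
  fixes A :: "'i \<Rightarrow> 'i \<Rightarrow> complex"
  assumes "finite I" "indexed_det I A = 0"
  shows "\<exists>c. (\<exists>i\<in>I. c i \<noteq> 0) \<and> (\<forall>k\<in>I. (\<Sum>i\<in>I. A k i * c i) = 0)"
proof -
  have "indexed_det I (\<lambda>i j. A j i) = 0" by (subst indexed_det_transpose) (rule assms(2))
  from indexed_det_zero_imp_left_null[OF assms(1) this] show ?thesis
    by (simp add: mult.commute)
qed

section \<open>Persistence of nondegenerate zeros\<close>

lemma compact_PiE_box:
  fixes S :: "'v \<Rightarrow> 'a::topological_space set"
  assumes "\<And>v. v \<in> V \<Longrightarrow> compact (S v)"
  shows "compact (Pi\<^sub>E V S)"
proof -
  let ?S = "\<lambda>v. if v \<in> V then S v else {undefined}"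
  have "Pi\<^sub>E V S = Pi\<^sub>E UNIV ?S"
    by (auto simp: PiE_def extensional_def Pi_def split: if_splits)
  moreover have "compactin (product_topology (\<lambda>v. euclidean) UNIV) (Pi\<^sub>E UNIV ?S)"
    using assms by (subst compactin_PiE) auto
  ultimately show ?thesis by (simp add: euclidean_product_topology)
qed

lemma tendsto_fun_componentwise:
  fixes f :: "nat \<Rightarrow> 'v \<Rightarrow> 'a::topological_space"
  assumes "\<And>v. (\<lambda>n. f n v) \<longlonglongrightarrow> l v"
  shows "f \<longlonglongrightarrow> l"
proof -
  have "limitin (product_topology (\<lambda>v. euclidean) UNIV) f l sequentially"
    using assms by (subst limitin_componentwise) auto
  then show ?thesis by (simp add: euclidean_product_topology)
qed

lemma tendsto_fun_apply: "f \<longlonglongrightarrow> l \<Longrightarrow> (\<lambda>n. f n v) \<longlonglongrightarrow> l v"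
  by (rule continuous_on_tendsto_compose[OF continuous_on_product_coordinates[of v]]) auto

text \<open>In a compact set a sequence converges as soon as all its convergent subsequences have the
  same limit.\<close>

lemma compact_seq_tendsto:
  fixes x :: "nat \<Rightarrow> 'a::metric_space"
  assumes "compact K" "\<And>n. x n \<in> K"
    and uniq: "\<And>r l. strict_mono r \<Longrightarrow> (x \<circ> r) \<longlonglongrightarrow> l \<Longrightarrow> l \<in> K \<Longrightarrow> l = p"
  shows "x \<longlonglongrightarrow> p"
proof (rule topological_tendstoI)
  fix U assume U: "open U" "p \<in> U"
  show "\<forall>\<^sub>F n in sequentially. x n \<in> U"
  proof (rule ccontr)
    assume "\<not> ?thesis"
    then obtain r :: "nat \<Rightarrow> nat" where r: "strict_mono r" "\<And>n. x (r n) \<notin> U"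
      using not_eventually_sequentiallyD by blast
    have xr: "\<forall>n. (x \<circ> r) n \<in> K" using assms(2) by simp
    obtain l r' where l: "l \<in> K" "strict_mono r'" "((x \<circ> r) \<circ> r') \<longlonglongrightarrow> l"
      by (rule seq_compactE[OF compact_imp_seq_compact[OF assms(1)] xr])
    have "l = p"
      using uniq[of "r \<circ> r'"] l r strict_mono_o[OF r(1) l(2)] by (simp add: comp_assoc)
    then have "\<forall>\<^sub>F n in sequentially. ((x \<circ> r) \<circ> r') n \<in> U"
      using topological_tendstoD[OF l(3)] U by simp
    then show False using r(2) by (auto simp: eventually_sequentially)
  qed
qed

lemma continuous_indexed_det:
  fixes A :: "'v \<Rightarrow> 'v \<Rightarrow> 'a::topological_space \<Rightarrow> complex"
  assumes "finite V" "\<And>e v. continuous_on UNIV (A e v)"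
  shows "continuous_on UNIV (\<lambda>s. indexed_det V (\<lambda>e v. A e v s))"
proof -
  have "(\<lambda>w. indexed_det V (\<lambda>e v. w (e, v))) \<in> poly_funs (V \<times> V)"
    by (rule indexed_det_poly_funs[OF assms(1)]) (auto intro: poly_funs.intros)
  then have "continuous_on UNIV (\<lambda>w :: 'v \<times> 'v \<Rightarrow> complex. indexed_det V (\<lambda>e v. w (e, v)))"
    by (rule poly_funs_continuous)
  moreover have "continuous_on UNIV (\<lambda>s (e, v). A e v s)"
    using assms(2) by (intro continuous_on_coordinatewise_then_product) auto
  ultimately show ?thesis
    using continuous_on_compose2[of UNIV "\<lambda>w. indexed_det V (\<lambda>e v. w (e, v))" UNIV "\<lambda>s (e, v). A e v s"]
    by simp
qed

text \<open>A family of square systems \<open>f e s x = 0\<close> over a parameter \<open>s\<close>, with difference quotients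
  \<open>A\<close>. Over the good parameters \<open>S\<close> all zeros are nondegenerate and, locally uniformly, bounded.
  The conclusion is that the number of zeros is constant on a connected open \<open>S\<close>.\<close>

locale zero_family =
  fixes V :: "'v::countable set"
    and f :: "'v \<Rightarrow> complex \<Rightarrow> ('v \<Rightarrow> complex) \<Rightarrow> complex"
    and A :: "'v \<Rightarrow> 'v \<Rightarrow> complex \<Rightarrow> ('v \<Rightarrow> complex) \<Rightarrow> ('v \<Rightarrow> complex) \<Rightarrow> complex"
    and S :: "complex set"
  assumes fin: "finite V"
    and cont_f: "\<And>e. continuous_on UNIV (\<lambda>(s, x). f e s x)"
    and cont_A: "\<And>e v. continuous_on UNIV (\<lambda>(s, x, y). A e v s x y)"
    and dq: "\<And>e s x y. e \<in> V \<Longrightarrow> f e s x - f e s y = (\<Sum>v\<in>V. A e v s x y * (x v - y v))"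
    and nondeg: "\<And>s x. s \<in> S \<Longrightarrow> x \<in> extensional V \<Longrightarrow> (\<And>e. e \<in> V \<Longrightarrow> f e s x = 0) \<Longrightarrow>
      indexed_det V (\<lambda>e v. A e v s x x) \<noteq> 0"
    and bdd: "\<And>s0. s0 \<in> S \<Longrightarrow> \<exists>R. \<forall>\<^sub>F s in nhds s0. \<forall>x. x \<in> extensional V \<longrightarrow>
      (\<forall>e\<in>V. f e s x = 0) \<longrightarrow> (\<forall>v\<in>V. cmod (x v) \<le> R)"
begin

definition zeros :: "complex \<Rightarrow> ('v \<Rightarrow> complex) set" where
  "zeros s = {x \<in> extensional V. \<forall>e\<in>V. f e s x = 0}"

definition D :: "complex \<Rightarrow> ('v \<Rightarrow> complex) \<Rightarrow> ('v \<Rightarrow> complex) \<Rightarrow> complex" where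
  "D s x y = indexed_det V (\<lambda>e v. A e v s x y)"

lemma tendsto_f: "s \<longlonglongrightarrow> s0 \<Longrightarrow> x \<longlonglongrightarrow> l \<Longrightarrow> (\<lambda>n. f e (s n) (x n)) \<longlonglongrightarrow> f e s0 l"
  using continuous_on_tendsto_compose[OF cont_f[of e], of "\<lambda>n. (s n, x n)" "(s0, l)" sequentially]
    tendsto_Pair[of s s0 sequentially x l]
  by simp

lemma tendsto_A: "s \<longlonglongrightarrow> s0 \<Longrightarrow> x \<longlonglongrightarrow> l \<Longrightarrow> y \<longlonglongrightarrow> m \<Longrightarrow>
    (\<lambda>n. A e v (s n) (x n) (y n)) \<longlonglongrightarrow> A e v s0 l m"
  using continuous_on_tendsto_compose[OF cont_A[of e v], of "\<lambda>n. (s n, x n, y n)" "(s0, l, m)" sequentially]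
    tendsto_Pair[of s s0 sequentially "\<lambda>n. (x n, y n)" "(l, m)"] tendsto_Pair[of x l sequentially y m]
  by simp

lemma tendsto_D:
  assumes "s \<longlonglongrightarrow> s0" "x \<longlonglongrightarrow> l" "y \<longlonglongrightarrow> m"
  shows "(\<lambda>n. D (s n) (x n) (y n)) \<longlonglongrightarrow> D s0 l m"
proof -
  have "continuous_on UNIV (\<lambda>w. indexed_det V (\<lambda>e v. (\<lambda>(s, x, y). A e v s x y) w))"
    by (rule continuous_indexed_det[OF fin cont_A])
  from continuous_on_tendsto_compose[OF this, of "\<lambda>n. (s n, x n, y n)" "(s0, l, m)" sequentially]
    tendsto_Pair[OF assms(1) tendsto_Pair[OF assms(2,3)]]
  show ?thesis by (simp add: D_def)
qed

text \<open>The vector \<open>x - y\<close> is in the kernel of the matrix of difference quotients.\<close>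

lemma zeros_unique:
  assumes "x \<in> zeros s" "y \<in> zeros s" "D s x y \<noteq> 0"
  shows "x = y"
proof (rule extensionalityI[of _ V])
  fix v assume v: "v \<in> V"
  have "D s x y * (x v - y v) = (\<Sum>e\<in>V. indexed_adj V (\<lambda>e v. A e v s x y) v e *
      (\<Sum>w\<in>V. A e w s x y * (x w - y w)))"
    unfolding D_def by (rule indexed_det_cramer[OF fin v, symmetric])
  also have "\<dots> = 0"
    using assms by (intro sum.neutral) (auto simp: dq[symmetric] zeros_def)
  finally show "x v = y v" using assms(3) by simp
qed (use assms in \<open>auto simp: zeros_def\<close>)

lemma D_nonzero: "s \<in> S \<Longrightarrow> x \<in> zeros s \<Longrightarrow> D s x x \<noteq> 0"
  using nondeg[of s x] by (auto simp: zeros_def D_def)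

lemma eventually_D_nonzero:
  assumes "s \<longlonglongrightarrow> s0" "x \<longlonglongrightarrow> l" "y \<longlonglongrightarrow> l" "s0 \<in> S" "l \<in> zeros s0"
  shows "\<forall>\<^sub>F n in sequentially. D (s n) (x n) (y n) \<noteq> 0"
  using tendsto_imp_eventually_ne[OF tendsto_D[OF assms(1-3)] D_nonzero[OF assms(4,5)]] .

text \<open>Bounded zeros subconverge.\<close>

lemma zeros_subsequence:
  assumes "s0 \<in> S" "s \<longlonglongrightarrow> s0" "\<And>n. x n \<in> zeros (s n)"
  obtains l r where "l \<in> zeros s0" "strict_mono r" "(x \<circ> r) \<longlonglongrightarrow> l"
proof -
  obtain R where R: "\<forall>\<^sub>F s in nhds s0. \<forall>x. x \<in> extensional V \<longrightarrow>
      (\<forall>e\<in>V. f e s x = 0) \<longrightarrow> (\<forall>v\<in>V. cmod (x v) \<le> R)"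
    using bdd[OF assms(1)] by blast
  have "\<forall>\<^sub>F n in sequentially. \<forall>v\<in>V. cmod (x n v) \<le> R"
    using eventually_compose_filterlim[OF R assms(2)]
    by eventually_elim (use assms(3) in \<open>auto simp: zeros_def\<close>)
  then obtain n0 where n0: "\<And>n. n \<ge> n0 \<Longrightarrow> \<forall>v\<in>V. cmod (x n v) \<le> R"
    by (auto simp: eventually_sequentially)
  let ?K = "Pi\<^sub>E V (\<lambda>_. cball (0::complex) R)"
  have xK: "\<forall>n. x (n + n0) \<in> ?K"
    using n0 assms(3) by (auto simp: zeros_def PiE_def Pi_def)
  have "seq_compact ?K"
    by (intro compact_imp_seq_compact compact_PiE_box) auto
  then obtain l r where l: "l \<in> ?K" "strict_mono r" "((\<lambda>n. x (n + n0)) \<circ> r) \<longlonglongrightarrow> l"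
    by (rule seq_compactE[OF _ xK])
  define r' where "r' n = r n + n0" for n
  have r': "strict_mono r'" using l(2) by (auto simp: r'_def strict_mono_def)
  have lim: "(x \<circ> r') \<longlonglongrightarrow> l" using l(3) by (simp add: r'_def comp_def)
  have "f e s0 l = 0" if "e \<in> V" for e
  proof -
    have "(\<lambda>n. f e ((s \<circ> r') n) ((x \<circ> r') n)) \<longlonglongrightarrow> f e s0 l"
      by (rule tendsto_f[OF LIMSEQ_subseq_LIMSEQ[OF assms(2) r'] lim])
    moreover have "(\<lambda>n. f e ((s \<circ> r') n) ((x \<circ> r') n)) = (\<lambda>n. 0)"
      using assms(3) that by (auto simp: zeros_def)
    ultimately show ?thesis using LIMSEQ_unique[OF _ tendsto_const] by metis
  qed
  then have "l \<in> zeros s0" using l(1) by (auto simp: zeros_def PiE_def)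
  then show ?thesis using that r' lim by blast
qed

text \<open>An accumulation point of zeros would be a nondegenerate zero, and near such a point there is
  at most one zero by \<open>zeros_unique\<close>.\<close>

lemma finite_zeros:
  assumes "s \<in> S"
  shows "finite (zeros s)"
proof (rule ccontr)
  assume "infinite (zeros s)"
  then obtain x :: "nat \<Rightarrow> _" where x: "inj x" "range x \<subseteq> zeros s"
    using infinite_countable_subset by blast
  obtain l r where l: "l \<in> zeros s" "strict_mono r" "(x \<circ> r) \<longlonglongrightarrow> l"
    using zeros_subsequence[OF assms tendsto_const, of x] x(2) by blast
  have "(\<lambda>n. (x \<circ> r) (Suc n)) \<longlonglongrightarrow> l" using l(3) by (rule LIMSEQ_Suc)
  from eventually_D_nonzero[OF tendsto_const l(3) this assms l(1)]
  obtain n where "D s ((x \<circ> r) n) ((x \<circ> r) (Suc n)) \<noteq> 0"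
    by (auto simp: eventually_sequentially)
  then have "x (r n) = x (r (Suc n))"
    using subsetD[OF x(2) rangeI] by (intro zeros_unique[of _ s]) auto
  then have "r n = r (Suc n)" using x(1) by (simp add: inj_eq)
  then show False using strict_monoD[OF l(2), of n "Suc n"] by simp
qed

text \<open>At a point where the difference-quotient matrix is invertible, moving along the solution \<open>w\<close>
  of \<open>A w = - f\<close> decreases every \<open>|f\<^sub>e|\<close> proportionally; hence an interior minimiser of \<open>\<Sum>|f\<^sub>e|\<close> is
  a zero.\<close>

lemma interior_minimum_is_zero:
  assumes "x \<in> extensional V" "D s x x \<noteq> 0"
    and interior: "\<And>v. v \<in> V \<Longrightarrow> dist (p v) (x v) < \<epsilon>"
    and min: "\<And>y. y \<in> Pi\<^sub>E V (\<lambda>v. cball (p v) \<epsilon>) \<Longrightarrow>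
      (\<Sum>e\<in>V. cmod (f e s x)) \<le> (\<Sum>e\<in>V. cmod (f e s y))"
  shows "x \<in> zeros s"
proof (rule ccontr)
  assume "x \<notin> zeros s"
  then obtain e0 where e0: "e0 \<in> V" "f e0 s x \<noteq> 0" using assms(1) by (auto simp: zeros_def)
  define \<Phi> where "\<Phi> = (\<Sum>e\<in>V. cmod (f e s x))"
  have "0 < \<Phi>" unfolding \<Phi>_def using e0 fin by (intro sum_pos2[of _ e0]) auto
  \<comment> \<open>Cramer's rule solves \<open>A w = - f\<close>.\<close>
  define g where "g v = (\<Sum>e\<in>V. indexed_adj V (\<lambda>e v. A e v s x x) v e * f e s x)" for v
  define w where "w v = - g v / D s x x" for v
  have w: "(\<Sum>v\<in>V. A e v s x x * w v) = - f e s x" if e: "e \<in> V" for e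
  proof -
    have "(\<Sum>v\<in>V. A e v s x x * (\<Sum>e'\<in>V. indexed_adj V (\<lambda>e v. A e v s x x) v e' * f e' s x))
      = (\<Sum>e'\<in>V. (\<Sum>v\<in>V. A e v s x x * indexed_adj V (\<lambda>e v. A e v s x x) v e') * f e' s x)"
      unfolding sum_distrib_left sum_distrib_right by (subst sum.swap) (simp add: mult.assoc)
    also have "\<dots> = (\<Sum>e'\<in>V. (if e = e' then D s x x else 0) * f e' s x)"
      using e by (intro sum.cong) (auto simp: indexed_adj_mult_right[OF fin, of _ _ "\<lambda>e v. A e v s x x"] D_def)
    also have "\<dots> = D s x x * f e s x"
      using e fin by (simp add: if_distrib[of "\<lambda>c. c * _"] cong: if_cong)
    finally have "(\<Sum>v\<in>V. A e v s x x * g v) = D s x x * f e s x"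
      by (simp add: g_def)
    moreover have "(\<Sum>v\<in>V. A e v s x x * w v) = - (\<Sum>v\<in>V. A e v s x x * g v) / D s x x"
      by (simp add: w_def sum_negf sum_divide_distrib)
    ultimately show ?thesis using assms(2) by simp
  qed
  define t where "t n = inverse (real (Suc (Suc n)))" for n
  have t0: "t \<longlonglongrightarrow> 0" unfolding t_def using LIMSEQ_Suc[OF LIMSEQ_inverse_real_of_nat] .
  have t: "0 < t n" "t n \<le> 1" for n by (auto simp: t_def field_simps)
  define y where "y n = (\<lambda>v. if v \<in> V then x v + of_real (t n) * w v else undefined)" for n
  have yv: "(\<lambda>n. y n v) \<longlonglongrightarrow> x v" for v
  proof (cases "v \<in> V")
    case True
    have "(\<lambda>n. x v + of_real (t n) * w v) \<longlonglongrightarrow> x v + of_real 0 * w v"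
      by (intro tendsto_intros t0)
    then show ?thesis using True by (simp add: y_def)
  next
    case False
    then show ?thesis using assms(1) by (simp add: y_def extensional_def)
  qed
  have y: "y \<longlonglongrightarrow> x" by (rule tendsto_fun_componentwise[OF yv])
  define \<delta> where "\<delta> e n = (\<Sum>v\<in>V. (A e v s (y n) x - A e v s x x) * w v)" for e n
  have fy: "f e s (y n) = of_real (1 - t n) * f e s x + of_real (t n) * \<delta> e n" if e: "e \<in> V" for e n
  proof -
    have "f e s (y n) - f e s x = (\<Sum>v\<in>V. A e v s (y n) x * (of_real (t n) * w v))"
      using dq[OF e, of s "y n" x] by (simp add: y_def)
    also have "\<dots> = of_real (t n) * (\<delta> e n + (\<Sum>v\<in>V. A e v s x x * w v))"
      by (simp add: \<delta>_def sum_distrib_left sum.distrib[symmetric] algebra_simps)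
    also have "\<dots> = of_real (t n) * (\<delta> e n - f e s x)" by (simp add: w[OF e])
    finally show ?thesis by (simp add: algebra_simps)
  qed
  have "(\<lambda>n. \<Sum>e\<in>V. cmod (\<delta> e n)) \<longlonglongrightarrow> (\<Sum>e\<in>V. cmod (\<Sum>v\<in>V. (A e v s x x - A e v s x x) * w v))"
    unfolding \<delta>_def by (intro tendsto_intros tendsto_A y)
  then have "(\<lambda>n. \<Sum>e\<in>V. cmod (\<delta> e n)) \<longlonglongrightarrow> 0" by simp
  from order_tendstoD(2)[OF this \<open>0 < \<Phi>\<close>]
  have ev1: "\<forall>\<^sub>F n in sequentially. (\<Sum>e\<in>V. cmod (\<delta> e n)) < \<Phi>" .
  have "\<forall>\<^sub>F n in sequentially. dist (p v) (y n v) < \<epsilon>" if "v \<in> V" for v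
    using order_tendstoD(2)[OF tendsto_dist[OF tendsto_const yv] interior[OF that]] .
  then have ev2: "\<forall>\<^sub>F n in sequentially. \<forall>v\<in>V. dist (p v) (y n v) < \<epsilon>"
    using fin by (simp add: eventually_ball_finite)
  obtain n where n: "(\<Sum>e\<in>V. cmod (\<delta> e n)) < \<Phi>" "\<forall>v\<in>V. dist (p v) (y n v) < \<epsilon>"
    using eventually_conj[OF ev1 ev2] by (auto simp: eventually_sequentially)
  have "y n \<in> Pi\<^sub>E V (\<lambda>v. cball (p v) \<epsilon>)"
    using n(2) by (auto simp: y_def less_imp_le)
  then have "\<Phi> \<le> (\<Sum>e\<in>V. cmod (f e s (y n)))" unfolding \<Phi>_def by (rule min)
  also have "\<dots> \<le> (\<Sum>e\<in>V. (1 - t n) * cmod (f e s x) + t n * cmod (\<delta> e n))"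
  proof (intro sum_mono)
    fix e assume "e \<in> V"
    have "cmod (f e s (y n)) \<le> cmod (of_real (1 - t n) * f e s x) + cmod (of_real (t n) * \<delta> e n)"
      unfolding fy[OF \<open>e \<in> V\<close>] by (rule norm_triangle_ineq)
    then show "cmod (f e s (y n)) \<le> (1 - t n) * cmod (f e s x) + t n * cmod (\<delta> e n)"
      using t[of n] by (simp only: norm_mult norm_of_real abs_of_nonneg diff_ge_0_iff_ge less_imp_le)
  qed
  also have "\<dots> = (1 - t n) * \<Phi> + t n * (\<Sum>e\<in>V. cmod (\<delta> e n))"
    by (simp add: \<Phi>_def sum.distrib sum_distrib_left)
  also have "\<dots> < (1 - t n) * \<Phi> + t n * \<Phi>"
    using n(1) t[of n] by simp
  finally show False by (simp add: algebra_simps)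
qed

text \<open>Take \<open>x n\<close> to be a minimizer of \<open>\<Sum>|f\<^sub>e|\<close> at the parameter \<open>s n\<close> over a box around \<open>p\<close> that
  contains no other zero at \<open>s0\<close>. Limit points of the \<open>x n\<close> are zeros, so \<open>x\<close> tends to \<open>p\<close>;
  eventually \<open>x n\<close> is interior and a zero by \<open>interior_minimum_is_zero\<close>. This plays the part of
  the implicit function theorem.\<close>

lemma zeros_persist:
  assumes "s0 \<in> S" "s \<longlonglongrightarrow> s0" "p \<in> zeros s0"
  obtains x where "x \<longlonglongrightarrow> p" "\<forall>\<^sub>F n in sequentially. x n \<in> zeros (s n)"
proof -
  have p: "p \<in> extensional V" using assms(3) by (simp add: zeros_def)
  \<comment> \<open>The box of radius \<open>\<epsilon>\<close> around \<open>p\<close> isolates \<open>p\<close> from the other zeros at \<open>s0\<close>.\<close>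
  obtain \<epsilon> where \<epsilon>: "\<epsilon> > 0" "\<And>q. q \<in> zeros s0 \<Longrightarrow> (\<forall>v\<in>V. dist (p v) (q v) \<le> \<epsilon>) \<Longrightarrow> q = p"
  proof -
    have "\<exists>d>0. \<not> (\<forall>v\<in>V. dist (p v) (q v) \<le> d)" if q: "q \<in> zeros s0" "q \<noteq> p" for q
    proof -
      have "q \<in> extensional V" using q by (simp add: zeros_def)
      then obtain v where "v \<in> V" "p v \<noteq> q v"
        using p q(2) by (metis extensionalityI)
      then show ?thesis by (intro exI[of _ "dist (p v) (q v) / 2"]) (auto intro!: bexI[of _ v])
    qed
    then obtain d where d: "\<And>q. q \<in> zeros s0 \<Longrightarrow> q \<noteq> p \<Longrightarrow> d q > 0 \<and> \<not> (\<forall>v\<in>V. dist (p v) (q v) \<le> d q)"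
      by metis
    define \<epsilon> where "\<epsilon> = Min (insert 1 (d ` (zeros s0 - {p})))"
    have finD: "finite (insert 1 (d ` (zeros s0 - {p})))" using finite_zeros[OF assms(1)] by simp
    have "\<epsilon> > 0" unfolding \<epsilon>_def using finD d by (subst Min_gr_iff) auto
    moreover have "q = p" if "q \<in> zeros s0" "\<forall>v\<in>V. dist (p v) (q v) \<le> \<epsilon>" for q
    proof (rule ccontr)
      assume "q \<noteq> p"
      then have "\<epsilon> \<le> d q" unfolding \<epsilon>_def using finD that by (intro Min_le) auto
      then show False using d[of q] that \<open>q \<noteq> p\<close> by force
    qed
    ultimately show ?thesis using that by blast
  qed
  let ?K = "Pi\<^sub>E V (\<lambda>v. cball (p v) \<epsilon>)"
  have K: "compact ?K" by (intro compact_PiE_box) auto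
  have pK: "p \<in> ?K" using p \<epsilon>(1) by (auto simp: PiE_def)
  have cont: "continuous_on ?K (\<lambda>y. \<Sum>e\<in>V. cmod (f e s' y))" for s'
  proof (intro continuous_intros)
    fix e
    have "continuous_on UNIV (\<lambda>y. case (s', y) of (s, x) \<Rightarrow> f e s x)"
      by (rule continuous_on_compose2[OF cont_f[of e]]) (auto intro!: continuous_intros)
    then show "continuous_on ?K (f e s')" by (auto intro: continuous_on_subset)
  qed
  have "\<exists>x\<in>?K. \<forall>y\<in>?K. (\<Sum>e\<in>V. cmod (f e (s n) x)) \<le> (\<Sum>e\<in>V. cmod (f e (s n) y))" for n
    using continuous_attains_inf[OF K _ cont] pK by blast
  then obtain x where xK: "\<And>n. x n \<in> ?K"
    and xmin: "\<And>n y. y \<in> ?K \<Longrightarrow> (\<Sum>e\<in>V. cmod (f e (s n) (x n))) \<le> (\<Sum>e\<in>V. cmod (f e (s n) y))"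
    by metis
  have lim: "x \<longlonglongrightarrow> p"
  proof (rule compact_seq_tendsto[OF K xK])
    fix r :: "nat \<Rightarrow> nat" and l assume r: "strict_mono r" "(x \<circ> r) \<longlonglongrightarrow> l" "l \<in> ?K"
    have sr: "(s \<circ> r) \<longlonglongrightarrow> s0" by (rule LIMSEQ_subseq_LIMSEQ[OF assms(2) r(1)])
    have "(\<lambda>n. \<Sum>e\<in>V. cmod (f e ((s \<circ> r) n) ((x \<circ> r) n))) \<longlonglongrightarrow> (\<Sum>e\<in>V. cmod (f e s0 l))"
      by (intro tendsto_intros tendsto_f sr r(2))
    moreover have "(\<lambda>n. \<Sum>e\<in>V. cmod (f e ((s \<circ> r) n) p)) \<longlonglongrightarrow> (\<Sum>e\<in>V. cmod (f e s0 p))"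
      by (intro tendsto_intros tendsto_f sr)
    ultimately have "(\<Sum>e\<in>V. cmod (f e s0 l)) \<le> (\<Sum>e\<in>V. cmod (f e s0 p))"
      by (rule LIMSEQ_le) (use xmin[OF pK] in auto)
    also have "\<dots> = 0" using assms(3) by (simp add: zeros_def)
    finally have "(\<Sum>e\<in>V. cmod (f e s0 l)) = 0" by (intro antisym sum_nonneg) auto
    then have "\<forall>e\<in>V. f e s0 l = 0" using fin by (simp add: sum_nonneg_eq_0_iff)
    then have "l \<in> zeros s0" using r(3) by (auto simp: zeros_def PiE_def)
    then show "l = p" using \<epsilon>(2) r(3) by (auto simp: PiE_def Pi_def)
  qed
  have "\<forall>\<^sub>F n in sequentially. dist (p v) (x n v) < \<epsilon>" for v
    using order_tendstoD(2)[OF tendsto_dist[OF tendsto_const[of "p v"] tendsto_fun_apply[OF lim, of v]], of \<epsilon>]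
      \<epsilon>(1) by simp
  then have ev: "\<forall>\<^sub>F n in sequentially. \<forall>v\<in>V. dist (p v) (x n v) < \<epsilon>"
    using fin by (simp add: eventually_ball_finite)
  have "\<forall>\<^sub>F n in sequentially. x n \<in> zeros (s n)"
    using eventually_D_nonzero[OF assms(2) lim lim assms(1,3)] ev
  proof eventually_elim
    case (elim n)
    show ?case
      by (rule interior_minimum_is_zero[of "x n" "s n" p \<epsilon>])
        (use elim xmin[of _ n] xK[of n] in \<open>auto simp: PiE_def\<close>)
  qed
  then show ?thesis using that lim by blast
qed

text \<open>The continuations of the zeros at \<open>s0\<close> are eventually distinct. A further zero at infinitely
  many \<open>s n\<close> would accumulate, by boundedness, at a zero \<open>p\<close> of \<open>s0\<close>, where \<open>zeros_unique\<close>
  identifies it with the continuation of \<open>p\<close>.\<close>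

lemma card_zeros_eventually:
  assumes "s0 \<in> S" "s \<longlonglongrightarrow> s0"
  shows "\<forall>\<^sub>F n in sequentially. card (zeros (s n)) = card (zeros s0)"
proof -
  have "\<forall>p\<in>zeros s0. \<exists>x. x \<longlonglongrightarrow> p \<and> (\<forall>\<^sub>F n in sequentially. x n \<in> zeros (s n))"
    using zeros_persist[OF assms] by blast
  then obtain x where x: "\<And>p. p \<in> zeros s0 \<Longrightarrow> x p \<longlonglongrightarrow> p"
    "\<And>p. p \<in> zeros s0 \<Longrightarrow> \<forall>\<^sub>F n in sequentially. x p n \<in> zeros (s n)"
    by metis
  have finz: "finite (zeros s0)" by (rule finite_zeros[OF assms(1)])
  have inj: "\<forall>\<^sub>F n in sequentially. \<forall>p\<in>zeros s0. \<forall>q\<in>zeros s0. p \<noteq> q \<longrightarrow> x p n \<noteq> x q n"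
  proof (intro eventually_ball_finite finz ballI)
    fix p q assume pq: "p \<in> zeros s0" "q \<in> zeros s0"
    show "\<forall>\<^sub>F n in sequentially. p \<noteq> q \<longrightarrow> x p n \<noteq> x q n"
    proof (cases "p = q")
      case False
      then have "0 < dist p q" by simp
      with order_tendstoD(1)[OF tendsto_dist[OF x(1)[OF pq(1)] x(1)[OF pq(2)]] this]
      show ?thesis by (auto elim: eventually_mono)
    qed simp
  qed
  have sub: "\<forall>\<^sub>F n in sequentially. \<forall>p\<in>zeros s0. x p n \<in> zeros (s n)"
    using finz x(2) by (intro eventually_ball_finite) auto
  have sup: "\<forall>\<^sub>F n in sequentially. zeros (s n) \<subseteq> (\<lambda>p. x p n) ` zeros s0"
  proof (rule ccontr)
    assume "\<not> ?thesis"
    then obtain r :: "nat \<Rightarrow> nat" where r: "strict_mono r"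
      "\<And>n. \<not> zeros (s (r n)) \<subseteq> (\<lambda>p. x p (r n)) ` zeros s0"
      using not_eventually_sequentiallyD by blast
    then have "\<forall>n. \<exists>y. y \<in> zeros (s (r n)) \<and> y \<notin> (\<lambda>p. x p (r n)) ` zeros s0" by blast
    then obtain y where y: "\<And>n. y n \<in> zeros ((s \<circ> r) n)" "\<And>n. y n \<notin> (\<lambda>p. x p (r n)) ` zeros s0"
      by (metis comp_apply)
    have sr: "(s \<circ> r) \<longlonglongrightarrow> s0" by (rule LIMSEQ_subseq_LIMSEQ[OF assms(2) r(1)])
    obtain p r' where p: "p \<in> zeros s0" "strict_mono r'" "(y \<circ> r') \<longlonglongrightarrow> p"
      by (rule zeros_subsequence[OF assms(1) sr y(1)])
    have rr: "strict_mono (r \<circ> r')" by (rule strict_mono_o[OF r(1) p(2)])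
    have "(x p \<circ> (r \<circ> r')) \<longlonglongrightarrow> p" by (rule LIMSEQ_subseq_LIMSEQ[OF x(1)[OF p(1)] rr])
    from eventually_D_nonzero[OF LIMSEQ_subseq_LIMSEQ[OF assms(2) rr] p(3) this assms(1) p(1)]
    have "\<forall>\<^sub>F n in sequentially. D ((s \<circ> (r \<circ> r')) n) ((y \<circ> r') n) ((x p \<circ> (r \<circ> r')) n) \<noteq> 0" .
    moreover have "\<forall>\<^sub>F n in sequentially. x p ((r \<circ> r') n) \<in> zeros (s ((r \<circ> r') n))"
      by (rule eventually_subseq[OF rr x(2)[OF p(1)]])
    ultimately have "\<forall>\<^sub>F n in sequentially. False"
    proof eventually_elim
      case (elim n)
      have "y (r' n) = x p (r (r' n))"
        using elim y(1)[of "r' n"] by (intro zeros_unique[of _ "s (r (r' n))"]) auto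
      then show False using y(2)[of "r' n"] p(1) by auto
    qed
    then show False by simp
  qed
  show ?thesis using inj sub sup
  proof eventually_elim
    case (elim n)
    have "zeros (s n) = (\<lambda>p. x p n) ` zeros s0" using elim(2,3) by auto
    moreover have "inj_on (\<lambda>p. x p n) (zeros s0)" using elim(1) by (auto simp: inj_on_def)
    ultimately show ?case by (simp add: card_image)
  qed
qed

lemma card_zeros_constant:
  assumes "connected S" "open S" "a \<in> S" "b \<in> S"
  shows "card (zeros a) = card (zeros b)"
proof -
  have "(\<lambda>s. card (zeros s)) constant_on S"
  proof (rule locally_constant_imp_constant[OF assms(1)])
    fix s0 assume s0: "s0 \<in> S"
    have "\<forall>\<^sub>F s in inf (nhds s0) (principal UNIV). card (zeros s) = card (zeros s0)"
      using card_zeros_eventually[OF s0] by (intro sequentially_imp_eventually_nhds_within) blast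
    then have "\<forall>\<^sub>F s in nhds s0. card (zeros s) = card (zeros s0)" by simp
    then obtain T where T: "open T" "s0 \<in> T" "\<forall>s\<in>T. card (zeros s) = card (zeros s0)"
      unfolding eventually_nhds by blast
    have "openin (top_of_set S) (S \<inter> T)" by (rule openin_open_Int[OF T(1)])
    then show "\<exists>T. openin (top_of_set S) T \<and> s0 \<in> T \<and> (\<forall>x\<in>T. card (zeros x) = card (zeros s0))"
      using T(2,3) s0 by blast
  qed
  then obtain c where "\<forall>s\<in>S. card (zeros s) = c" unfolding constant_on_def by blast
  then show ?thesis using assms(3,4) by simp
qed

end

section \<open>Conservation of the number of zeros\<close>

definition common_zeros :: "'v set \<Rightarrow> ('v \<Rightarrow> ('v \<Rightarrow> complex) \<Rightarrow> complex) \<Rightarrow> ('v \<Rightarrow> complex) set" where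
  "common_zeros V g = {x \<in> extensional V. \<forall>e\<in>V. g e x = 0}"

text \<open>A zero at which the Jacobian is invertible, expressed by difference quotients with base
  point \<open>p\<close>.\<close>

definition simple_zero :: "'v set \<Rightarrow> ('v \<Rightarrow> ('v \<Rightarrow> complex) \<Rightarrow> complex) \<Rightarrow> ('v \<Rightarrow> complex) \<Rightarrow> bool" where
  "simple_zero V g p \<longleftrightarrow> p \<in> common_zeros V g \<and>
     (\<exists>A. (\<forall>e\<in>V. \<forall>v\<in>V. A e v \<in> poly_funs V) \<and>
       (\<forall>e\<in>V. \<forall>x. g e x = (\<Sum>v\<in>V. A e v x * (x v - p v))) \<and>
       indexed_det V (\<lambda>e v. A e v p) \<noteq> 0)"

lemma continuous_on_case_sum:
  assumes "continuous_on S a" "continuous_on S b"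
  shows "continuous_on S (\<lambda>s. case_sum (a s) (b s))"
proof (rule continuous_on_coordinatewise_then_product)
  fix i show "continuous_on S (\<lambda>s. case_sum (a s) (b s) i)"
    using assms[THEN continuous_on_product_then_coordinatewise] by (cases i) auto
qed

text \<open>A system with parameter \<open>u\<close> together with functions \<open>b \<sigma>\<close> that, up to the denominator \<open>\<Delta>\<close>,
  span the functions on the zeros of the system: multiplication by a coordinate \<open>x v\<close> acts on the
  vector \<open>(b \<sigma> x)\<^sub>\<sigma>\<close> through a matrix \<open>M v\<close> that is polynomial in \<open>u\<close>. In the language of algebraic
  geometry, the scheme of zeros is finite over \<open>\<Delta> \<noteq> 0\<close>.\<close>

locale finite_zero_scheme =
  fixes V :: "'v::countable set" and L :: "'l set"
    and f :: "'v \<Rightarrow> ('l \<Rightarrow> complex) \<Rightarrow> ('v \<Rightarrow> complex) \<Rightarrow> complex"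
    and B :: "'b set" and b :: "'b \<Rightarrow> ('v \<Rightarrow> complex) \<Rightarrow> complex"
    and \<Delta> :: "('l \<Rightarrow> complex) \<Rightarrow> complex"
    and M :: "'v \<Rightarrow> 'b \<Rightarrow> 'b \<Rightarrow> ('l \<Rightarrow> complex) \<Rightarrow> complex"
  assumes finV: "finite V" and finB: "finite B"
    and joint: "\<And>e. e \<in> V \<Longrightarrow> (\<lambda>w. f e (w \<circ> Inl) (w \<circ> Inr)) \<in> poly_funs (L <+> V)"
    and \<Delta>_poly: "\<Delta> \<in> poly_funs L"
    and M_poly: "\<And>v \<sigma> \<tau>. v \<in> V \<Longrightarrow> \<sigma> \<in> B \<Longrightarrow> \<tau> \<in> B \<Longrightarrow> M v \<sigma> \<tau> \<in> poly_funs L"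
    and eigen: "\<And>u x v \<sigma>. x \<in> common_zeros V (\<lambda>e. f e u) \<Longrightarrow> v \<in> V \<Longrightarrow> \<sigma> \<in> B \<Longrightarrow>
      \<Delta> u * (x v * b \<sigma> x) = (\<Sum>\<tau>\<in>B. M v \<sigma> \<tau> u * b \<tau> x)"
    and nonzero: "\<And>u x. x \<in> common_zeros V (\<lambda>e. f e u) \<Longrightarrow> \<Delta> u \<noteq> 0 \<Longrightarrow> \<exists>\<sigma>\<in>B. b \<sigma> x \<noteq> 0"
begin

text \<open>What holds for the coordinates holds for all polynomials: sums and products of the matrices
  represent sums and products of functions.\<close>

lemma functional_calculus:
  assumes "g \<in> poly_funs (L <+> V)"
  shows "\<exists>r Mg. (\<forall>\<sigma>\<in>B. \<forall>\<tau>\<in>B. Mg \<sigma> \<tau> \<in> poly_funs L) \<and>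
    (\<forall>u. \<forall>x\<in>common_zeros V (\<lambda>e. f e u). \<forall>\<sigma>\<in>B.
      \<Delta> u ^ r * (g (case_sum u x) * b \<sigma> x) = (\<Sum>\<tau>\<in>B. Mg \<sigma> \<tau> u * b \<tau> x))"
  using assms
proof (induction rule: poly_funs.induct)
  case (const c)
  show ?case
    using finB by (intro exI[of _ 0] exI[of _ "\<lambda>\<sigma> \<tau> u. if \<sigma> = \<tau> then c else 0"])
      (auto intro: poly_funs.const simp: if_distrib[of "\<lambda>c. c * _"] cong: if_cong)
next
  case (var w)
  show ?case
  proof (cases w)
    case (Inl l)
    then have l: "(\<lambda>u. u l) \<in> poly_funs L" using var by (auto intro: poly_funs.var)
    have "(\<lambda>u. if \<sigma> = \<tau> then u l else 0) \<in> poly_funs L" for \<sigma> \<tau> :: 'b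
      by (cases "\<sigma> = \<tau>") (auto intro: l poly_funs.const)
    then show ?thesis
      using finB Inl by (intro exI[of _ 0] exI[of _ "\<lambda>\<sigma> \<tau> u. if \<sigma> = \<tau> then u l else 0"])
        (simp add: if_distrib[of "\<lambda>c. c * _"] cong: if_cong)
  next
    case (Inr v)
    then have "v \<in> V" using var by auto
    then show ?thesis
      using Inr by (intro exI[of _ 1] exI[of _ "M v"]) (auto intro: M_poly simp: eigen)
  qed
next
  case (add g h)
  from add.IH(1) obtain r G where G: "\<forall>\<sigma>\<in>B. \<forall>\<tau>\<in>B. G \<sigma> \<tau> \<in> poly_funs L"
    "\<forall>u. \<forall>x\<in>common_zeros V (\<lambda>e. f e u). \<forall>\<sigma>\<in>B.
      \<Delta> u ^ r * (g (case_sum u x) * b \<sigma> x) = (\<Sum>\<tau>\<in>B. G \<sigma> \<tau> u * b \<tau> x)" by (elim exE conjE)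
  from add.IH(2) obtain r' H where H: "\<forall>\<sigma>\<in>B. \<forall>\<tau>\<in>B. H \<sigma> \<tau> \<in> poly_funs L"
    "\<forall>u. \<forall>x\<in>common_zeros V (\<lambda>e. f e u). \<forall>\<sigma>\<in>B.
      \<Delta> u ^ r' * (h (case_sum u x) * b \<sigma> x) = (\<Sum>\<tau>\<in>B. H \<sigma> \<tau> u * b \<tau> x)" by (elim exE conjE)
  show ?case
  proof (intro exI[of _ "r + r'"] exI[of _ "\<lambda>\<sigma> \<tau> u. \<Delta> u ^ r' * G \<sigma> \<tau> u + \<Delta> u ^ r * H \<sigma> \<tau> u"]
      conjI allI ballI)
    fix \<sigma> \<tau> assume "\<sigma> \<in> B" "\<tau> \<in> B"
    then show "(\<lambda>u. \<Delta> u ^ r' * G \<sigma> \<tau> u + \<Delta> u ^ r * H \<sigma> \<tau> u) \<in> poly_funs L"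
      using G(1) H(1) \<Delta>_poly by (intro poly_funs.add poly_funs.mult poly_funs_power) auto
  next
    fix u x \<sigma> assume x: "x \<in> common_zeros V (\<lambda>e. f e u)" and \<sigma>: "\<sigma> \<in> B"
    have "\<Delta> u ^ (r + r') * ((g (case_sum u x) + h (case_sum u x)) * b \<sigma> x) =
        \<Delta> u ^ r' * (\<Delta> u ^ r * (g (case_sum u x) * b \<sigma> x)) +
        \<Delta> u ^ r * (\<Delta> u ^ r' * (h (case_sum u x) * b \<sigma> x))"
      by (simp add: power_add algebra_simps)
    also have "\<dots> = \<Delta> u ^ r' * (\<Sum>\<tau>\<in>B. G \<sigma> \<tau> u * b \<tau> x) + \<Delta> u ^ r * (\<Sum>\<tau>\<in>B. H \<sigma> \<tau> u * b \<tau> x)"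
      using G(2) H(2) x \<sigma> by simp
    finally show "\<Delta> u ^ (r + r') * ((g (case_sum u x) + h (case_sum u x)) * b \<sigma> x) =
        (\<Sum>\<tau>\<in>B. (\<Delta> u ^ r' * G \<sigma> \<tau> u + \<Delta> u ^ r * H \<sigma> \<tau> u) * b \<tau> x)"
      by (simp add: sum_distrib_left sum.distrib distrib_right mult.assoc)
  qed
next
  case (mult g h)
  from mult.IH(1) obtain r G where G: "\<forall>\<sigma>\<in>B. \<forall>\<tau>\<in>B. G \<sigma> \<tau> \<in> poly_funs L"
    "\<forall>u. \<forall>x\<in>common_zeros V (\<lambda>e. f e u). \<forall>\<sigma>\<in>B.
      \<Delta> u ^ r * (g (case_sum u x) * b \<sigma> x) = (\<Sum>\<tau>\<in>B. G \<sigma> \<tau> u * b \<tau> x)" by (elim exE conjE)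
  from mult.IH(2) obtain r' H where H: "\<forall>\<sigma>\<in>B. \<forall>\<tau>\<in>B. H \<sigma> \<tau> \<in> poly_funs L"
    "\<forall>u. \<forall>x\<in>common_zeros V (\<lambda>e. f e u). \<forall>\<sigma>\<in>B.
      \<Delta> u ^ r' * (h (case_sum u x) * b \<sigma> x) = (\<Sum>\<tau>\<in>B. H \<sigma> \<tau> u * b \<tau> x)" by (elim exE conjE)
  show ?case
  proof (intro exI[of _ "r + r'"] exI[of _ "\<lambda>\<sigma> \<tau> u. \<Sum>\<rho>\<in>B. G \<sigma> \<rho> u * H \<rho> \<tau> u"] conjI allI ballI)
    fix \<sigma> \<tau> assume "\<sigma> \<in> B" "\<tau> \<in> B"
    then show "(\<lambda>u. \<Sum>\<rho>\<in>B. G \<sigma> \<rho> u * H \<rho> \<tau> u) \<in> poly_funs L"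
      using G(1) H(1) by (intro poly_funs_sum poly_funs.mult) auto
  next
    fix u x \<sigma> assume x: "x \<in> common_zeros V (\<lambda>e. f e u)" and \<sigma>: "\<sigma> \<in> B"
    have "\<Delta> u ^ (r + r') * ((g (case_sum u x) * h (case_sum u x)) * b \<sigma> x) =
        \<Delta> u ^ r' * h (case_sum u x) * (\<Delta> u ^ r * (g (case_sum u x) * b \<sigma> x))"
      by (simp add: power_add algebra_simps)
    also have "\<dots> = (\<Sum>\<rho>\<in>B. G \<sigma> \<rho> u * (\<Delta> u ^ r' * (h (case_sum u x) * b \<rho> x)))"
      using G(2) x \<sigma> by (simp add: sum_distrib_left ac_simps)
    also have "\<dots> = (\<Sum>\<rho>\<in>B. G \<sigma> \<rho> u * (\<Sum>\<tau>\<in>B. H \<rho> \<tau> u * b \<tau> x))"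
      using H(2) x by simp
    also have "\<dots> = (\<Sum>\<tau>\<in>B. (\<Sum>\<rho>\<in>B. G \<sigma> \<rho> u * H \<rho> \<tau> u) * b \<tau> x)"
      unfolding sum_distrib_left sum_distrib_right by (subst sum.swap) (simp add: mult.assoc)
    finally show "\<Delta> u ^ (r + r') * ((g (case_sum u x) * h (case_sum u x)) * b \<sigma> x) =
        (\<Sum>\<tau>\<in>B. (\<Sum>\<rho>\<in>B. G \<sigma> \<rho> u * H \<rho> \<tau> u) * b \<tau> x)" .
  qed
qed

text \<open>Eigenvalues are bounded by the entries of the matrix: compare moduli in the row of the
  \<open>b \<sigma> x\<close> of largest modulus.\<close>

lemma norm_coordinate_bound:
  assumes "x \<in> common_zeros V (\<lambda>e. f e u)" "\<Delta> u \<noteq> 0" "v \<in> V"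
  shows "cmod (x v) \<le> (\<Sum>v\<in>V. \<Sum>\<sigma>\<in>B. \<Sum>\<tau>\<in>B. cmod (M v \<sigma> \<tau> u)) / cmod (\<Delta> u)"
proof -
  obtain \<rho> where \<rho>: "\<rho> \<in> B" "b \<rho> x \<noteq> 0" using nonzero[OF assms(1,2)] by blast
  define m where "m = Max ((\<lambda>\<sigma>. cmod (b \<sigma> x)) ` B)"
  have "m \<in> (\<lambda>\<sigma>. cmod (b \<sigma> x)) ` B" unfolding m_def using finB \<rho> by (intro Max_in) auto
  then obtain \<sigma> where \<sigma>: "\<sigma> \<in> B" "m = cmod (b \<sigma> x)" by blast
  have le: "cmod (b \<tau> x) \<le> cmod (b \<sigma> x)" if "\<tau> \<in> B" for \<tau>
    using finB that \<sigma>(2) unfolding m_def by (metis Max_ge finite_imageI image_eqI)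
  have pos: "0 < cmod (b \<sigma> x)" using le[OF \<rho>(1)] \<rho>(2) by (meson less_le_trans zero_less_norm_iff)
  have "cmod (\<Delta> u) * cmod (x v) * cmod (b \<sigma> x) = cmod (\<Sum>\<tau>\<in>B. M v \<sigma> \<tau> u * b \<tau> x)"
    unfolding eigen[OF assms(1,3) \<sigma>(1), symmetric] by (simp add: norm_mult)
  also have "\<dots> \<le> (\<Sum>\<tau>\<in>B. cmod (M v \<sigma> \<tau> u) * cmod (b \<sigma> x))"
    by (rule order_trans[OF norm_sum]) (auto intro!: sum_mono mult_left_mono le simp: norm_mult)
  also have "\<dots> = (\<Sum>\<tau>\<in>B. cmod (M v \<sigma> \<tau> u)) * cmod (b \<sigma> x)" by (simp add: sum_distrib_right)
  finally have "cmod (\<Delta> u) * cmod (x v) \<le> (\<Sum>\<tau>\<in>B. cmod (M v \<sigma> \<tau> u))" using pos by simp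
  also have "\<dots> \<le> (\<Sum>\<sigma>\<in>B. \<Sum>\<tau>\<in>B. cmod (M v \<sigma> \<tau> u))"
    using finB \<sigma>(1) by (intro member_le_sum[of \<sigma> B "\<lambda>\<sigma>. \<Sum>\<tau>\<in>B. cmod (M v \<sigma> \<tau> u)"]) (auto intro: sum_nonneg)
  also have "\<dots> \<le> (\<Sum>v\<in>V. \<Sum>\<sigma>\<in>B. \<Sum>\<tau>\<in>B. cmod (M v \<sigma> \<tau> u))"
    using finV assms(3) by (intro member_le_sum[of v V "\<lambda>v. \<Sum>\<sigma>\<in>B. \<Sum>\<tau>\<in>B. cmod (M v \<sigma> \<tau> u)"]) (auto intro!: sum_nonneg)
  finally show ?thesis using assms(2) by (simp add: field_simps)
qed

text \<open>The polynomial \<open>P\<close> is \<open>\<Delta>\<close> times the determinant \<open>Q\<close> of the matrix that represents \<open>T\<close> times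
  the Jacobian determinant \<open>J\<close>. If \<open>P u \<noteq> 0\<close>, then neither \<open>T\<close> nor \<open>J\<close> vanishes at a zero \<open>x\<close>,
  since otherwise the vector \<open>(b \<sigma> x)\<^sub>\<sigma>\<close> would be in the kernel of that matrix. At \<open>u0\<close> the
  determinant \<open>Q\<close> is nonzero because a left kernel vector would give a linear relation between the
  \<open>b \<sigma>\<close> on the zeros, which \<open>pairing\<close> forbids. The number of zeros is then followed along the
  complex line through \<open>u0\<close> and \<open>u\<close>, where \<open>P\<close> has finitely many roots.\<close>

theorem conservation_of_number:
  assumes u0: "\<Delta> u0 \<noteq> 0"
    and T: "T \<in> poly_funs V" "\<And>x. x \<in> common_zeros V (\<lambda>e. f e u0) \<Longrightarrow> T x \<noteq> 0"
    and nondeg: "\<And>x w. x \<in> common_zeros V (\<lambda>e. f e u0) \<Longrightarrow>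
      (\<And>e. e \<in> V \<Longrightarrow> ((\<lambda>t. f e u0 (\<lambda>v. x v + t * w v) / t) \<longlongrightarrow> 0) (at 0)) \<Longrightarrow> \<forall>v\<in>V. w v = 0"
    and pairing: "\<And>c. (\<And>x. x \<in> common_zeros V (\<lambda>e. f e u0) \<Longrightarrow> (\<Sum>\<sigma>\<in>B. c \<sigma> * b \<sigma> x) = 0) \<Longrightarrow>
      \<forall>\<sigma>\<in>B. c \<sigma> = 0"
  shows "\<exists>P\<in>poly_funs L. P u0 \<noteq> 0 \<and> (\<forall>u. P u \<noteq> 0 \<longrightarrow>
    finite (common_zeros V (\<lambda>e. f e u)) \<and>
    card (common_zeros V (\<lambda>e. f e u)) = card (common_zeros V (\<lambda>e. f e u0)) \<and>
    (\<forall>x\<in>common_zeros V (\<lambda>e. f e u). T x \<noteq> 0 \<and> simple_zero V (\<lambda>e. f e u) x))"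
proof -
  let ?Z = "\<lambda>u. common_zeros V (\<lambda>e. f e u)"
  have "\<forall>e\<in>V. \<exists>A. (\<forall>v\<in>V. A v \<in> poly_funs (L <+> (V <+> V))) \<and>
    (\<forall>u x y. f e u x - f e u y = (\<Sum>v\<in>V. A v (case_sum u (case_sum x y)) * (x v - y v)))"
    using poly_funs_difference_quotient[OF joint finV] by (simp add: case_sum_o_inj)
  then obtain A where A0: "\<forall>e\<in>V. (\<forall>v\<in>V. A e v \<in> poly_funs (L <+> (V <+> V))) \<and>
    (\<forall>u x y. f e u x - f e u y = (\<Sum>v\<in>V. A e v (case_sum u (case_sum x y)) * (x v - y v)))"
    by (rule bchoice[THEN exE])
  have A: "\<And>e v. e \<in> V \<Longrightarrow> v \<in> V \<Longrightarrow> A e v \<in> poly_funs (L <+> (V <+> V))"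
    and dq: "\<And>e u x y. e \<in> V \<Longrightarrow>
      f e u x - f e u y = (\<Sum>v\<in>V. A e v (case_sum u (case_sum x y)) * (x v - y v))"
    using A0 by simp_all
  define J where "J u x = indexed_det V (\<lambda>e v. A e v (case_sum u (case_sum x x)))" for u x
  have "(\<lambda>w. A e v (case_sum (w \<circ> Inl) (case_sum (w \<circ> Inr) (w \<circ> Inr)))) \<in> poly_funs (L <+> V)"
    if "e \<in> V" "v \<in> V" for e v
    by (rule poly_funs_substitute[OF A[OF that]]) (auto intro: poly_funs.intros)
  then have "(\<lambda>w. J (w \<circ> Inl) (w \<circ> Inr)) \<in> poly_funs (L <+> V)"
    unfolding J_def by (intro indexed_det_poly_funs[OF finV])
  moreover have "(\<lambda>w. T (w \<circ> Inr)) \<in> poly_funs (L <+> V)"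
    by (rule poly_funs_substitute[OF T(1)]) (auto intro: poly_funs.intros)
  ultimately have "(\<lambda>w. T (w \<circ> Inr) * J (w \<circ> Inl) (w \<circ> Inr)) \<in> poly_funs (L <+> V)"
    by (rule poly_funs.mult[rotated])
  from functional_calculus[OF this] obtain r MJ where
    MJ: "\<forall>\<sigma>\<in>B. \<forall>\<tau>\<in>B. MJ \<sigma> \<tau> \<in> poly_funs L"
    and MJ_eigen0: "\<forall>u. \<forall>x\<in>?Z u. \<forall>\<sigma>\<in>B. \<Delta> u ^ r *
      (T (case_sum u x \<circ> Inr) * J (case_sum u x \<circ> Inl) (case_sum u x \<circ> Inr) * b \<sigma> x) =
      (\<Sum>\<tau>\<in>B. MJ \<sigma> \<tau> u * b \<tau> x)"
    by (elim exE conjE)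
  have MJ_eigen: "\<Delta> u ^ r * (T x * J u x * b \<sigma> x) = (\<Sum>\<tau>\<in>B. MJ \<sigma> \<tau> u * b \<tau> x)"
    if "x \<in> ?Z u" "\<sigma> \<in> B" for u x \<sigma>
    using MJ_eigen0 that by (simp add: case_sum_o_inj)
  define Q where "Q u = indexed_det B (\<lambda>\<sigma> \<tau>. MJ \<sigma> \<tau> u)" for u
  define P where "P u = \<Delta> u * Q u" for u
  have Q_poly: "Q \<in> poly_funs L" unfolding Q_def using MJ by (intro indexed_det_poly_funs finB) auto
  have P_poly: "P \<in> poly_funs L" unfolding P_def by (intro poly_funs.mult \<Delta>_poly Q_poly)
  have TJ: "T x \<noteq> 0 \<and> J u x \<noteq> 0" if Pu: "P u \<noteq> 0" and x: "x \<in> ?Z u" for u x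
  proof (rule ccontr)
    assume "\<not> ?thesis"
    then have null: "(\<Sum>\<tau>\<in>B. MJ \<sigma> \<tau> u * b \<tau> x) = 0" if "\<sigma> \<in> B" for \<sigma>
      using MJ_eigen[OF x that] by auto
    have "\<Delta> u \<noteq> 0" using Pu by (simp add: P_def)
    then obtain \<sigma> where "\<sigma> \<in> B" "b \<sigma> x \<noteq> 0" using nonzero[OF x] by blast
    then have "Q u = 0" unfolding Q_def
      by (intro indexed_det_right_null_imp_zero[OF finB, of \<sigma> "\<lambda>\<tau>. b \<tau> x"] null)
    then show False using Pu by (simp add: P_def)
  qed
  \<comment> \<open>A kernel vector \<open>w\<close> of the Jacobian is a direction in which the system vanishes faster than linearly.\<close>
  have J0: "J u0 x \<noteq> 0" if x: "x \<in> ?Z u0" for x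
  proof
    assume "J u0 x = 0"
    then obtain w where w: "\<exists>v\<in>V. w v \<noteq> 0"
      "\<And>e. e \<in> V \<Longrightarrow> (\<Sum>v\<in>V. A e v (case_sum u0 (case_sum x x)) * w v) = 0"
      using indexed_det_zero_imp_right_null[OF finV, of "\<lambda>e v. A e v (case_sum u0 (case_sum x x))"]
      unfolding J_def by blast
    have "((\<lambda>t. f e u0 (\<lambda>v. x v + t * w v) / t) \<longlongrightarrow> 0) (at 0)" if e: "e \<in> V" for e
    proof -
      have cont: "isCont (\<lambda>t. A e v (case_sum u0 (case_sum (\<lambda>v. x v + t * w v) x))) 0" if "v \<in> V" for v
      proof -
        have "continuous_on UNIV (\<lambda>t v. x v + t * w v)"
          by (intro continuous_on_coordinatewise_then_product continuous_intros)
        then have "continuous_on UNIV (\<lambda>t. case_sum u0 (case_sum (\<lambda>v. x v + t * w v) x))"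
          by (intro continuous_on_case_sum continuous_on_const)
        then have "continuous_on UNIV (\<lambda>t. A e v (case_sum u0 (case_sum (\<lambda>v. x v + t * w v) x)))"
          using continuous_on_compose2[OF poly_funs_continuous[OF A[OF e that]]] by blast
        then show ?thesis by (simp add: continuous_on_eq_continuous_at)
      qed
      have "((\<lambda>t. \<Sum>v\<in>V. A e v (case_sum u0 (case_sum (\<lambda>v. x v + t * w v) x)) * w v) \<longlongrightarrow>
          (\<Sum>v\<in>V. A e v (case_sum u0 (case_sum (\<lambda>v. x v + 0 * w v) x)) * w v)) (at 0)"
        by (intro tendsto_sum tendsto_mult tendsto_const) (use cont in \<open>simp add: isCont_def\<close>)
      then have "((\<lambda>t. \<Sum>v\<in>V. A e v (case_sum u0 (case_sum (\<lambda>v. x v + t * w v) x)) * w v) \<longlongrightarrow> 0) (at 0)"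
        using w(2)[OF e] by simp
      moreover have "\<forall>\<^sub>F t in at 0. (\<Sum>v\<in>V. A e v (case_sum u0 (case_sum (\<lambda>v. x v + t * w v) x)) * w v) =
          f e u0 (\<lambda>v. x v + t * w v) / t"
      proof (rule eventually_at_filter[THEN iffD2], intro always_eventually allI impI)
        fix t :: complex assume "t \<noteq> 0"
        have "f e u0 (\<lambda>v. x v + t * w v) =
            (\<Sum>v\<in>V. A e v (case_sum u0 (case_sum (\<lambda>v. x v + t * w v) x)) * (t * w v))"
          using dq[OF e, of u0 "\<lambda>v. x v + t * w v" x] x e by (simp add: common_zeros_def)
        also have "\<dots> = t * (\<Sum>v\<in>V. A e v (case_sum u0 (case_sum (\<lambda>v. x v + t * w v) x)) * w v)"
          by (simp add: sum_distrib_left mult.left_commute)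
        finally show "(\<Sum>v\<in>V. A e v (case_sum u0 (case_sum (\<lambda>v. x v + t * w v) x)) * w v) =
          f e u0 (\<lambda>v. x v + t * w v) / t" using \<open>t \<noteq> 0\<close> by simp
      qed
      ultimately show ?thesis by (rule Lim_transform_eventually)
    qed
    then have "\<forall>v\<in>V. w v = 0" by (rule nondeg[OF x])
    then show False using w(1) by blast
  qed
  have "Q u0 \<noteq> 0"
  proof
    assume "Q u0 = 0"
    then obtain c where c: "\<exists>\<sigma>\<in>B. c \<sigma> \<noteq> 0" "\<And>\<tau>. \<tau> \<in> B \<Longrightarrow> (\<Sum>\<sigma>\<in>B. c \<sigma> * MJ \<sigma> \<tau> u0) = 0"
      using indexed_det_zero_imp_left_null[OF finB, of "\<lambda>\<sigma> \<tau>. MJ \<sigma> \<tau> u0"] unfolding Q_def by blast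
    have "(\<Sum>\<sigma>\<in>B. c \<sigma> * b \<sigma> x) = 0" if x: "x \<in> ?Z u0" for x
    proof -
      have "\<Delta> u0 ^ r * (T x * J u0 x) * (\<Sum>\<sigma>\<in>B. c \<sigma> * b \<sigma> x) =
          (\<Sum>\<sigma>\<in>B. c \<sigma> * (\<Delta> u0 ^ r * (T x * J u0 x * b \<sigma> x)))"
        by (simp add: sum_distrib_left ac_simps)
      also have "\<dots> = (\<Sum>\<sigma>\<in>B. c \<sigma> * (\<Sum>\<tau>\<in>B. MJ \<sigma> \<tau> u0 * b \<tau> x))"
        using MJ_eigen x by simp
      also have "\<dots> = (\<Sum>\<tau>\<in>B. (\<Sum>\<sigma>\<in>B. c \<sigma> * MJ \<sigma> \<tau> u0) * b \<tau> x)"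
        unfolding sum_distrib_left sum_distrib_right by (subst sum.swap) (simp add: mult.assoc)
      also have "\<dots> = 0" using c(2) by simp
      finally show ?thesis using u0 T(2)[OF x] J0[OF x] by simp
    qed
    then show False using pairing c(1) by blast
  qed
  then have P0: "P u0 \<noteq> 0" using u0 by (simp add: P_def)
  have main: "finite (?Z u1) \<and> card (?Z u1) = card (?Z u0)" if P1: "P u1 \<noteq> 0" for u1
  proof -
    define U where "U s = (\<lambda>l. u0 l + s * (u1 l - u0 l))" for s :: complex
    define S where "S = {s. P (U s) \<noteq> 0}"
    obtain p where p: "\<And>s. P (U s) = poly p s"
      using poly_funs_on_line[OF P_poly, of u0 "\<lambda>l. u1 l - u0 l"] unfolding U_def by blast
    have U01: "U 0 = u0" "U 1 = u1" by (auto simp: U_def)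
    have "p \<noteq> 0" using p[of 0] P0 U01 by auto
    then have "finite {s. poly p s = 0}" by (rule poly_roots_finite)
    moreover have S: "S = UNIV - {s. poly p s = 0}" by (auto simp: S_def p)
    ultimately have "connected S" "open S"
      using connected_open_delete_finite[OF open_UNIV connected_UNIV, of "{s. poly p s = 0}"]
        open_Diff[OF open_UNIV finite_imp_closed, of "{s. poly p s = 0}"] by auto
    have contUU: "continuous_on UNIV U"
      unfolding U_def by (intro continuous_on_coordinatewise_then_product continuous_intros)
    \<comment> \<open>Extension by zero: the assumptions on the system concern indices in \<open>V\<close> only.\<close>
    define f' where "f' e s x = (if e \<in> V then f e (U s) x else 0)" for e s x
    define A' where "A' e v s x y = (if e \<in> V \<and> v \<in> V then A e v (case_sum (U s) (case_sum x y)) else 0)"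
      for e v s x y
    have det_eq: "indexed_det V (\<lambda>e v. A' e v s x x) = J (U s) x" for s x
    proof -
      have "enumeration V a \<in> V" if "a < card V" for a
        using enumeration_bij[OF finV] that by (auto simp: bij_betw_def)
      then have "indexed_mat V (\<lambda>e v. A' e v s x x) =
          indexed_mat V (\<lambda>e v. A e v (case_sum (U s) (case_sum x x)))"
        by (intro eq_matI) (auto simp: indexed_mat_def A'_def)
      then show ?thesis by (simp add: indexed_det_def J_def)
    qed
    have Z': "x \<in> ?Z (U s)" if "x \<in> extensional V" "\<And>e. e \<in> V \<Longrightarrow> f' e s x = 0" for s x
      using that by (auto simp: common_zeros_def f'_def)
    interpret zero_family V f' A' S
    proof
      show "finite V" by (rule finV)
      show "continuous_on UNIV (\<lambda>(s, x). f' e s x)" for e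
      proof (cases "e \<in> V")
        case True
        have "continuous_on UNIV (\<lambda>sx :: complex \<times> ('v \<Rightarrow> complex). case_sum (U (fst sx)) (snd sx))"
          by (intro continuous_on_case_sum continuous_on_compose2[OF contUU] continuous_intros) auto
        from continuous_on_compose2[OF poly_funs_continuous[OF joint[OF True]] this]
        show ?thesis using True by (simp add: f'_def case_sum_o_inj case_prod_unfold)
      qed (simp add: f'_def)
      show "continuous_on UNIV (\<lambda>(s, x, y). A' e v s x y)" for e v
      proof (cases "e \<in> V \<and> v \<in> V")
        case True
        have "continuous_on UNIV (\<lambda>sxy :: complex \<times> ('v \<Rightarrow> complex) \<times> ('v \<Rightarrow> complex).
            case_sum (U (fst sxy)) (case_sum (fst (snd sxy)) (snd (snd sxy))))"
          by (intro continuous_on_case_sum continuous_on_compose2[OF contUU] continuous_intros) auto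
        from continuous_on_compose2[OF poly_funs_continuous[OF A[of e v]] this]
        show ?thesis using True by (simp add: A'_def case_prod_unfold)
      next
        case False
        then have "A' e v = (\<lambda>s x y. 0)" by (auto simp: A'_def fun_eq_iff)
        then show ?thesis by simp
      qed
      show "f' e s x - f' e s y = (\<Sum>v\<in>V. A' e v s x y * (x v - y v))" if "e \<in> V" for e s x y
        using that dq[OF that, of "U s" x y] by (simp add: f'_def A'_def)
      show "indexed_det V (\<lambda>e v. A' e v s x x) \<noteq> 0"
        if "s \<in> S" "x \<in> extensional V" "\<And>e. e \<in> V \<Longrightarrow> f' e s x = 0" for s x
        unfolding det_eq using TJ[OF _ Z'[OF that(2,3)]] that(1) by (simp add: S_def)
      show "\<exists>R. \<forall>\<^sub>F s in nhds s0. \<forall>x. x \<in> extensional V \<longrightarrow>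
          (\<forall>e\<in>V. f' e s x = 0) \<longrightarrow> (\<forall>v\<in>V. cmod (x v) \<le> R)" if s0: "s0 \<in> S" for s0
      proof -
        define R where "R s = (\<Sum>v\<in>V. \<Sum>\<sigma>\<in>B. \<Sum>\<tau>\<in>B. cmod (M v \<sigma> \<tau> (U s))) / cmod (\<Delta> (U s))" for s
        have \<Delta>S: "\<Delta> (U s) \<noteq> 0" if "s \<in> S" for s using that by (auto simp: S_def P_def)
        have cp: "continuous_on S (\<lambda>s. g (U s))" if "g \<in> poly_funs L" for g
          using continuous_on_compose2[OF poly_funs_continuous[OF that] contUU]
          by (auto intro: continuous_on_subset)
        have "continuous_on S R"
          unfolding R_def using \<Delta>S by (intro continuous_intros cp M_poly \<Delta>_poly) auto
        then have "isCont R s0" using \<open>open S\<close> s0 by (simp add: continuous_on_eq_continuous_at)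
        then have "(R \<longlongrightarrow> R s0) (nhds s0)" by (simp add: isCont_def tendsto_at_iff_tendsto_nhds)
        then have "\<forall>\<^sub>F s in nhds s0. R s < R s0 + 1" by (rule order_tendstoD) simp
        moreover have "\<forall>\<^sub>F s in nhds s0. s \<in> S"
          using \<open>open S\<close> s0 by (rule eventually_nhds_in_open)
        ultimately have "\<forall>\<^sub>F s in nhds s0. \<forall>x. x \<in> extensional V \<longrightarrow>
          (\<forall>e\<in>V. f' e s x = 0) \<longrightarrow> (\<forall>v\<in>V. cmod (x v) \<le> R s0 + 1)"
        proof eventually_elim
          case (elim s)
          show ?case
          proof (intro allI impI ballI)
            fix x v assume "x \<in> extensional V" "\<forall>e\<in>V. f' e s x = 0" "v \<in> V"
            then have "cmod (x v) \<le> R s"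
              unfolding R_def using Z' \<Delta>S[OF elim(2)] by (intro norm_coordinate_bound) auto
            then show "cmod (x v) \<le> R s0 + 1" using elim(1) by simp
          qed
        qed
        then show ?thesis by blast
      qed
    qed
    have zeros_eq: "zeros s = ?Z (U s)" for s
      by (auto simp: zeros_def common_zeros_def f'_def)
    have "0 \<in> S" "1 \<in> S" using P0 P1 U01 by (auto simp: S_def)
    then show ?thesis
      using finite_zeros[of 1] card_zeros_constant[OF \<open>connected S\<close> \<open>open S\<close>, of 1 0]
      by (simp add: zeros_eq U01)
  qed
  have simple: "simple_zero V (\<lambda>e. f e u) x" if "P u \<noteq> 0" "x \<in> ?Z u" for u x
    unfolding simple_zero_def
  proof (intro conjI exI[of _ "\<lambda>e v y. A e v (case_sum u (case_sum y x))"] ballI allI)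
    fix e v assume "e \<in> V" "v \<in> V"
    show "(\<lambda>y. A e v (case_sum u (case_sum y x))) \<in> poly_funs V"
      by (rule poly_funs_substitute[OF A[OF \<open>e \<in> V\<close> \<open>v \<in> V\<close>]]) (auto intro: poly_funs.intros)
  next
    fix e y assume "e \<in> V"
    then show "f e u y = (\<Sum>v\<in>V. A e v (case_sum u (case_sum y x)) * (y v - x v))"
      using dq[of e u y x] that(2) by (simp add: common_zeros_def)
  next
    show "indexed_det V (\<lambda>e v. A e v (case_sum u (case_sum x x))) \<noteq> 0"
      using TJ[OF that] by (simp add: J_def)
  qed (rule that(2))
  show ?thesis
  proof (intro bexI[of _ P] conjI allI impI ballI)
    fix u assume P: "P u \<noteq> 0"
    show "finite (?Z u)" "card (?Z u) = card (?Z u0)" using main[OF P] by blast+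
    fix x assume "x \<in> ?Z u"
    then show "T x \<noteq> 0" "simple_zero V (\<lambda>e. f e u) x" using TJ[OF P] simple[OF P] by blast+
  qed (fact P0 P_poly)+
qed

end

section \<open>Multiplicity of simple zeros\<close>

text \<open>Write \<open>q\<close> as a combination of the \<open>x v - p v\<close>. By Cramer's rule each \<open>x v - p v\<close>, multiplied
  by the determinant \<open>h\<close> of the difference quotients, is a combination of the equations, and
  \<open>h p \<noteq> 0\<close>.\<close>

lemma vanishing_poly_in_local_ideal:
  assumes "finite V" "simple_zero V g p" "q \<in> poly_funs V" "q p = 0"
  shows "q \<in> local_ideal V V g p"
proof -
  obtain A where A: "\<And>e v. e \<in> V \<Longrightarrow> v \<in> V \<Longrightarrow> A e v \<in> poly_funs V"
    and g: "\<And>e x. e \<in> V \<Longrightarrow> g e x = (\<Sum>v\<in>V. A e v x * (x v - p v))"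
    and det: "indexed_det V (\<lambda>e v. A e v p) \<noteq> 0"
    using assms(2) unfolding simple_zero_def by blast
  define h where "h x = indexed_det V (\<lambda>e v. A e v x)" for x
  have h: "h \<in> poly_funs V" unfolding h_def by (intro indexed_det_poly_funs assms(1) A)
  have "(\<lambda>w. q (w \<circ> Inr)) \<in> poly_funs (({} :: nat set) <+> V)"
    by (rule poly_funs_substitute[OF assms(3)]) (auto intro: poly_funs.intros)
  from poly_funs_difference_quotient[OF this assms(1)]
  obtain B where B: "\<forall>v\<in>V. B v \<in> poly_funs (({} :: nat set) <+> (V <+> V))"
    and qB: "\<forall>u x y. q (case_sum u x \<circ> Inr) - q (case_sum u y \<circ> Inr) =
      (\<Sum>v\<in>V. B v (case_sum u (case_sum x y)) * (x v - y v))"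
    by (elim exE conjE)
  define Q where "Q v x = B v (case_sum undefined (case_sum x p))" for v x
  have Q: "Q v \<in> poly_funs V" if "v \<in> V" for v
    unfolding Q_def by (rule poly_funs_substitute[OF B[rule_format, OF that]]) (auto intro: poly_funs.intros)
  have q: "q x = (\<Sum>v\<in>V. Q v x * (x v - p v))" for x
    using qB[rule_format, of undefined x p] assms(4) by (simp add: Q_def case_sum_o_inj)
  define c where "c e x = (\<Sum>v\<in>V. Q v x * indexed_adj V (\<lambda>e v. A e v x) v e)" for e x
  have c: "c e \<in> poly_funs V" if "e \<in> V" for e
    unfolding c_def using that by (intro poly_funs_sum poly_funs.mult Q indexed_adj_poly_funs assms(1) A)
  have "h x * q x = (\<Sum>e\<in>V. c e x * g e x)" for x
  proof -
    have "h x * q x = (\<Sum>v\<in>V. Q v x * (h x * (x v - p v)))"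
      by (simp add: q sum_distrib_left mult.left_commute)
    also have "\<dots> = (\<Sum>v\<in>V. Q v x * (\<Sum>e\<in>V. indexed_adj V (\<lambda>e v. A e v x) v e * g e x))"
      using indexed_det_cramer[OF assms(1), of _ "\<lambda>e v. A e v x" "\<lambda>v. x v - p v"]
      by (intro sum.cong refl) (simp add: g h_def)
    also have "\<dots> = (\<Sum>e\<in>V. c e x * g e x)"
      unfolding c_def sum_distrib_left sum_distrib_right by (subst sum.swap) (simp add: mult.assoc)
    finally show ?thesis .
  qed
  then have "(\<lambda>x. h x * q x) = (\<lambda>x. \<Sum>e\<in>V. c e x * g e x)" by blast
  then have "(\<lambda>x. h x * q x) \<in> poly_ideal V V g" using c by (auto simp: poly_ideal_def)
  moreover have "h p \<noteq> 0" using det by (simp add: h_def)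
  ultimately show ?thesis using h assms(3) unfolding local_ideal_def by blast
qed

text \<open>The local ideal is the maximal ideal: of any two polynomials a nontrivial combination
  vanishes at \<open>p\<close>.\<close>

lemma simple_zero_multiplicity:
  assumes "finite V" "simple_zero V g p"
  shows "local_multiplicity V V g p = 1"
proof -
  let ?ind = "\<lambda>n :: nat. \<exists>G. (\<forall>l<n. G l \<in> poly_funs V) \<and>
     (\<forall>c. (\<lambda>x. \<Sum>l<n. c l * G l x) \<in> local_ideal V V g p \<longrightarrow> (\<forall>l<n. c l = (0::complex)))"
  have ind1: "?ind 1"
  proof (intro exI[of _ "\<lambda>l x. 1"] conjI allI impI)
    fix c :: "nat \<Rightarrow> complex" and l :: nat
    assume "(\<lambda>x. \<Sum>l<1. c l * 1) \<in> local_ideal V V g p" "l < 1"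
    then obtain h k where h: "h p \<noteq> 0" "(\<lambda>x. h x * c 0) = (\<lambda>x. \<Sum>e\<in>V. k e x * g e x)"
      unfolding local_ideal_def poly_ideal_def by auto
    have "h p * c 0 = (\<Sum>e\<in>V. k e p * g e p)" using h(2) by (rule fun_cong)
    also have "\<dots> = 0" using assms(2) by (simp add: simple_zero_def common_zeros_def)
    finally show "c l = 0" using h(1) \<open>l < 1\<close> by simp
  qed (auto intro: poly_funs.intros)
  have le1: "n \<le> 1" if ind_n: "?ind n" for n
  proof (rule ccontr)
    assume n: "\<not> n \<le> 1"
    obtain G where G: "\<And>l. l < n \<Longrightarrow> G l \<in> poly_funs V"
      and ind: "\<And>c l. (\<lambda>x. \<Sum>l<n. c l * G l x) \<in> local_ideal V V g p \<Longrightarrow> l < n \<Longrightarrow> c l = 0"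
      using ind_n by blast
    \<comment> \<open>A nontrivial combination of \<open>G 0\<close> and \<open>G 1\<close> that vanishes at \<open>p\<close>.\<close>
    define c :: "nat \<Rightarrow> complex" where "c l = (if G 0 p = 0 \<and> G 1 p = 0 then (if l = 0 then 1 else 0)
      else if l = 0 then G 1 p else if l = 1 then - G 0 p else 0)" for l :: nat
    have "(\<Sum>l<n. c l * G l p) = (\<Sum>l\<in>{0,1}. c l * G l p)"
      using n by (intro sum.mono_neutral_right) (auto simp: c_def)
    also have "\<dots> = 0" by (auto simp: c_def)
    finally have "(\<lambda>x. \<Sum>l<n. c l * G l x) \<in> local_ideal V V g p"
      using G by (intro vanishing_poly_in_local_ideal[OF assms] poly_funs_sum poly_funs_cmult) auto
    then have "c 0 = 0" "c 1 = 0" using n ind by auto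
    then show False by (auto simp: c_def split: if_splits)
  qed
  have "Sup {enat n | n. ?ind n} = enat 1"
  proof (rule Sup_eqI)
    fix y assume "y \<in> {enat n | n. ?ind n}"
    then obtain n where "y = enat n" "?ind n" by blast
    then show "y \<le> enat 1" using le1[of n] by simp
  next
    fix y assume "\<And>z. z \<in> {enat n | n. ?ind n} \<Longrightarrow> z \<le> y"
    then show "enat 1 \<le> y" using ind1 by blast
  qed
  then show ?thesis by (simp add: local_multiplicity_def one_enat_def)
qed

section \<open>Monic interpolation\<close>

text \<open>The value at \<open>\<theta>\<close> of the monic polynomial of degree \<open>card I\<close> with the values \<open>a i\<close> at the
  nodes (Lagrange's formula for the difference from \<open>\<Prod>i. \<theta> - node i\<close>).\<close>

definition interp :: "'i set \<Rightarrow> ('i \<Rightarrow> complex) \<Rightarrow> ('i \<Rightarrow> complex) \<Rightarrow> complex \<Rightarrow> complex" where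
  "interp I node a \<theta> = (\<Prod>i\<in>I. \<theta> - node i) +
     (\<Sum>i\<in>I. a i * (\<Prod>j\<in>I - {i}. (\<theta> - node j) / (node i - node j)))"

lemma interp_node:
  assumes "finite I" "inj_on node I" "i \<in> I"
  shows "interp I node a (node i) = a i"
proof -
  have "(\<Prod>j\<in>I. node i - node j) = 0" using assms by (intro prod_zero) auto
  moreover have "(\<Sum>l\<in>I. a l * (\<Prod>j\<in>I - {l}. (node i - node j) / (node l - node j))) =
      (\<Sum>l\<in>I. if l = i then a i else 0)"
  proof (intro sum.cong refl)
    fix l assume l: "l \<in> I"
    show "a l * (\<Prod>j\<in>I - {l}. (node i - node j) / (node l - node j)) = (if l = i then a i else 0)"
    proof (cases "l = i")
      case True
      have "(\<Prod>j\<in>I - {i}. (node i - node j) / (node i - node j)) = 1"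
        using assms by (intro prod.neutral) (auto simp: inj_on_def)
      then show ?thesis using True by simp
    next
      case False
      have "(\<Prod>j\<in>I - {l}. (node i - node j) / (node l - node j)) = 0"
        using assms False by (intro prod_zero) auto
      then show ?thesis using False by simp
    qed
  qed
  ultimately show ?thesis using assms by (simp add: interp_def)
qed

lemma interp_poly:
  assumes "finite I"
  obtains p where "\<And>\<theta>. poly p \<theta> = interp I node a \<theta>" "Polynomial.degree p \<le> card I" "Polynomial.coeff p (card I) = 1"
proof -
  define P where "P = (\<Prod>i\<in>I. [:- node i, 1:])"
  define S where "S = (\<Sum>i\<in>I. Polynomial.smult (a i) (\<Prod>j\<in>I - {i}. Polynomial.smult (1 / (node i - node j)) [:- node j, 1:]))"
  have ev: "poly (P + S) \<theta> = interp I node a \<theta>" for \<theta>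
    by (simp add: P_def S_def interp_def poly_prod poly_sum diff_divide_distrib)
  have "Polynomial.degree P = (\<Sum>i\<in>I. degree [:- node i, 1:])"
    unfolding P_def by (rule degree_prod_eq_sum_degree) auto
  then have degP: "Polynomial.degree P = card I" by simp
  moreover have "lead_coeff P = 1" unfolding P_def by (simp add: lead_coeff_prod)
  ultimately have cP: "Polynomial.coeff P (card I) = 1" by simp
  have degS: "Polynomial.degree S \<le> card I - 1"
    unfolding S_def
  proof (intro degree_sum_le assms)
    fix i assume i: "i \<in> I"
    have "Polynomial.degree (\<Prod>j\<in>I - {i}. Polynomial.smult (1 / (node i - node j)) [:- node j, 1:]) \<le>
        (\<Sum>j\<in>I - {i}. degree (Polynomial.smult (1 / (node i - node j)) [:- node j, 1:]))"
      using degree_prod_sum_le[of "I - {i}" "\<lambda>j. Polynomial.smult (1 / (node i - node j)) [:- node j, 1:]"] assms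
      by (simp add: comp_def)
    also have "\<dots> \<le> (\<Sum>j\<in>I - {i}. 1)"
      by (intro sum_mono) simp
    finally show "Polynomial.degree (Polynomial.smult (a i) (\<Prod>j\<in>I - {i}. Polynomial.smult (1 / (node i - node j)) [:- node j, 1:])) \<le> card I - 1"
      using assms i by (simp add: order_trans[OF degree_smult_le])
  qed
  have "Polynomial.coeff S (card I) = 0"
  proof (cases "I = {}")
    case False
    then have "card I > 0" using assms by (simp add: card_gt_0_iff)
    then show ?thesis using degS by (intro coeff_eq_0) simp
  qed (simp add: S_def)
  moreover have "Polynomial.degree (P + S) \<le> card I"
    using degP degS by (intro degree_add_le) auto
  ultimately show ?thesis using that[OF ev] cP by simp
qed

text \<open>A monic polynomial of degree \<open>n\<close> is determined by its values at any \<open>n\<close> points.\<close>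

lemma interp_change_nodes:
  assumes "finite I" "finite I'" "card I' = card I" "inj_on node' I'"
  shows "interp I node a \<theta> = interp I' node' (\<lambda>i. interp I node a (node' i)) \<theta>"
proof -
  obtain p where p: "\<And>\<theta>. poly p \<theta> = interp I node a \<theta>" "Polynomial.degree p \<le> card I" "Polynomial.coeff p (card I) = 1"
    using interp_poly[OF assms(1)] by blast
  obtain q where q: "\<And>\<theta>. poly q \<theta> = interp I' node' (\<lambda>i. interp I node a (node' i)) \<theta>"
    "Polynomial.degree q \<le> card I'" "Polynomial.coeff q (card I') = 1"
    using interp_poly[OF assms(2)] by blast
  have "p = q"
  proof (rule poly_eqI_degree_lead_coeff[where A = "node' ` I'" and n = "card I"])
    fix z assume "z \<in> node' ` I'"
    then obtain i where i: "i \<in> I'" "z = node' i" by blast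
    then show "poly p z = poly q z"
      using interp_node[OF assms(2,4) i(1), of "\<lambda>i. interp I node a (node' i)"] p(1) q(1) by simp
  qed (use p q assms card_image[OF assms(4)] in auto)
  then show ?thesis using p(1) q(1) by metis
qed

section \<open>A product system with linear factors in general position\<close>

text \<open>An element \<open>(i, s)\<close> of \<open>E\<close> is one of the \<open>k i\<close> equations of player \<open>i\<close>, and also one of the
  \<open>k i\<close> factors \<open>L\<^sub>i\<close> in \<open>\<Prod> L\<^sub>i(z)\<^bsup>k\<^sub>i\<^esup>\<close>. An assignment chooses for each of them an in-neighbour of
  \<open>i\<close>.\<close>

locale game =
  fixes N :: nat and k :: "nat \<Rightarrow> nat" and F :: "(nat \<times> nat) set"
  assumes F: "F \<subseteq> arcs N"
begin

abbreviation E :: "(nat \<times> nat) set" where "E \<equiv> unknowns N k"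

abbreviation nbrs :: "nat \<times> nat \<Rightarrow> nat set" where "nbrs e \<equiv> in_nbrs F (fst e)"

abbreviation sp :: "(nat \<times> nat \<Rightarrow> complex) \<Rightarrow> nat \<Rightarrow> nat \<Rightarrow> complex" where
  "sp \<equiv> strategy_prob k"

lemma finite_E [simp]: "finite E"
proof -
  have "E = Sigma {1..N} (\<lambda>q. {1..k q})" by (auto simp: unknowns_def)
  then show ?thesis by simp
qed

lemma card_E: "card E = (\<Sum>q\<in>{1..N}. k q)"
proof -
  have "E = Sigma {1..N} (\<lambda>q. {1..k q})" by (auto simp: unknowns_def)
  then show ?thesis by simp
qed

lemma in_nbrs_subset: "in_nbrs F i \<subseteq> {1..N}"
  using F by (auto simp: in_nbrs_def arcs_def)

lemma finite_in_nbrs [simp]: "finite (in_nbrs F i)"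
  by (rule finite_subset[OF in_nbrs_subset]) simp

definition assignments :: "(nat \<times> nat \<Rightarrow> nat) set" where
  "assignments = Pi\<^sub>E E nbrs"

definition fibre :: "(nat \<times> nat \<Rightarrow> nat) \<Rightarrow> nat \<Rightarrow> (nat \<times> nat) set" where
  "fibre \<sigma> q = {e \<in> E. \<sigma> e = q}"

definition balanced :: "(nat \<times> nat \<Rightarrow> nat) set" where
  "balanced = {\<sigma> \<in> assignments. \<forall>q\<in>{1..N}. card (fibre \<sigma> q) = k q}"

lemma finite_assignments [simp]: "finite assignments"
  unfolding assignments_def by (intro finite_PiE) auto

lemma finite_balanced [simp]: "finite balanced"
  unfolding balanced_def by simp

lemma finite_fibre [simp]: "finite (fibre \<sigma> q)"
  unfolding fibre_def by simp

text \<open>The node of the equation \<open>e\<close>. All that matters is that these numbers are distinct from each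
  other and from the positive integers.\<close>

definition \<tau> :: "nat \<times> nat \<Rightarrow> complex" where
  "\<tau> e = - of_nat (prod_encode e)"

lemma \<tau>_inj: "\<tau> e = \<tau> e' \<longleftrightarrow> e = e'"
  by (simp add: \<tau>_def inj_eq[OF inj_prod_encode])

lemma inj_on_\<tau> [simp]: "inj_on \<tau> S"
  by (simp add: inj_on_def \<tau>_inj)

lemma of_nat_neq_\<tau>:
  assumes "t \<ge> 1"
  shows "of_nat t \<noteq> \<tau> e"
proof
  assume "of_nat t = \<tau> e"
  then have "of_nat (t + prod_encode e) = (0::complex)" by (simp add: \<tau>_def)
  then show False using assms by (simp only: of_nat_eq_0_iff)
qed

text \<open>The unknowns of a block \<open>q\<close> are the values at \<open>1, \<dots>, k q\<close> of a monic polynomial \<open>Y q x\<close> of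
  degree \<open>k q\<close>, and they determine it. In these terms the form \<open>\<ll> e q\<close> is its value at the node
  \<open>\<tau> e\<close>: any \<open>k q\<close> of the forms are affine coordinates on the block, and more than \<open>k q\<close> of them
  cannot vanish together because the polynomial is monic.\<close>

definition Y :: "nat \<Rightarrow> (nat \<times> nat \<Rightarrow> complex) \<Rightarrow> complex \<Rightarrow> complex" where
  "Y q x \<theta> = interp {1..k q} of_nat (\<lambda>t. x (q, t)) \<theta>"

definition \<ll> :: "nat \<times> nat \<Rightarrow> nat \<Rightarrow> (nat \<times> nat \<Rightarrow> complex) \<Rightarrow> complex" where
  "\<ll> e q x = Y q x (\<tau> e)"

lemma Y_of_nat: "t \<in> {1..k q} \<Longrightarrow> Y q x (of_nat t) = x (q, t)"
  unfolding Y_def by (intro interp_node) (auto simp: inj_on_def)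

lemma Y_via_fibre:
  assumes "finite S" "card S = k q"
  shows "Y q x \<theta> = (\<Prod>e\<in>S. \<theta> - \<tau> e) +
    (\<Sum>e\<in>S. \<ll> e q x * (\<Prod>e'\<in>S - {e}. (\<theta> - \<tau> e') / (\<tau> e - \<tau> e')))"
  using interp_change_nodes[of "{1..k q}" S \<tau> of_nat "\<lambda>t. x (q, t)" \<theta>] assms
  unfolding \<ll>_def Y_def by (simp add: interp_def[of S])

lemma Y_of_product:
  assumes "finite S" "card S = k q" "\<And>t. t \<in> {1..k q} \<Longrightarrow> x (q, t) = (\<Prod>e\<in>S. of_nat t - \<tau> e)"
  shows "Y q x \<theta> = (\<Prod>e\<in>S. \<theta> - \<tau> e)"
proof -
  have "interp S \<tau> (\<lambda>e. 0) \<theta> = interp {1..k q} of_nat (\<lambda>t. interp S \<tau> (\<lambda>e. 0) (of_nat t)) \<theta>"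
    by (rule interp_change_nodes) (use assms(1,2) in \<open>auto simp: inj_on_def\<close>)
  also have "\<dots> = Y q x \<theta>"
    unfolding Y_def using assms(3) by (simp add: interp_def)
  finally show ?thesis by (simp add: interp_def)
qed

text \<open>The point at which \<open>Y q\<close> has the nodes of the fibre over \<open>q\<close> as its roots, for every \<open>q\<close>.\<close>

definition sol :: "(nat \<times> nat \<Rightarrow> nat) \<Rightarrow> nat \<times> nat \<Rightarrow> complex" where
  "sol \<sigma> = (\<lambda>(q, t)\<in>E. \<Prod>e\<in>fibre \<sigma> q. of_nat t - \<tau> e)"

lemma Y_sol: "\<sigma> \<in> balanced \<Longrightarrow> q \<in> {1..N} \<Longrightarrow> Y q (sol \<sigma>) \<theta> = (\<Prod>e\<in>fibre \<sigma> q. \<theta> - \<tau> e)"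
  by (rule Y_of_product) (auto simp: balanced_def sol_def unknowns_def)

lemma \<ll>_sol_eq_0_iff:
  assumes "\<sigma> \<in> balanced" "q \<in> {1..N}" "e \<in> E"
  shows "\<ll> e q (sol \<sigma>) = 0 \<longleftrightarrow> \<sigma> e = q"
  using assms by (auto simp: \<ll>_def Y_sol \<tau>_inj fibre_def)

lemma sol_nonzero: "v \<in> E \<Longrightarrow> sol \<sigma> v \<noteq> 0"
  by (auto simp: sol_def unknowns_def of_nat_neq_\<tau> split: prod.splits)

lemma sum_sp: "(\<Sum>t\<in>{0..k q}. sp x q t) = 1"
proof -
  have "(\<Sum>t\<in>{0..k q}. sp x q t) = sp x q 0 + (\<Sum>t\<in>{1..k q}. sp x q t)"
    by (simp add: sum.atLeast_Suc_atMost)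
  also have "(\<Sum>t\<in>{1..k q}. sp x q t) = (\<Sum>t\<in>{1..k q}. x (q, t))"
    by (intro sum.cong) (auto simp: strategy_prob_def)
  finally show ?thesis by (simp add: strategy_prob_def)
qed

text \<open>The coefficients of \<open>\<ll> e q\<close> as a linear form in the strategy probabilities of block \<open>q\<close>,
  obtained from Lagrange's formula; the product, a constant, is added to every coefficient because
  the probabilities sum to \<open>1\<close>.\<close>

definition coef :: "nat \<times> nat \<Rightarrow> nat \<Rightarrow> nat \<Rightarrow> complex" where
  "coef e q t = (\<Prod>s\<in>{1..k q}. \<tau> e - of_nat s) +
     (if t = 0 then 0 else \<Prod>s\<in>{1..k q} - {t}. (\<tau> e - of_nat s) / (of_nat t - of_nat s))"

lemma \<ll>_eq_sum_sp: "\<ll> e q x = (\<Sum>t\<in>{0..k q}. coef e q t * sp x q t)"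
proof -
  let ?c = "\<Prod>s\<in>{1..k q}. \<tau> e - of_nat s"
  let ?L = "\<lambda>t. \<Prod>s\<in>{1..k q} - {t}. (\<tau> e - of_nat s) / (of_nat t - of_nat s)"
  have "(\<Sum>t\<in>{0..k q}. coef e q t * sp x q t) =
      ?c * (\<Sum>t\<in>{0..k q}. sp x q t) + (\<Sum>t\<in>{0..k q}. (if t = 0 then 0 else ?L t) * sp x q t)"
    by (simp add: coef_def distrib_right sum.distrib sum_distrib_left)
  also have "(\<Sum>t\<in>{0..k q}. (if t = 0 then 0 else ?L t) * sp x q t) = (\<Sum>t\<in>{1..k q}. ?L t * sp x q t)"
    by (rule sum.mono_neutral_cong_right) auto
  also have "\<dots> = (\<Sum>t\<in>{1..k q}. x (q, t) * ?L t)"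
    by (intro sum.cong) (auto simp: strategy_prob_def)
  finally show ?thesis by (simp add: sum_sp \<ll>_def Y_def interp_def)
qed

text \<open>Interpolation at the \<open>k q\<close> nodes of \<open>S\<close> instead of \<open>1, \<dots>, k q\<close>.\<close>

lemma sp_in_fibre_span:
  assumes "finite S" "card S = k q" "t \<le> k q"
  shows "\<exists>c d. \<forall>x. sp x q t = c + (\<Sum>e\<in>S. d e * \<ll> e q x)"
proof -
  have coord: "\<exists>c d. \<forall>x. x (q, t) = c + (\<Sum>e\<in>S. d e * \<ll> e q x)" if "t \<in> {1..k q}" for t
  proof (intro exI allI)
    fix x show "x (q, t) = (\<Prod>e\<in>S. of_nat t - \<tau> e) +
        (\<Sum>e\<in>S. (\<Prod>e'\<in>S - {e}. (of_nat t - \<tau> e') / (\<tau> e - \<tau> e')) * \<ll> e q x)"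
      using Y_via_fibre[OF assms(1,2), of x "of_nat t"] Y_of_nat[OF that, of x] by (simp add: mult.commute)
  qed
  show ?thesis
  proof (cases "t = 0")
    case False
    then show ?thesis using coord[of t] assms(3) by (simp add: strategy_prob_def)
  next
    case True
    obtain c d where cd: "\<And>t x. t \<in> {1..k q} \<Longrightarrow> x (q, t) = c t + (\<Sum>e\<in>S. d t e * \<ll> e q x)"
      using coord by metis
    have "sp x q t = (1 - (\<Sum>t\<in>{1..k q}. c t)) + (\<Sum>e\<in>S. (- (\<Sum>t\<in>{1..k q}. d t e)) * \<ll> e q x)" for x
    proof -
      have "(\<Sum>t\<in>{1..k q}. x (q, t)) = (\<Sum>t\<in>{1..k q}. c t + (\<Sum>e\<in>S. d t e * \<ll> e q x))"
        using cd by (intro sum.cong) auto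
      also have "\<dots> = (\<Sum>t\<in>{1..k q}. c t) + (\<Sum>e\<in>S. (\<Sum>t\<in>{1..k q}. d t e) * \<ll> e q x)"
        unfolding sum.distrib sum_distrib_right by (subst sum.swap) simp
      finally show ?thesis using True by (simp add: strategy_prob_def sum_negf)
    qed
    then show ?thesis by (intro exI allI)
  qed
qed

text \<open>The divided difference of \<open>Y q\<close> at \<open>k q + 1\<close> nodes is its leading coefficient.\<close>

lemma one_in_large_fibre_span:
  assumes "finite S" "card S > k q"
  shows "\<exists>d. \<forall>x. (\<Sum>e\<in>S. d e * \<ll> e q x) = 1"
proof -
  obtain S' where S': "S' \<subseteq> S" "card S' = k q"
    using assms(2) by (meson obtain_subset_with_card_n less_imp_le)
  have finS': "finite S'" using S'(1) assms(1) by (rule finite_subset)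
  have "S' \<noteq> S" using S'(2) assms(2) by auto
  then obtain e1 where e1: "e1 \<in> S" "e1 \<notin> S'" using S'(1) by blast
  define c where "c = (\<Prod>e\<in>S'. \<tau> e1 - \<tau> e)"
  define L where "L e = (\<Prod>e'\<in>S' - {e}. (\<tau> e1 - \<tau> e') / (\<tau> e - \<tau> e'))" for e
  have c: "c \<noteq> 0" using finS' e1(2) by (auto simp: c_def \<tau>_inj)
  define d where "d e = (if e = e1 then 1 / c else if e \<in> S' then - L e / c else 0)" for e
  have "(\<Sum>e\<in>S. d e * \<ll> e q x) = 1" for x
  proof -
    have "(\<Sum>e\<in>S. d e * \<ll> e q x) = (\<Sum>e\<in>insert e1 S'. d e * \<ll> e q x)"
      using assms(1) S'(1) e1 by (intro sum.mono_neutral_right) (auto simp: d_def)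
    also have "\<dots> = \<ll> e1 q x / c + (\<Sum>e\<in>S'. - L e / c * \<ll> e q x)"
      using finS' e1(2) by (simp add: d_def) (intro sum.cong; auto)
    also have "(\<Sum>e\<in>S'. - L e / c * \<ll> e q x) = - (\<Sum>e\<in>S'. \<ll> e q x * L e) / c"
      by (simp add: sum_negf sum_divide_distrib mult.commute)
    also have "\<ll> e1 q x = c + (\<Sum>e\<in>S'. \<ll> e q x * L e)"
      using Y_via_fibre[OF finS' S'(2), of x "\<tau> e1"] by (simp add: \<ll>_def[of e1] c_def L_def)
    finally show ?thesis using c by (simp add: field_simps)
  qed
  then show ?thesis by blast
qed

lemma sp_in_large_fibre_span:
  assumes "finite S" "card S > k q" "t \<le> k q"
  shows "\<exists>d. \<forall>x. sp x q t = (\<Sum>e\<in>S. d e * \<ll> e q x)"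
proof -
  obtain S' where S': "S' \<subseteq> S" "card S' = k q"
    using assms(2) by (meson obtain_subset_with_card_n less_imp_le)
  have finS': "finite S'" using S'(1) assms(1) by (rule finite_subset)
  obtain c d where cd: "\<And>x. sp x q t = c + (\<Sum>e\<in>S'. d e * \<ll> e q x)"
    using sp_in_fibre_span[OF finS' S'(2) assms(3)] by blast
  obtain d' where d': "\<And>x. (\<Sum>e\<in>S. d' e * \<ll> e q x) = 1"
    using one_in_large_fibre_span[OF assms(1,2)] by blast
  have "sp x q t = (\<Sum>e\<in>S. (c * d' e + (if e \<in> S' then d e else 0)) * \<ll> e q x)" for x
  proof -
    have "(\<Sum>e\<in>S'. d e * \<ll> e q x) = (\<Sum>e\<in>S. (if e \<in> S' then d e else 0) * \<ll> e q x)"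
      using assms(1) S'(1) by (intro sum.mono_neutral_cong_left) auto
    moreover have "c = (\<Sum>e\<in>S. c * d' e * \<ll> e q x)"
      using d'[of x] by (simp add: mult.assoc sum_distrib_left[symmetric])
    ultimately show ?thesis using cd[of x] by (simp add: distrib_right sum.distrib)
  qed
  then show ?thesis by (intro exI allI)
qed

text \<open>By counting: the fibre sizes and the \<open>k q\<close> have the same sum \<open>card E\<close>.\<close>

lemma overfull_fibre:
  assumes "\<sigma> \<in> assignments" "\<sigma> \<notin> balanced"
  obtains q where "q \<in> {1..N}" "card (fibre \<sigma> q) > k q"
proof -
  have "\<exists>q\<in>{1..N}. card (fibre \<sigma> q) > k q"
  proof (rule ccontr)
    assume "\<not> ?thesis"
    then have le: "\<And>q. q \<in> {1..N} \<Longrightarrow> card (fibre \<sigma> q) \<le> k q" by force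
    have "E = (\<Union>q\<in>{1..N}. fibre \<sigma> q)"
      using assms(1) in_nbrs_subset by (fastforce simp: fibre_def assignments_def PiE_def Pi_def)
    then have "card E = card (\<Union>q\<in>{1..N}. fibre \<sigma> q)" by simp
    also have "\<dots> = (\<Sum>q\<in>{1..N}. card (fibre \<sigma> q))"
      by (intro card_UN_disjoint) (auto simp: fibre_def)
    finally have eq: "(\<Sum>q\<in>{1..N}. card (fibre \<sigma> q)) = (\<Sum>q\<in>{1..N}. k q)" by (simp add: card_E)
    have "card (fibre \<sigma> q) = k q" if "q \<in> {1..N}" for q
    proof (rule ccontr)
      assume "card (fibre \<sigma> q) \<noteq> k q"
      then have "(\<Sum>q\<in>{1..N}. card (fibre \<sigma> q)) < (\<Sum>q\<in>{1..N}. k q)"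
        using le that by (intro sum_strict_mono_ex1) (auto intro!: bexI[of _ q] simp: le_less)
      then show False using eq by simp
    qed
    then show False using assms by (simp add: balanced_def)
  qed
  then show ?thesis using that by blast
qed

end

section \<open>Polynomials of bounded multidegree modulo the product system\<close>

context game
begin

text \<open>Products with exactly \<open>n q\<close> strategy probabilities of block \<open>q\<close>. As the probabilities of a
  block sum to \<open>1\<close>, these are the monomials of multidegree \<open>n\<close> in homogeneous coordinates, and
  their span \<open>W n\<close> consists of the polynomials of degree at most \<open>n q\<close> in each block.\<close>

definition words :: "(nat \<Rightarrow> nat) \<Rightarrow> ((nat \<times> nat \<Rightarrow> complex) \<Rightarrow> complex) set" where
  "words n = (\<lambda>c x. \<Prod>q\<in>{1..N}. \<Prod>r<n q. sp x q (c (q, r))) `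
     (\<Pi>\<^sub>E (q, r)\<in>(SIGMA q:{1..N}. {..<n q}). {0..k q})"

lemma finite_words [simp]: "finite (words n)"
  unfolding words_def by (intro finite_imageI finite_PiE) (auto split: prod.splits)

lemma wordsI:
  assumes "\<And>q r. q \<in> {1..N} \<Longrightarrow> r < n q \<Longrightarrow> c (q, r) \<le> k q"
  shows "(\<lambda>x. \<Prod>q\<in>{1..N}. \<Prod>r<n q. sp x q (c (q, r))) \<in> words n"
proof -
  let ?I = "SIGMA q:{1..N}. {..<n q}"
  have "(\<lambda>x. \<Prod>q\<in>{1..N}. \<Prod>r<n q. sp x q (c (q, r))) =
      (\<lambda>x. \<Prod>q\<in>{1..N}. \<Prod>r<n q. sp x q (restrict c ?I (q, r)))"
    by (intro ext prod.cong refl) auto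
  moreover have "restrict c ?I \<in> (\<Pi>\<^sub>E (q, r)\<in>?I. {0..k q})" using assms by auto
  ultimately show ?thesis unfolding words_def by blast
qed

lemma wordsE:
  assumes "g \<in> words n"
  obtains c where "g = (\<lambda>x. \<Prod>q\<in>{1..N}. \<Prod>r<n q. sp x q (c (q, r)))"
    "\<And>q r. q \<in> {1..N} \<Longrightarrow> r < n q \<Longrightarrow> c (q, r) \<le> k q"
  using assms unfolding words_def by (fastforce simp: PiE_def Pi_def)

lemma words_cong:
  assumes "\<And>q. q \<in> {1..N} \<Longrightarrow> m q = n q"
  shows "words m = words n"
proof -
  have "(SIGMA q:{1..N}. {..<m q}) = (SIGMA q:{1..N}. {..<n q})" using assms by auto
  then show ?thesis unfolding words_def
    by (intro image_cong ext prod.cong refl) (use assms in auto)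
qed

lemma words_mult:
  assumes "g \<in> words n" "q \<in> {1..N}" "t \<le> k q"
  shows "(\<lambda>x. sp x q t * g x) \<in> words (n(q := Suc (n q)))"
proof -
  obtain c where c: "g = (\<lambda>x. \<Prod>q\<in>{1..N}. \<Prod>r<n q. sp x q (c (q, r)))"
    "\<And>q r. q \<in> {1..N} \<Longrightarrow> r < n q \<Longrightarrow> c (q, r) \<le> k q"
    using wordsE[OF assms(1)] by blast
  let ?n = "n(q := Suc (n q))" and ?c = "c((q, n q) := t)"
  have "sp x q t * g x = (\<Prod>q\<in>{1..N}. \<Prod>r<?n q. sp x q (?c (q, r)))" for x
  proof -
    have "(\<Prod>q\<in>{1..N}. \<Prod>r<?n q. sp x q (?c (q, r))) =
        (\<Prod>r<Suc (n q). sp x q (?c (q, r))) * (\<Prod>q\<in>{1..N} - {q}. \<Prod>r<n q. sp x q (c (q, r)))"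
      using assms(2) by (subst prod.remove[of _ q]) (auto intro!: prod.cong)
    also have "(\<Prod>r<Suc (n q). sp x q (?c (q, r))) = sp x q t * (\<Prod>r<n q. sp x q (c (q, r)))"
      by (simp add: mult.commute)
    finally have "(\<Prod>q\<in>{1..N}. \<Prod>r<?n q. sp x q (?c (q, r))) = sp x q t *
        ((\<Prod>r<n q. sp x q (c (q, r))) * (\<Prod>q\<in>{1..N} - {q}. \<Prod>r<n q. sp x q (c (q, r))))"
      by (simp only: mult.assoc)
    moreover have "g x = (\<Prod>r<n q. sp x q (c (q, r))) * (\<Prod>q\<in>{1..N} - {q}. \<Prod>r<n q. sp x q (c (q, r)))"
      unfolding c(1) using assms(2) by (subst prod.remove[of _ q]) auto
    ultimately show ?thesis by (simp only:)
  qed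
  moreover have "(\<lambda>x. \<Prod>q\<in>{1..N}. \<Prod>r<?n q. sp x q (?c (q, r))) \<in> words ?n"
    using c(2) assms(3) by (intro wordsI) (auto split: if_splits simp: less_Suc_eq)
  ultimately show ?thesis by simp
qed

lemma words_split:
  assumes "g \<in> words n" "q \<in> {1..N}" "n q > 0"
  obtains t g' where "t \<le> k q" "g' \<in> words (n(q := n q - 1))" "g = (\<lambda>x. sp x q t * g' x)"
proof -
  obtain c where c: "g = (\<lambda>x. \<Prod>q\<in>{1..N}. \<Prod>r<n q. sp x q (c (q, r)))"
    "\<And>q r. q \<in> {1..N} \<Longrightarrow> r < n q \<Longrightarrow> c (q, r) \<le> k q"
    using wordsE[OF assms(1)] by blast
  obtain m where m: "n q = Suc m" using assms(3) by (cases "n q") auto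
  let ?n = "n(q := n q - 1)"
  let ?g = "\<lambda>x. \<Prod>q\<in>{1..N}. \<Prod>r<?n q. sp x q (c (q, r))"
  have "g x = sp x q (c (q, m)) * ?g x" for x
  proof -
    have "?g x = (\<Prod>r<m. sp x q (c (q, r))) * (\<Prod>q\<in>{1..N} - {q}. \<Prod>r<n q. sp x q (c (q, r)))"
      using assms(2) m by (subst prod.remove[of _ q]) (auto intro!: prod.cong)
    moreover have "g x = (\<Prod>r<Suc m. sp x q (c (q, r))) * (\<Prod>q\<in>{1..N} - {q}. \<Prod>r<n q. sp x q (c (q, r)))"
      unfolding c(1) using assms(2) m by (subst prod.remove[of _ q]) auto
    ultimately show ?thesis by (simp add: mult.commute mult.left_commute)
  qed
  moreover have "?g \<in> words ?n" using c(2) by (intro wordsI) (auto split: if_splits)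
  moreover have "c (q, m) \<le> k q" using c(2)[OF assms(2)] m by simp
  ultimately show ?thesis using that by blast
qed

lemma words_zero: "(\<And>q. q \<in> {1..N} \<Longrightarrow> n q = 0) \<Longrightarrow> g \<in> words n \<Longrightarrow> g = (\<lambda>x. 1)"
  by (erule wordsE) simp

lemma one_in_words: "(\<lambda>x. 1) \<in> words (\<lambda>q. 0)"
  using wordsI[of "\<lambda>q. 0" "\<lambda>_. 0"] by simp

inductive_set W :: "(nat \<Rightarrow> nat) \<Rightarrow> ((nat \<times> nat \<Rightarrow> complex) \<Rightarrow> complex) set"
  for n :: "nat \<Rightarrow> nat" where
  zero: "(\<lambda>x. 0) \<in> W n"
| step: "g \<in> words n \<Longrightarrow> f \<in> W n \<Longrightarrow> (\<lambda>x. a * g x + f x) \<in> W n"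

lemma W_words: "g \<in> words n \<Longrightarrow> g \<in> W n"
  using W.step[OF _ W.zero, of g n 1] by simp

lemma W_add: "f \<in> W n \<Longrightarrow> g \<in> W n \<Longrightarrow> (\<lambda>x. f x + g x) \<in> W n"
  by (induction rule: W.induct) (auto simp: add.assoc intro: W.step)

lemma W_scale: "f \<in> W n \<Longrightarrow> (\<lambda>x. c * f x) \<in> W n"
proof (induction rule: W.induct)
  case (step g f a)
  then have "(\<lambda>x. (c * a) * g x + c * f x) \<in> W n" by (intro W.step)
  then show ?case by (simp add: algebra_simps)
qed (simp add: W.zero)

lemma W_sum: "(\<And>i. i \<in> I \<Longrightarrow> f i \<in> W n) \<Longrightarrow> (\<lambda>x. \<Sum>i\<in>I. f i x) \<in> W n"
  by (induction I rule: infinite_finite_induct) (auto intro: W.zero W_add)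

lemma W_sp:
  assumes "f \<in> W n" "q \<in> {1..N}" "t \<le> k q"
  shows "(\<lambda>x. sp x q t * f x) \<in> W (n(q := Suc (n q)))"
  using assms(1)
proof (induction rule: W.induct)
  case (step g f a)
  then have "(\<lambda>x. a * (sp x q t * g x) + sp x q t * f x) \<in> W (n(q := Suc (n q)))"
    using words_mult[OF step.hyps(1) assms(2,3)] by (intro W.step)
  then show ?case by (simp add: algebra_simps fun_upd_def)
qed (simp add: W.zero)

definition linear_in :: "nat \<Rightarrow> ((nat \<times> nat \<Rightarrow> complex) \<Rightarrow> complex) \<Rightarrow> bool" where
  "linear_in q a \<longleftrightarrow> (\<exists>c. a = (\<lambda>x. \<Sum>t\<in>{0..k q}. c t * sp x q t))"

lemma linear_in_\<ll>: "linear_in q (\<ll> e q)"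
  unfolding linear_in_def by (intro exI[of _ "coef e q"] ext \<ll>_eq_sum_sp)

lemma linear_in_sp: "t \<le> k q \<Longrightarrow> linear_in q (\<lambda>x. sp x q t)"
  unfolding linear_in_def
  by (intro exI[of _ "\<lambda>s. if s = t then 1 else 0"] ext)
    (simp add: if_distrib[of "\<lambda>c. c * _"] cong: if_cong)

lemma linear_in_one: "linear_in q (\<lambda>x. 1)"
  unfolding linear_in_def by (intro exI[of _ "\<lambda>s. 1"]) (simp add: sum_sp)

lemma W_linear:
  assumes "linear_in q a" "f \<in> W n" "q \<in> {1..N}"
  shows "(\<lambda>x. a x * f x) \<in> W (n(q := Suc (n q)))"
proof -
  obtain c where a: "a = (\<lambda>x. \<Sum>t\<in>{0..k q}. c t * sp x q t)" using assms(1) by (auto simp: linear_in_def)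
  have "(\<lambda>x. \<Sum>t\<in>{0..k q}. c t * (sp x q t * f x)) \<in> W (n(q := Suc (n q)))"
    using assms by (intro W_sum W_scale W_sp) auto
  then show ?thesis by (simp add: a sum_distrib_right mult.assoc)
qed

lemma W_cong: "(\<And>q. q \<in> {1..N} \<Longrightarrow> m q = n q) \<Longrightarrow> f \<in> W m \<Longrightarrow> f \<in> W n"
  by (erule W.induct) (use words_cong[of m n] in \<open>auto intro: W.intros\<close>)

text \<open>A factor \<open>1\<close> may be inserted as the sum of the strategy probabilities of a block.\<close>

lemma W_mono:
  assumes "f \<in> W m" "\<And>q. q \<in> {1..N} \<Longrightarrow> m q \<le> n q"
  shows "f \<in> W n"
  using assms
proof (induction "\<Sum>q\<in>{1..N}. n q - m q" arbitrary: m)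
  case 0
  have "m q = n q" if "q \<in> {1..N}" for q
  proof -
    have "n q - m q = 0" using 0(1) that by (simp add: eq_commute[of 0])
    then show ?thesis using 0(3)[OF that] by simp
  qed
  then show ?case by (rule W_cong[OF _ 0(2)])
next
  case (Suc d)
  have "\<exists>q\<in>{1..N}. n q - m q \<noteq> 0"
  proof (rule ccontr)
    assume "\<not> ?thesis"
    then have "(\<Sum>q\<in>{1..N}. n q - m q) = 0" by simp
    then show False using Suc.hyps(2) by simp
  qed
  then obtain q where q: "q \<in> {1..N}" "n q - m q \<noteq> 0" by blast
  let ?m = "m(q := Suc (m q))"
  have "(\<Sum>q\<in>{1..N}. n q - m q) = (n q - m q) + (\<Sum>q\<in>{1..N} - {q}. n q - m q)"
    using q by (intro sum.remove) auto
  moreover have "(\<Sum>q\<in>{1..N}. n q - ?m q) = (n q - Suc (m q)) + (\<Sum>q\<in>{1..N} - {q}. n q - m q)"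
    using q by (subst sum.remove[of _ q]) (auto intro!: sum.cong)
  ultimately have "d = (\<Sum>q\<in>{1..N}. n q - ?m q)" using Suc.hyps(2) q(2) by simp
  moreover have "f \<in> W ?m" using W_linear[OF linear_in_one Suc.prems(1) q(1)] by simp
  moreover have "?m q' \<le> n q'" if "q' \<in> {1..N}" for q' using Suc.prems(2)[OF that] q(2) by simp
  ultimately show ?case using Suc.hyps(1) by blast
qed

lemma W_prod_linear:
  assumes "finite D" "D \<subseteq> {1..N}" "\<And>q. q \<in> D \<Longrightarrow> linear_in q (a q)" "f \<in> W n"
  shows "(\<lambda>x. (\<Prod>q\<in>D. a q x) * f x) \<in> W (\<lambda>q. n q + (if q \<in> D then 1 else 0))"
  using assms
proof (induction D rule: finite_induct)
  case empty
  then show ?case by simp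
next
  case (insert q D)
  then have "(\<lambda>x. (\<Prod>q\<in>D. a q x) * f x) \<in> W (\<lambda>q. n q + (if q \<in> D then 1 else 0))" by simp
  from W_linear[OF _ this, of q "a q"] insert
  have "(\<lambda>x. a q x * ((\<Prod>q\<in>D. a q x) * f x)) \<in>
      W ((\<lambda>q. n q + (if q \<in> D then 1 else 0))(q := Suc (n q + (if q \<in> D then 1 else 0))))"
    by simp
  then have "(\<lambda>x. a q x * ((\<Prod>q\<in>D. a q x) * f x)) \<in> W (\<lambda>r. n r + (if r \<in> insert q D then 1 else 0))"
    by (rule W_mono) (use insert in auto)
  then show ?case using insert by (simp add: mult.assoc)
qed

lemma W_coordinates:
  assumes "f \<in> W n"
  shows "\<exists>\<kappa>. \<forall>x. f x = (\<Sum>g\<in>words n. \<kappa> g * g x)"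
  using assms
proof (induction rule: W.induct)
  case zero
  show ?case by (rule exI[of _ "\<lambda>g. 0"]) simp
next
  case (step g f a)
  then obtain \<kappa> where \<kappa>: "\<forall>x. f x = (\<Sum>g\<in>words n. \<kappa> g * g x)" by blast
  have "a * g x + f x = (\<Sum>h\<in>words n. (\<kappa> h + (if h = g then a else 0)) * h x)" for x
    using step.hyps(1) \<kappa>
    by (simp add: distrib_right sum.distrib if_distrib[of "\<lambda>c. c * _"] cong: if_cong)
  then show ?case by (intro exI[of _ "\<lambda>h. \<kappa> h + (if h = g then a else 0)"]) simp
qed

text \<open>Sums of multiples of the functions in \<open>X\<close> and of multiples, of bounded multidegree, of the
  generators \<open>\<phi> e\<close>, where \<open>\<phi> e\<close> has degree one in the blocks \<open>\<delta> e\<close> and degree zero in the others.\<close>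

inductive_set span_ideal ::
  "((nat \<times> nat \<Rightarrow> complex) \<Rightarrow> complex) set \<Rightarrow> (nat \<times> nat \<Rightarrow> (nat \<times> nat \<Rightarrow> complex) \<Rightarrow> complex)
    \<Rightarrow> (nat \<times> nat \<Rightarrow> nat set) \<Rightarrow> (nat \<Rightarrow> nat) \<Rightarrow> ((nat \<times> nat \<Rightarrow> complex) \<Rightarrow> complex) set"
  for X \<phi> \<delta> n where
  zero: "(\<lambda>x. 0) \<in> span_ideal X \<phi> \<delta> n"
| basis: "g \<in> X \<Longrightarrow> f \<in> span_ideal X \<phi> \<delta> n \<Longrightarrow> (\<lambda>x. a * g x + f x) \<in> span_ideal X \<phi> \<delta> n"
| gen: "e \<in> E \<Longrightarrow> h \<in> W m \<Longrightarrow> (\<And>q. q \<in> {1..N} \<Longrightarrow> m q + (if q \<in> \<delta> e then 1 else 0) \<le> n q) \<Longrightarrow>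
    f \<in> span_ideal X \<phi> \<delta> n \<Longrightarrow> (\<lambda>x. h x * \<phi> e x + f x) \<in> span_ideal X \<phi> \<delta> n"

lemma span_ideal_add:
  "f \<in> span_ideal X \<phi> \<delta> n \<Longrightarrow> g \<in> span_ideal X \<phi> \<delta> n \<Longrightarrow> (\<lambda>x. f x + g x) \<in> span_ideal X \<phi> \<delta> n"
proof (induction rule: span_ideal.induct)
  case (gen e h m f)
  have "(\<lambda>x. h x * \<phi> e x + (f x + g x)) \<in> span_ideal X \<phi> \<delta> n"
    by (rule span_ideal.gen[OF gen.hyps(1,2) gen.hyps(3) gen.IH[OF gen.prems]])
  then show ?case by (simp add: add.assoc)
qed (simp_all add: add.assoc span_ideal.basis)

lemma span_ideal_scale:
  "f \<in> span_ideal X \<phi> \<delta> n \<Longrightarrow> (\<lambda>x. c * f x) \<in> span_ideal X \<phi> \<delta> n"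
proof (induction rule: span_ideal.induct)
  case (basis g f a)
  then have "(\<lambda>x. (c * a) * g x + c * f x) \<in> span_ideal X \<phi> \<delta> n" by (intro span_ideal.basis)
  then show ?case by (simp add: algebra_simps)
next
  case (gen e h m f)
  then have "(\<lambda>x. (c * h x) * \<phi> e x + c * f x) \<in> span_ideal X \<phi> \<delta> n"
    by (intro span_ideal.gen[of e "\<lambda>x. c * h x" m] W_scale) auto
  then show ?case by (simp add: algebra_simps)
qed (simp add: span_ideal.zero)

lemma span_ideal_sum:
  "(\<And>i. i \<in> I \<Longrightarrow> f i \<in> span_ideal X \<phi> \<delta> n) \<Longrightarrow> (\<lambda>x. \<Sum>i\<in>I. f i x) \<in> span_ideal X \<phi> \<delta> n"
  by (induction I rule: infinite_finite_induct) (auto intro: span_ideal.zero span_ideal_add)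

lemma W_subset_span_ideal:
  assumes "words n \<subseteq> span_ideal X \<phi> \<delta> n"
  shows "W n \<subseteq> span_ideal X \<phi> \<delta> n"
proof
  fix f assume "f \<in> W n"
  then show "f \<in> span_ideal X \<phi> \<delta> n"
  proof (induction rule: W.induct)
    case (step g f a)
    then have "(\<lambda>x. a * g x) \<in> span_ideal X \<phi> \<delta> n" using assms by (intro span_ideal_scale) auto
    then show ?case using span_ideal_add[OF _ step.IH] by blast
  qed (rule span_ideal.zero)
qed

lemma span_ideal_coordinates:
  assumes "f \<in> span_ideal (b ` B) \<phi> \<delta> n" "finite B"
  shows "\<exists>\<beta> h. (\<forall>e\<in>E. h e \<in> W (\<lambda>q. n q - (if q \<in> \<delta> e then 1 else 0))) \<and>
    (\<forall>x. f x = (\<Sum>\<sigma>\<in>B. \<beta> \<sigma> * b \<sigma> x) + (\<Sum>e\<in>E. h e x * \<phi> e x))"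
  using assms(1)
proof (induction rule: span_ideal.induct)
  case zero
  show ?case by (intro exI[of _ "\<lambda>\<sigma>. 0"] exI[of _ "\<lambda>e x. 0"]) (simp add: W.zero)
next
  case (basis g f a)
  from basis.IH obtain \<beta> h where h: "\<forall>e\<in>E. h e \<in> W (\<lambda>q. n q - (if q \<in> \<delta> e then 1 else 0))"
    "\<forall>x. f x = (\<Sum>\<sigma>\<in>B. \<beta> \<sigma> * b \<sigma> x) + (\<Sum>e\<in>E. h e x * \<phi> e x)" by (elim exE conjE)
  obtain \<rho> where \<rho>: "\<rho> \<in> B" "g = b \<rho>" using basis.hyps(1) by blast
  have "a * g x + f x = (\<Sum>\<sigma>\<in>B. (\<beta> \<sigma> + (if \<sigma> = \<rho> then a else 0)) * b \<sigma> x) + (\<Sum>e\<in>E. h e x * \<phi> e x)" for x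
    using \<rho> assms(2) h(2)
    by (simp add: distrib_right sum.distrib if_distrib[of "\<lambda>c. c * _"] cong: if_cong)
  then show ?case
    using h(1) by (intro exI[of _ "\<lambda>\<sigma>. \<beta> \<sigma> + (if \<sigma> = \<rho> then a else 0)"] exI[of _ h]) simp
next
  case (gen e0 g m f)
  from gen.IH obtain \<beta> h where h: "\<forall>e\<in>E. h e \<in> W (\<lambda>q. n q - (if q \<in> \<delta> e then 1 else 0))"
    "\<forall>x. f x = (\<Sum>\<sigma>\<in>B. \<beta> \<sigma> * b \<sigma> x) + (\<Sum>e\<in>E. h e x * \<phi> e x)" by (elim exE conjE)
  define h' where "h' e x = (if e = e0 then g x else 0) + h e x" for e x
  have "g \<in> W (\<lambda>q. n q - (if q \<in> \<delta> e0 then 1 else 0))"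
    by (rule W_mono[OF gen.hyps(2)]) (use gen.hyps(3) in \<open>fastforce split: if_splits\<close>)
  then have "h' e \<in> W (\<lambda>q. n q - (if q \<in> \<delta> e then 1 else 0))" if "e \<in> E" for e
    unfolding h'_def[abs_def] using h(1) that by (cases "e = e0") (auto intro: W_add)
  moreover have "g x * \<phi> e0 x + f x = (\<Sum>\<sigma>\<in>B. \<beta> \<sigma> * b \<sigma> x) + (\<Sum>e\<in>E. h' e x * \<phi> e x)" for x
    using gen.hyps(1) h(2)
    by (simp add: h'_def distrib_right sum.distrib if_distrib[of "\<lambda>c. c * _"] cong: if_cong)
  ultimately show ?case by (intro exI[of _ \<beta>] exI[of _ h']) blast
qed

lemma fibre_span_in_span_ideal:
  assumes "S \<subseteq> fibre \<sigma> q" "w \<in> W m" "q \<in> {1..N}" "m q + 1 \<le> n q" "\<And>r. r \<in> {1..N} \<Longrightarrow> m r \<le> n r"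
  shows "(\<lambda>x. w x * (\<Sum>e\<in>S. d e * \<ll> e q x)) \<in> span_ideal X (\<lambda>e. \<ll> e (\<sigma> e)) (\<lambda>e. {\<sigma> e}) n"
proof -
  have "(\<lambda>x. (d e * w x) * \<ll> e q x) \<in> span_ideal X (\<lambda>e. \<ll> e (\<sigma> e)) (\<lambda>e. {\<sigma> e}) n" if "e \<in> S" for e
  proof -
    have e: "e \<in> E" "\<sigma> e = q" using that assms(1) by (auto simp: fibre_def)
    have "(\<lambda>x. (d e * w x) * \<ll> e (\<sigma> e) x + 0) \<in> span_ideal X (\<lambda>e. \<ll> e (\<sigma> e)) (\<lambda>e. {\<sigma> e}) n"
      by (rule span_ideal.gen[OF e(1) W_scale[OF assms(2)] _ span_ideal.zero]) (use assms e in auto)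
    then show ?thesis by (simp add: e(2))
  qed
  then have "(\<lambda>x. \<Sum>e\<in>S. (d e * w x) * \<ll> e q x) \<in> span_ideal X (\<lambda>e. \<ll> e (\<sigma> e)) (\<lambda>e. {\<sigma> e}) n"
    by (rule span_ideal_sum)
  then show ?thesis by (simp add: sum_distrib_left ac_simps)
qed

lemma span_ideal_sp_balanced:
  assumes "\<And>q. q \<in> {1..N} \<Longrightarrow> card (fibre \<sigma> q) = k q" "q \<in> {1..N}" "t \<le> k q"
    and "f \<in> span_ideal {\<lambda>x. 1} (\<lambda>e. \<ll> e (\<sigma> e)) (\<lambda>e. {\<sigma> e}) n"
  shows "(\<lambda>x. sp x q t * f x) \<in> span_ideal {\<lambda>x. 1} (\<lambda>e. \<ll> e (\<sigma> e)) (\<lambda>e. {\<sigma> e}) (n(q := Suc (n q)))"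
  using assms(4)
proof (induction rule: span_ideal.induct)
  case zero
  then show ?case by (simp add: span_ideal.zero)
next
  case (basis g f a)
  let ?J = "span_ideal {\<lambda>x. 1} (\<lambda>e. \<ll> e (\<sigma> e)) (\<lambda>e. {\<sigma> e}) (n(q := Suc (n q)))"
  obtain c d where cd: "\<And>x. sp x q t = c + (\<Sum>e\<in>fibre \<sigma> q. d e * \<ll> e q x)"
    using sp_in_fibre_span[OF finite_fibre assms(1)[OF assms(2)] assms(3)] by blast
  have "(\<lambda>x. 1 * (\<Sum>e\<in>fibre \<sigma> q. d e * \<ll> e q x)) \<in> ?J"
    by (rule fibre_span_in_span_ideal[OF order_refl W_words[OF one_in_words] assms(2)]) auto
  then have "(\<lambda>x. c * 1 + (\<Sum>e\<in>fibre \<sigma> q. d e * \<ll> e q x)) \<in> ?J"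
    by (intro span_ideal.basis) auto
  then have "(\<lambda>x. sp x q t) \<in> ?J" by (simp add: cd)
  then have "(\<lambda>x. a * sp x q t + sp x q t * f x) \<in> ?J"
    by (intro span_ideal_add span_ideal_scale basis.IH)
  then show ?case using basis.hyps(1) by (simp add: algebra_simps fun_upd_def)
next
  case (gen e h m f)
  have "(\<lambda>x. (sp x q t * h x) * \<ll> e (\<sigma> e) x + sp x q t * f x) \<in>
      span_ideal {\<lambda>x. 1} (\<lambda>e. \<ll> e (\<sigma> e)) (\<lambda>e. {\<sigma> e}) (n(q := Suc (n q)))"
    by (rule span_ideal.gen[OF gen.hyps(1) W_sp[OF gen.hyps(2) assms(2,3)] _ gen.IH])
      (use gen.hyps(3) in \<open>auto split: if_splits\<close>)
  then show ?case by (simp add: algebra_simps fun_upd_def)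
qed

text \<open>For a balanced choice of one linear factor from every equation, the forms of each block are
  affine coordinates centred at the single solution; every function is then a constant modulo the
  forms, by induction on the degree.\<close>

lemma words_balanced:
  assumes "\<And>q. q \<in> {1..N} \<Longrightarrow> card (fibre \<sigma> q) = k q" "g \<in> words n"
  shows "g \<in> span_ideal {\<lambda>x. 1} (\<lambda>e. \<ll> e (\<sigma> e)) (\<lambda>e. {\<sigma> e}) n"
  using assms(2)
proof (induction "\<Sum>q\<in>{1..N}. n q" arbitrary: n g)
  case 0
  then have "g = (\<lambda>x. 1)" by (intro words_zero[of n]) auto
  then show ?case
    using span_ideal.basis[OF _ span_ideal.zero, of "\<lambda>x. 1" "{\<lambda>x. 1}" 1] by simp
next
  case (Suc d)
  have "\<exists>q\<in>{1..N}. n q \<noteq> 0"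
  proof (rule ccontr)
    assume "\<not> ?thesis"
    then have "(\<Sum>q\<in>{1..N}. n q) = 0" by simp
    then show False using Suc.hyps(2) by simp
  qed
  then obtain q where q: "q \<in> {1..N}" "n q \<noteq> 0" by blast
  let ?n = "n(q := n q - 1)"
  obtain t g' where g: "t \<le> k q" "g' \<in> words ?n" "g = (\<lambda>x. sp x q t * g' x)"
    using words_split[OF Suc.prems q(1)] q(2) by blast
  have "(\<Sum>q\<in>{1..N}. n q) = n q + (\<Sum>q\<in>{1..N} - {q}. n q)"
    using q by (intro sum.remove) auto
  moreover have "(\<Sum>q\<in>{1..N}. ?n q) = (n q - 1) + (\<Sum>q\<in>{1..N} - {q}. n q)"
    using q by (subst sum.remove[of _ q]) (auto intro!: sum.cong)
  ultimately have "d = (\<Sum>q\<in>{1..N}. ?n q)" using Suc.hyps(2) q(2) by simp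
  from Suc.hyps(1)[OF this g(2)] span_ideal_sp_balanced[OF assms(1) q(1) g(1)]
  have "g \<in> span_ideal {\<lambda>x. 1} (\<lambda>e. \<ll> e (\<sigma> e)) (\<lambda>e. {\<sigma> e}) (?n(q := Suc (?n q)))"
    unfolding g(3) by blast
  moreover have "?n(q := Suc (?n q)) = n" using q(2) by auto
  ultimately show ?case by simp
qed

text \<open>If more than \<open>k q\<close> forms of the block \<open>q\<close> are chosen, the chosen forms generate the constant
  \<open>1\<close>.\<close>

lemma words_overfull:
  assumes "q \<in> {1..N}" "card (fibre \<sigma> q) > k q" "n q \<ge> 1" "g \<in> words n"
  shows "g \<in> span_ideal X (\<lambda>e. \<ll> e (\<sigma> e)) (\<lambda>e. {\<sigma> e}) n"
proof -
  obtain t g' where g: "t \<le> k q" "g' \<in> words (n(q := n q - 1))" "g = (\<lambda>x. sp x q t * g' x)"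
    using words_split[OF assms(4,1)] assms(3) by auto
  obtain d where d: "\<And>x. sp x q t = (\<Sum>e\<in>fibre \<sigma> q. d e * \<ll> e q x)"
    using sp_in_large_fibre_span[OF finite_fibre assms(2) g(1)] by blast
  have "(\<lambda>x. g' x * (\<Sum>e\<in>fibre \<sigma> q. d e * \<ll> e q x)) \<in> span_ideal X (\<lambda>e. \<ll> e (\<sigma> e)) (\<lambda>e. {\<sigma> e}) n"
    by (rule fibre_span_in_span_ideal[OF order_refl W_words[OF g(2)] assms(1)]) (use assms(3) in auto)
  then show ?thesis by (simp add: g(3) d mult.commute)
qed

definition product_form :: "nat \<times> nat \<Rightarrow> (nat \<times> nat \<Rightarrow> complex) \<Rightarrow> complex" where
  "product_form e x = (\<Prod>q\<in>nbrs e. \<ll> e q x)"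

text \<open>The next definitions interpolate between two systems. For \<open>e \<in> R\<close> the equation is the full
  product, for \<open>e \<notin> R\<close> it is the single factor chosen by \<open>\<sigma>\<close>. The solutions are the balanced
  assignments that agree with \<open>\<sigma>\<close> outside \<open>R\<close>.\<close>

definition extensions :: "(nat \<times> nat) set \<Rightarrow> (nat \<times> nat \<Rightarrow> nat) \<Rightarrow> (nat \<times> nat \<Rightarrow> nat) set" where
  "extensions R \<sigma> = {\<rho> \<in> balanced. \<forall>e\<in>E - R. \<rho> e = \<sigma> e}"

text \<open>The factors of the products that come before the one chosen by \<open>\<rho>\<close>, in the order of the
  in-neighbours. At the solution of \<open>\<rho>'\<close> this is nonzero only if \<open>\<rho> \<le> \<rho>'\<close> on \<open>R\<close>, which makes the
  evaluation matrix triangular.\<close>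

definition bas :: "(nat \<times> nat) set \<Rightarrow> (nat \<times> nat \<Rightarrow> nat) \<Rightarrow> (nat \<times> nat \<Rightarrow> complex) \<Rightarrow> complex" where
  "bas R \<rho> x = (\<Prod>e\<in>R. \<Prod>q\<in>{q \<in> nbrs e. q < \<rho> e}. \<ll> e q x)"

definition gens where
  "gens R \<sigma> e = (if e \<in> R then product_form e else \<ll> e (\<sigma> e))"

definition degs where
  "degs R \<sigma> e = (if e \<in> R then nbrs e else {\<sigma> e})"

lemma spanning_empty:
  assumes "\<And>e. e \<in> E \<Longrightarrow> \<sigma> e \<in> nbrs e" "\<And>q. q \<in> {1..N} \<Longrightarrow> n q \<ge> 1"
  shows "W n \<subseteq> span_ideal (bas {} ` extensions {} \<sigma>) (gens {} \<sigma>) (degs {} \<sigma>) n"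
proof (rule W_subset_span_ideal, rule subsetI)
  fix g assume g: "g \<in> words n"
  let ?\<sigma> = "restrict \<sigma> E"
  have fib: "fibre ?\<sigma> q = fibre \<sigma> q" for q by (auto simp: fibre_def)
  have gd: "gens {} \<sigma> = (\<lambda>e. \<ll> e (\<sigma> e))" "degs {} \<sigma> = (\<lambda>e. {\<sigma> e})"
    by (auto simp: gens_def degs_def)
  have as: "?\<sigma> \<in> assignments" using assms(1) by (auto simp: assignments_def)
  show "g \<in> span_ideal (bas {} ` extensions {} \<sigma>) (gens {} \<sigma>) (degs {} \<sigma>) n"
  proof (cases "?\<sigma> \<in> balanced")
    case True
    then have "\<And>q. q \<in> {1..N} \<Longrightarrow> card (fibre \<sigma> q) = k q" by (simp add: balanced_def fib)
    from words_balanced[OF this g]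
    have "g \<in> span_ideal {\<lambda>x. 1} (\<lambda>e. \<ll> e (\<sigma> e)) (\<lambda>e. {\<sigma> e}) n" .
    moreover have "bas {} ` extensions {} \<sigma> = {\<lambda>x. 1}"
    proof -
      have "?\<sigma> \<in> extensions {} \<sigma>" using True by (simp add: extensions_def)
      moreover have "bas {} \<rho> = (\<lambda>x. 1)" for \<rho> by (simp add: bas_def fun_eq_iff)
      ultimately show ?thesis by auto
    qed
    ultimately show ?thesis by (simp add: gd)
  next
    case False
    obtain q where "q \<in> {1..N}" "card (fibre ?\<sigma> q) > k q"
      using overfull_fibre[OF as False] by blast
    then show ?thesis unfolding gd using words_overfull[of q \<sigma> n g] assms(2) g by (simp add: fib)
  qed
qed

text \<open>One step in splitting off the factors of the product of \<open>e0\<close>. Multiplication by the factors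
  \<open>D\<close> that precede \<open>\<ll> e0 j\<close> turns the basis for the system with the single factor \<open>\<ll> e0 j\<close> into
  basis elements for the system with the product, and multiples of \<open>\<ll> e0 j\<close> into multiples of the
  next partial product; those are what \<open>h\<close> collects.\<close>

lemma spanning_transfer:
  assumes e0: "e0 \<in> E" "e0 \<notin> R" "R \<subseteq> E" and j: "j \<in> nbrs e0"
    and D: "D = {q \<in> nbrs e0. q < j}" and n1: "\<And>q. q \<in> {1..N} \<Longrightarrow> n q \<ge> 1"
    and f: "f \<in> span_ideal (bas R ` extensions R (\<sigma>(e0 := j))) (gens R (\<sigma>(e0 := j)))
      (degs R (\<sigma>(e0 := j))) (\<lambda>q. n q - (if q \<in> D then 1 else 0))"
  shows "\<exists>h\<in>W (\<lambda>q. n q - (if q \<in> insert j D then 1 else 0)).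
    (\<lambda>x. (f x - h x * \<ll> e0 j x) * (\<Prod>q\<in>D. \<ll> e0 q x)) \<in>
      span_ideal (bas (insert e0 R) ` extensions (insert e0 R) \<sigma>) (gens (insert e0 R) \<sigma>)
        (degs (insert e0 R) \<sigma>) n"
  using f
proof (induction rule: span_ideal.induct)
  case zero
  show ?case by (intro bexI[of _ "\<lambda>x. 0"]) (simp_all add: span_ideal.zero W.zero)
next
  case (basis g f a)
  let ?J = "span_ideal (bas (insert e0 R) ` extensions (insert e0 R) \<sigma>) (gens (insert e0 R) \<sigma>)
        (degs (insert e0 R) \<sigma>) n"
  obtain \<rho> where \<rho>: "\<rho> \<in> extensions R (\<sigma>(e0 := j))" "g = bas R \<rho>" using basis.hyps(1) by blast
  have finR: "finite R" using e0(3) by (rule finite_subset) simp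
  have "\<rho> e0 = j" using \<rho>(1) e0 by (auto simp: extensions_def)
  then have "bas (insert e0 R) \<rho> x = g x * (\<Prod>q\<in>D. \<ll> e0 q x)" for x
    using e0(2) finR by (simp add: bas_def \<rho>(2) D mult.commute)
  moreover have "\<rho> \<in> extensions (insert e0 R) \<sigma>" using \<rho>(1) by (auto simp: extensions_def)
  moreover obtain h where h: "h \<in> W (\<lambda>q. n q - (if q \<in> insert j D then 1 else 0))"
    "(\<lambda>x. (f x - h x * \<ll> e0 j x) * (\<Prod>q\<in>D. \<ll> e0 q x)) \<in> ?J" using basis.IH by blast
  ultimately have "(\<lambda>x. a * bas (insert e0 R) \<rho> x + (f x - h x * \<ll> e0 j x) * (\<Prod>q\<in>D. \<ll> e0 q x)) \<in> ?J"
    by (intro span_ideal.basis imageI)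
  then show ?case
    using h(1) \<open>\<And>x. bas (insert e0 R) \<rho> x = g x * (\<Prod>q\<in>D. \<ll> e0 q x)\<close>
    by (intro bexI[of _ h]) (simp_all add: algebra_simps)
next
  case (gen e g m f)
  let ?J = "span_ideal (bas (insert e0 R) ` extensions (insert e0 R) \<sigma>) (gens (insert e0 R) \<sigma>)
        (degs (insert e0 R) \<sigma>) n"
  obtain h where h: "h \<in> W (\<lambda>q. n q - (if q \<in> insert j D then 1 else 0))"
    "(\<lambda>x. (f x - h x * \<ll> e0 j x) * (\<Prod>q\<in>D. \<ll> e0 q x)) \<in> ?J" using gen.IH by blast
  have jD: "j \<notin> D" using D by simp
  have DN: "D \<subseteq> {1..N}" using D in_nbrs_subset by blast
  show ?case
  proof (cases "e = e0")
    case True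
    have "g \<in> W (\<lambda>q. n q - (if q \<in> insert j D then 1 else 0))"
    proof (rule W_mono[OF gen.hyps(2)])
      fix q assume "q \<in> {1..N}"
      then show "m q \<le> n q - (if q \<in> insert j D then 1 else 0)"
        using gen.hyps(3)[of q] True e0(2) jD by (auto simp: degs_def split: if_splits)
    qed
    then have "(\<lambda>x. g x + h x) \<in> W (\<lambda>q. n q - (if q \<in> insert j D then 1 else 0))"
      using h(1) by (rule W_add)
    moreover have "gens R (\<sigma>(e0 := j)) e = \<ll> e0 j" using True e0(2) by (simp add: gens_def)
    ultimately show ?thesis using h(2)
      by (intro bexI[of _ "\<lambda>x. g x + h x"]) (simp_all add: algebra_simps)
  next
    case False
    then have eq: "gens R (\<sigma>(e0 := j)) e = gens (insert e0 R) \<sigma> e"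
      "degs R (\<sigma>(e0 := j)) e = degs (insert e0 R) \<sigma> e"
      by (auto simp: gens_def degs_def)
    have "(\<lambda>x. (\<Prod>q\<in>D. \<ll> e0 q x) * g x) \<in> W (\<lambda>q. m q + (if q \<in> D then 1 else 0))"
      using DN gen.hyps(2) by (intro W_prod_linear linear_in_\<ll>) (auto intro: finite_subset)
    then have "(\<lambda>x. (\<Prod>q\<in>D. \<ll> e0 q x) * g x * gens (insert e0 R) \<sigma> e x +
        (f x - h x * \<ll> e0 j x) * (\<Prod>q\<in>D. \<ll> e0 q x)) \<in> ?J"
    proof (rule span_ideal.gen[OF gen.hyps(1) _ _ h(2)])
      fix q assume q: "q \<in> {1..N}"
      show "m q + (if q \<in> D then 1 else 0) + (if q \<in> degs (insert e0 R) \<sigma> e then 1 else 0) \<le> n q"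
        using gen.hyps(3)[OF q] n1[OF q] unfolding eq by (auto split: if_splits)
    qed
    then show ?thesis using h(1) unfolding eq by (intro bexI[of _ h]) (simp_all add: algebra_simps)
  qed
qed

text \<open>Adding \<open>e0\<close> to \<open>R\<close>: run through the in-neighbours \<open>j\<close> of \<open>e0\<close> in increasing order and
  maintain \<open>g \<equiv> h \<cdot> (product of the factors before j)\<close>. The induction hypothesis for the factor
  \<open>\<ll> e0 j\<close> expands \<open>h\<close>, and \<open>spanning_transfer\<close> moves on to the next factor. At the end \<open>h\<close>
  multiplies the complete product, which is a generator. Each added equation costs one degree in
  every block.\<close>

lemma spanning:
  assumes "finite R" "R \<subseteq> E" "\<And>e. e \<in> E - R \<Longrightarrow> \<sigma> e \<in> nbrs e"
    "\<And>q. q \<in> {1..N} \<Longrightarrow> n q \<ge> Suc (card R)"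
  shows "W n \<subseteq> span_ideal (bas R ` extensions R \<sigma>) (gens R \<sigma>) (degs R \<sigma>) n"
  using assms
proof (induction R arbitrary: \<sigma> n rule: finite_induct)
  case empty
  then show ?case by (intro spanning_empty) auto
next
  case (insert e0 R)
  let ?J = "span_ideal (bas (insert e0 R) ` extensions (insert e0 R) \<sigma>) (gens (insert e0 R) \<sigma>)
        (degs (insert e0 R) \<sigma>) n"
  have e0: "e0 \<in> E" "R \<subseteq> E" using insert.prems(1) by auto
  have n2: "n q \<ge> Suc (Suc (card R))" if "q \<in> {1..N}" for q
    using insert.prems(3)[OF that] insert.hyps by simp
  show ?case
  proof
    fix g assume g: "g \<in> W n"
    have "\<exists>h\<in>W (\<lambda>q. n q - (if q \<in> {q \<in> nbrs e0. q < j} then 1 else 0)).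
      (\<lambda>x. g x - h x * (\<Prod>q\<in>{q \<in> nbrs e0. q < j}. \<ll> e0 q x)) \<in> ?J" for j
    proof (induction j)
      case 0
      show ?case using g by (intro bexI[of _ g]) (simp_all add: span_ideal.zero)
    next
      case (Suc j)
      define D where "D = {q \<in> nbrs e0. q < j}"
      obtain h where h: "h \<in> W (\<lambda>q. n q - (if q \<in> D then 1 else 0))"
        "(\<lambda>x. g x - h x * (\<Prod>q\<in>D. \<ll> e0 q x)) \<in> ?J" using Suc unfolding D_def by blast
      show ?case
      proof (cases "j \<in> nbrs e0")
        case False
        then have "{q \<in> nbrs e0. q < Suc j} = D" by (auto simp: D_def less_Suc_eq)
        then show ?thesis using h by auto
      next
        case True
        then have ins: "{q \<in> nbrs e0. q < Suc j} = insert j D" by (auto simp: D_def less_Suc_eq)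
        have jD: "j \<notin> D" "finite D" by (simp_all add: D_def)
        have "h \<in> span_ideal (bas R ` extensions R (\<sigma>(e0 := j))) (gens R (\<sigma>(e0 := j)))
            (degs R (\<sigma>(e0 := j))) (\<lambda>q. n q - (if q \<in> D then 1 else 0))"
        proof (rule subsetD[OF insert.IH h(1)])
          show "(\<sigma>(e0 := j)) e \<in> nbrs e" if "e \<in> E - R" for e
            using that True insert.prems(2)[of e] by auto
          show "Suc (card R) \<le> n q - (if q \<in> D then 1 else 0)" if "q \<in> {1..N}" for q
            using n2[OF that] by auto
        qed (rule e0(2))
        from spanning_transfer[OF e0(1) insert.hyps(2) e0(2) True D_def _ this]
        obtain h' where h': "h' \<in> W (\<lambda>q. n q - (if q \<in> insert j D then 1 else 0))"
          "(\<lambda>x. (h x - h' x * \<ll> e0 j x) * (\<Prod>q\<in>D. \<ll> e0 q x)) \<in> ?J"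
          using n2 by force
        have "(\<lambda>x. (g x - h x * (\<Prod>q\<in>D. \<ll> e0 q x)) +
            (h x - h' x * \<ll> e0 j x) * (\<Prod>q\<in>D. \<ll> e0 q x)) \<in> ?J"
          by (rule span_ideal_add[OF h(2) h'(2)])
        then have "(\<lambda>x. g x - h' x * (\<Prod>q\<in>insert j D. \<ll> e0 q x)) \<in> ?J"
          using jD by (simp add: algebra_simps)
        then show ?thesis unfolding ins using h'(1) by blast
      qed
    qed
    \<comment> \<open>No in-neighbour exceeds \<open>N\<close>.\<close>
    from this[of "Suc N"]
    have "\<exists>h\<in>W (\<lambda>q. n q - (if q \<in> nbrs e0 then 1 else 0)).
      (\<lambda>x. g x - h x * (\<Prod>q\<in>nbrs e0. \<ll> e0 q x)) \<in> ?J"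
    proof -
      have "{q \<in> nbrs e0. q < Suc N} = nbrs e0" using in_nbrs_subset[of "fst e0"] by auto
      then show ?thesis using \<open>\<exists>h\<in>W (\<lambda>q. n q - (if q \<in> {q \<in> nbrs e0. q < Suc N} then 1 else 0)). _\<close>
        by simp
    qed
    then obtain h where h: "h \<in> W (\<lambda>q. n q - (if q \<in> nbrs e0 then 1 else 0))"
      "(\<lambda>x. g x - h x * (\<Prod>q\<in>nbrs e0. \<ll> e0 q x)) \<in> ?J" by blast
    have "(\<lambda>x. h x * gens (insert e0 R) \<sigma> e0 x + (g x - h x * (\<Prod>q\<in>nbrs e0. \<ll> e0 q x))) \<in> ?J"
    proof (rule span_ideal.gen[OF e0(1) h(1) _ h(2)])
      fix q assume "q \<in> {1..N}"
      then show "n q - (if q \<in> nbrs e0 then 1 else 0) + (if q \<in> degs (insert e0 R) \<sigma> e0 then 1 else 0) \<le> n q"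
        using n2[of q] by (auto simp: degs_def)
    qed
    then show "g \<in> ?J" by (simp add: gens_def product_form_def)
  qed
qed

definition b :: "(nat \<times> nat \<Rightarrow> nat) \<Rightarrow> (nat \<times> nat \<Rightarrow> complex) \<Rightarrow> complex" where
  "b \<sigma> = bas E \<sigma>"

definition top_degree :: "nat \<Rightarrow> nat" where
  "top_degree q = Suc (card E)"

text \<open>The case \<open>R = E\<close>, in which nothing remains of the initial choice \<open>\<sigma>\<close>.\<close>

lemma product_system_certificate:
  assumes "g \<in> W top_degree"
  shows "\<exists>\<beta> h. (\<forall>e\<in>E. h e \<in> W (\<lambda>q. top_degree q - (if q \<in> nbrs e then 1 else 0))) \<and>
    (\<forall>x. g x = (\<Sum>\<sigma>\<in>balanced. \<beta> \<sigma> * b \<sigma> x) + (\<Sum>e\<in>E. h e x * product_form e x))"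
proof -
  have "g \<in> span_ideal (bas E ` extensions E undefined) (gens E undefined) (degs E undefined) top_degree"
    by (rule subsetD[OF spanning assms]) (auto simp: top_degree_def)
  moreover have "extensions E undefined = balanced" by (auto simp: extensions_def)
  ultimately have "g \<in> span_ideal (b ` balanced) (gens E undefined) (degs E undefined) top_degree"
    by (simp add: b_def)
  from span_ideal_coordinates[OF this finite_balanced]
  obtain \<beta> h where h: "\<forall>e\<in>E. h e \<in> W (\<lambda>q. top_degree q - (if q \<in> degs E undefined e then 1 else 0))"
    "\<forall>x. g x = (\<Sum>\<sigma>\<in>balanced. \<beta> \<sigma> * b \<sigma> x) + (\<Sum>e\<in>E. h e x * gens E undefined e x)"
    by (elim exE conjE)
  then show ?thesis
    by (intro exI[of _ \<beta>] exI[of _ h]) (auto simp: gens_def degs_def)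
qed

lemma b_degree:
  "b \<sigma> \<in> W (\<lambda>q. card E)"
proof -
  have "(\<lambda>x. (\<Prod>e\<in>R. \<Prod>q\<in>{q \<in> nbrs e. q < \<sigma> e}. \<ll> e q x)) \<in> W (\<lambda>q. card R)" if "finite R" for R
    using that
  proof (induction R rule: finite_induct)
    case empty
    show ?case using W_words[OF one_in_words] by simp
  next
    case (insert e R)
    have "(\<lambda>x. (\<Prod>q\<in>{q \<in> nbrs e. q < \<sigma> e}. \<ll> e q x) *
        (\<Prod>e\<in>R. \<Prod>q\<in>{q \<in> nbrs e. q < \<sigma> e}. \<ll> e q x)) \<in>
      W (\<lambda>q. card R + (if q \<in> {q \<in> nbrs e. q < \<sigma> e} then 1 else 0))"
      using in_nbrs_subset by (intro W_prod_linear linear_in_\<ll> insert.IH) auto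
    then have "(\<lambda>x. (\<Prod>q\<in>{q \<in> nbrs e. q < \<sigma> e}. \<ll> e q x) *
        (\<Prod>e\<in>R. \<Prod>q\<in>{q \<in> nbrs e. q < \<sigma> e}. \<ll> e q x)) \<in> W (\<lambda>q. card (insert e R))"
      by (rule W_mono) (use insert in auto)
    then show ?case using insert by simp
  qed
  from this[OF finite_E] show ?thesis by (simp add: b_def bas_def[abs_def])
qed

end

section \<open>The algebraic degree counts balanced assignments\<close>

context game
begin

abbreviation L :: "(nat \<times> nat \<times> (nat \<Rightarrow> nat)) set" where "L \<equiv> payoff_index N k F"

text \<open>The payoff table whose indifference equation for \<open>e\<close> is \<open>\<Prod>q. \<ll> e q\<close>; the coefficients are
  products because the forms involve different blocks.\<close>

definition u0 :: "nat \<times> nat \<times> (nat \<Rightarrow> nat) \<Rightarrow> complex" where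
  "u0 = (\<lambda>(i, s, \<alpha>)\<in>L. if s = 0 then 0 else \<Prod>q\<in>in_nbrs F i. coef (i, s) q (\<alpha> q))"

abbreviation Z :: "(nat \<times> nat \<times> (nat \<Rightarrow> nat) \<Rightarrow> complex) \<Rightarrow> (nat \<times> nat \<Rightarrow> complex) set" where
  "Z u \<equiv> common_zeros E (\<lambda>e. indifference k F u e)"

lemma nbrs_range: "q \<in> in_nbrs F i \<Longrightarrow> q \<in> {1..N}"
  using in_nbrs_subset by blast

lemma L_mem: "(i, s) \<in> E \<Longrightarrow> \<alpha> \<in> profiles k F i \<Longrightarrow> (i, s, \<alpha>) \<in> L \<and> (i, 0, \<alpha>) \<in> L"
  by (auto simp: payoff_index_def unknowns_def)

lemma indifference_u0:
  assumes "e \<in> E"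
  shows "indifference k F u0 e x = product_form e x"
proof -
  obtain i s where e: "e = (i, s)" by (cases e)
  have s: "s \<noteq> 0" using assms e by (auto simp: unknowns_def)
  have "product_form e x = (\<Prod>q\<in>in_nbrs F i. \<Sum>t\<in>{0..k q}. coef e q t * sp x q t)"
    by (simp add: product_form_def e \<ll>_eq_sum_sp)
  also have "\<dots> = (\<Sum>\<alpha>\<in>profiles k F i. \<Prod>q\<in>in_nbrs F i. coef e q (\<alpha> q) * sp x q (\<alpha> q))"
    unfolding profiles_def by (rule prod_sum_PiE) auto
  also have "\<dots> = (\<Sum>\<alpha>\<in>profiles k F i. (u0 (i, s, \<alpha>) - u0 (i, 0, \<alpha>)) * (\<Prod>q\<in>in_nbrs F i. sp x q (\<alpha> q)))"
    using L_mem[of i s] assms e s by (intro sum.cong refl) (simp add: u0_def prod.distrib)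
  finally show ?thesis by (simp add: e indifference_def)
qed

text \<open>A solution kills one factor of every equation. The choice of factors cannot have a fibre
  with more than \<open>k q\<close> elements, a monic polynomial of degree \<open>k q\<close> having at most \<open>k q\<close> roots, so
  it is balanced; then all roots of all \<open>Y q\<close> are known.\<close>

lemma Z_u0: "Z u0 = sol ` balanced"
proof (intro equalityI subsetI)
  fix x assume "x \<in> sol ` balanced"
  then obtain \<sigma> where \<sigma>: "\<sigma> \<in> balanced" "x = sol \<sigma>" by blast
  have "product_form e (sol \<sigma>) = 0" if e: "e \<in> E" for e
  proof -
    have q: "\<sigma> e \<in> nbrs e" using \<sigma>(1) e by (auto simp: balanced_def assignments_def)
    have "\<ll> e (\<sigma> e) (sol \<sigma>) = 0" using \<ll>_sol_eq_0_iff[OF \<sigma>(1) nbrs_range[OF q] e] by simp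
    then show ?thesis unfolding product_form_def by (intro prod_zero bexI[OF _ q]) auto
  qed
  then show "x \<in> Z u0" by (simp add: common_zeros_def \<sigma>(2) indifference_u0) (simp add: sol_def)
next
  fix x assume x: "x \<in> Z u0"
  have "\<exists>q\<in>nbrs e. \<ll> e q x = 0" if e: "e \<in> E" for e
    using x e by (simp add: common_zeros_def indifference_u0 product_form_def)
  then obtain \<sigma> where \<sigma>: "\<And>e. e \<in> E \<Longrightarrow> \<sigma> e \<in> nbrs e \<and> \<ll> e (\<sigma> e) x = 0" by metis
  let ?\<sigma> = "restrict \<sigma> E"
  have as: "?\<sigma> \<in> assignments" using \<sigma> by (auto simp: assignments_def)
  have zero: "\<ll> e q x = 0" if "e \<in> fibre ?\<sigma> q" for e q
  proof -
    have "e \<in> E" "\<sigma> e = q" using that by (auto simp: fibre_def)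
    then show ?thesis using \<sigma> by blast
  qed
  have bal: "?\<sigma> \<in> balanced"
  proof (rule ccontr)
    assume "?\<sigma> \<notin> balanced"
    then obtain q where q: "q \<in> {1..N}" "card (fibre ?\<sigma> q) > k q" using overfull_fibre[OF as] by blast
    obtain d where "\<And>x. (\<Sum>e\<in>fibre ?\<sigma> q. d e * \<ll> e q x) = 1"
      using one_in_large_fibre_span[OF finite_fibre q(2)] by blast
    then have "(\<Sum>e\<in>fibre ?\<sigma> q. d e * \<ll> e q x) = 1" .
    then show False by (simp add: zero)
  qed
  have "x = sol ?\<sigma>"
  proof (rule extensionalityI[of _ E])
    fix v assume v: "v \<in> E"
    obtain q t where qt: "v = (q, t)" "q \<in> {1..N}" "t \<in> {1..k q}" using v by (auto simp: unknowns_def)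
    have "x (q, t) = Y q x (of_nat t)" using Y_of_nat[OF qt(3)] by simp
    also have "\<dots> = (\<Prod>e\<in>fibre ?\<sigma> q. of_nat t - \<tau> e)"
      using bal qt(2) by (subst Y_via_fibre[OF finite_fibre, of ?\<sigma> q q]) (simp_all add: zero balanced_def)
    finally show "x v = sol ?\<sigma> v" using v by (simp add: sol_def qt(1))
  qed (use x in \<open>auto simp: common_zeros_def sol_def\<close>)
  then show "x \<in> sol ` balanced" using bal by blast
qed

lemma inj_on_sol: "inj_on sol balanced"
proof (rule inj_onI)
  fix \<sigma> \<rho> assume *: "\<sigma> \<in> balanced" "\<rho> \<in> balanced" "sol \<sigma> = sol \<rho>"
  show "\<sigma> = \<rho>"
  proof (rule extensionalityI[of _ E])
    fix e assume e: "e \<in> E"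
    have "\<sigma> e \<in> {1..N}"
      using *(1) e in_nbrs_subset by (fastforce simp: balanced_def assignments_def)
    then show "\<sigma> e = \<rho> e"
      using \<ll>_sol_eq_0_iff[OF *(1) _ e, of "\<sigma> e"] \<ll>_sol_eq_0_iff[OF *(2) _ e, of "\<sigma> e"] *(3) by simp
  qed (use * in \<open>auto simp: balanced_def assignments_def PiE_def\<close>)
qed

lemma card_Z_u0: "card (Z u0) = card balanced"
  unfolding Z_u0 by (rule card_image[OF inj_on_sol])

lemma \<ll>_affine:
  "\<ll> e q (\<lambda>v. x v + t * w v) = \<ll> e q x + t * (\<ll> e q (\<lambda>v. x v + w v) - \<ll> e q x)"
  unfolding \<ll>_def Y_def interp_def by (simp add: distrib_right sum.distrib sum_distrib_left mult.assoc)

text \<open>In the equation of \<open>e\<close> only the factor \<open>\<sigma> e\<close> vanishes, so the derivative in direction \<open>w\<close> is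
  a nonzero multiple of the derivative of that factor. The factor is affine, so it also vanishes
  at \<open>x + w\<close>; hence \<open>x + w\<close> is again the point \<open>sol \<sigma>\<close> on \<open>E\<close>.\<close>

lemma u0_nondegenerate:
  assumes x: "x \<in> Z u0"
    and lim: "\<And>e. e \<in> E \<Longrightarrow> ((\<lambda>t. indifference k F u0 e (\<lambda>v. x v + t * w v) / t) \<longlongrightarrow> 0) (at 0)"
  shows "\<forall>v\<in>E. w v = 0"
proof -
  obtain \<sigma> where \<sigma>: "\<sigma> \<in> balanced" "x = sol \<sigma>" using x Z_u0 by blast
  have nb: "\<sigma> e \<in> nbrs e" if "e \<in> E" for e using \<sigma>(1) that by (auto simp: balanced_def assignments_def)
  have zero: "\<ll> e (\<sigma> e) (\<lambda>v. x v + w v) = 0" if e: "e \<in> E" for e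
  proof -
    define m where "m q = \<ll> e q (\<lambda>v. x v + w v) - \<ll> e q x" for q
    have l0: "\<ll> e (\<sigma> e) x = 0"
      unfolding \<sigma>(2) using \<ll>_sol_eq_0_iff[OF \<sigma>(1) nbrs_range[OF nb[OF e]] e] by simp
    have "\<forall>\<^sub>F t in at 0. indifference k F u0 e (\<lambda>v. x v + t * w v) / t =
        m (\<sigma> e) * (\<Prod>q\<in>nbrs e - {\<sigma> e}. \<ll> e q x + t * m q)"
      unfolding eventually_at_filter
    proof (intro always_eventually allI impI)
      fix t :: complex assume "t \<noteq> 0"
      then show "indifference k F u0 e (\<lambda>v. x v + t * w v) / t =
        m (\<sigma> e) * (\<Prod>q\<in>nbrs e - {\<sigma> e}. \<ll> e q x + t * m q)"
        using nb[OF e] by (simp add: indifference_u0[OF e] product_form_def \<ll>_affine[of e _ x t w]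
            m_def[symmetric] prod.remove[of "nbrs e" "\<sigma> e"] l0)
    qed
    from Lim_transform_eventually[OF lim[OF e] this]
    have "((\<lambda>t. m (\<sigma> e) * (\<Prod>q\<in>nbrs e - {\<sigma> e}. \<ll> e q x + t * m q)) \<longlongrightarrow> 0) (at 0)" .
    moreover have "((\<lambda>t. m (\<sigma> e) * (\<Prod>q\<in>nbrs e - {\<sigma> e}. \<ll> e q x + t * m q)) \<longlongrightarrow>
        m (\<sigma> e) * (\<Prod>q\<in>nbrs e - {\<sigma> e}. \<ll> e q x + 0 * m q)) (at 0)"
      by (intro tendsto_intros)
    ultimately have "m (\<sigma> e) * (\<Prod>q\<in>nbrs e - {\<sigma> e}. \<ll> e q x + 0 * m q) = 0"
      by (intro tendsto_unique[OF trivial_limit_at]) auto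
    moreover have "\<ll> e q x \<noteq> 0" if "q \<in> nbrs e - {\<sigma> e}" for q
      unfolding \<sigma>(2) using that \<ll>_sol_eq_0_iff[OF \<sigma>(1) nbrs_range e, of q] by auto
    ultimately have "m (\<sigma> e) = 0" by (simp add: prod_zero_iff)
    then show ?thesis by (simp add: m_def l0)
  qed
  show ?thesis
  proof
    fix v assume v: "v \<in> E"
    obtain q t where qt: "v = (q, t)" "q \<in> {1..N}" "t \<in> {1..k q}" using v by (auto simp: unknowns_def)
    have "x (q, t) + w (q, t) = Y q (\<lambda>v. x v + w v) (of_nat t)"
      using Y_of_nat[OF qt(3), of "\<lambda>v. x v + w v"] by simp
    also have "\<dots> = (\<Prod>e\<in>fibre \<sigma> q. of_nat t - \<tau> e)"
    proof -
      have "\<ll> e q (\<lambda>v. x v + w v) = 0" if "e \<in> fibre \<sigma> q" for e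
        using zero[of e] that by (simp add: fibre_def) 
      then show ?thesis
        using \<sigma>(1) qt(2) by (subst Y_via_fibre[OF finite_fibre, of \<sigma> q q]) (simp_all add: balanced_def)
    qed
    also have "\<dots> = x (q, t)" using v by (simp add: \<sigma>(2) sol_def qt(1))
    finally show "w v = 0" by (simp add: qt(1))
  qed
qed

lemma b_sol_nonzero_iff:
  assumes "\<sigma> \<in> balanced" "\<rho> \<in> balanced"
  shows "b \<sigma> (sol \<rho>) \<noteq> 0 \<longleftrightarrow> (\<forall>e\<in>E. \<sigma> e \<le> \<rho> e)"
proof -
  have "\<ll> e q (sol \<rho>) = 0 \<longleftrightarrow> \<rho> e = q" if "e \<in> E" "q \<in> nbrs e" for e q
    using \<ll>_sol_eq_0_iff[OF assms(2) _ that(1), of q] that(2) in_nbrs_subset by blast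
  moreover have "\<rho> e \<in> nbrs e" if "e \<in> E" for e
    using assms(2) that by (auto simp: balanced_def assignments_def)
  ultimately show ?thesis
    by (auto simp: b_def bas_def prod_zero_iff not_less[symmetric])
qed

text \<open>The evaluation matrix is triangular by \<open>b_sol_nonzero_iff\<close>: in a nontrivial relation
  evaluate at a solution with coefficient \<open>c \<sigma> \<noteq> 0\<close> and \<open>\<sigma>\<close> of minimal sum.\<close>

lemma u0_pairing:
  assumes "\<And>x. x \<in> Z u0 \<Longrightarrow> (\<Sum>\<sigma>\<in>balanced. c \<sigma> * b \<sigma> x) = 0"
  shows "\<forall>\<sigma>\<in>balanced. c \<sigma> = 0"
proof (rule ccontr)
  assume "\<not> ?thesis"
  then have "\<exists>\<sigma>. \<sigma> \<in> balanced \<and> c \<sigma> \<noteq> 0" by blast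
  then obtain \<sigma> where \<sigma>: "\<sigma> \<in> balanced" "c \<sigma> \<noteq> 0"
    and min: "\<And>\<rho>. \<rho> \<in> balanced \<Longrightarrow> c \<rho> \<noteq> 0 \<Longrightarrow> (\<Sum>e\<in>E. \<sigma> e) \<le> (\<Sum>e\<in>E. \<rho> e)"
    using ex_has_least_nat[of "\<lambda>\<sigma>. \<sigma> \<in> balanced \<and> c \<sigma> \<noteq> 0" _ "\<lambda>\<sigma>. \<Sum>e\<in>E. \<sigma> e"] by blast
  have "c \<rho> * b \<rho> (sol \<sigma>) = 0" if \<rho>: "\<rho> \<in> balanced - {\<sigma>}" for \<rho>
  proof (rule ccontr)
    assume "\<not> ?thesis"
    then have le: "\<forall>e\<in>E. \<rho> e \<le> \<sigma> e" and "c \<rho> \<noteq> 0" using \<rho> \<sigma>(1) b_sol_nonzero_iff[of \<rho> \<sigma>] by auto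
    have "\<exists>e\<in>E. \<rho> e \<noteq> \<sigma> e"
      using \<rho> \<sigma>(1) by (auto simp: balanced_def assignments_def intro: PiE_ext)
    then have "(\<Sum>e\<in>E. \<rho> e) < (\<Sum>e\<in>E. \<sigma> e)"
      using le by (intro sum_strict_mono_ex1) (auto simp: le_less)
    then show False using min[of \<rho>] \<rho> \<open>c \<rho> \<noteq> 0\<close> by simp
  qed
  then have "(\<Sum>\<rho>\<in>balanced - {\<sigma>}. c \<rho> * b \<rho> (sol \<sigma>)) = 0" by (rule sum.neutral[OF ballI])
  then have "(\<Sum>\<rho>\<in>balanced. c \<rho> * b \<rho> (sol \<sigma>)) = c \<sigma> * b \<sigma> (sol \<sigma>)"
    using \<sigma>(1) by (simp add: sum.remove[of balanced \<sigma>])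
  moreover have "(\<Sum>\<rho>\<in>balanced. c \<rho> * b \<rho> (sol \<sigma>)) = 0" using assms \<sigma>(1) by (auto simp: Z_u0)
  ultimately show False using \<sigma> b_sol_nonzero_iff[OF \<sigma>(1) \<sigma>(1)] by simp
qed

lemma sp_poly:
  assumes "q \<in> {1..N}" "t \<le> k q"
  shows "(\<lambda>w. sp (w \<circ> Inr) q t) \<in> poly_funs (L <+> E)"
proof (cases "t = 0")
  case True
  have "(\<lambda>w. 1 - (\<Sum>t'\<in>{1..k q}. w (Inr (q, t')))) \<in> poly_funs (L <+> E)"
    using assms(1) by (intro poly_funs_diff poly_funs_sum poly_funs.const poly_funs.var) (auto simp: unknowns_def)
  then show ?thesis using True by (simp add: strategy_prob_def)
next
  case False
  have "(\<lambda>w. w (Inr (q, t))) \<in> poly_funs (L <+> E)"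
    using assms False by (intro poly_funs.var) (auto simp: unknowns_def)
  then show ?thesis using False by (simp add: strategy_prob_def)
qed

lemma indifference_poly:
  assumes "e \<in> E"
  shows "(\<lambda>w. indifference k F (w \<circ> Inl) e (w \<circ> Inr)) \<in> poly_funs (L <+> E)"
proof -
  obtain i s where e: "e = (i, s)" by (cases e)
  have "(\<lambda>w. \<Sum>\<alpha>\<in>profiles k F i. (w (Inl (i, s, \<alpha>)) - w (Inl (i, 0, \<alpha>))) *
      (\<Prod>q\<in>in_nbrs F i. sp (w \<circ> Inr) q (\<alpha> q))) \<in> poly_funs (L <+> E)"
  proof (intro poly_funs_sum poly_funs.mult poly_funs_diff poly_funs_prod)
    fix \<alpha> assume \<alpha>: "\<alpha> \<in> profiles k F i"
    show "(\<lambda>w. w (Inl (i, s, \<alpha>))) \<in> poly_funs (L <+> E)" "(\<lambda>w. w (Inl (i, 0, \<alpha>))) \<in> poly_funs (L <+> E)"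
      using L_mem[OF _ \<alpha>, of s] assms e by (auto intro: poly_funs.var)
    fix q assume "q \<in> in_nbrs F i"
    then show "(\<lambda>w. sp (w \<circ> Inr) q (\<alpha> q)) \<in> poly_funs (L <+> E)"
      using \<alpha> nbrs_range by (intro sp_poly) (auto simp: profiles_def)
  qed
  then show ?thesis by (simp add: e indifference_def)
qed

text \<open>Moving the payoff table away from \<open>u0\<close> perturbs the identity that writes the words in terms
  of the \<open>b \<sigma>\<close> by a matrix that vanishes at \<open>u0\<close>; by Cramer's rule the words, and hence all
  functions of the same multidegree, are still combinations of the \<open>b \<sigma>\<close> on the zeros.\<close>

lemma spanning_near_u0:
  obtains \<Delta> where "\<Delta> \<in> poly_funs L" "\<Delta> u0 \<noteq> 0"
    "\<And>f. f \<in> W top_degree \<Longrightarrow> \<exists>R. (\<forall>\<sigma>\<in>balanced. R \<sigma> \<in> poly_funs L) \<and>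
      (\<forall>u. \<forall>x\<in>Z u. \<Delta> u * f x = (\<Sum>\<sigma>\<in>balanced. R \<sigma> u * b \<sigma> x))"
proof -
  let ?G = "words top_degree"
  have "\<forall>g\<in>?G. \<exists>\<beta> h. (\<forall>e\<in>E. h e \<in> W (\<lambda>q. top_degree q - (if q \<in> nbrs e then 1 else 0))) \<and>
    (\<forall>x. g x = (\<Sum>\<sigma>\<in>balanced. \<beta> \<sigma> * b \<sigma> x) + (\<Sum>e\<in>E. h e x * product_form e x))"
    using product_system_certificate W_words by blast
  then obtain \<beta> where "\<forall>g\<in>?G. \<exists>h. (\<forall>e\<in>E. h e \<in> W (\<lambda>q. top_degree q - (if q \<in> nbrs e then 1 else 0))) \<and>
    (\<forall>x. g x = (\<Sum>\<sigma>\<in>balanced. \<beta> g \<sigma> * b \<sigma> x) + (\<Sum>e\<in>E. h e x * product_form e x))"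
    by (rule bchoice[THEN exE])
  then obtain h where bh: "\<forall>g\<in>?G. (\<forall>e\<in>E. h g e \<in> W (\<lambda>q. top_degree q - (if q \<in> nbrs e then 1 else 0))) \<and>
    (\<forall>x. g x = (\<Sum>\<sigma>\<in>balanced. \<beta> g \<sigma> * b \<sigma> x) + (\<Sum>e\<in>E. h g e x * product_form e x))"
    by (rule bchoice[THEN exE])
  define mono where "mono e \<alpha> x = (\<Prod>q\<in>nbrs e. sp x q (\<alpha> q))" for e :: "nat \<times> nat" and \<alpha> x
  have "\<exists>\<kappa>. \<forall>x. mono e \<alpha> x * h g e x = (\<Sum>g'\<in>?G. \<kappa> g' * g' x)"
    if "g \<in> ?G" "e \<in> E" "\<alpha> \<in> profiles k F (fst e)" for g e \<alpha>
  proof -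
    have "h g e \<in> W (\<lambda>q. top_degree q - (if q \<in> nbrs e then 1 else 0))" using bh that by blast
    then have "(\<lambda>x. mono e \<alpha> x * h g e x) \<in>
        W (\<lambda>q. top_degree q - (if q \<in> nbrs e then 1 else 0) + (if q \<in> nbrs e then 1 else 0))"
      unfolding mono_def using that(3) in_nbrs_subset
      by (intro W_prod_linear linear_in_sp) (auto simp: profiles_def)
    then have "(\<lambda>x. mono e \<alpha> x * h g e x) \<in> W top_degree"
      by (rule W_mono) (auto simp: top_degree_def)
    from W_coordinates[OF this] show ?thesis .
  qed
  then have "\<forall>t\<in>{(g, e, \<alpha>). g \<in> ?G \<and> e \<in> E \<and> \<alpha> \<in> profiles k F (fst e)}. \<exists>\<kappa>. \<forall>x.
      mono (fst (snd t)) (snd (snd t)) x * h (fst t) (fst (snd t)) x = (\<Sum>g'\<in>?G. \<kappa> g' * g' x)"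
    by auto
  then obtain \<kappa>0 where "\<forall>t\<in>{(g, e, \<alpha>). g \<in> ?G \<and> e \<in> E \<and> \<alpha> \<in> profiles k F (fst e)}. \<forall>x.
      mono (fst (snd t)) (snd (snd t)) x * h (fst t) (fst (snd t)) x = (\<Sum>g'\<in>?G. \<kappa>0 t g' * g' x)"
    by (rule bchoice[THEN exE])
  note \<kappa>1 = this
  have \<kappa>0: "mono e \<alpha> x * h g e x = (\<Sum>g'\<in>?G. \<kappa>0 (g, e, \<alpha>) g' * g' x)"
    if "g \<in> ?G" "e \<in> E" "\<alpha> \<in> profiles k F (fst e)" for g e \<alpha> x
    using \<kappa>1[rule_format, of "(g, e, \<alpha>)"] that by simp
  define pay where "pay u e \<alpha> = u (fst e, snd e, \<alpha>) - u (fst e, 0, \<alpha>)"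
    for u :: "nat \<times> nat \<times> (nat \<Rightarrow> nat) \<Rightarrow> complex" and e :: "nat \<times> nat" and \<alpha>
  \<comment> \<open>The coordinates, in the words, of the error made by replacing the system of \<open>u0\<close> by that of \<open>u\<close>.\<close>
  define \<Xi> where "\<Xi> u g g' = (\<Sum>e\<in>E. \<Sum>\<alpha>\<in>profiles k F (fst e). (pay u0 e \<alpha> - pay u e \<alpha>) * \<kappa>0 (g, e, \<alpha>) g')"
    for u g g'
  \<comment> \<open>On the zeros of the system of \<open>u\<close>, the matrix \<open>K u\<close> maps the vector of words to combinations of the \<open>b \<sigma>\<close>.\<close>
  define K where "K u g g' = (if g = g' then 1 else 0) - \<Xi> u g g'" for u g g'
  define \<Delta> where "\<Delta> u = indexed_det ?G (K u)" for u
  have pay_poly: "(\<lambda>u. pay u e \<alpha>) \<in> poly_funs L" if "e \<in> E" "\<alpha> \<in> profiles k F (fst e)" for e \<alpha>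
    unfolding pay_def using L_mem[of "fst e" "snd e" \<alpha>] that
    by (intro poly_funs_diff poly_funs.var) auto
  have \<Xi>_poly: "(\<lambda>u. \<Xi> u g g') \<in> poly_funs L" for g g'
    unfolding \<Xi>_def by (intro poly_funs_sum poly_funs.mult poly_funs_diff poly_funs.const pay_poly)
  have K_poly: "(\<lambda>u. K u g g') \<in> poly_funs L" for g g'
    unfolding K_def by (intro poly_funs_diff poly_funs.const \<Xi>_poly)
  have \<Delta>_poly: "\<Delta> \<in> poly_funs L"
    unfolding \<Delta>_def[abs_def] by (rule indexed_det_poly_funs[OF finite_words K_poly])
  have "\<Delta> u0 = 1" unfolding \<Delta>_def
    by (rule indexed_det_identity) (auto simp: K_def \<Xi>_def)
  have ind: "indifference k F u e x = (\<Sum>\<alpha>\<in>profiles k F (fst e). pay u e \<alpha> * mono e \<alpha> x)" for u e x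
    by (cases e) (simp add: indifference_def pay_def mono_def)
  have perturbed: "(\<Sum>g'\<in>?G. K u g g' * g' x) = (\<Sum>\<sigma>\<in>balanced. \<beta> g \<sigma> * b \<sigma> x)"
    if g: "g \<in> ?G" and x: "x \<in> Z u" for g u x
  proof -
    have zero: "indifference k F u e x = 0" if "e \<in> E" for e using x that by (simp add: common_zeros_def)
    have "(\<Sum>e\<in>E. h g e x * product_form e x) =
        (\<Sum>e\<in>E. h g e x * (indifference k F u0 e x - indifference k F u e x))"
      by (intro sum.cong refl) (simp add: zero indifference_u0)
    also have "\<dots> = (\<Sum>e\<in>E. \<Sum>\<alpha>\<in>profiles k F (fst e). (pay u0 e \<alpha> - pay u e \<alpha>) * (mono e \<alpha> x * h g e x))"
      unfolding ind by (simp add: sum_subtractf[symmetric] sum_distrib_left algebra_simps)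
    also have "\<dots> = (\<Sum>e\<in>E. \<Sum>\<alpha>\<in>profiles k F (fst e). (pay u0 e \<alpha> - pay u e \<alpha>) *
        (\<Sum>g'\<in>?G. \<kappa>0 (g, e, \<alpha>) g' * g' x))"
      using g by (intro sum.cong refl) (simp add: \<kappa>0)
    also have "\<dots> = (\<Sum>e\<in>E. \<Sum>g'\<in>?G. \<Sum>\<alpha>\<in>profiles k F (fst e).
        (pay u0 e \<alpha> - pay u e \<alpha>) * \<kappa>0 (g, e, \<alpha>) g' * g' x)"
      unfolding sum_distrib_left mult.assoc[symmetric] by (intro sum.cong refl sum.swap)
    also have "\<dots> = (\<Sum>g'\<in>?G. \<Xi> u g g' * g' x)"
      unfolding \<Xi>_def sum_distrib_right by (rule sum.swap)
    finally have "(\<Sum>e\<in>E. h g e x * product_form e x) = (\<Sum>g'\<in>?G. \<Xi> u g g' * g' x)" .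
    moreover have "g x = (\<Sum>\<sigma>\<in>balanced. \<beta> g \<sigma> * b \<sigma> x) + (\<Sum>e\<in>E. h g e x * product_form e x)"
      using bh g by blast
    moreover have "(\<Sum>g'\<in>?G. K u g g' * g' x) = g x - (\<Sum>g'\<in>?G. \<Xi> u g g' * g' x)"
      using g by (simp add: K_def left_diff_distrib sum_subtractf if_distrib[of "\<lambda>c. c * _"] cong: if_cong)
    ultimately show ?thesis by simp
  qed
  have "\<exists>R. (\<forall>\<sigma>\<in>balanced. R \<sigma> \<in> poly_funs L) \<and>
      (\<forall>u. \<forall>x\<in>Z u. \<Delta> u * f x = (\<Sum>\<sigma>\<in>balanced. R \<sigma> u * b \<sigma> x))" if f: "f \<in> W top_degree" for f
  proof -
    obtain \<kappa> where \<kappa>: "\<And>x. f x = (\<Sum>g\<in>?G. \<kappa> g * g x)" using W_coordinates[OF f] by blast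
    define R where "R \<sigma> u = (\<Sum>g\<in>?G. \<kappa> g * (\<Sum>g'\<in>?G. indexed_adj ?G (K u) g g' * \<beta> g' \<sigma>))" for \<sigma> u
    have "R \<sigma> \<in> poly_funs L" for \<sigma>
      unfolding R_def by (intro poly_funs_sum poly_funs.mult poly_funs.const indexed_adj_poly_funs K_poly) auto
    moreover have "\<Delta> u * f x = (\<Sum>\<sigma>\<in>balanced. R \<sigma> u * b \<sigma> x)" if x: "x \<in> Z u" for u x
    proof -
      have "\<Delta> u * g x = (\<Sum>\<sigma>\<in>balanced. (\<Sum>g'\<in>?G. indexed_adj ?G (K u) g g' * \<beta> g' \<sigma>) * b \<sigma> x)"
        if g: "g \<in> ?G" for g
      proof -
        have "\<Delta> u * g x = (\<Sum>g'\<in>?G. indexed_adj ?G (K u) g g' * (\<Sum>g''\<in>?G. K u g' g'' * g'' x))"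
          unfolding \<Delta>_def using indexed_det_cramer[OF finite_words g, of "K u" "\<lambda>g. g x"] by simp
        also have "\<dots> = (\<Sum>g'\<in>?G. \<Sum>\<sigma>\<in>balanced. indexed_adj ?G (K u) g g' * \<beta> g' \<sigma> * b \<sigma> x)"
          using perturbed[OF _ x] by (simp add: sum_distrib_left mult.assoc)
        finally show ?thesis by (subst (asm) sum.swap) (simp add: sum_distrib_right)
      qed
      note row = this
      have "\<Delta> u * f x = (\<Sum>g\<in>?G. \<kappa> g * (\<Delta> u * g x))"
        by (simp add: \<kappa> sum_distrib_left mult.left_commute)
      also have "\<dots> = (\<Sum>g\<in>?G. \<kappa> g * (\<Sum>\<sigma>\<in>balanced.
          (\<Sum>g'\<in>?G. indexed_adj ?G (K u) g g' * \<beta> g' \<sigma>) * b \<sigma> x))"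
        by (intro sum.cong refl) (simp only: row)
      also have "\<dots> = (\<Sum>g\<in>?G. \<Sum>\<sigma>\<in>balanced.
          \<kappa> g * (\<Sum>g'\<in>?G. indexed_adj ?G (K u) g g' * \<beta> g' \<sigma>) * b \<sigma> x)"
        by (subst sum_distrib_left) (simp only: mult.assoc)
      also have "\<dots> = (\<Sum>\<sigma>\<in>balanced. R \<sigma> u * b \<sigma> x)"
        unfolding R_def sum_distrib_right[of _ ?G] by (rule sum.swap)
      finally show ?thesis .
    qed
    ultimately show ?thesis by blast
  qed
  then show ?thesis using that[OF \<Delta>_poly] \<open>\<Delta> u0 = 1\<close> by simp
qed

text \<open>The \<open>b \<sigma>\<close> satisfy the hypotheses of \<open>finite_zero_scheme\<close>: \<open>x v * b \<sigma>\<close> and the constant \<open>1\<close>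
  have multidegree at most \<open>top_degree\<close>, so \<open>spanning_near_u0\<close> expresses both through the \<open>b \<tau>\<close>.
  The choice \<open>T = \<Prod> x v\<close> keeps the solutions in the torus.\<close>

lemma generic_count:
  obtains P where "P \<in> poly_funs L" "P u0 \<noteq> 0"
    "\<And>u. P u \<noteq> 0 \<Longrightarrow> finite (Z u) \<and> card (Z u) = card balanced \<and>
      (\<forall>x\<in>Z u. (\<Prod>v\<in>E. x v) \<noteq> 0 \<and> simple_zero E (\<lambda>e. indifference k F u e) x)"
proof -
  obtain \<Delta> where \<Delta>: "\<Delta> \<in> poly_funs L" "\<Delta> u0 \<noteq> 0"
    and span: "\<And>f. f \<in> W top_degree \<Longrightarrow> \<exists>R. (\<forall>\<sigma>\<in>balanced. R \<sigma> \<in> poly_funs L) \<and>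
      (\<forall>u. \<forall>x\<in>Z u. \<Delta> u * f x = (\<Sum>\<sigma>\<in>balanced. R \<sigma> u * b \<sigma> x))"
    by (rule spanning_near_u0) blast
  have "(\<lambda>x. x v * b \<sigma> x) \<in> W top_degree" if v: "v \<in> E" for v \<sigma>
  proof -
    obtain q t where qt: "v = (q, t)" "q \<in> {1..N}" "t \<in> {1..k q}" using v by (auto simp: unknowns_def)
    have "(\<lambda>x. sp x q t * b \<sigma> x) \<in> W ((\<lambda>q. card E)(q := Suc (card E)))"
      using W_sp[OF b_degree qt(2), of t \<sigma>] qt(3) by simp
    then have "(\<lambda>x. sp x q t * b \<sigma> x) \<in> W top_degree" by (rule W_mono) (simp add: top_degree_def)
    then show ?thesis using qt by (simp add: strategy_prob_def)
  qed
  then have "\<forall>t\<in>E \<times> balanced. \<exists>R. (\<forall>\<tau>\<in>balanced. R \<tau> \<in> poly_funs L) \<and>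
      (\<forall>u. \<forall>x\<in>Z u. \<Delta> u * (x (fst t) * b (snd t) x) = (\<Sum>\<tau>\<in>balanced. R \<tau> u * b \<tau> x))"
    using span by auto
  then obtain M0 where M0: "\<forall>t\<in>E \<times> balanced. (\<forall>\<tau>\<in>balanced. M0 t \<tau> \<in> poly_funs L) \<and>
      (\<forall>u. \<forall>x\<in>Z u. \<Delta> u * (x (fst t) * b (snd t) x) = (\<Sum>\<tau>\<in>balanced. M0 t \<tau> u * b \<tau> x))"
    by (rule bchoice[THEN exE])
  have "(\<lambda>x. 1) \<in> W top_degree" by (rule W_mono[OF W_words[OF one_in_words]]) simp
  from span[OF this] obtain R1 where R1: "\<And>u x. x \<in> Z u \<Longrightarrow> \<Delta> u * 1 = (\<Sum>\<sigma>\<in>balanced. R1 \<sigma> u * b \<sigma> x)"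
    by blast
  interpret finite_zero_scheme E L "\<lambda>e u. indifference k F u e" balanced b \<Delta> "\<lambda>v \<sigma> \<tau>. M0 (v, \<sigma>) \<tau>"
  proof
    show "(\<lambda>w. indifference k F (w \<circ> Inl) e (w \<circ> Inr)) \<in> poly_funs (L <+> E)" if "e \<in> E" for e
      by (rule indifference_poly[OF that])
    show "M0 (v, \<sigma>) \<tau> \<in> poly_funs L" if "v \<in> E" "\<sigma> \<in> balanced" "\<tau> \<in> balanced" for v \<sigma> \<tau>
      using M0 that by auto
    show "\<Delta> u * (x v * b \<sigma> x) = (\<Sum>\<tau>\<in>balanced. M0 (v, \<sigma>) \<tau> u * b \<tau> x)"
      if "x \<in> Z u" "v \<in> E" "\<sigma> \<in> balanced" for u x v \<sigma>
      using M0 that by auto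
    show "\<exists>\<sigma>\<in>balanced. b \<sigma> x \<noteq> 0" if "x \<in> Z u" "\<Delta> u \<noteq> 0" for u x
    proof (rule ccontr)
      assume "\<not> ?thesis"
      then show False using R1[OF that(1)] that(2) by simp
    qed
  qed (use \<Delta> in auto)
  have "(\<lambda>x. \<Prod>v\<in>E. x v) \<in> poly_funs E" by (intro poly_funs_prod poly_funs.var)
  then have "\<exists>P\<in>poly_funs L. P u0 \<noteq> 0 \<and> (\<forall>u. P u \<noteq> 0 \<longrightarrow>
      finite (Z u) \<and> card (Z u) = card (Z u0) \<and>
      (\<forall>x\<in>Z u. (\<Prod>v\<in>E. x v) \<noteq> 0 \<and> simple_zero E (\<lambda>e. indifference k F u e) x))"
  proof (rule conservation_of_number[OF \<Delta>(2)])
    show "(\<Prod>v\<in>E. x v) \<noteq> 0" if "x \<in> Z u0" for x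
      using that sol_nonzero by (auto simp: Z_u0 prod_zero_iff)
    show "\<forall>v\<in>E. w v = 0" if "x \<in> Z u0"
      "\<And>e. e \<in> E \<Longrightarrow> ((\<lambda>t. indifference k F u0 e (\<lambda>v. x v + t * w v) / t) \<longlongrightarrow> 0) (at 0)" for x w
      by (rule u0_nondegenerate[OF that])
    show "\<forall>\<sigma>\<in>balanced. c \<sigma> = 0"
      if "\<And>x. x \<in> Z u0 \<Longrightarrow> (\<Sum>\<sigma>\<in>balanced. c \<sigma> * b \<sigma> x) = 0" for c
      by (rule u0_pairing[OF that])
  qed
  then obtain P where "P \<in> poly_funs L" "P u0 \<noteq> 0" "\<forall>u. P u \<noteq> 0 \<longrightarrow>
      finite (Z u) \<and> card (Z u) = card (Z u0) \<and>
      (\<forall>x\<in>Z u. (\<Prod>v\<in>E. x v) \<noteq> 0 \<and> simple_zero E (\<lambda>e. indifference k F u e) x)"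
    by blast
  then show ?thesis using that by (simp add: card_Z_u0)
qed

lemma isolated_count:
  assumes "finite (Z u)" "\<And>x. x \<in> Z u \<Longrightarrow> (\<Prod>v\<in>E. x v) \<noteq> 0 \<and> simple_zero E (\<lambda>e. indifference k F u e) x"
  shows "has_isolated_count N k F u (card (Z u))"
proof -
  have torus: "torus_solutions N k F u = Z u"
  proof (intro equalityI subsetI)
    fix x assume "x \<in> torus_solutions N k F u"
    then show "x \<in> Z u" by (auto simp: torus_solutions_def common_zeros_def PiE_def)
  next
    fix x assume x: "x \<in> Z u"
    then have "\<forall>v\<in>E. x v \<noteq> 0" using assms(2) by (auto simp: prod_zero_iff)
    then show "x \<in> torus_solutions N k F u"
      using x by (auto simp: torus_solutions_def common_zeros_def PiE_def)
  qed
  have "x isolated_in Z u" if "x \<in> Z u" for x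
  proof -
    have "open (- (Z u - {x}))" using assms(1) by (intro open_Compl finite_imp_closed) auto
    moreover have "- (Z u - {x}) \<inter> Z u = {x}" using that by auto
    ultimately show ?thesis using that unfolding isolated_in_def by blast
  qed
  then have iso: "isolated_solutions N k F u = Z u" by (auto simp: isolated_solutions_def torus)
  have "(\<Sum>x\<in>Z u. local_multiplicity E E (indifference k F u) x) = (\<Sum>x\<in>Z u. 1)"
  proof (intro sum.cong refl)
    fix x assume "x \<in> Z u"
    then have "simple_zero E (indifference k F u) x" using assms(2) by simp
    then show "local_multiplicity E E (indifference k F u) x = 1"
      by (rule simple_zero_multiplicity[OF finite_E])
  qed
  then show ?thesis using assms(1) by (simp add: has_isolated_count_def iso of_nat_eq_enat)
qed

text \<open>For uniqueness of the degree, two nonempty Zariski-open sets are compared on the line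
  through a point of each: on it both omit only finitely many parameters, so they share a table.\<close>

theorem algebraic_degree_eq_card_balanced: "algebraic_degree N k F = card balanced"
  unfolding algebraic_degree_def
proof (rule the_equality)
  obtain P where P: "P \<in> poly_funs L" "P u0 \<noteq> 0"
    "\<And>u. P u \<noteq> 0 \<Longrightarrow> finite (Z u) \<and> card (Z u) = card balanced \<and>
      (\<forall>x\<in>Z u. (\<Prod>v\<in>E. x v) \<noteq> 0 \<and> simple_zero E (\<lambda>e. indifference k F u e) x)"
    by (rule generic_count) blast
  have count: "has_isolated_count N k F u (card balanced)" if "P u \<noteq> 0" for u
    using isolated_count[of u] P(3)[OF that] by metis
  define U where "U = {u \<in> L \<rightarrow>\<^sub>E UNIV. P u \<noteq> 0}"
  have "zariski_open L U"
    unfolding zariski_open_def U_def using P(1) by (intro exI[of _ "{P}"]) auto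
  moreover have "u0 \<in> U" using P(2) by (auto simp: U_def u0_def)
  ultimately show "\<exists>U. zariski_open L U \<and> U \<noteq> {} \<and> (\<forall>u\<in>U. has_isolated_count N k F u (card balanced))"
    using count by (intro exI[of _ U]) (auto simp: U_def)
  fix n assume "\<exists>U. zariski_open L U \<and> U \<noteq> {} \<and> (\<forall>u\<in>U. has_isolated_count N k F u n)"
  then obtain U' u1 where U': "zariski_open L U'" "u1 \<in> U'" "\<forall>u\<in>U'. has_isolated_count N k F u n"
    by blast
  obtain Q where Q: "Q \<subseteq> poly_funs L" "U' = {u \<in> L \<rightarrow>\<^sub>E UNIV. \<exists>f\<in>Q. f u \<noteq> 0}"
    using U'(1) unfolding zariski_open_def by blast
  obtain f where f: "f \<in> Q" "f u1 \<noteq> 0" using U'(2) Q(2) by blast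
  define line where "line t = (\<lambda>l. u0 l + t * (u1 l - u0 l))" for t :: complex
  obtain p where p: "\<And>t. P (line t) = poly p t"
    using poly_funs_on_line[OF P(1), of u0 "\<lambda>l. u1 l - u0 l"] unfolding line_def by blast
  obtain q where q: "\<And>t. f (line t) = poly q t"
    using poly_funs_on_line[of f L u0 "\<lambda>l. u1 l - u0 l"] f(1) Q(1) unfolding line_def by blast
  have "line 0 = u0" "line 1 = u1" by (auto simp: line_def)
  then have "p \<noteq> 0" "q \<noteq> 0" using p[of 0] q[of 1] P(2) f(2) by auto
  then have "finite {t. poly (p * q) t = 0}" by (intro poly_roots_finite) simp
  then obtain t where "t \<notin> {t. poly (p * q) t = 0}"
    using ex_new_if_finite[OF infinite_UNIV_char_0] by blast
  then have t: "P (line t) \<noteq> 0" "f (line t) \<noteq> 0" by (simp_all add: p q)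
  have "line t \<in> L \<rightarrow>\<^sub>E UNIV"
    using U'(2) Q(2) by (auto simp: line_def u0_def PiE_def extensional_def)
  then have "line t \<in> U'" using Q(2) f(1) t(2) by blast
  then have "has_isolated_count N k F (line t) n" using U'(3) by blast
  then show "n = card balanced" using count[OF t(1)] by (simp add: has_isolated_count_def)
qed

end

section \<open>Components of the bipartite graph\<close>

locale flow = game +
  assumes k_pos: "\<And>i. i \<in> {1..N} \<Longrightarrow> 0 < k i"
    and positive_flow: "\<exists>a\<in>flow_polytope N k F. \<forall>e\<in>F. 0 < a e"
begin

abbreviation V :: "(nat + nat) set" where "V \<equiv> bip_vertices N"

definition bip_rel :: "((nat + nat) \<times> (nat + nat)) set" where
  "bip_rel = (bip_adj F)\<^sup>* \<inter> V \<times> V"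

definition comp :: "nat + nat \<Rightarrow> (nat + nat) set" where
  "comp v = bip_rel `` {v}"

lemma finite_V [simp]: "finite V"
  by (simp add: bip_vertices_def)

lemma F_range: "(j, i) \<in> F \<Longrightarrow> j \<in> {1..N} \<and> i \<in> {1..N}"
  using F by (auto simp: arcs_def)

lemma finite_F [simp]: "finite F"
  by (rule finite_subset[of _ "{1..N} \<times> {1..N}"]) (use F_range in auto)

lemma Inl_V [simp]: "Inl i \<in> V \<longleftrightarrow> i \<in> {1..N}" and Inr_V [simp]: "Inr j \<in> V \<longleftrightarrow> j \<in> {1..N}"
  by (auto simp: bip_vertices_def)

lemma sym_bip_adj: "sym (bip_adj F)"
  by (auto simp: sym_def bip_adj_def)

lemma equiv_bip_rel: "equiv V bip_rel"
proof (rule equivI)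
  show "refl_on V bip_rel" by (auto simp: refl_on_def bip_rel_def)
  show "sym bip_rel" using sym_rtrancl[OF sym_bip_adj] by (auto simp: bip_rel_def sym_def)
  show "trans bip_rel" by (auto simp: bip_rel_def trans_def intro: rtrancl_trans)
qed (auto simp: bip_rel_def)

lemma bip_components_eq: "bip_components N F = V // bip_rel"
  by (simp add: bip_components_def bip_rel_def)

lemma comp_in_components: "v \<in> V \<Longrightarrow> comp v \<in> bip_components N F"
  by (simp add: comp_def bip_components_eq quotientI)

lemma component_eq_comp:
  assumes "C \<in> bip_components N F" "v \<in> C"
  shows "C = comp v" "v \<in> V"
proof -
  obtain u where u: "u \<in> V" "C = bip_rel `` {u}"
    using assms(1) unfolding bip_components_eq by (rule quotientE)
  have "(u, v) \<in> bip_rel" using assms(2) u by auto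
  then show "C = comp v" "v \<in> V"
    using equiv_class_eq[OF equiv_bip_rel] u by (auto simp: comp_def bip_rel_def)
qed

lemma mem_comp: "v \<in> V \<Longrightarrow> v \<in> comp v"
  using equiv_class_self[OF equiv_bip_rel] by (simp add: comp_def)

lemma comp_edge: "(j, i) \<in> F \<Longrightarrow> comp (Inr j) = comp (Inl i)"
  unfolding comp_def
  by (rule equiv_class_eq[OF equiv_bip_rel]) (use F_range in \<open>auto simp: bip_rel_def bip_adj_def\<close>)

lemma component_invariant:
  assumes edge: "\<And>j i. (j, i) \<in> F \<Longrightarrow> g (Inl i) = g (Inr j)"
    and "(u, v) \<in> bip_rel"
  shows "g u = g v"
proof -
  have "(u, v) \<in> (bip_adj F)\<^sup>*" using assms(2) by (simp add: bip_rel_def)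
  then show ?thesis
    by (induction rule: rtrancl_induct) (use edge in \<open>auto simp: bip_adj_def\<close>)
qed

text \<open>The bound \<open>B\<close> is uniform in \<open>d\<close>, because it only depends on the lengths of paths in the
  finite graph.\<close>

lemma path_bound:
  obtains B :: real where "B > 0"
    "\<And>(d :: nat + nat \<Rightarrow> nat + nat \<Rightarrow> real) u v. (\<And>v. d v v = 0) \<Longrightarrow> (\<And>u v w. d u w \<le> d u v + d v w) \<Longrightarrow>
      (\<And>u v. (u, v) \<in> bip_adj F \<Longrightarrow> d u v \<le> 1) \<Longrightarrow> (u, v) \<in> bip_rel \<Longrightarrow> d u v \<le> B"
proof -
  let ?P = "\<lambda>d :: nat + nat \<Rightarrow> nat + nat \<Rightarrow> real. (\<forall>v. d v v = 0) \<and> (\<forall>u v w. d u w \<le> d u v + d v w) \<and>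
      (\<forall>u v. (u, v) \<in> bip_adj F \<longrightarrow> d u v \<le> 1)"
  have "\<exists>b :: real. \<forall>d. ?P d \<longrightarrow> d u v \<le> b" if "(u, v) \<in> (bip_adj F)\<^sup>*" for u v
    using that
  proof (induction rule: rtrancl_induct)
    case base
    show ?case by (intro exI[of _ 0]) auto
  next
    case (step v w)
    then obtain b where b: "\<And>d. ?P d \<Longrightarrow> d u v \<le> b" by blast
    have "d u w \<le> b + 1" if "?P d" for d
    proof -
      have "d u w \<le> d u v + d v w" "d v w \<le> 1" using that step.hyps by blast+
      then show ?thesis using b[OF that] by linarith
    qed
    then show ?case by blast
  qed
  then have "\<forall>p\<in>bip_rel. \<exists>b :: real. \<forall>d. ?P d \<longrightarrow> d (fst p) (snd p) \<le> b"
    by (auto simp: bip_rel_def)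
  then obtain b where b: "\<forall>p\<in>bip_rel. \<forall>d. ?P d \<longrightarrow> d (fst p) (snd p) \<le> b p"
    by (rule bchoice[THEN exE])
  have fin: "finite bip_rel" by (rule finite_subset[of _ "V \<times> V"]) (auto simp: bip_rel_def)
  define B where "B = 1 + (\<Sum>p\<in>bip_rel. \<bar>b p\<bar>)"
  show ?thesis
  proof (rule that[of B])
    show "B > 0" unfolding B_def by (smt (verit) sum_nonneg abs_ge_zero)
    fix d :: "nat + nat \<Rightarrow> nat + nat \<Rightarrow> real" and u v
    assume d: "\<And>v. d v v = 0" "\<And>u v w. d u w \<le> d u v + d v w"
      "\<And>u v. (u, v) \<in> bip_adj F \<Longrightarrow> d u v \<le> 1" and uv: "(u, v) \<in> bip_rel"
    have "d u v \<le> b (u, v)" using b[rule_format, OF uv, of d] d by simp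
    also have "\<dots> \<le> \<bar>b (u, v)\<bar>" by simp
    also have "\<dots> \<le> (\<Sum>p\<in>bip_rel. \<bar>b p\<bar>)" using fin uv by (intro member_le_sum) auto
    finally show "d u v \<le> B" by (simp add: B_def)
  qed
qed

section \<open>Capacity, entropy and the minimizer\<close>

lemma sum_in_nbrs: "(\<Sum>i\<in>{1..N}. \<Sum>j\<in>in_nbrs F i. g j i) = (\<Sum>(j, i)\<in>F. g j i)"
proof -
  have "(\<Sum>(j, i)\<in>F. g j i) = (\<Sum>(i, j)\<in>(SIGMA i:{1..N}. in_nbrs F i). g j i)"
    by (rule sum.reindex_bij_witness[of _ "\<lambda>(i, j). (j, i)" "\<lambda>(j, i). (i, j)"])
      (use F_range in \<open>auto simp: in_nbrs_def\<close>)
  then show ?thesis by (subst sum.Sigma) auto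
qed

lemma finite_out_nbrs [simp]: "finite (out_nbrs F j)"
  by (rule finite_subset[of _ "{1..N}"]) (use F_range in \<open>auto simp: out_nbrs_def\<close>)

lemma sum_out_nbrs: "(\<Sum>j\<in>{1..N}. \<Sum>i\<in>out_nbrs F j. g j i) = (\<Sum>(j, i)\<in>F. g j i)"
proof -
  have "F = (SIGMA j:{1..N}. out_nbrs F j)" using F_range by (auto simp: out_nbrs_def)
  then show ?thesis by (subst sum.Sigma) auto
qed

lemma in_nbrs_nonempty:
  assumes "i \<in> {1..N}"
  shows "in_nbrs F i \<noteq> {}"
proof
  assume *: "in_nbrs F i = {}"
  obtain a where "a \<in> flow_polytope N k F" using positive_flow by blast
  then have "(\<Sum>j\<in>in_nbrs F i. a (j, i)) = real (k i)" using assms by (simp add: flow_polytope_def)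
  then show False using * k_pos[OF assms] by simp
qed

lemma component_has_right_vertex:
  assumes "C \<in> bip_components N F"
  shows "\<exists>j\<in>{1..N}. Inr j \<in> C"
proof -
  obtain u where u: "u \<in> V" "C = comp u"
    using assms unfolding bip_components_eq comp_def by (auto elim: quotientE)
  show ?thesis
  proof (cases u)
    case (Inr j)
    then show ?thesis using u mem_comp[OF u(1)] by (intro bexI[of _ j]) auto
  next
    case (Inl i)
    then obtain j where j: "(j, i) \<in> F" using u(1) in_nbrs_nonempty[of i] by (auto simp: in_nbrs_def)
    have "Inr j \<in> comp (Inr j)" using F_range[OF j] by (intro mem_comp) simp
    then show ?thesis using comp_edge[OF j] u(2) Inl F_range[OF j] by auto
  qed
qed

lemma pos_vectorsD: "z \<in> pos_vectors N \<Longrightarrow> j \<in> {1..N} \<Longrightarrow> 0 < z j"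
  by (simp add: pos_vectors_def)

lemma lin_form_pos: "z \<in> pos_vectors N \<Longrightarrow> i \<in> {1..N} \<Longrightarrow> 0 < lin_form F z i"
  unfolding lin_form_def using in_nbrs_nonempty nbrs_range
  by (intro sum_pos) (auto simp: pos_vectors_def)

lemma le_lin_form: "z \<in> pos_vectors N \<Longrightarrow> (j, i) \<in> F \<Longrightarrow> z j \<le> lin_form F z i"
  unfolding lin_form_def using nbrs_range[of _ i]
  by (intro member_le_sum) (auto simp: pos_vectors_def in_nbrs_def[of _ i, symmetric] less_imp_le, simp add: in_nbrs_def)

lemma pos_vectors_F: "z \<in> pos_vectors N \<Longrightarrow> (j, i) \<in> F \<Longrightarrow> 0 < z j \<and> 0 < lin_form F z i"
  using F_range lin_form_pos by (auto simp: pos_vectors_def)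

definition G :: "(nat \<Rightarrow> real) \<Rightarrow> real" where
  "G z = (\<Sum>i\<in>{1..N}. real (k i) * ln (lin_form F z i)) - (\<Sum>j\<in>{1..N}. real (k j) * ln (z j))"

lemma cap_quotient_pos: "z \<in> pos_vectors N \<Longrightarrow> 0 < cap_quotient N k F z"
  unfolding cap_quotient_def using lin_form_pos
  by (intro divide_pos_pos prod_pos) (auto simp: pos_vectors_def)

lemma ln_cap_quotient:
  assumes "z \<in> pos_vectors N"
  shows "ln (cap_quotient N k F z) = G z"
proof -
  have z: "z j \<noteq> 0" "lin_form F z j \<noteq> 0" if "j \<in> {1..N}" for j
    using pos_vectorsD[OF assms that] lin_form_pos[OF assms that] by simp_all
  have "(\<Prod>i\<in>{1..N}. lin_form F z i ^ k i) \<noteq> 0" "(\<Prod>j\<in>{1..N}. z j ^ k j) \<noteq> 0"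
    using z by (simp_all add: prod_zero_iff)
  then have "ln (cap_quotient N k F z) =
      ln (\<Prod>i\<in>{1..N}. lin_form F z i ^ k i) - ln (\<Prod>j\<in>{1..N}. z j ^ k j)"
    unfolding cap_quotient_def by (simp only: ln_div simp_thms if_True)
  also have "ln (\<Prod>i\<in>{1..N}. lin_form F z i ^ k i) = (\<Sum>i\<in>{1..N}. ln (lin_form F z i ^ k i))"
    by (intro ln_prod power_not_zero z) auto
  also have "ln (\<Prod>j\<in>{1..N}. z j ^ k j) = (\<Sum>j\<in>{1..N}. ln (z j ^ k j))"
    by (intro ln_prod power_not_zero z) auto
  finally show ?thesis unfolding G_def by (simp add: ln_realpow)
qed

text \<open>The weights \<open>k i\<close> and \<open>k j\<close> are the row and column sums of the flow, so both sums of \<open>G\<close>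
  become sums over arcs.\<close>

lemma G_flow:
  assumes "a \<in> flow_polytope N k F"
  shows "G z = (\<Sum>(j, i)\<in>F. a (j, i) * (ln (lin_form F z i) - ln (z j)))"
proof -
  have "(\<Sum>i\<in>{1..N}. real (k i) * ln (lin_form F z i)) =
      (\<Sum>i\<in>{1..N}. \<Sum>j\<in>in_nbrs F i. a (j, i) * ln (lin_form F z i))"
    using assms by (intro sum.cong) (auto simp: flow_polytope_def sum_distrib_right[symmetric])
  also have "\<dots> = (\<Sum>(j, i)\<in>F. a (j, i) * ln (lin_form F z i))" by (rule sum_in_nbrs)
  finally have 1: "(\<Sum>i\<in>{1..N}. real (k i) * ln (lin_form F z i)) = (\<Sum>(j, i)\<in>F. a (j, i) * ln (lin_form F z i))" .
  have "(\<Sum>j\<in>{1..N}. real (k j) * ln (z j)) = (\<Sum>j\<in>{1..N}. \<Sum>i\<in>out_nbrs F j. a (j, i) * ln (z j))"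
    using assms by (intro sum.cong) (auto simp: flow_polytope_def sum_distrib_right[symmetric])
  also have "\<dots> = (\<Sum>(j, i)\<in>F. a (j, i) * ln (z j))" by (rule sum_out_nbrs)
  finally show ?thesis
    unfolding G_def 1 by (simp add: sum_subtractf[symmetric] right_diff_distrib case_prod_unfold)
qed

lemma G_edge_bound:
  assumes "a \<in> flow_polytope N k F" "z \<in> pos_vectors N" "(j, i) \<in> F"
  shows "0 \<le> ln (lin_form F z i) - ln (z j)" "a (j, i) * (ln (lin_form F z i) - ln (z j)) \<le> G z"
proof -
  have nn: "0 \<le> ln (lin_form F z i) - ln (z j)" if "(j, i) \<in> F" for j i
    using le_lin_form[OF assms(2) that] pos_vectors_F[OF assms(2) that] by simp
  then show "0 \<le> ln (lin_form F z i) - ln (z j)" using assms(3) by blast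
  have "0 \<le> a e" if "e \<in> F" for e
    using assms(1) PiE_mem[OF _ that, of a "\<lambda>_. {0..}"] by (simp add: flow_polytope_def)
  then have "(case (j, i) of (j, i) \<Rightarrow> a (j, i) * (ln (lin_form F z i) - ln (z j))) \<le>
      (\<Sum>(j, i)\<in>F. a (j, i) * (ln (lin_form F z i) - ln (z j)))"
    using assms(3) nn by (intro member_le_sum) auto
  then show "a (j, i) * (ln (lin_form F z i) - ln (z j)) \<le> G z" by (simp add: G_flow[OF assms(1)])
qed

lemma rescaling_ratio:
  assumes "component_rescaling N F z z'" "z \<in> pos_vectors N"
  shows "z' \<in> pos_vectors N"
    "(j, i) \<in> F \<Longrightarrow> z' j / lin_form F z' i = z j / lin_form F z i"
proof -
  obtain c where c: "\<And>C. C \<in> bip_components N F \<Longrightarrow> (0::real) < c C"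
    "\<And>C j. C \<in> bip_components N F \<Longrightarrow> j \<in> {1..N} \<Longrightarrow> Inr j \<in> C \<Longrightarrow> z' j = c C * z j"
    using assms(1) unfolding component_rescaling_def by blast
  have z': "z' j = c (comp (Inr j)) * z j" "0 < c (comp (Inr j))" if "j \<in> {1..N}" for j
    using c comp_in_components[of "Inr j"] mem_comp[of "Inr j"] that by auto
  then show "z' \<in> pos_vectors N" using assms(2) by (auto simp: pos_vectors_def)
  assume ji: "(j, i) \<in> F"
  have "lin_form F z' i = (\<Sum>l\<in>in_nbrs F i. c (comp (Inl i)) * z l)"
    unfolding lin_form_def
  proof (intro sum.cong refl)
    fix l assume "l \<in> in_nbrs F i"
    then have "(l, i) \<in> F" by (simp add: in_nbrs_def)
    then show "z' l = c (comp (Inl i)) * z l" using z'[of l] comp_edge[of l i] F_range by auto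
  qed
  then have "lin_form F z' i = c (comp (Inl i)) * lin_form F z i"
    by (simp add: lin_form_def sum_distrib_left)
  moreover have "z' j = c (comp (Inl i)) * z j" "0 < c (comp (Inl i))"
    using z'[of j] comp_edge[OF ji] F_range[OF ji] by auto
  ultimately show "z' j / lin_form F z' i = z j / lin_form F z i" by simp
qed

text \<open>The ratios \<open>L\<^sub>i(z')/L\<^sub>i(z)\<close> and \<open>z'\<^sub>j/z\<^sub>j\<close> agree across every edge, so they are constant on
  components.\<close>

lemma rescaling_of_ratio:
  assumes "z \<in> pos_vectors N" "z' \<in> pos_vectors N"
    and "\<And>j i. (j, i) \<in> F \<Longrightarrow> z' j / lin_form F z' i = z j / lin_form F z i"
  shows "component_rescaling N F z z'"
proof -
  define r :: "nat + nat \<Rightarrow> real" where "r = case_sum (\<lambda>i. lin_form F z' i / lin_form F z i) (\<lambda>j. z' j / z j)"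
  have edge: "r (Inl i) = r (Inr j)" if "(j, i) \<in> F" for j i
    using assms(3)[OF that] pos_vectors_F[OF assms(1) that] pos_vectors_F[OF assms(2) that]
    by (simp add: r_def field_simps)
  have rpos: "0 < r (Inr j)" if "j \<in> {1..N}" for j
    using assms(1,2) that by (auto simp: r_def pos_vectors_def)
  define c :: "(nat + nat) set \<Rightarrow> real" where "c C = r (Inr (SOME j. j \<in> {1..N} \<and> Inr j \<in> C))" for C
  show ?thesis unfolding component_rescaling_def
  proof (intro exI[of _ c] ballI conjI impI)
    fix C assume C: "C \<in> bip_components N F"
    define l where "l = (SOME j. j \<in> {1..N} \<and> Inr j \<in> C)"
    have l: "l \<in> {1..N}" "Inr l \<in> C"
      using someI_ex[of "\<lambda>j. j \<in> {1..N} \<and> Inr j \<in> C"] component_has_right_vertex[OF C]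
      unfolding l_def by blast+
    show "0 < c C" using rpos[OF l(1)] by (simp add: c_def l_def)
    fix j assume j: "j \<in> {1..N}" "Inr j \<in> C"
    have "(Inr l, Inr j) \<in> bip_rel"
      using component_eq_comp(1)[OF C l(2)] j(2) by (simp add: comp_def)
    then have "c C = r (Inr j)" using component_invariant[OF edge] by (simp add: c_def l_def)
    then show "z' j = c C * z j" using pos_vectorsD[OF assms(1) j(1)] by (simp add: r_def)
  qed
qed

lemma G_rescaling:
  assumes "component_rescaling N F z z'" "z \<in> pos_vectors N"
  shows "G z' = G z"
proof -
  obtain a where a: "a \<in> flow_polytope N k F" using positive_flow by blast
  have z': "z' \<in> pos_vectors N" by (rule rescaling_ratio(1)[OF assms])
  have "ln (lin_form F z' i) - ln (z' j) = ln (lin_form F z i) - ln (z j)" if ji: "(j, i) \<in> F" for j i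
  proof -
    have "ln (z' j / lin_form F z' i) = ln (z j / lin_form F z i)"
      using rescaling_ratio(2)[OF assms ji] by simp
    then show ?thesis
      using pos_vectors_F[OF z' ji] pos_vectors_F[OF assms(2) ji] by (simp add: ln_div)
  qed
  then show ?thesis unfolding G_flow[OF a] by (intro sum.cong) auto
qed

text \<open>By \<open>G_edge_bound\<close> with a positive flow, \<open>G z \<le> G 1\<close> bounds \<open>log L\<^sub>i(z) - log z\<^sub>j\<close> on every
  edge, and \<open>path_bound\<close> bounds the variation of \<open>log z\<close> on components. Dividing each component by
  the value of \<open>z\<close> at a root puts \<open>log z\<close> into a fixed compact box.\<close>

lemma G_minimum_exists: "\<exists>z\<in>pos_vectors N. \<forall>z'\<in>pos_vectors N. G z \<le> G z'"
proof -
  obtain a where a: "a \<in> flow_polytope N k F" "\<And>e. e \<in> F \<Longrightarrow> 0 < a e" using positive_flow by blast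
  obtain \<alpha> where \<alpha>: "0 < \<alpha>" "\<And>e. e \<in> F \<Longrightarrow> \<alpha> \<le> a e"
  proof -
    have "0 < Min (insert 1 (a ` F))" using a(2) by (subst Min_gr_iff) auto
    moreover have "Min (insert 1 (a ` F)) \<le> a e" if "e \<in> F" for e using that by (intro Min_le) auto
    ultimately show ?thesis using that by blast
  qed
  define one :: "nat \<Rightarrow> real" where "one = (\<lambda>_. 1)"
  have one: "one \<in> pos_vectors N" by (simp add: one_def pos_vectors_def)
  \<comment> \<open>If \<open>G z \<le> G 1\<close>, then \<open>log L\<^sub>i(z) - log z\<^sub>j \<le> M\<close> on every edge; the summand \<open>1\<close> keeps \<open>M\<close> positive.\<close>
  define M where "M = (\<bar>G one\<bar> + 1) / \<alpha>"
  have M: "0 < M" using \<alpha>(1) by (simp add: M_def add_nonneg_pos)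
  obtain B where B: "B > 0"
    "\<And>(d :: nat + nat \<Rightarrow> nat + nat \<Rightarrow> real) u v. (\<And>v. d v v = 0) \<Longrightarrow> (\<And>u v w. d u w \<le> d u v + d v w) \<Longrightarrow>
      (\<And>u v. (u, v) \<in> bip_adj F \<Longrightarrow> d u v \<le> 1) \<Longrightarrow> (u, v) \<in> bip_rel \<Longrightarrow> d u v \<le> B"
    using path_bound by blast
  let ?K = "Pi\<^sub>E {1..N} (\<lambda>_. {- (B * M)..B * M})"
  have K: "compact ?K" by (intro compact_PiE_box) auto
  have y0: "restrict (\<lambda>_. 0) {1..N} \<in> ?K" using B(1) M by auto
  have coord: "continuous_on ?K (\<lambda>y. y j)" for j
    by (rule continuous_on_subset[OF continuous_on_product_coordinates]) simp
  have ln_cont: "continuous_on ?K (\<lambda>y. ln (\<Sum>j\<in>in_nbrs F i. exp (y j)))" if "i \<in> {1..N}" for i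
  proof (rule continuous_on_ln)
    show "\<forall>y\<in>?K. (\<Sum>j\<in>in_nbrs F i. exp (y j)) \<noteq> 0"
    proof
      fix y :: "nat \<Rightarrow> real"
      have "0 < (\<Sum>j\<in>in_nbrs F i. exp (y j))"
        using in_nbrs_nonempty[OF that] by (intro sum_pos) auto
      then show "(\<Sum>j\<in>in_nbrs F i. exp (y j)) \<noteq> 0" by simp
    qed
  qed (intro continuous_intros coord)
  have cont: "continuous_on ?K (\<lambda>y. G (\<lambda>j. exp (y j)))"
    unfolding G_def lin_form_def ln_exp
    by (intro continuous_on_diff continuous_on_sum continuous_on_mult continuous_on_const ln_cont coord)
  have "?K \<noteq> {}" using y0 by blast
  from continuous_attains_inf[OF K this cont]
  obtain y where y: "y \<in> ?K" "\<And>y'. y' \<in> ?K \<Longrightarrow> G (\<lambda>j. exp (y j)) \<le> G (\<lambda>j. exp (y' j))"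
    by (elim bexE) simp
  have G_cong: "G z = G z'" if "\<And>j. j \<in> {1..N} \<Longrightarrow> z j = z' j" for z z'
    unfolding G_def lin_form_def using that nbrs_range
    by (intro arg_cong2[where f = "(-)"] sum.cong arg_cong2[where f = "(*)"] arg_cong[where f = ln]) auto
  have "G (\<lambda>j. exp (y j)) \<le> G z" if z: "z \<in> pos_vectors N" for z
  proof (cases "G one \<le> G z")
    case True
    have "G (\<lambda>j. exp (y j)) \<le> G (\<lambda>j. exp (restrict (\<lambda>_. 0) {1..N} j))" by (rule y(2)[OF y0])
    also have "\<dots> = G one" by (rule G_cong) (simp add: one_def)
    finally show ?thesis using True by simp
  next
    case False
    \<comment> \<open>A potential on all vertices whose differences along edges are the terms bounded by \<open>M\<close>.\<close>
    define \<Phi> where "\<Phi> = case_sum (\<lambda>i. ln (lin_form F z i)) (\<lambda>j. ln (z j))"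
    define d where "d u v = \<bar>\<Phi> u - \<Phi> v\<bar> / M" for u v
    have edge: "\<bar>\<Phi> (Inl i) - \<Phi> (Inr j)\<bar> \<le> M" if ji: "(j, i) \<in> F" for j i
    proof -
      let ?x = "ln (lin_form F z i) - ln (z j)"
      have x: "0 \<le> ?x" "a (j, i) * ?x \<le> G z" by (rule G_edge_bound[OF a(1) z ji])+
      have "\<alpha> * ?x \<le> a (j, i) * ?x" using \<alpha>(2)[OF ji] x(1) by (rule mult_right_mono)
      also have "\<dots> \<le> \<bar>G one\<bar> + 1" using x(2) False by simp
      finally have "?x \<le> M" using \<alpha>(1) by (simp add: M_def field_simps)
      then show ?thesis using x(1) by (simp add: \<Phi>_def)
    qed
    have bound: "\<bar>\<Phi> u - \<Phi> v\<bar> \<le> B * M" if "(u, v) \<in> bip_rel" for u v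
    proof -
      have "d u v \<le> B"
      proof (rule B(2)[OF _ _ _ that])
        show "d v v = 0" for v by (simp add: d_def)
        show "d u w \<le> d u v + d v w" for u v w
          using M unfolding d_def add_divide_distrib[symmetric] by (intro divide_right_mono) auto
        show "d u v \<le> 1" if "(u, v) \<in> bip_adj F" for u v
        proof -
          have "\<bar>\<Phi> u - \<Phi> v\<bar> \<le> M" using that edge by (auto simp: bip_adj_def abs_minus_commute)
          then show ?thesis using M by (simp add: d_def)
        qed
      qed
      then show ?thesis using M by (simp add: d_def field_simps)
    qed
    define root where "root C = (SOME j. j \<in> {1..N} \<and> Inr j \<in> C)" for C :: "(nat + nat) set"
    have root: "root C \<in> {1..N}" "Inr (root C) \<in> C" if "C \<in> bip_components N F" for C
      using someI_ex[of "\<lambda>j. j \<in> {1..N} \<and> Inr j \<in> C"] component_has_right_vertex[OF that]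
      unfolding root_def by blast+
    define z' where "z' j = 1 / z (root (comp (Inr j))) * z j" for j
    have "component_rescaling N F z z'" unfolding component_rescaling_def
    proof (intro exI[of _ "\<lambda>C. 1 / z (root C)"] ballI conjI impI)
      fix C assume C: "C \<in> bip_components N F"
      show "0 < 1 / z (root C)" using z root(1)[OF C] by (simp add: pos_vectors_def)
      fix j assume "Inr j \<in> C"
      then show "z' j = 1 / z (root C) * z j" using component_eq_comp(1)[OF C] by (simp add: z'_def)
    qed
    then have z': "z' \<in> pos_vectors N" "G z' = G z" using rescaling_ratio(1) G_rescaling z by blast+
    let ?y = "restrict (\<lambda>j. ln (z' j)) {1..N}"
    have "\<bar>ln (z' j)\<bar> \<le> B * M" if j: "j \<in> {1..N}" for j
    proof -
      have C: "comp (Inr j) \<in> bip_components N F" using j by (intro comp_in_components) simp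
      have "(Inr j, Inr (root (comp (Inr j)))) \<in> bip_rel" using root(2)[OF C] by (simp add: comp_def)
      then have "\<bar>ln (z j) - ln (z (root (comp (Inr j))))\<bar> \<le> B * M" using bound by (fastforce simp: \<Phi>_def)
      moreover have "ln (z' j) = ln (z j) - ln (z (root (comp (Inr j))))"
        using pos_vectorsD[OF z j] pos_vectorsD[OF z root(1)[OF C]] by (simp add: z'_def ln_div)
      ultimately show ?thesis by simp
    qed
    then have "- (B * M) \<le> ln (z' j) \<and> ln (z' j) \<le> B * M" if "j \<in> {1..N}" for j
      using that by (simp add: abs_le_iff minus_le_iff)
    then have "?y \<in> ?K" by (intro restrict_PiE_iff[THEN iffD2]) simp
    then have "G (\<lambda>j. exp (y j)) \<le> G (\<lambda>j. exp (?y j))" by (rule y(2))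
    also have "\<dots> = G z'" by (rule G_cong) (use z'(1) in \<open>simp add: pos_vectors_def\<close>)
    finally show ?thesis using z'(2) by simp
  qed
  then show ?thesis by (intro bexI[of _ "\<lambda>j. exp (y j)"]) (auto simp: pos_vectors_def)
qed

lemma cap_minimizer_iff:
  "cap_minimizer N k F z \<longleftrightarrow> z \<in> pos_vectors N \<and> (\<forall>z'\<in>pos_vectors N. G z \<le> G z')"
  and capacity_eq: "cap_minimizer N k F z \<Longrightarrow> 0 < capacity N k F \<and> ln (capacity N k F) = G z"
proof -
  have q_le: "cap_quotient N k F z \<le> cap_quotient N k F z' \<longleftrightarrow> G z \<le> G z'"
    if "z \<in> pos_vectors N" "z' \<in> pos_vectors N" for z z'
    using cap_quotient_pos that by (simp add: ln_cap_quotient[symmetric])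
  have bdd: "bdd_below (cap_quotient N k F ` pos_vectors N)"
    using cap_quotient_pos by (intro bdd_belowI2[of _ 0]) (simp add: less_imp_le)
  show "cap_minimizer N k F z \<longleftrightarrow> z \<in> pos_vectors N \<and> (\<forall>z'\<in>pos_vectors N. G z \<le> G z')"
  proof
    assume z: "cap_minimizer N k F z"
    have "cap_quotient N k F z \<le> cap_quotient N k F z'" if "z' \<in> pos_vectors N" for z'
      using z cINF_lower[OF bdd that] by (simp add: cap_minimizer_def capacity_def)
    moreover have "z \<in> pos_vectors N" using z by (simp add: cap_minimizer_def)
    ultimately show "z \<in> pos_vectors N \<and> (\<forall>z'\<in>pos_vectors N. G z \<le> G z')"
      using q_le by blast
  next
    assume z: "z \<in> pos_vectors N \<and> (\<forall>z'\<in>pos_vectors N. G z \<le> G z')"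
    then have "capacity N k F = cap_quotient N k F z"
      unfolding capacity_def using q_le by (intro cInf_eq_minimum) auto
    then show "cap_minimizer N k F z" using z by (simp add: cap_minimizer_def)
  qed
  show "0 < capacity N k F \<and> ln (capacity N k F) = G z" if "cap_minimizer N k F z"
    using that cap_quotient_pos[of z] ln_cap_quotient[of z] by (simp add: cap_minimizer_def)
qed

lemma cap_minimizer_exists: "\<exists>z. cap_minimizer N k F z"
  using G_minimum_exists by (auto simp: cap_minimizer_iff)

definition gibbs_flow :: "(nat \<Rightarrow> real) \<Rightarrow> nat \<times> nat \<Rightarrow> real" where
  "gibbs_flow z = (\<lambda>(j, i)\<in>F. real (k i) * z j / lin_form F z i)"

lemma gibbs_flow_pos: "z \<in> pos_vectors N \<Longrightarrow> e \<in> F \<Longrightarrow> 0 < gibbs_flow z e"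
  using pos_vectors_F F_range k_pos by (cases e) (auto simp: gibbs_flow_def)

text \<open>The derivative of \<open>G\<close> with respect to one variable vanishes at a minimum.\<close>

lemma minimizer_stationary:
  assumes "cap_minimizer N k F z" "j0 \<in> {1..N}"
  shows "(\<Sum>i\<in>out_nbrs F j0. real (k i) * z j0 / lin_form F z i) = real (k j0)"
proof -
  have z: "z \<in> pos_vectors N" "\<And>z'. z' \<in> pos_vectors N \<Longrightarrow> G z \<le> G z'"
    using assms(1) by (auto simp: cap_minimizer_iff)
  have zj: "0 < z j0" using z(1) assms(2) by (auto simp: pos_vectors_def)
  define c :: "nat \<Rightarrow> real" where "c i = (if j0 \<in> in_nbrs F i then 1 else 0)" for i
  let ?L = "\<lambda>i t. lin_form F z i + c i * (t - z j0)"
  have L: "lin_form F (z(j0 := t)) i = ?L i t" for i t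
  proof (cases "j0 \<in> in_nbrs F i")
    case True
    have "lin_form F (z(j0 := t)) i = t + (\<Sum>j\<in>in_nbrs F i - {j0}. z j)"
      unfolding lin_form_def using True by (subst sum.remove[of _ j0]) (auto intro!: sum.cong)
    moreover have "lin_form F z i = z j0 + (\<Sum>j\<in>in_nbrs F i - {j0}. z j)"
      unfolding lin_form_def using True by (subst sum.remove[of _ j0]) auto
    ultimately show ?thesis using True by (simp add: c_def)
  next
    case False
    then show ?thesis by (auto simp: lin_form_def c_def intro!: sum.cong)
  qed
  let ?g = "\<lambda>t. (\<Sum>i\<in>{1..N}. real (k i) * ln (?L i t)) -
      (real (k j0) * ln t + (\<Sum>j\<in>{1..N} - {j0}. real (k j) * ln (z j)))"
  have Gg: "G (z(j0 := t)) = ?g t" for t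
  proof -
    have "(\<Sum>j\<in>{1..N}. real (k j) * ln ((z(j0 := t)) j)) =
        real (k j0) * ln t + (\<Sum>j\<in>{1..N} - {j0}. real (k j) * ln (z j))"
      using assms(2) by (subst sum.remove[of _ j0]) (auto intro!: sum.cong)
    then show ?thesis by (simp only: G_def L)
  qed
  have Lpos: "0 < ?L i (z j0)" if "i \<in> {1..N}" for i using lin_form_pos[OF z(1) that] by simp
  let ?D = "(\<Sum>i\<in>{1..N}. real (k i) * (c i / lin_form F z i)) - real (k j0) / z j0"
  have "((\<lambda>t. real (k i) * ln (?L i t)) has_real_derivative real (k i) * (c i / lin_form F z i)) (at (z j0))"
    if "i \<in> {1..N}" for i
    using Lpos[OF that] by (auto intro!: derivative_eq_intros simp: divide_inverse)
  then have "((\<lambda>t. \<Sum>i\<in>{1..N}. real (k i) * ln (?L i t)) has_real_derivative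
      (\<Sum>i\<in>{1..N}. real (k i) * (c i / lin_form F z i))) (at (z j0))"
    by (rule DERIV_sum)
  moreover have "((\<lambda>t. real (k j0) * ln t + (\<Sum>j\<in>{1..N} - {j0}. real (k j) * ln (z j)))
      has_real_derivative real (k j0) / z j0) (at (z j0))"
    using zj by (auto intro!: derivative_eq_intros simp: divide_inverse)
  ultimately have "(?g has_real_derivative ?D) (at (z j0))"
    by (rule DERIV_diff)
  moreover have "\<forall>t. \<bar>z j0 - t\<bar> < z j0 \<longrightarrow> ?g (z j0) \<le> ?g t"
  proof (intro allI impI)
    fix t assume "\<bar>z j0 - t\<bar> < z j0"
    then have "z(j0 := t) \<in> pos_vectors N" using z(1) by (auto simp: pos_vectors_def)
    then have "G (z(j0 := z j0)) \<le> G (z(j0 := t))" using z(2) by simp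
    then show "?g (z j0) \<le> ?g t" unfolding Gg .
  qed
  ultimately have "?D = 0" using zj by (intro DERIV_local_min)
  moreover have "(\<Sum>i\<in>{1..N}. real (k i) * (c i / lin_form F z i)) =
      (\<Sum>i\<in>out_nbrs F j0. real (k i) / lin_form F z i)"
    using F_range by (intro sum.mono_neutral_cong_right) (auto simp: out_nbrs_def in_nbrs_def c_def)
  ultimately have "(\<Sum>i\<in>out_nbrs F j0. real (k i) / lin_form F z i) * z j0 = real (k j0)"
    using zj by (simp add: field_simps)
  then show ?thesis by (simp add: sum_distrib_right)
qed

lemma gibbs_flow_in_polytope:
  assumes "cap_minimizer N k F z"
  shows "gibbs_flow z \<in> flow_polytope N k F"
proof -
  have z: "z \<in> pos_vectors N" using assms by (simp add: cap_minimizer_def)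
  have "(\<Sum>j\<in>in_nbrs F i. gibbs_flow z (j, i)) = real (k i)" if i: "i \<in> {1..N}" for i
  proof -
    have "(\<Sum>j\<in>in_nbrs F i. gibbs_flow z (j, i)) = (\<Sum>j\<in>in_nbrs F i. real (k i) / lin_form F z i * z j)"
      by (intro sum.cong) (auto simp: gibbs_flow_def in_nbrs_def)
    also have "\<dots> = real (k i) / lin_form F z i * lin_form F z i"
      by (simp add: lin_form_def sum_distrib_left)
    finally show ?thesis using lin_form_pos[OF z i] by simp
  qed
  moreover have "(\<Sum>i\<in>out_nbrs F j. gibbs_flow z (j, i)) = real (k j)" if j: "j \<in> {1..N}" for j
  proof -
    have "(\<Sum>i\<in>out_nbrs F j. gibbs_flow z (j, i)) = (\<Sum>i\<in>out_nbrs F j. real (k i) * z j / lin_form F z i)"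
      by (intro sum.cong) (auto simp: gibbs_flow_def out_nbrs_def)
    then show ?thesis using minimizer_stationary[OF assms j] by simp
  qed
  ultimately show ?thesis
    using gibbs_flow_pos[OF z] by (auto simp: flow_polytope_def gibbs_flow_def less_imp_le)
qed

text \<open>This is \<open>log t \<le> t - 1\<close> at \<open>t = y/x\<close>, with its equality case.\<close>

lemma x_ln_ratio_ge:
  fixes x y :: real
  assumes "0 \<le> x" "0 < y"
  shows "0 \<le> x * (ln x - ln y) - x + y" "x * (ln x - ln y) - x + y = 0 \<Longrightarrow> x = y"
proof -
  have *: "0 \<le> x * (ln x - ln y) - x + y \<and> (x * (ln x - ln y) - x + y = 0 \<longrightarrow> x = y)"
  proof (cases "x = 0")
    case False
    then have x: "0 < x" using assms by simp
    have e: "x * (ln x - ln y) - x + y = x * ((y / x - 1) - ln (y / x))"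
      using x assms(2) by (simp add: ln_div field_simps)
    have le: "ln (y / x) \<le> y / x - 1" using x assms(2) by (intro ln_le_minus_one) simp
    have eq: "x = y" if "x * ((y / x - 1) - ln (y / x)) = 0"
    proof -
      have "ln (y / x) = y / x - 1" using that x by simp
      then have "y / x = 1" using ln_eq_minus_one[of "y / x"] x assms(2) by simp
      then show ?thesis using x by simp
    qed
    have "0 \<le> x * ((y / x - 1) - ln (y / x))" using le x by simp
    then show ?thesis unfolding e using eq by blast
  qed (use assms in auto)
  then show "0 \<le> x * (ln x - ln y) - x + y" "x * (ln x - ln y) - x + y = 0 \<Longrightarrow> x = y" by blast+
qed

text \<open>The terms \<open>- p/k + z/L\<close> are free to insert: weighted by \<open>k i\<close> they sum to zero over each
  row. They complete every summand to the nonnegative expression of \<open>x_ln_ratio_ge\<close>.\<close>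

lemma G_minus_entropy:
  assumes "p \<in> flow_polytope N k F" "z \<in> pos_vectors N"
  shows "G z - flow_entropy N k F p = (\<Sum>(j, i)\<in>F. real (k i) *
    (p (j, i) / k i * (ln (p (j, i) / k i) - ln (z j / lin_form F z i)) - p (j, i) / k i + z j / lin_form F z i))"
proof -
  have "flow_entropy N k F p = (\<Sum>i\<in>{1..N}. \<Sum>j\<in>in_nbrs F i. - (p (j, i) * ln (p (j, i) / k i)))"
    unfolding flow_entropy_def
  proof (intro sum.cong refl)
    fix i assume i: "i \<in> {1..N}"
    have "row_entropy k F p i = - (\<Sum>j\<in>in_nbrs F i. p (j, i) / k i * ln (p (j, i) / k i))"
      unfolding row_entropy_def by (intro arg_cong[where f = uminus] sum.cong) (auto simp: flow_row_def in_nbrs_def)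
    then show "real (k i) * row_entropy k F p i = (\<Sum>j\<in>in_nbrs F i. - (p (j, i) * ln (p (j, i) / k i)))"
      using k_pos[OF i] by (simp add: sum_negf sum_distrib_left)
  qed
  also have "\<dots> = (\<Sum>(j, i)\<in>F. - (p (j, i) * ln (p (j, i) / k i)))" by (rule sum_in_nbrs)
  finally have ent: "flow_entropy N k F p = (\<Sum>(j, i)\<in>F. - (p (j, i) * ln (p (j, i) / k i)))" .
  have "(\<Sum>(j, i)\<in>F. real (k i) * (z j / lin_form F z i - p (j, i) / k i)) =
      (\<Sum>i\<in>{1..N}. \<Sum>j\<in>in_nbrs F i. real (k i) * (z j / lin_form F z i - p (j, i) / k i))"
    by (rule sum_in_nbrs[symmetric])
  also have "\<dots> = (\<Sum>i\<in>{1..N}. 0)"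
  proof (intro sum.cong refl)
    fix i assume i: "i \<in> {1..N}"
    have "(\<Sum>j\<in>in_nbrs F i. real (k i) * (z j / lin_form F z i - p (j, i) / k i)) =
        real (k i) * ((\<Sum>j\<in>in_nbrs F i. z j) / lin_form F z i - (\<Sum>j\<in>in_nbrs F i. p (j, i)) / k i)"
      by (simp only: sum_distrib_left[symmetric] sum_subtractf sum_divide_distrib)
    also have "\<dots> = 0"
      using assms(1) i k_pos[OF i] lin_form_pos[OF assms(2) i]
      by (simp add: flow_polytope_def lin_form_def[symmetric])
    finally show "(\<Sum>j\<in>in_nbrs F i. real (k i) * (z j / lin_form F z i - p (j, i) / k i)) = 0" .
  qed
  finally have zero: "(\<Sum>(j, i)\<in>F. real (k i) * (z j / lin_form F z i - p (j, i) / k i)) = 0" by simp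
  have "G z - flow_entropy N k F p = G z - flow_entropy N k F p +
      (\<Sum>(j, i)\<in>F. real (k i) * (z j / lin_form F z i - p (j, i) / k i))" by (simp add: zero)
  also have "\<dots> = (\<Sum>e\<in>F. (case e of (j, i) \<Rightarrow> p (j, i) * (ln (lin_form F z i) - ln (z j))) -
      (case e of (j, i) \<Rightarrow> - (p (j, i) * ln (p (j, i) / k i))) +
      (case e of (j, i) \<Rightarrow> real (k i) * (z j / lin_form F z i - p (j, i) / k i)))"
    unfolding G_flow[OF assms(1)] ent by (simp only: sum.distrib sum_subtractf)
  also have "\<dots> = (\<Sum>(j, i)\<in>F. real (k i) *
    (p (j, i) / k i * (ln (p (j, i) / k i) - ln (z j / lin_form F z i)) - p (j, i) / k i + z j / lin_form F z i))"
  proof (intro sum.cong refl)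
    fix e assume e: "e \<in> F"
    obtain j i where ji: "e = (j, i)" by (cases e)
    have ki: "0 < k i" using F_range[of j i] e ji k_pos by simp
    have l: "ln (z j / lin_form F z i) = ln (z j) - ln (lin_form F z i)"
      using pos_vectors_F[OF assms(2), of j i] e ji by (simp add: ln_div)
    show "(case e of (j, i) \<Rightarrow> p (j, i) * (ln (lin_form F z i) - ln (z j))) -
      (case e of (j, i) \<Rightarrow> - (p (j, i) * ln (p (j, i) / k i))) +
      (case e of (j, i) \<Rightarrow> real (k i) * (z j / lin_form F z i - p (j, i) / k i)) =
      (case e of (j, i) \<Rightarrow> real (k i) *
    (p (j, i) / k i * (ln (p (j, i) / k i) - ln (z j / lin_form F z i)) - p (j, i) / k i + z j / lin_form F z i))"
      unfolding ji prod.case l using ki by (simp add: field_simps)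
  qed
  finally show ?thesis .
qed

lemma entropy_gap:
  assumes "p \<in> flow_polytope N k F" "z \<in> pos_vectors N"
  shows "flow_entropy N k F p \<le> G z" "flow_entropy N k F p = G z \<Longrightarrow> p = gibbs_flow z"
proof -
  let ?t = "\<lambda>e. case e of (j, i) \<Rightarrow> real (k i) *
    (p (j, i) / k i * (ln (p (j, i) / k i) - ln (z j / lin_form F z i)) - p (j, i) / k i + z j / lin_form F z i)"
  have key: "0 \<le> ?t (j, i) \<and> (?t (j, i) = 0 \<longrightarrow> p (j, i) = gibbs_flow z (j, i))" if ji: "(j, i) \<in> F" for j i
  proof -
    have ki: "0 < k i" using F_range[OF ji] k_pos by simp
    have "0 \<le> p (j, i)"
      using assms(1) PiE_mem[OF _ ji, of p "\<lambda>_. {0..}"] by (simp add: flow_polytope_def)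
    then have x: "0 \<le> p (j, i) / k i" by simp
    have y: "0 < z j / lin_form F z i" using pos_vectors_F[OF assms(2) ji] by simp
    show ?thesis using x_ln_ratio_ge[OF x y] ki ji by (auto simp: gibbs_flow_def field_simps)
  qed
  then have nn: "0 \<le> ?t e" if "e \<in> F" for e using that by (cases e) blast
  show "flow_entropy N k F p \<le> G z"
    using G_minus_entropy[OF assms] sum_nonneg[of F ?t, OF nn] by simp
  assume "flow_entropy N k F p = G z"
  then have "(\<Sum>e\<in>F. ?t e) = 0" using G_minus_entropy[OF assms] by simp
  moreover have "(\<Sum>e\<in>F. ?t e) = 0 \<longleftrightarrow> (\<forall>e\<in>F. ?t e = 0)"
    by (rule sum_nonneg_eq_0_iff[OF finite_F]) (rule nn)
  ultimately have zero: "\<forall>e\<in>F. ?t e = 0" by blast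
  show "p = gibbs_flow z"
  proof (rule extensionalityI[of _ F])
    fix e assume "e \<in> F"
    then show "p e = gibbs_flow z e" using key zero by (cases e) blast
  qed (use assms(1) in \<open>auto simp: flow_polytope_def gibbs_flow_def PiE_def\<close>)
qed

lemma gibbs_flow_entropy:
  assumes "cap_minimizer N k F z"
  shows "flow_entropy N k F (gibbs_flow z) = G z"
proof -
  have z: "z \<in> pos_vectors N" using assms by (simp add: cap_minimizer_def)
  have "G z - flow_entropy N k F (gibbs_flow z) = 0"
    unfolding G_minus_entropy[OF gibbs_flow_in_polytope[OF assms] z]
  proof (intro sum.neutral ballI)
    fix e assume e: "e \<in> F"
    obtain j i where ji: "e = (j, i)" by (cases e)
    have "0 < k i" using F_range[of j i] e ji k_pos by simp
    then have "gibbs_flow z (j, i) / k i = z j / lin_form F z i"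
      using e ji by (simp add: gibbs_flow_def)
    then show "(case e of (j, i) \<Rightarrow> real (k i) * (gibbs_flow z (j, i) / k i *
      (ln (gibbs_flow z (j, i) / k i) - ln (z j / lin_form F z i)) - gibbs_flow z (j, i) / k i + z j / lin_form F z i)) = 0"
      by (simp add: ji)
  qed
  then show ?thesis by simp
qed

lemma gibbs_flow_unique:
  assumes "cap_minimizer N k F z" "cap_minimizer N k F z'"
  shows "gibbs_flow z' = gibbs_flow z"
proof -
  have "G z = G z'" using capacity_eq[OF assms(1)] capacity_eq[OF assms(2)] by simp
  then show ?thesis
    using entropy_gap(2)[OF gibbs_flow_in_polytope[OF assms(2)], of z] gibbs_flow_entropy[OF assms(2)] assms(1)
    by (simp add: cap_minimizer_def)
qed

lemma minimizer_iff_rescaling: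
  assumes "cap_minimizer N k F z"
  shows "cap_minimizer N k F z' \<longleftrightarrow> component_rescaling N F z z'"
proof
  have z: "z \<in> pos_vectors N" using assms by (simp add: cap_minimizer_def)
  {
    assume z': "cap_minimizer N k F z'"
    show "component_rescaling N F z z'"
    proof (rule rescaling_of_ratio[OF z])
      show "z' \<in> pos_vectors N" using z' by (simp add: cap_minimizer_def)
      fix j i assume ji: "(j, i) \<in> F"
      have "gibbs_flow z' (j, i) = gibbs_flow z (j, i)" by (simp add: gibbs_flow_unique[OF assms z'])
      then show "z' j / lin_form F z' i = z j / lin_form F z i"
        using ji k_pos[of i] F_range[OF ji]
        by (simp add: gibbs_flow_def times_divide_eq_right[symmetric] del: times_divide_eq_right)
    qed
  next
    assume r: "component_rescaling N F z z'"
    show "cap_minimizer N k F z'"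
      using assms rescaling_ratio(1)[OF r z] G_rescaling[OF r z] by (simp add: cap_minimizer_iff)
  }
qed

theorem maximum_entropy_duality:
  assumes "cap_minimizer N k F z"
  shows "is_arg_max (flow_entropy N k F) (\<lambda>a. a \<in> flow_polytope N k F) p \<longleftrightarrow> p = gibbs_flow z"
    "ln (capacity N k F) = flow_entropy N k F (gibbs_flow z)"
proof -
  have z: "z \<in> pos_vectors N" using assms by (simp add: cap_minimizer_def)
  show "ln (capacity N k F) = flow_entropy N k F (gibbs_flow z)"
    using capacity_eq[OF assms] gibbs_flow_entropy[OF assms] by simp
  show "is_arg_max (flow_entropy N k F) (\<lambda>a. a \<in> flow_polytope N k F) p \<longleftrightarrow> p = gibbs_flow z"
  proof
    assume p: "is_arg_max (flow_entropy N k F) (\<lambda>a. a \<in> flow_polytope N k F) p"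
    then have pT: "p \<in> flow_polytope N k F" by (simp add: is_arg_max_def)
    have "\<not> flow_entropy N k F p < flow_entropy N k F (gibbs_flow z)"
      using p gibbs_flow_in_polytope[OF assms] by (auto simp: is_arg_max_def)
    then have "flow_entropy N k F p = G z"
      using entropy_gap(1)[OF pT z] gibbs_flow_entropy[OF assms] by simp
    then show "p = gibbs_flow z" by (rule entropy_gap(2)[OF pT z])
  next
    assume "p = gibbs_flow z"
    then show "is_arg_max (flow_entropy N k F) (\<lambda>a. a \<in> flow_polytope N k F) p"
      using gibbs_flow_in_polytope[OF assms] entropy_gap(1)[OF _ z] gibbs_flow_entropy[OF assms]
      by (auto simp: is_arg_max_def not_less)
  qed
qed

end

section \<open>Gaussian integrals and the Laplace principle on finite products\<close>

interpretation lborel_product: product_sigma_finite "\<lambda>_. lborel :: real measure"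
  by (rule product_sigma_finite.intro) (rule sigma_finite_lborel)

lemma emeasure_lborel_vimage_scale:
  fixes c :: real
  assumes "c > 0" "A \<in> sets borel"
  shows "emeasure lborel ((*) c -` A) = ennreal (inverse c) * emeasure lborel A"
proof -
  have "emeasure lborel ((*) c -` A) = emeasure (distr lborel borel ((*) c)) A"
    using assms(2) by (subst emeasure_distr) auto
  also have "\<dots> = ennreal (inverse c) * emeasure lborel A"
    using assms by (subst lborel_distr_mult) (auto simp: emeasure_density nn_integral_cmult_indicator)
  finally show ?thesis .
qed

text \<open>A product measure is determined by its boxes.\<close>

lemma PiM_lborel_scale:
  fixes c :: real
  assumes S: "finite S" and c: "c > 0"
  shows "density (distr (Pi\<^sub>M S (\<lambda>_. lborel)) (Pi\<^sub>M S (\<lambda>_. lborel)) (\<lambda>\<theta>. \<lambda>i\<in>S. c * \<theta> i))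
    (\<lambda>_. ennreal (c ^ card S)) = Pi\<^sub>M S (\<lambda>_. lborel)" (is "?P = ?M")
proof (rule lborel_product.PiM_eqI[OF S])
  show "sets ?P = sets ?M" by simp
  fix A :: "'a \<Rightarrow> real set" assume A: "\<And>i. i \<in> S \<Longrightarrow> A i \<in> sets lborel"
  have meas: "(\<lambda>\<theta>. \<lambda>i\<in>S. c * \<theta> i) \<in> measurable ?M ?M" by measurable
  have box: "Pi\<^sub>E S A \<in> sets ?M" using S A by (intro sets_PiM_I_finite) auto
  have "emeasure ?P (Pi\<^sub>E S A) = ennreal (c ^ card S) * emeasure (distr ?M ?M (\<lambda>\<theta>. \<lambda>i\<in>S. c * \<theta> i)) (Pi\<^sub>E S A)"
    using box by (subst emeasure_density) (auto simp: nn_integral_cmult_indicator)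
  also have "emeasure (distr ?M ?M (\<lambda>\<theta>. \<lambda>i\<in>S. c * \<theta> i)) (Pi\<^sub>E S A) =
      emeasure ?M ((\<lambda>\<theta>. \<lambda>i\<in>S. c * \<theta> i) -` Pi\<^sub>E S A \<inter> space ?M)"
    by (rule emeasure_distr[OF meas box])
  also have "(\<lambda>\<theta>. \<lambda>i\<in>S. c * \<theta> i) -` Pi\<^sub>E S A \<inter> space ?M = Pi\<^sub>E S (\<lambda>i. (*) c -` A i)"
    by (auto simp: space_PiM PiE_iff)
  also have "emeasure ?M \<dots> = (\<Prod>i\<in>S. emeasure lborel ((*) c -` A i))"
    using S A by (intro lborel_product.emeasure_PiM) (auto intro!: measurable_sets_borel[of "(*) c" borel])
  also have "\<dots> = (\<Prod>i\<in>S. ennreal (inverse c) * emeasure lborel (A i))"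
    using A c by (intro prod.cong refl emeasure_lborel_vimage_scale) auto
  also have "\<dots> = ennreal (inverse c ^ card S) * (\<Prod>i\<in>S. emeasure lborel (A i))"
    using c by (simp add: prod.distrib ennreal_power)
  also have "ennreal (c ^ card S) * (ennreal (inverse c ^ card S) * (\<Prod>i\<in>S. emeasure lborel (A i))) =
      (\<Prod>i\<in>S. emeasure lborel (A i))"
    using c by (simp add: mult.assoc[symmetric] ennreal_mult[symmetric] power_mult_distrib[symmetric])
  finally show "emeasure ?P (Pi\<^sub>E S A) = (\<Prod>i\<in>S. emeasure lborel (A i))" .
qed

lemma integral_PiM_scale:
  fixes f :: "('i \<Rightarrow> real) \<Rightarrow> 'b :: {banach, second_countable_topology}"
  assumes S: "finite S" and c: "c > 0" and f: "f \<in> borel_measurable (Pi\<^sub>M S (\<lambda>_. lborel))"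
  shows "(\<integral>\<theta>. f \<theta> \<partial>Pi\<^sub>M S (\<lambda>_. lborel)) =
    (c ^ card S) *\<^sub>R (\<integral>\<theta>. f (\<lambda>i\<in>S. c * \<theta> i) \<partial>Pi\<^sub>M S (\<lambda>_. lborel))"
proof -
  let ?M = "Pi\<^sub>M S (\<lambda>_. lborel)"
  have meas: "(\<lambda>\<theta>. \<lambda>i\<in>S. c * \<theta> i) \<in> measurable ?M ?M" by measurable
  have "(\<integral>\<theta>. f \<theta> \<partial>?M) = (\<integral>\<theta>. f \<theta> \<partial>density (distr ?M ?M (\<lambda>\<theta>. \<lambda>i\<in>S. c * \<theta> i)) (\<lambda>_. ennreal (c ^ card S)))"
    by (simp only: PiM_lborel_scale[OF S c])
  also have "\<dots> = (\<integral>\<theta>. (c ^ card S) *\<^sub>R f \<theta> \<partial>distr ?M ?M (\<lambda>\<theta>. \<lambda>i\<in>S. c * \<theta> i))"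
    using c f by (intro integral_density) auto
  also have "\<dots> = (\<integral>\<theta>. (c ^ card S) *\<^sub>R f (\<lambda>i\<in>S. c * \<theta> i) \<partial>?M)"
    using f by (intro integral_distr[OF meas]) auto
  finally show ?thesis by simp
qed

lemma nn_integral_gaussian_1d:
  fixes \<alpha> \<mu> :: real
  assumes "\<alpha> > 0"
  shows "(\<integral>\<^sup>+y. ennreal (exp (- (\<alpha> * (y + \<mu>)\<^sup>2) / 2)) \<partial>lborel) = ennreal (sqrt (2 * pi) / sqrt \<alpha>)"
proof -
  define \<sigma> where "\<sigma> = 1 / sqrt \<alpha>"
  have \<sigma>: "\<sigma> > 0" "\<sigma>\<^sup>2 = 1 / \<alpha>" using assms by (auto simp: \<sigma>_def power_divide)
  have c: "sqrt (2 * pi * \<sigma>\<^sup>2) = sqrt (2 * pi) / sqrt \<alpha>"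
    by (simp add: \<sigma>(2) real_sqrt_mult[symmetric] real_sqrt_divide[symmetric])
  have "exp (- (\<alpha> * (y + \<mu>)\<^sup>2) / 2) = sqrt (2 * pi) / sqrt \<alpha> * normal_density (- \<mu>) \<sigma> y" for y
    unfolding normal_density_def c using assms by (simp add: \<sigma>(2) field_simps)
  then have "(\<integral>\<^sup>+y. ennreal (exp (- (\<alpha> * (y + \<mu>)\<^sup>2) / 2)) \<partial>lborel) =
      (\<integral>\<^sup>+y. ennreal (sqrt (2 * pi) / sqrt \<alpha>) * ennreal (normal_density (- \<mu>) \<sigma> y) \<partial>lborel)"
    using assms by (intro nn_integral_cong) (simp add: ennreal_mult'[symmetric])
  also have "\<dots> = ennreal (sqrt (2 * pi) / sqrt \<alpha>) * (\<integral>\<^sup>+y. ennreal (normal_density (- \<mu>) \<sigma> y) \<partial>lborel)"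
    by (rule nn_integral_cmult) simp
  also have "(\<integral>\<^sup>+y. ennreal (normal_density (- \<mu>) \<sigma> y) \<partial>lborel) = 1"
    using \<sigma>(1) by (subst nn_integral_eq_integral) auto
  finally show ?thesis by simp
qed

definition list_mat :: "('i \<Rightarrow> 'i \<Rightarrow> real) \<Rightarrow> 'i list \<Rightarrow> real Matrix.mat" where
  "list_mat A xs = Matrix.mat (length xs) (length xs) (\<lambda>(a, b). A (xs ! a) (xs ! b))"

definition quad_form :: "('i \<Rightarrow> 'i \<Rightarrow> real) \<Rightarrow> 'i set \<Rightarrow> ('i \<Rightarrow> real) \<Rightarrow> real" where
  "quad_form A S v = (\<Sum>a\<in>S. \<Sum>b\<in>S. v a * A a b * v b)"

text \<open>Gaussian elimination of the first row and column leaves the Schur complement of the pivot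
  \<open>A x x\<close>.\<close>

lemma det_list_mat_Cons:
  assumes "A x x \<noteq> 0"
  shows "Determinant.det (list_mat A (x # xs)) =
    A x x * Determinant.det (list_mat (\<lambda>a b. A a b - A a x * A x b / A x x) xs)"
proof -
  let ?n = "length xs"
  let ?B = "list_mat (\<lambda>a b. A a b - A a x * A x b / A x x) xs"
  let ?c = "Matrix.mat ?n 1 (\<lambda>(a, b). A (xs ! a) x / A x x)"
  let ?r = "Matrix.mat 1 ?n (\<lambda>(a, b). A x (xs ! b))"
  let ?a = "Matrix.mat 1 1 (\<lambda>_. A x x)"
  let ?L = "four_block_mat (1\<^sub>m 1) (0\<^sub>m 1 ?n) ?c (1\<^sub>m ?n)"
  let ?U = "four_block_mat ?a ?r (0\<^sub>m ?n 1) ?B"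
  have B: "?B \<in> carrier_mat ?n ?n" by (simp add: list_mat_def)
  have "?L * ?U = four_block_mat (1\<^sub>m 1 * ?a + 0\<^sub>m 1 ?n * 0\<^sub>m ?n 1) (1\<^sub>m 1 * ?r + 0\<^sub>m 1 ?n * ?B)
      (?c * ?a + 1\<^sub>m ?n * 0\<^sub>m ?n 1) (?c * ?r + 1\<^sub>m ?n * ?B)"
    by (rule mult_four_block_mat[of _ 1 1 _ ?n _ ?n _ _ 1 _ ?n]) (use B in auto)
  also have "\<dots> = list_mat A (x # xs)"
  proof (rule eq_matI)
    fix a b assume "a < dim_row (list_mat A (x # xs))" "b < dim_col (list_mat A (x # xs))"
    then have ab: "a < Suc ?n" "b < Suc ?n" by (auto simp: list_mat_def)
    show "four_block_mat (1\<^sub>m 1 * ?a + 0\<^sub>m 1 ?n * 0\<^sub>m ?n 1) (1\<^sub>m 1 * ?r + 0\<^sub>m 1 ?n * ?B)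
      (?c * ?a + 1\<^sub>m ?n * 0\<^sub>m ?n 1) (?c * ?r + 1\<^sub>m ?n * ?B) $$ (a, b) = list_mat A (x # xs) $$ (a, b)"
      using ab B assms by (cases a; cases b) (auto simp: list_mat_def scalar_prod_def)
  qed (use B in \<open>auto simp: list_mat_def\<close>)
  finally have LU: "?L * ?U = list_mat A (x # xs)" .
  have L: "?L \<in> carrier_mat (1 + ?n) (1 + ?n)" by (rule four_block_carrier_mat) auto
  have U: "?U \<in> carrier_mat (1 + ?n) (1 + ?n)" by (rule four_block_carrier_mat) (use B in auto)
  have "Determinant.det (list_mat A (x # xs)) = Determinant.det ?L * Determinant.det ?U"
    unfolding LU[symmetric] by (rule det_mult[OF L U])
  also have "Determinant.det ?L = 1"
    by (subst det_four_block_mat_upper_right_zero[of _ 1 _ ?n]) auto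
  also have "Determinant.det ?U = Determinant.det ?a * Determinant.det ?B"
    by (rule det_four_block_mat_lower_left_zero[of _ 1 _ ?n]) (use B in auto)
  also have "Determinant.det ?a = A x x" by (simp add: det_single)
  finally show ?thesis by simp
qed

text \<open>Completing the square in the variable \<open>x\<close>; the remainder is the form of the Schur
  complement.\<close>

lemma quad_form_insert:
  assumes "finite S" "x \<notin> S" "A x x \<noteq> 0" "\<And>a. a \<in> S \<Longrightarrow> A a x = A x a"
  shows "quad_form A (insert x S) v = A x x * (v x + (\<Sum>b\<in>S. A x b * v b) / A x x)\<^sup>2 +
    quad_form (\<lambda>a b. A a b - A a x * A x b / A x x) S v"
proof -
  define m where "m = (\<Sum>b\<in>S. A x b * v b)"
  have 1: "(\<Sum>b\<in>S. v x * A x b * v b) = v x * m" by (simp add: m_def sum_distrib_left mult.assoc)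
  have 2: "(\<Sum>a\<in>S. v a * A a x * v x) = v x * m"
    using assms(4) by (simp add: m_def sum_distrib_left mult.commute mult.left_commute)
  have "quad_form A (insert x S) v = v x * A x x * v x + v x * m + (v x * m + quad_form A S v)"
    using assms(1,2) by (simp add: quad_form_def sum.distrib 1 2)
  then have "quad_form A (insert x S) v = A x x * (v x)\<^sup>2 + v x * m + (v x * m + quad_form A S v)"
    by (simp add: power2_eq_square mult.commute mult.left_commute)
  moreover have "quad_form (\<lambda>a b. A a b - A a x * A x b / A x x) S v = quad_form A S v - m\<^sup>2 / A x x"
  proof -
    have "(\<Sum>a\<in>S. \<Sum>b\<in>S. v a * (A a x * A x b / A x x) * v b) = (\<Sum>a\<in>S. \<Sum>b\<in>S. (A x a * v a) * (A x b * v b) / A x x)"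
      using assms(4) by (intro sum.cong) (auto simp: mult.commute mult.left_commute)
    also have "\<dots> = m * m / A x x"
      by (simp add: m_def sum_product sum_divide_distrib)
    finally have e: "(\<Sum>a\<in>S. \<Sum>b\<in>S. v a * (A a x * A x b / A x x) * v b) = m * m / A x x" .
    have "quad_form (\<lambda>a b. A a b - A a x * A x b / A x x) S v =
        quad_form A S v - (\<Sum>a\<in>S. \<Sum>b\<in>S. v a * (A a x * A x b / A x x) * v b)"
      by (simp add: quad_form_def sum_subtractf[symmetric] right_diff_distrib left_diff_distrib)
    then show ?thesis by (simp only: e power2_eq_square)
  qed
  moreover have "A x x * (v x + m / A x x)\<^sup>2 = A x x * (v x)\<^sup>2 + 2 * (v x * m) + m\<^sup>2 / A x x"
    using assms(3) by (simp add: power2_eq_square field_simps)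
  ultimately show ?thesis by (simp add: m_def)
qed

lemma quad_form_measurable [measurable]:
  assumes "finite S"
  shows "quad_form A S \<in> borel_measurable (Pi\<^sub>M S (\<lambda>_. lborel))"
  unfolding quad_form_def by measurable

text \<open>Integrating out one variable contributes \<open>\<surd>(2\<pi>/A x x)\<close> and leaves the Schur complement,
  whose determinant is smaller by the factor \<open>A x x\<close>; see \<open>quad_form_insert\<close> and
  \<open>det_list_mat_Cons\<close>.\<close>

theorem nn_integral_gaussian:
  assumes "distinct xs" "\<And>a b. A a b = A b a"
    and "\<And>v. (\<exists>a\<in>set xs. v a \<noteq> 0) \<Longrightarrow> 0 < quad_form A (set xs) v"
  shows "0 < Determinant.det (list_mat A xs) \<and>
    (\<integral>\<^sup>+\<theta>. ennreal (exp (- quad_form A (set xs) \<theta> / 2)) \<partial>Pi\<^sub>M (set xs) (\<lambda>_. lborel)) =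
      ennreal (sqrt (2 * pi) ^ length xs / sqrt (Determinant.det (list_mat A xs)))"
  using assms
proof (induction xs arbitrary: A)
  case Nil
  have "Determinant.det (list_mat A []) = 1" by (simp add: list_mat_def det_dim_zero)
  then show ?case
    by (simp add: quad_form_def nn_integral_const emeasure_space PiM_empty)
next
  case (Cons x xs)
  let ?S = "set xs" and ?\<alpha> = "A x x"
  let ?A = "\<lambda>a b. A a b - A a x * A x b / A x x"
  have x: "x \<notin> ?S" "distinct xs" using Cons.prems(1) by auto
  have \<alpha>: "0 < ?\<alpha>"
  proof -
    let ?v = "\<lambda>a. if a = x then 1 else 0 :: real"
    have "0 < quad_form A (set (x # xs)) ?v" by (rule Cons.prems(3)) auto
    also have "\<dots> = ?\<alpha>"
      by (simp add: quad_form_def if_distrib[of "\<lambda>c. c * _"] if_distrib[of "\<lambda>c. _ * c"] cong: if_cong)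
    finally show ?thesis .
  qed
  have ins: "quad_form A (insert x ?S) v = ?\<alpha> * (v x + (\<Sum>b\<in>?S. A x b * v b) / ?\<alpha>)\<^sup>2 + quad_form ?A ?S v" for v
    using x \<alpha> Cons.prems(2) by (intro quad_form_insert) auto
  have pos: "0 < quad_form ?A ?S v" if v: "\<exists>a\<in>?S. v a \<noteq> 0" for v
  proof -
    let ?w = "v(x := - (\<Sum>b\<in>?S. A x b * v b) / ?\<alpha>)"
    have "\<exists>a\<in>set (x # xs). ?w a \<noteq> 0" using v x by auto
    then have "0 < quad_form A (insert x ?S) ?w" using Cons.prems(3)[of ?w] by (simp only: list.set)
    also have "\<dots> = quad_form ?A ?S ?w"
    proof -
      have "(\<Sum>b\<in>?S. A x b * ?w b) = (\<Sum>b\<in>?S. A x b * v b)" using x by (intro sum.cong) auto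
      then show ?thesis unfolding ins by simp
    qed
    also have "\<dots> = quad_form ?A ?S v"
      unfolding quad_form_def using x by (intro sum.cong) auto
    finally show ?thesis .
  qed
  have IH: "0 < Determinant.det (list_mat ?A xs)"
    "(\<integral>\<^sup>+\<theta>. ennreal (exp (- quad_form ?A ?S \<theta> / 2)) \<partial>Pi\<^sub>M ?S (\<lambda>_. lborel)) =
      ennreal (sqrt (2 * pi) ^ length xs / sqrt (Determinant.det (list_mat ?A xs)))"
    using Cons.IH[OF x(2), of ?A] pos Cons.prems(2) by (auto simp: mult.commute)
  have det: "Determinant.det (list_mat A (x # xs)) = ?\<alpha> * Determinant.det (list_mat ?A xs)"
    using \<alpha> by (intro det_list_mat_Cons) simp
  have "(\<integral>\<^sup>+\<theta>. ennreal (exp (- quad_form A (insert x ?S) \<theta> / 2)) \<partial>Pi\<^sub>M (insert x ?S) (\<lambda>_. lborel)) =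
      (\<integral>\<^sup>+\<theta>. (\<integral>\<^sup>+y. ennreal (exp (- quad_form A (insert x ?S) (\<theta>(x := y)) / 2)) \<partial>lborel) \<partial>Pi\<^sub>M ?S (\<lambda>_. lborel))"
    by (rule lborel_product.product_nn_integral_insert[OF _ x(1)]) (auto intro: measurable_compose[OF quad_form_measurable])
  also have "\<dots> = (\<integral>\<^sup>+\<theta>. ennreal (sqrt (2 * pi) / sqrt ?\<alpha>) * ennreal (exp (- quad_form ?A ?S \<theta> / 2)) \<partial>Pi\<^sub>M ?S (\<lambda>_. lborel))"
  proof (rule nn_integral_cong)
    fix \<theta> :: "'a \<Rightarrow> real"
    let ?m = "(\<Sum>b\<in>?S. A x b * \<theta> b) / ?\<alpha>"
    have "exp (- quad_form A (insert x ?S) (\<theta>(x := y)) / 2) =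
        exp (- quad_form ?A ?S \<theta> / 2) * exp (- (?\<alpha> * (y + ?m)\<^sup>2) / 2)" for y
    proof -
      have "(\<Sum>b\<in>?S. A x b * (\<theta>(x := y)) b) = (\<Sum>b\<in>?S. A x b * \<theta> b)" using x by (intro sum.cong) auto
      moreover have "quad_form ?A ?S (\<theta>(x := y)) = quad_form ?A ?S \<theta>"
        unfolding quad_form_def using x by (intro sum.cong) auto
      ultimately have "quad_form A (insert x ?S) (\<theta>(x := y)) = ?\<alpha> * (y + ?m)\<^sup>2 + quad_form ?A ?S \<theta>"
        unfolding ins by simp
      then show ?thesis by (simp add: exp_add[symmetric] add_divide_distrib)
    qed
    then have "(\<integral>\<^sup>+y. ennreal (exp (- quad_form A (insert x ?S) (\<theta>(x := y)) / 2)) \<partial>lborel) =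
        (\<integral>\<^sup>+y. ennreal (exp (- quad_form ?A ?S \<theta> / 2)) * ennreal (exp (- (?\<alpha> * (y + ?m)\<^sup>2) / 2)) \<partial>lborel)"
      by (simp add: ennreal_mult)
    also have "\<dots> = ennreal (exp (- quad_form ?A ?S \<theta> / 2)) * ennreal (sqrt (2 * pi) / sqrt ?\<alpha>)"
      unfolding nn_integral_gaussian_1d[OF \<alpha>, of ?m, symmetric] by (rule nn_integral_cmult) simp
    finally show "(\<integral>\<^sup>+y. ennreal (exp (- quad_form A (insert x ?S) (\<theta>(x := y)) / 2)) \<partial>lborel) =
      ennreal (sqrt (2 * pi) / sqrt ?\<alpha>) * ennreal (exp (- quad_form ?A ?S \<theta> / 2))" by (simp add: mult.commute)
  qed
  also have "\<dots> = ennreal (sqrt (2 * pi) / sqrt ?\<alpha>) *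
      ennreal (sqrt (2 * pi) ^ length xs / sqrt (Determinant.det (list_mat ?A xs)))"
    unfolding IH(2)[symmetric]
    by (rule nn_integral_cmult) (auto intro: measurable_compose[OF quad_form_measurable])
  also have "\<dots> = ennreal (sqrt (2 * pi) ^ length (x # xs) / sqrt (Determinant.det (list_mat A (x # xs))))"
    using \<alpha> IH(1) by (simp add: det ennreal_mult'[symmetric] real_sqrt_mult)
  finally show ?case using \<alpha> IH(1) by (simp add: det)
qed

text \<open>Substituting \<open>\<theta>/\<surd>m\<close> absorbs the factor \<open>\<surd>m\<^bsup>card S\<^esup>\<close>. The integrands converge pointwise and
  their moduli are at most \<open>exp (- c/m |\<theta>|\<^sup>2)\<^bsup>m\<^esup> = exp (- c |\<theta>|\<^sup>2)\<close>, so dominated convergence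
  applies.\<close>

theorem laplace_principle:
  fixes \<phi> :: "('i \<Rightarrow> real) \<Rightarrow> complex"
  assumes xs: "distinct xs" "set xs = S" and sym: "\<And>a b. A a b = A b a"
    and posdef: "\<And>v. (\<exists>a\<in>S. v a \<noteq> 0) \<Longrightarrow> 0 < quad_form A S v"
    and \<phi>: "\<phi> \<in> borel_measurable (Pi\<^sub>M S (\<lambda>_. lborel))"
    and c: "c > 0" "\<And>\<theta>. (\<And>i. i \<in> S \<Longrightarrow> \<bar>\<theta> i\<bar> \<le> r) \<Longrightarrow> cmod (\<phi> \<theta>) \<le> exp (- c * (\<Sum>i\<in>S. (\<theta> i)\<^sup>2))"
    and r: "r > 0"
    and lim: "\<And>\<theta>. (\<lambda>m. \<phi> (\<lambda>i\<in>S. \<theta> i / sqrt (real m)) ^ m) \<longlonglongrightarrow> complex_of_real (exp (- quad_form A S \<theta> / 2))"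
  shows "(\<lambda>m. complex_of_real (sqrt (real m) ^ card S) *
      (\<integral>\<theta>. indicator {\<theta>. \<forall>i\<in>S. \<bar>\<theta> i\<bar> \<le> r} \<theta> *\<^sub>R \<phi> \<theta> ^ m \<partial>Pi\<^sub>M S (\<lambda>_. lborel))) \<longlonglongrightarrow>
    complex_of_real (sqrt (2 * pi) ^ card S / sqrt (Determinant.det (list_mat A xs)))"
proof -
  let ?M = "Pi\<^sub>M S (\<lambda>_. lborel :: real measure)"
  let ?B = "{\<theta>. \<forall>i\<in>S. \<bar>\<theta> i\<bar> \<le> r}"
  have S: "finite S" using xs(2) by auto
  have Bm: "(\<lambda>\<theta>. indicator ?B \<theta> :: real) \<in> borel_measurable ?M"
  proof -
    have "(\<lambda>\<theta>. indicator ?B \<theta> :: real) = (\<lambda>\<theta>. \<Prod>i\<in>S. indicator {-r..r} (\<theta> i))"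
      using S by (auto simp: fun_eq_iff indicator_def abs_le_iff minus_le_iff prod_zero_iff)
    then show ?thesis by simp
  qed
  define g where "g m \<theta> = indicator ?B \<theta> *\<^sub>R \<phi> \<theta> ^ m" for m :: nat and \<theta>
  have gm: "g m \<in> borel_measurable ?M" for m
    unfolding g_def using Bm \<phi> by (intro borel_measurable_scaleR borel_measurable_power)
  \<comment> \<open>The index is shifted by one because \<open>\<surd>m\<close> must be positive.\<close>
  let ?s = "\<lambda>m \<theta>. \<lambda>i\<in>S. 1 / sqrt (real (Suc m)) * \<theta> i"
  have sm: "?s m \<in> measurable ?M ?M" for m by measurable
  have scaled: "complex_of_real (sqrt (real (Suc m)) ^ card S) * (\<integral>\<theta>. g (Suc m) \<theta> \<partial>?M) =
      (\<integral>\<theta>. g (Suc m) (?s m \<theta>) \<partial>?M)" for m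
  proof -
    have first: "(\<integral>\<theta>. g (Suc m) \<theta> \<partial>?M) = ((1 / sqrt (real (Suc m))) ^ card S) *\<^sub>R (\<integral>\<theta>. g (Suc m) (?s m \<theta>) \<partial>?M)"
      by (rule integral_PiM_scale[OF S _ gm]) simp
    have second: "sqrt (real (Suc m)) ^ card S * (1 / sqrt (real (Suc m))) ^ card S = 1"
      by (simp add: power_mult_distrib[symmetric] del: of_nat_Suc)
    show ?thesis
      by (simp only: first scaleR_conv_of_real[symmetric] scaleR_scaleR second scaleR_one)
  qed
  define w where "w \<theta> = (\<Prod>i\<in>S. exp (- c * (\<theta> i)\<^sup>2))" for \<theta> :: "'i \<Rightarrow> real"
  have w_int: "integrable ?M w"
  proof -
    have "integrable lborel (\<lambda>y :: real. exp (- c * y\<^sup>2))"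
    proof (rule integrableI_nonneg)
      have "(\<integral>\<^sup>+y. ennreal (exp (- c * y\<^sup>2)) \<partial>lborel) = ennreal (sqrt (2 * pi) / sqrt (2 * c))"
        using nn_integral_gaussian_1d[of "2 * c" 0] c(1) by simp
      then show "(\<integral>\<^sup>+y. ennreal (exp (- c * y\<^sup>2)) \<partial>lborel) < \<infinity>" by simp
    qed auto
    then show ?thesis unfolding w_def by (intro lborel_product.product_integrable_prod S)
  qed
  have w_eq: "w \<theta> = exp (- c * (\<Sum>i\<in>S. (\<theta> i)\<^sup>2))" for \<theta>
    using S by (simp add: w_def exp_sum[symmetric] sum_distrib_left)
  let ?f = "\<lambda>\<theta>. complex_of_real (exp (- quad_form A S \<theta> / 2))"
  have "(\<lambda>m. \<integral>\<theta>. g (Suc m) (?s m \<theta>) \<partial>?M) \<longlonglongrightarrow> (\<integral>\<theta>. ?f \<theta> \<partial>?M)"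
  proof (rule integral_dominated_convergence[OF _ _ w_int])
    show "?f \<in> borel_measurable ?M" using S by measurable
    show "(\<lambda>\<theta>. g (Suc m) (?s m \<theta>)) \<in> borel_measurable ?M" for m
      by (rule measurable_compose[OF sm gm])
    show "AE \<theta> in ?M. (\<lambda>m. g (Suc m) (?s m \<theta>)) \<longlonglongrightarrow> ?f \<theta>"
    proof (rule AE_I2)
      fix \<theta> :: "'i \<Rightarrow> real"
      have "(\<lambda>m. 1 / sqrt (real (Suc m)) * \<bar>\<theta> i\<bar>) \<longlonglongrightarrow> 0" for i
      proof -
        have "(\<lambda>m. 1 / sqrt (real (Suc m))) \<longlonglongrightarrow> 0" by real_asymp
        then show ?thesis by (rule tendsto_mult_left_zero)
      qed
      then have "\<forall>\<^sub>F m in sequentially. 1 / sqrt (real (Suc m)) * \<bar>\<theta> i\<bar> < r" for i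
        using r by (rule order_tendstoD)
      then have "\<forall>\<^sub>F m in sequentially. \<forall>i\<in>S. 1 / sqrt (real (Suc m)) * \<bar>\<theta> i\<bar> < r"
        using S by (simp add: eventually_ball_finite)
      then have "\<forall>\<^sub>F m in sequentially. \<phi> (\<lambda>i\<in>S. \<theta> i / sqrt (real (Suc m))) ^ Suc m = g (Suc m) (?s m \<theta>)"
      proof eventually_elim
        case (elim m)
        have "?s m \<theta> \<in> ?B" using elim by (auto simp: abs_mult less_imp_le)
        moreover have "?s m \<theta> = (\<lambda>i\<in>S. \<theta> i / sqrt (real (Suc m)))" by (auto simp: fun_eq_iff)
        ultimately show ?case by (simp add: g_def)
      qed
      from Lim_transform_eventually[OF LIMSEQ_Suc[OF lim[of \<theta>]] this]
      show "(\<lambda>m. g (Suc m) (?s m \<theta>)) \<longlonglongrightarrow> ?f \<theta>" .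
    qed
    show "AE \<theta> in ?M. norm (g (Suc m) (?s m \<theta>)) \<le> w \<theta>" for m
    proof (rule AE_I2)
      fix \<theta> :: "'i \<Rightarrow> real"
      show "norm (g (Suc m) (?s m \<theta>)) \<le> w \<theta>"
      proof (cases "?s m \<theta> \<in> ?B")
        case True
        have "cmod (\<phi> (?s m \<theta>)) \<le> exp (- c * (\<Sum>i\<in>S. (?s m \<theta> i)\<^sup>2))" using True by (intro c(2)) auto
        then have "cmod (\<phi> (?s m \<theta>)) ^ Suc m \<le> exp (- c * (\<Sum>i\<in>S. (?s m \<theta> i)\<^sup>2)) ^ Suc m"
          by (intro power_mono) auto
        also have "\<dots> = exp (real (Suc m) * (- c * (\<Sum>i\<in>S. (?s m \<theta> i)\<^sup>2)))"
          by (simp only: exp_of_nat_mult)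
        also have "(\<Sum>i\<in>S. (?s m \<theta> i)\<^sup>2) = (\<Sum>i\<in>S. (\<theta> i)\<^sup>2) / real (Suc m)"
          by (simp add: power_mult_distrib power_divide sum_divide_distrib del: of_nat_Suc)
        also have "real (Suc m) * (- c * ((\<Sum>i\<in>S. (\<theta> i)\<^sup>2) / real (Suc m))) = - c * (\<Sum>i\<in>S. (\<theta> i)\<^sup>2)"
          by (simp del: of_nat_Suc)
        finally show ?thesis
          by (simp only: g_def w_eq indicator_simps(1)[OF True] scaleR_one norm_power)
      next
        case False
        then show ?thesis by (simp add: g_def w_eq)
      qed
    qed
  qed
  also have "(\<integral>\<theta>. ?f \<theta> \<partial>?M) = complex_of_real (\<integral>\<theta>. exp (- quad_form A S \<theta> / 2) \<partial>?M)"
    by (rule integral_complex_of_real)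
  also have "(\<integral>\<theta>. exp (- quad_form A S \<theta> / 2) \<partial>?M) = sqrt (2 * pi) ^ card S / sqrt (Determinant.det (list_mat A xs))"
  proof -
    have *: "0 < Determinant.det (list_mat A xs)"
      "(\<integral>\<^sup>+\<theta>. ennreal (exp (- quad_form A S \<theta> / 2)) \<partial>?M) =
        ennreal (sqrt (2 * pi) ^ card S / sqrt (Determinant.det (list_mat A xs)))"
      using nn_integral_gaussian[OF xs(1) sym] posdef xs distinct_card[OF xs(1)] by auto
    show ?thesis
      by (rule integral_eq_nn_integral[THEN trans]) (use * S in auto)
  qed
  finally have "(\<lambda>m. complex_of_real (sqrt (real (Suc m)) ^ card S) * (\<integral>\<theta>. g (Suc m) \<theta> \<partial>?M)) \<longlonglongrightarrow>
      complex_of_real (sqrt (2 * pi) ^ card S / sqrt (Determinant.det (list_mat A xs)))"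
    unfolding scaled .
  from LIMSEQ_imp_Suc[OF this] show ?thesis by (simp only: g_def)
qed

section \<open>Trigonometric estimates\<close>

lemma half_le_sin:
  fixes x :: real
  assumes "0 \<le> x" "x \<le> pi / 2"
  shows "x / 2 \<le> sin x"
proof -
  define y where "y = x / 2"
  have y: "0 \<le> y" "y \<le> pi / 4" using assms by (auto simp: y_def)
  have "(\<lambda>t. sin t - t * cos t) 0 \<le> (\<lambda>t. sin t - t * cos t) y"
  proof (rule DERIV_nonneg_imp_nondecreasing[OF y(1)])
    fix t assume t: "0 \<le> t" "t \<le> y"
    have "((\<lambda>t. sin t - t * cos t) has_real_derivative t * sin t) (at t)"
      by (auto intro!: derivative_eq_intros)
    moreover have "0 \<le> t * sin t" using t y pi_gt_zero by (intro mult_nonneg_nonneg sin_ge_zero) linarith+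
    ultimately show "\<exists>d. ((\<lambda>t. sin t - t * cos t) has_real_derivative d) (at t) \<and> 0 \<le> d" by blast
  qed
  then have sy: "y * cos y \<le> sin y" by simp
  have "cos (pi / 4) \<le> cos y" using y pi_gt_zero by (intro cos_monotone_0_pi_le) linarith+
  then have cy: "sqrt 2 / 2 \<le> cos y" by (simp add: cos_45)
  then have "(sqrt 2 / 2)\<^sup>2 \<le> (cos y)\<^sup>2" by (intro power_mono) auto
  then have cy2: "1 / 2 \<le> (cos y)\<^sup>2" by (simp add: power_divide)
  have "0 \<le> cos y" by (rule order_trans[OF _ cy]) simp
  have "x / 2 = 2 * y * (1 / 2)" by (simp add: y_def)
  also have "\<dots> \<le> 2 * y * (cos y)\<^sup>2" using cy2 y by (intro mult_left_mono) auto
  also have "\<dots> = 2 * (y * cos y) * cos y" by (simp add: power2_eq_square)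
  also have "\<dots> \<le> 2 * sin y * cos y" using sy \<open>0 \<le> cos y\<close> by (intro mult_right_mono) auto
  also have "\<dots> = sin x" using sin_double[of y] by (simp add: y_def)
  finally show ?thesis .
qed

lemma abs_le_sin_half:
  fixes \<theta> :: real
  assumes "\<bar>\<theta>\<bar> \<le> pi"
  shows "\<bar>\<theta>\<bar> / 4 \<le> \<bar>sin (\<theta> / 2)\<bar>"
proof -
  have "\<bar>\<theta>\<bar> / 4 \<le> sin (\<bar>\<theta>\<bar> / 2)" using half_le_sin[of "\<bar>\<theta>\<bar> / 2"] assms by simp
  also have "\<dots> \<le> \<bar>sin (\<theta> / 2)\<bar>" by (cases "\<theta> \<ge> 0") auto
  finally show ?thesis .
qed

lemma abs_sin_add_le: "\<bar>sin (x + y :: real)\<bar> \<le> \<bar>sin x\<bar> + \<bar>sin y\<bar>"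
proof -
  have "\<bar>sin (x + y)\<bar> \<le> \<bar>sin x\<bar> * \<bar>cos y\<bar> + \<bar>cos x\<bar> * \<bar>sin y\<bar>"
    unfolding sin_add abs_mult[symmetric] by (rule abs_triangle_ineq)
  also have "\<dots> \<le> \<bar>sin x\<bar> * 1 + 1 * \<bar>sin y\<bar>"
    by (intro add_mono mult_mono) auto
  finally show ?thesis by simp
qed

text \<open>The square of the left-hand side is \<open>\<Sum> q j q l cos (\<theta> j - \<theta> l) = 1 - 2 s\<close>, where \<open>s\<close> is the
  sum in the exponent, and \<open>1 - 2 s \<le> exp (- 2 s)\<close>.\<close>

lemma norm_convex_cis_le:
  assumes "finite J" "\<And>j. j \<in> J \<Longrightarrow> 0 \<le> q j" "(\<Sum>j\<in>J. q j) = 1"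
  shows "cmod (\<Sum>j\<in>J. of_real (q j) * cis (\<theta> j)) \<le>
    exp (- (\<Sum>j\<in>J. \<Sum>l\<in>J. q j * q l * (sin ((\<theta> j - \<theta> l) / 2))\<^sup>2))"
proof -
  define s where "s = (\<Sum>j\<in>J. \<Sum>l\<in>J. q j * q l * (sin ((\<theta> j - \<theta> l) / 2))\<^sup>2)"
  have "(cmod (\<Sum>j\<in>J. of_real (q j) * cis (\<theta> j)))\<^sup>2 =
      (\<Sum>j\<in>J. q j * cos (\<theta> j))\<^sup>2 + (\<Sum>j\<in>J. q j * sin (\<theta> j))\<^sup>2"
    by (simp add: cmod_power2 Re_sum Im_sum)
  also have "\<dots> = (\<Sum>j\<in>J. \<Sum>l\<in>J. q j * q l * cos (\<theta> j - \<theta> l))"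
    unfolding power2_eq_square sum_product
    by (simp add: sum.distrib[symmetric] cos_diff algebra_simps)
  also have "\<dots> = (\<Sum>j\<in>J. \<Sum>l\<in>J. q j * q l - 2 * (q j * q l * (sin ((\<theta> j - \<theta> l) / 2))\<^sup>2))"
  proof (intro sum.cong refl)
    fix j l
    have "cos (\<theta> j - \<theta> l) = 1 - 2 * (sin ((\<theta> j - \<theta> l) / 2))\<^sup>2"
    proof -
      have "2 * ((\<theta> j - \<theta> l) / 2) = \<theta> j - \<theta> l" by simp
      then show ?thesis using cos_double_sin[of "(\<theta> j - \<theta> l) / 2"] by (simp only:)
    qed
    then show "q j * q l * cos (\<theta> j - \<theta> l) = q j * q l - 2 * (q j * q l * (sin ((\<theta> j - \<theta> l) / 2))\<^sup>2)"
      by (simp only: right_diff_distrib mult_1_right mult.left_commute[of 2])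
  qed
  also have "\<dots> = (\<Sum>j\<in>J. \<Sum>l\<in>J. q j * q l) - 2 * s"
    by (simp add: sum_subtractf s_def sum_distrib_left)
  also have "\<dots> = 1 + (- (2 * s))" by (simp only: sum_product[symmetric] assms(3))
  also have "\<dots> \<le> exp (- (2 * s))" by (rule exp_ge_add_one_self)
  also have "\<dots> = (exp (- s))\<^sup>2" by (simp add: power2_eq_square exp_add[symmetric])
  finally have "cmod (\<Sum>j\<in>J. of_real (q j) * cis (\<theta> j)) \<le> exp (- s)"
    by (rule power2_le_imp_le) simp
  then show ?thesis by (simp add: s_def)
qed

text \<open>The central limit theorem for characteristic functions of a centred finitely supported
  variable: replace \<open>cis\<close> by its second-order expansion, at the cost of \<open>m\<close> times a third moment
  of order \<open>m\<^bsup>-3/2\<^esup>\<close>, and use \<open>(1 - s/(2m))\<^sup>m \<longlonglongrightarrow> exp (- s/2)\<close>.\<close>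

lemma cis_power_limit:
  assumes J: "finite J" "\<And>j. j \<in> J \<Longrightarrow> 0 \<le> q j" "(\<Sum>j\<in>J. q j) = 1"
    and centred: "(\<Sum>j\<in>J. q j * x j) = 0"
  shows "(\<lambda>m. (\<Sum>j\<in>J. of_real (q j) * cis (x j / sqrt (real m))) ^ m) \<longlonglongrightarrow>
    complex_of_real (exp (- (\<Sum>j\<in>J. q j * (x j)\<^sup>2) / 2))"
proof -
  define s where "s = (\<Sum>j\<in>J. q j * (x j)\<^sup>2)"
  define ch where "ch m = (\<Sum>j\<in>J. of_real (q j) * cis (x j / sqrt (real m)))" for m
  define w where "w m = 1 - s / (2 * real m)" for m
  have "0 \<le> s" unfolding s_def using J(2) by (intro sum_nonneg) auto
  have norm_ch: "cmod (ch m) \<le> 1" for m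
  proof -
    have "cmod (ch m) \<le> (\<Sum>j\<in>J. cmod (of_real (q j) * cis (x j / sqrt (real m))))"
      unfolding ch_def by (rule norm_sum)
    also have "\<dots> = (\<Sum>j\<in>J. q j)" using J(2) by (intro sum.cong) (auto simp: norm_mult)
    finally show ?thesis using J(3) by simp
  qed
  define r where "r u = cis u - (1 + \<i> * of_real u - of_real (u\<^sup>2) / 2)" for u :: real
  have r: "cmod (r u) \<le> \<bar>u\<bar> ^ 3 / 6" for u
    using iexp_approx1[of u 2] by (simp add: r_def cis_conv_exp numeral_eq_Suc power2_eq_square algebra_simps)
  have diff: "ch m - of_real (w m) = (\<Sum>j\<in>J. of_real (q j) * r (x j / sqrt (real m)))" if "m > 0" for m
  proof -
    have "ch m = (\<Sum>j\<in>J. of_real (q j) * r (x j / sqrt (real m))) + of_real (\<Sum>j\<in>J. q j) +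
        \<i> * of_real ((\<Sum>j\<in>J. q j * x j) / sqrt (real m)) - of_real (s / real m) / 2"
      using that by (simp add: ch_def r_def s_def sum.distrib[symmetric] sum_subtractf[symmetric]
        sum_distrib_left sum_divide_distrib power_divide algebra_simps)
    then show ?thesis by (simp add: J(3) centred w_def)
  qed
  have "cmod (ch m ^ m - of_real (w m) ^ m) \<le> (\<Sum>j\<in>J. q j * \<bar>x j\<bar> ^ 3) / 6 / sqrt (real m)"
    if m: "m > 0" "s / 4 \<le> real m" for m
  proof -
    have "\<bar>w m\<bar> \<le> 1" using m \<open>0 \<le> s\<close> by (simp add: w_def abs_le_iff field_simps)
    then have "cmod (ch m ^ m - of_real (w m) ^ m) \<le> real m * cmod (ch m - of_real (w m))"
      by (intro norm_power_diff norm_ch) simp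
    also have "\<dots> \<le> real m * (\<Sum>j\<in>J. q j * (\<bar>x j / sqrt (real m)\<bar> ^ 3 / 6))"
      unfolding diff[OF m(1)]
    proof (intro mult_left_mono order_trans[OF norm_sum] sum_mono)
      fix j assume "j \<in> J"
      then have "\<bar>q j\<bar> = q j" using J(2) by simp
      then show "cmod (of_real (q j) * r (x j / sqrt (real m))) \<le> q j * (\<bar>x j / sqrt (real m)\<bar> ^ 3 / 6)"
        unfolding norm_mult norm_of_real \<open>\<bar>q j\<bar> = q j\<close> using J(2)[OF \<open>j \<in> J\<close>] by (intro mult_left_mono r)
    qed simp
    also have "\<dots> = (\<Sum>j\<in>J. q j * \<bar>x j\<bar> ^ 3) / 6 * (real m / sqrt (real m) ^ 3)"
      using m by (simp add: abs_divide power_divide sum_distrib_left sum_divide_distrib sum_distrib_right mult_ac)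
    also have "real m / sqrt (real m) ^ 3 = 1 / sqrt (real m)"
      using m by (simp add: power3_eq_cube field_simps)
    finally show ?thesis by simp
  qed
  moreover have "\<forall>\<^sub>F m in sequentially. m > 0 \<and> s / 4 \<le> real m"
    by (intro eventually_conj eventually_gt_at_top) (meson eventually_sequentiallyI nat_ceiling_le_eq)
  ultimately have "\<forall>\<^sub>F m in sequentially. norm (ch m ^ m - of_real (w m) ^ m) \<le>
      (\<Sum>j\<in>J. q j * \<bar>x j\<bar> ^ 3) / 6 / sqrt (real m)"
    by (auto elim: eventually_mono)
  moreover have "(\<lambda>m. (\<Sum>j\<in>J. q j * \<bar>x j\<bar> ^ 3) / 6 / sqrt (real m)) \<longlonglongrightarrow> 0"
    by (intro tendsto_divide_0[OF tendsto_const] filterlim_at_top_imp_at_infinity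
      filterlim_compose[OF sqrt_at_top] filterlim_real_sequentially)
  ultimately have "(\<lambda>m. ch m ^ m - of_real (w m) ^ m) \<longlonglongrightarrow> 0"
    by (rule Lim_null_comparison)
  moreover have "(\<lambda>m. complex_of_real (w m) ^ m) \<longlonglongrightarrow> of_real (exp (- s / 2))"
  proof -
    have "(\<lambda>m. (1 + (- s / 2) / real m) ^ m) \<longlonglongrightarrow> exp (- s / 2)"
      by (rule tendsto_exp_limit_sequentially)
    then have "(\<lambda>m. w m ^ m) \<longlonglongrightarrow> exp (- s / 2)" by (simp add: w_def)
    then have "(\<lambda>m. complex_of_real (w m ^ m)) \<longlonglongrightarrow> of_real (exp (- s / 2))" by (rule tendsto_of_real)
    then show ?thesis by simp
  qed
  ultimately have "(\<lambda>m. (ch m ^ m - of_real (w m) ^ m) + of_real (w m) ^ m) \<longlonglongrightarrow> 0 + of_real (exp (- s / 2))"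
    by (rule tendsto_add)
  then show ?thesis by (simp add: ch_def s_def)
qed

lemma integral_cis_period:
  fixes n :: int
  shows "(\<integral>\<theta>. indicator {-pi..pi} \<theta> *\<^sub>R cis (of_int n * \<theta>) \<partial>lborel) = (if n = 0 then 2 * pi else 0)"
    "integrable lborel (\<lambda>\<theta>. indicator {-pi..pi} \<theta> *\<^sub>R cis (of_int n * \<theta>))"
proof -
  have cont: "continuous_on {-pi..pi} (\<lambda>\<theta>. cis (of_int n * \<theta>))"
    by (intro continuous_intros)
  show "integrable lborel (\<lambda>\<theta>. indicator {-pi..pi} \<theta> *\<^sub>R cis (of_int n * \<theta>))"
    using borel_integrable_compact[OF _ cont] by simp
  show "(\<integral>\<theta>. indicator {-pi..pi} \<theta> *\<^sub>R cis (of_int n * \<theta>) \<partial>lborel) = (if n = 0 then 2 * pi else 0)"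
  proof (cases "n = 0")
    case True
    have "(\<integral>\<theta>. indicator {-pi..pi} \<theta> *\<^sub>R (1::complex) \<partial>lborel) = measure lborel {-pi..pi} *\<^sub>R 1"
      by (subst integral_scaleR_left) auto
    then show ?thesis using True by (simp add: scaleR_conv_of_real)
  next
    case False
    have "(\<integral>\<theta>. indicator {-pi..pi} \<theta> *\<^sub>R cis (of_int n * \<theta>) \<partial>lborel) =
        cis (of_int n * pi) / (\<i> * of_int n) - cis (of_int n * (-pi)) / (\<i> * of_int n)"
    proof (rule integral_FTC_Icc)
      fix \<theta> :: real
      show "((\<lambda>\<theta>. cis (of_int n * \<theta>) / (\<i> * of_int n)) has_vector_derivative cis (of_int n * \<theta>)) (at \<theta> within {-pi..pi})"
      proof -
        have "((\<lambda>\<theta>. exp (\<i> * of_int n * of_real \<theta>) / (\<i> * of_int n)) has_vector_derivative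
            exp (\<i> * of_int n * of_real \<theta>)) (at \<theta> within {-pi..pi})"
          using False by (auto intro!: derivative_eq_intros has_vector_derivative_real_field simp: field_simps)
        then show ?thesis by (simp add: cis_conv_exp mult.assoc)
      qed
    qed (use cont in auto)
    also have "cis (of_int n * (-pi)) = cis (of_int n * pi)"
      by (simp add: complex_eq_iff) (simp add: mult.commute)
    finally show ?thesis using False by simp
  qed
qed

section \<open>The local limit theorem\<close>

text \<open>For the probabilistic argument, fix a minimizer \<open>z\<close> and the right vertices \<open>R\<close> to be
  deleted; \<open>Em\<close> and \<open>bal\<close> belong to the multiplicities \<open>m k\<close>.\<close>

locale flow_min = flow +
  fixes z :: "nat \<Rightarrow> real" and R :: "nat set"
  assumes z_min: "cap_minimizer N k F z" and R: "right_transversal N F R"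
begin

abbreviation p :: "nat \<times> nat \<Rightarrow> real" where "p \<equiv> gibbs_flow z"
abbreviation cap :: real where "cap \<equiv> capacity N k F"
abbreviation Em :: "nat \<Rightarrow> (nat \<times> nat) set" where "Em m \<equiv> unknowns N (\<lambda>i. m * k i)"
abbreviation bal :: "nat \<Rightarrow> (nat \<times> nat \<Rightarrow> nat) set" where "bal m \<equiv> game.balanced N (\<lambda>i. m * k i) F"

text \<open>The probability that a factor \<open>L\<^sub>i\<close> chooses the variable \<open>z\<^sub>j\<close>; \<open>weight\<close> is the probability of
  an assignment.\<close>

definition q :: "nat \<Rightarrow> nat \<Rightarrow> real" where
  "q i j = z j / lin_form F z i"

definition S :: "nat set" where
  "S = {1..N} - R"

definition ext0 :: "(nat \<Rightarrow> real) \<Rightarrow> nat \<Rightarrow> real" where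
  "ext0 \<theta> j = (if j \<in> S then \<theta> j else 0)"

definition count :: "nat \<Rightarrow> (nat \<times> nat \<Rightarrow> nat) \<Rightarrow> nat \<Rightarrow> nat" where
  "count m \<sigma> j = card {e \<in> Em m. \<sigma> e = j}"

definition weight :: "nat \<Rightarrow> (nat \<times> nat \<Rightarrow> nat) \<Rightarrow> real" where
  "weight m \<sigma> = (\<Prod>e\<in>Em m. q (fst e) (\<sigma> e))"

lemma z_pos: "z \<in> pos_vectors N"
  using z_min by (simp add: cap_minimizer_def)

lemma finite_Em [simp]: "finite (Em m)"
proof -
  have "Em m = (SIGMA i:{1..N}. {1..m * k i})" by (auto simp: unknowns_def)
  then show ?thesis by simp
qed

lemma Em_Sigma: "Em m = (SIGMA i:{1..N}. {1..m * k i})"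
  by (auto simp: unknowns_def)

lemma prod_Em:
  fixes g :: "nat \<Rightarrow> 'a :: comm_monoid_mult"
  shows "(\<Prod>e\<in>Em m. g (fst e)) = (\<Prod>i\<in>{1..N}. g i ^ (m * k i))"
proof -
  have "(\<Prod>i\<in>{1..N}. \<Prod>s\<in>{1..m * k i}. g i) = (\<Prod>(i, s)\<in>(SIGMA i:{1..N}. {1..m * k i}). g i)"
    by (rule prod.Sigma) auto
  then show ?thesis by (simp add: Em_Sigma case_prod_unfold)
qed

lemma prod_assigned:
  fixes g :: "nat \<Rightarrow> 'a :: comm_monoid_mult"
  assumes "\<And>e. e \<in> Em m \<Longrightarrow> \<sigma> e \<in> {1..N}"
  shows "(\<Prod>e\<in>Em m. g (\<sigma> e)) = (\<Prod>j\<in>{1..N}. g j ^ count m \<sigma> j)"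
proof -
  have "(\<Prod>j\<in>{1..N}. \<Prod>e\<in>{e \<in> Em m. \<sigma> e = j}. g (\<sigma> e)) = (\<Prod>e\<in>Em m. g (\<sigma> e))"
    using assms by (intro prod.group) auto
  moreover have "(\<Prod>e\<in>{e \<in> Em m. \<sigma> e = j}. g (\<sigma> e)) = g j ^ count m \<sigma> j" for j
    by (simp add: count_def)
  ultimately show ?thesis by simp
qed

lemma scaled_game: "game N F"
  by unfold_locales (rule F)

definition assignments_m :: "nat \<Rightarrow> (nat \<times> nat \<Rightarrow> nat) set" where
  "assignments_m m = (\<Pi>\<^sub>E e\<in>Em m. in_nbrs F (fst e))"

lemma bal_iff: "\<sigma> \<in> bal m \<longleftrightarrow> \<sigma> \<in> assignments_m m \<and> (\<forall>j\<in>{1..N}. count m \<sigma> j = m * k j)"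
  by (simp add: game.balanced_def[OF scaled_game] game.assignments_def[OF scaled_game]
    game.fibre_def[OF scaled_game] assignments_m_def count_def)

lemma finite_assignments_m [simp]: "finite (assignments_m m)"
  unfolding assignments_m_def by (intro finite_PiE) auto

lemma finite_bal [simp]: "finite (bal m)"
  by (rule finite_subset[of _ "assignments_m m"]) (auto simp: bal_iff)

lemma assignments_m_range: "\<sigma> \<in> assignments_m m \<Longrightarrow> e \<in> Em m \<Longrightarrow> \<sigma> e \<in> in_nbrs F (fst e) \<and> \<sigma> e \<in> {1..N}"
  unfolding assignments_m_def using nbrs_range[of "\<sigma> e" "fst e"] PiE_mem[of \<sigma> "Em m" "\<lambda>e. in_nbrs F (fst e)" e] by blast

lemma mem_in_nbrs: "j \<in> in_nbrs F i \<longleftrightarrow> (j, i) \<in> F"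
  by (simp add: in_nbrs_def)

lemma q_pos: "(j, i) \<in> F \<Longrightarrow> 0 < q i j"
  using pos_vectors_F[OF z_pos] by (simp add: q_def)

lemma sum_q: "i \<in> {1..N} \<Longrightarrow> (\<Sum>j\<in>in_nbrs F i. q i j) = 1"
  using lin_form_pos[OF z_pos, of i]
  by (simp only: q_def sum_divide_distrib[symmetric] lin_form_def[symmetric]) simp

lemma cap_pos: "0 < cap"
  using capacity_eq[OF z_min] by simp

lemma cap_eq: "cap = (\<Prod>i\<in>{1..N}. lin_form F z i ^ k i) / (\<Prod>j\<in>{1..N}. z j ^ k j)"
  using z_min by (simp add: cap_minimizer_def cap_quotient_def)

text \<open>In a balanced assignment every \<open>z\<^sub>j\<close> occurs \<open>m k\<^sub>j\<close> times, so the probability is the \<open>m\<close>-th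
  power of the reciprocal of the quotient that defines the capacity.\<close>

lemma weight_bal:
  assumes "\<sigma> \<in> bal m"
  shows "weight m \<sigma> = 1 / cap ^ m"
proof -
  have \<sigma>: "\<sigma> \<in> assignments_m m" "\<And>j. j \<in> {1..N} \<Longrightarrow> count m \<sigma> j = m * k j"
    using assms by (auto simp: bal_iff)
  have "weight m \<sigma> = (\<Prod>e\<in>Em m. z (\<sigma> e)) / (\<Prod>e\<in>Em m. lin_form F z (fst e))"
    by (simp add: weight_def q_def prod_dividef)
  also have "(\<Prod>e\<in>Em m. z (\<sigma> e)) = (\<Prod>j\<in>{1..N}. z j ^ (m * k j))"
    using assignments_m_range[OF \<sigma>(1)] \<sigma>(2) by (subst prod_assigned) auto
  also have "\<dots> = (\<Prod>j\<in>{1..N}. z j ^ k j) ^ m"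
    by (simp add: prod_power_distrib power_mult[symmetric] mult.commute)
  also have "(\<Prod>e\<in>Em m. lin_form F z (fst e)) = (\<Prod>i\<in>{1..N}. lin_form F z i ^ k i) ^ m"
    by (simp add: prod_Em prod_power_distrib power_mult[symmetric] mult.commute)
  finally show ?thesis by (simp add: cap_eq power_divide)
qed

lemma weight_nonneg: "\<sigma> \<in> assignments_m m \<Longrightarrow> 0 \<le> weight m \<sigma>"
  unfolding weight_def using assignments_m_range q_pos
  by (intro prod_nonneg) (auto simp: in_nbrs_def less_imp_le)

lemma card_bal: "real (card (bal m)) / cap ^ m = (\<Sum>\<sigma>\<in>bal m. weight m \<sigma>)"
  by (simp add: weight_bal)

lemma q_flow: "(j, i) \<in> F \<Longrightarrow> p (j, i) = real (k i) * q i j"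
  by (simp add: gibbs_flow_def q_def)

lemma sum_kq: "j \<in> {1..N} \<Longrightarrow> (\<Sum>i\<in>out_nbrs F j. real (k i) * q i j) = real (k j)"
  using minimizer_stationary[OF z_min] by (simp add: q_def)

lemma R_subset: "R \<subseteq> {1..N}"
  using R by (simp add: right_transversal_def)

lemma root_exists:
  assumes "j \<in> {1..N}"
  obtains r where "r \<in> R" "(Inr r, Inr j) \<in> bip_rel"
proof -
  have C: "comp (Inr j) \<in> bip_components N F" using assms by (intro comp_in_components) simp
  then obtain r where r: "r \<in> R" "Inr r \<in> comp (Inr j)" using R unfolding right_transversal_def by blast
  have "(Inr j, Inr r) \<in> bip_rel" using r(2) by (simp add: comp_def)
  then have "(Inr r, Inr j) \<in> bip_rel" using equiv_bip_rel by (auto simp: equiv_def sym_def)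
  then show ?thesis using that r(1) by blast
qed

lemma card_R: "card R = num_components N F"
proof -
  have "bij_betw (\<lambda>r. comp (Inr r)) R (bip_components N F)"
  proof (rule bij_betwI')
    fix r s assume rs: "r \<in> R" "s \<in> R"
    show "comp (Inr r) = comp (Inr s) \<longleftrightarrow> r = s"
    proof
      assume eq: "comp (Inr r) = comp (Inr s)"
      have V: "Inr r \<in> V" "Inr s \<in> V" using rs R_subset by auto
      have "comp (Inr r) \<in> bip_components N F" "Inr r \<in> comp (Inr r)" "Inr s \<in> comp (Inr r)"
        using comp_in_components[OF V(1)] mem_comp[OF V(1)] mem_comp[OF V(2)] eq by simp_all
      then show "r = s" using R rs unfolding right_transversal_def by blast
    qed simp
  next
    fix r assume "r \<in> R"
    then show "comp (Inr r) \<in> bip_components N F" using R_subset by (intro comp_in_components) auto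
  next
    fix C assume C: "C \<in> bip_components N F"
    then obtain r where "r \<in> R" "Inr r \<in> C" using R unfolding right_transversal_def by blast
    then show "\<exists>r\<in>R. C = comp (Inr r)" using component_eq_comp(1)[OF C] by blast
  qed
  then show ?thesis by (simp add: num_components_def bij_betw_same_card)
qed

lemma finite_S [simp]: "finite S"
  by (simp add: S_def)

lemma card_S: "real (card S) = real N - real (num_components N F)"
proof -
  have "card R \<le> card {1..N}" using R_subset by (intro card_mono) auto
  then show ?thesis using R_subset by (simp add: S_def card_Diff_subset finite_subset[OF R_subset] card_R[symmetric])
qed

text \<open>A flow carries the total weight of the right vertices of a component to its left vertices.\<close>

lemma component_balance:
  assumes "C \<in> bip_components N F"
  shows "(\<Sum>j\<in>{j \<in> {1..N}. Inr j \<in> C}. k j) = (\<Sum>i\<in>{i \<in> {1..N}. Inl i \<in> C}. k i)"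
proof -
  obtain a where a: "a \<in> flow_polytope N k F" using positive_flow by blast
  have iff: "Inr j \<in> C \<longleftrightarrow> Inl i \<in> C" if "(j, i) \<in> F" for j i
    using comp_edge[OF that] component_eq_comp[OF assms] mem_comp[of "Inr j"] mem_comp[of "Inl i"] F_range[OF that]
    by (metis Inl_V Inr_V)
  have "real (\<Sum>j\<in>{j \<in> {1..N}. Inr j \<in> C}. k j) = (\<Sum>j\<in>{1..N}. \<Sum>i\<in>out_nbrs F j. if Inr j \<in> C then a (j, i) else 0)"
    unfolding of_nat_sum
    by (rule sum.mono_neutral_cong_left) (use a in \<open>auto simp: flow_polytope_def\<close>)
  also have "\<dots> = (\<Sum>(j, i)\<in>F. if Inr j \<in> C then a (j, i) else 0)" by (rule sum_out_nbrs)
  also have "\<dots> = (\<Sum>(j, i)\<in>F. if Inl i \<in> C then a (j, i) else 0)"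
    using iff by (intro sum.cong) auto
  also have "\<dots> = (\<Sum>i\<in>{1..N}. \<Sum>j\<in>in_nbrs F i. if Inl i \<in> C then a (j, i) else 0)"
    by (rule sum_in_nbrs[symmetric])
  also have "\<dots> = real (\<Sum>i\<in>{i \<in> {1..N}. Inl i \<in> C}. k i)"
    unfolding of_nat_sum
    by (rule sum.mono_neutral_cong_right) (use a in \<open>auto simp: flow_polytope_def\<close>)
  finally show ?thesis by (simp only: of_nat_eq_iff)
qed

lemma component_count:
  assumes "C \<in> bip_components N F" "\<sigma> \<in> assignments_m m"
  shows "(\<Sum>j\<in>{j \<in> {1..N}. Inr j \<in> C}. count m \<sigma> j) = m * (\<Sum>i\<in>{i \<in> {1..N}. Inl i \<in> C}. k i)"
proof -
  have iff: "Inr (\<sigma> e) \<in> C \<longleftrightarrow> Inl (fst e) \<in> C" if "e \<in> Em m" for e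
  proof -
    have ji: "(\<sigma> e, fst e) \<in> F" using assignments_m_range[OF assms(2) that] by (simp add: in_nbrs_def)
    show ?thesis
      using comp_edge[OF ji] component_eq_comp[OF assms(1)] mem_comp[of "Inr (\<sigma> e)"] mem_comp[of "Inl (fst e)"] F_range[OF ji]
      by (metis Inl_V Inr_V)
  qed
  have "(\<Sum>j\<in>{j \<in> {1..N}. Inr j \<in> C}. count m \<sigma> j) =
      card (\<Union>j\<in>{j \<in> {1..N}. Inr j \<in> C}. {e \<in> Em m. \<sigma> e = j})"
    unfolding count_def by (rule card_UN_disjoint[symmetric]) auto
  also have "(\<Union>j\<in>{j \<in> {1..N}. Inr j \<in> C}. {e \<in> Em m. \<sigma> e = j}) =
      (SIGMA i:{i \<in> {1..N}. Inl i \<in> C}. {1..m * k i})"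
  proof -
    have "(\<Union>j\<in>{j \<in> {1..N}. Inr j \<in> C}. {e \<in> Em m. \<sigma> e = j}) = {e \<in> Em m. Inl (fst e) \<in> C}"
      using iff assignments_m_range[OF assms(2)] by blast
    also have "\<dots> = (SIGMA i:{i \<in> {1..N}. Inl i \<in> C}. {1..m * k i})" by (auto simp: Em_Sigma)
    finally show ?thesis .
  qed
  finally show ?thesis by (simp add: sum_distrib_left)
qed

text \<open>In each component the total count is forced by \<open>component_count\<close> and \<open>component_balance\<close>, so
  the counts away from the deleted vertex determine the count there.\<close>

lemma bal_iff_S: "\<sigma> \<in> bal m \<longleftrightarrow> \<sigma> \<in> assignments_m m \<and> (\<forall>j\<in>S. count m \<sigma> j = m * k j)"
proof
  assume "\<sigma> \<in> bal m"
  then show "\<sigma> \<in> assignments_m m \<and> (\<forall>j\<in>S. count m \<sigma> j = m * k j)" by (auto simp: bal_iff S_def)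
next
  assume *: "\<sigma> \<in> assignments_m m \<and> (\<forall>j\<in>S. count m \<sigma> j = m * k j)"
  have "count m \<sigma> r = m * k r" if r: "r \<in> R" for r
  proof -
    let ?C = "comp (Inr r)"
    have rN: "r \<in> {1..N}" using r R_subset by blast
    have C: "?C \<in> bip_components N F" "Inr r \<in> ?C"
      using rN by (auto intro!: comp_in_components mem_comp)
    let ?J = "{j \<in> {1..N}. Inr j \<in> ?C}"
    have J: "finite ?J" "r \<in> ?J" using rN C(2) by auto
    have "?J - {r} \<subseteq> S" using R C r unfolding right_transversal_def S_def by blast
    then have "(\<Sum>j\<in>?J - {r}. count m \<sigma> j) = (\<Sum>j\<in>?J - {r}. m * k j)"
      using * by (intro sum.cong) auto
    moreover have "(\<Sum>j\<in>?J. count m \<sigma> j) = (\<Sum>j\<in>?J. m * k j)"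
      using component_count[OF C(1), of \<sigma> m] * by (simp only: component_balance[OF C(1)] sum_distrib_left[symmetric])
    ultimately show ?thesis using sum.remove[OF J, of "count m \<sigma>"] sum.remove[OF J, of "\<lambda>j. m * k j"] by simp
  qed
  then show "\<sigma> \<in> bal m" using * by (auto simp: bal_iff S_def)
qed

text \<open>The characteristic function of the choice made by one factor \<open>L\<^sub>i\<close>, in the variables that are
  kept.\<close>

definition ch :: "nat \<Rightarrow> (nat \<Rightarrow> real) \<Rightarrow> complex" where
  "ch i \<theta> = (\<Sum>j\<in>in_nbrs F i. of_real (q i j) * cis (ext0 \<theta> j))"

text \<open>The characteristic function of the vector of counts for \<open>m = 1\<close>, centred at its mean \<open>k\<close>.\<close>

definition \<phi> :: "(nat \<Rightarrow> real) \<Rightarrow> complex" where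
  "\<phi> \<theta> = (\<Prod>i\<in>{1..N}. ch i \<theta> ^ k i) * cis (- (\<Sum>j\<in>S. real (k j) * \<theta> j))"

lemma cis_sum: "finite A \<Longrightarrow> cis (\<Sum>a\<in>A. f a) = (\<Prod>a\<in>A. cis (f a))"
  by (induction A rule: finite_induct) (auto simp: cis_mult[symmetric])

lemma \<phi>_power:
  "\<phi> \<theta> ^ m = (\<Sum>\<sigma>\<in>assignments_m m. of_real (weight m \<sigma>) *
    (\<Prod>j\<in>S. cis (of_int (int (count m \<sigma> j) - int (m * k j)) * \<theta> j)))"
proof -
  have "(\<Prod>i\<in>{1..N}. ch i \<theta> ^ k i) ^ m = (\<Prod>i\<in>{1..N}. ch i \<theta> ^ (m * k i))"
    by (simp add: prod_power_distrib power_mult[symmetric] mult.commute)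
  also have "\<dots> = (\<Prod>e\<in>Em m. \<Sum>j\<in>in_nbrs F (fst e). of_real (q (fst e) j) * cis (ext0 \<theta> j))"
    using prod_Em[of "\<lambda>i. ch i \<theta>" m] by (simp only: ch_def)
  also have "\<dots> = (\<Sum>\<sigma>\<in>assignments_m m. \<Prod>e\<in>Em m. of_real (q (fst e) (\<sigma> e)) * cis (ext0 \<theta> (\<sigma> e)))"
    unfolding assignments_m_def by (rule prod_sum_PiE) auto
  also have "\<dots> = (\<Sum>\<sigma>\<in>assignments_m m. of_real (weight m \<sigma>) * (\<Prod>j\<in>S. cis (of_nat (count m \<sigma> j) * \<theta> j)))"
  proof (intro sum.cong refl)
    fix \<sigma> assume \<sigma>: "\<sigma> \<in> assignments_m m"
    have "(\<Prod>e\<in>Em m. cis (ext0 \<theta> (\<sigma> e))) = (\<Prod>j\<in>{1..N}. cis (ext0 \<theta> j) ^ count m \<sigma> j)"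
      using assignments_m_range[OF \<sigma>] by (intro prod_assigned[where g = "\<lambda>j. cis (ext0 \<theta> j)"]) auto
    also have "\<dots> = (\<Prod>j\<in>S. cis (of_nat (count m \<sigma> j) * \<theta> j))"
      by (rule prod.mono_neutral_cong_right) (auto simp: S_def ext0_def Complex.DeMoivre)
    finally show "(\<Prod>e\<in>Em m. of_real (q (fst e) (\<sigma> e)) * cis (ext0 \<theta> (\<sigma> e))) =
        of_real (weight m \<sigma>) * (\<Prod>j\<in>S. cis (of_nat (count m \<sigma> j) * \<theta> j))"
      by (simp add: prod.distrib weight_def)
  qed
  finally have 1: "(\<Prod>i\<in>{1..N}. ch i \<theta> ^ k i) ^ m =
    (\<Sum>\<sigma>\<in>assignments_m m. of_real (weight m \<sigma>) * (\<Prod>j\<in>S. cis (of_nat (count m \<sigma> j) * \<theta> j)))" .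
  have "cis (- (\<Sum>j\<in>S. real (k j) * \<theta> j)) ^ m = cis (\<Sum>j\<in>S. - (of_nat (m * k j) * \<theta> j))"
    by (simp add: Complex.DeMoivre sum_distrib_left sum_negf mult.assoc)
  also have "\<dots> = (\<Prod>j\<in>S. cis (- (of_nat (m * k j) * \<theta> j)))" by (rule cis_sum) simp
  finally have 2: "cis (- (\<Sum>j\<in>S. real (k j) * \<theta> j)) ^ m = (\<Prod>j\<in>S. cis (- (of_nat (m * k j) * \<theta> j)))" .
  have 3: "cis (of_nat a * t) * cis (- (of_nat b * t)) = cis (of_int (int a - int b) * t)" for a b t
    by (simp add: cis_mult left_diff_distrib)
  show ?thesis
    unfolding \<phi>_def power_mult_distrib 1 2 sum_distrib_right mult.assoc prod.distrib[symmetric] 3 ..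
qed

text \<open>Expand the power by \<open>\<phi>_power\<close>; the integral over the cube keeps the assignments with
  vanishing frequency, which are the balanced ones by \<open>bal_iff_S\<close>.\<close>

lemma fourier_inversion:
  "(\<integral>\<theta>. indicator {\<theta>. \<forall>i\<in>S. \<bar>\<theta> i\<bar> \<le> pi} \<theta> *\<^sub>R \<phi> \<theta> ^ m \<partial>Pi\<^sub>M S (\<lambda>_. lborel)) =
    of_real ((2 * pi) ^ card S * (real (card (bal m)) / cap ^ m))"
proof -
  let ?M = "Pi\<^sub>M S (\<lambda>_. lborel :: real measure)"
  let ?n = "\<lambda>\<sigma> j. int (count m \<sigma> j) - int (m * k j)"
  let ?g = "\<lambda>\<sigma> \<theta>. \<Prod>j\<in>S. indicator {-pi..pi} (\<theta> j) *\<^sub>R cis (of_int (?n \<sigma> j) * \<theta> j)"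
  have ind: "indicator {\<theta>. \<forall>i\<in>S. \<bar>\<theta> i\<bar> \<le> pi} \<theta> = (\<Prod>j\<in>S. indicator {-pi..pi} (\<theta> j) :: real)" for \<theta>
    by (auto simp: indicator_def abs_le_iff minus_le_iff prod_zero_iff)
  have "indicator {\<theta>. \<forall>i\<in>S. \<bar>\<theta> i\<bar> \<le> pi} \<theta> *\<^sub>R \<phi> \<theta> ^ m =
      (\<Sum>\<sigma>\<in>assignments_m m. of_real (weight m \<sigma>) * ?g \<sigma> \<theta>)" for \<theta>
    unfolding \<phi>_power ind scaleR_conv_of_real of_real_prod sum_distrib_left prod.distrib
    by (simp only: mult.left_commute)
  then have "(\<integral>\<theta>. indicator {\<theta>. \<forall>i\<in>S. \<bar>\<theta> i\<bar> \<le> pi} \<theta> *\<^sub>R \<phi> \<theta> ^ m \<partial>?M) =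
      (\<integral>\<theta>. (\<Sum>\<sigma>\<in>assignments_m m. of_real (weight m \<sigma>) * ?g \<sigma> \<theta>) \<partial>?M)" by simp
  also have "\<dots> = (\<Sum>\<sigma>\<in>assignments_m m. of_real (weight m \<sigma>) * (\<integral>\<theta>. ?g \<sigma> \<theta> \<partial>?M))"
  proof -
    have "integrable ?M (?g \<sigma>)" for \<sigma>
      by (rule lborel_product.product_integrable_prod[OF finite_S integral_cis_period(2)])
    then show ?thesis by (subst Bochner_Integration.integral_sum) auto
  qed
  also have "\<dots> = (\<Sum>\<sigma>\<in>assignments_m m. of_real (weight m \<sigma>) *
      (if \<forall>j\<in>S. count m \<sigma> j = m * k j then of_real ((2 * pi) ^ card S) else 0))"
  proof (intro sum.cong refl arg_cong2[where f = "(*)"])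
    fix \<sigma>
    have "(\<integral>\<theta>. ?g \<sigma> \<theta> \<partial>?M) = (\<Prod>j\<in>S. (\<integral>t. indicator {-pi..pi} t *\<^sub>R cis (of_int (?n \<sigma> j) * t) \<partial>lborel))"
      by (rule lborel_product.product_integral_prod[OF finite_S integral_cis_period(2)])
    also have "\<dots> = (\<Prod>j\<in>S. if count m \<sigma> j = m * k j then of_real (2 * pi) else 0)"
      unfolding integral_cis_period(1)
      by (intro prod.cong) (auto simp: of_nat_mult[symmetric] simp del: of_nat_mult)
    also have "\<dots> = (if \<forall>j\<in>S. count m \<sigma> j = m * k j then of_real ((2 * pi) ^ card S) else 0)"
      by (auto simp: prod_zero_iff)
    finally show "(\<integral>\<theta>. ?g \<sigma> \<theta> \<partial>?M) = (if \<forall>j\<in>S. count m \<sigma> j = m * k j then of_real ((2 * pi) ^ card S) else 0)" .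
  qed
  also have "\<dots> = (\<Sum>\<sigma>\<in>bal m. of_real (weight m \<sigma>) * of_real ((2 * pi) ^ card S))"
    by (rule sum.mono_neutral_cong_right) (auto simp: bal_iff_S)
  also have "\<dots> = of_real ((2 * pi) ^ card S * (\<Sum>\<sigma>\<in>bal m. weight m \<sigma>))"
    by (simp add: sum_distrib_left mult.commute)
  finally show ?thesis by (simp only: card_bal)
qed

text \<open>Mean and variance of the linear functional \<open>\<theta>\<close> of one choice made by \<open>L\<^sub>i\<close>.\<close>

definition mean :: "nat \<Rightarrow> (nat \<Rightarrow> real) \<Rightarrow> real" where
  "mean i \<theta> = (\<Sum>j\<in>in_nbrs F i. q i j * ext0 \<theta> j)"

definition var :: "nat \<Rightarrow> (nat \<Rightarrow> real) \<Rightarrow> real" where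
  "var i \<theta> = (\<Sum>j\<in>in_nbrs F i. q i j * (ext0 \<theta> j - mean i \<theta>)\<^sup>2)"

lemma flow_row_eq: "i \<in> {1..N} \<Longrightarrow> flow_row k F p i j = (if (j, i) \<in> F then q i j else 0)"
  using k_pos[of i] by (simp add: flow_row_def q_flow)

lemma var_eq:
  assumes "i \<in> {1..N}"
  shows "var i \<theta> = (\<Sum>j\<in>in_nbrs F i. q i j * (ext0 \<theta> j)\<^sup>2) - (mean i \<theta>)\<^sup>2"
proof -
  have "var i \<theta> = (\<Sum>j\<in>in_nbrs F i. q i j * (ext0 \<theta> j)\<^sup>2) - 2 * mean i \<theta> * mean i \<theta> +
      (mean i \<theta>)\<^sup>2 * (\<Sum>j\<in>in_nbrs F i. q i j)"
    unfolding var_def mean_def[of i \<theta>, THEN arg_cong[where f = "\<lambda>x. 2 * mean i \<theta> * x"]]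
    by (simp add: sum_distrib_left sum.distrib[symmetric] sum_subtractf[symmetric] power2_eq_square algebra_simps)
  then show ?thesis by (simp add: sum_q[OF assms] power2_eq_square)
qed

text \<open>The covariance form is the sum of the variances of the independent choices.\<close>

lemma quad_form_cov: "quad_form (flow_cov N k F p) S \<theta> = (\<Sum>i\<in>{1..N}. real (k i) * var i \<theta>)"
proof -
  have row: "(\<Sum>a\<in>S. \<Sum>b\<in>S. \<theta> a * ((if a = b then flow_row k F p i a else 0) -
      flow_row k F p i a * flow_row k F p i b) * \<theta> b) = var i \<theta>" if i: "i \<in> {1..N}" for i
  proof -
    let ?f = "flow_row k F p i"
    have 1: "(\<Sum>a\<in>S. ?f a * g (\<theta> a)) = (\<Sum>j\<in>in_nbrs F i. q i j * g (ext0 \<theta> j))" if "g 0 = 0" for g :: "real \<Rightarrow> real"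
    proof -
      have "(\<Sum>a\<in>S. ?f a * g (\<theta> a)) = (\<Sum>a\<in>S \<inter> in_nbrs F i. q i a * g (\<theta> a))"
        by (rule sum.mono_neutral_cong_right) (auto simp: flow_row_eq[OF i] in_nbrs_def)
      also have "\<dots> = (\<Sum>j\<in>in_nbrs F i. q i j * g (ext0 \<theta> j))"
        by (rule sum.mono_neutral_cong_left) (auto simp: ext0_def that)
      finally show ?thesis .
    qed
    have "(\<Sum>a\<in>S. \<Sum>b\<in>S. \<theta> a * ((if a = b then ?f a else 0) - ?f a * ?f b) * \<theta> b) =
        (\<Sum>a\<in>S. \<Sum>b\<in>S. (if a = b then ?f a * (\<theta> a)\<^sup>2 else 0)) - (\<Sum>a\<in>S. \<Sum>b\<in>S. (?f a * \<theta> a) * (?f b * \<theta> b))"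
      unfolding sum_subtractf[symmetric]
      by (intro sum.cong refl) (auto simp: power2_eq_square algebra_simps)
    also have "(\<Sum>a\<in>S. \<Sum>b\<in>S. (if a = b then ?f a * (\<theta> a)\<^sup>2 else 0)) = (\<Sum>j\<in>in_nbrs F i. q i j * (ext0 \<theta> j)\<^sup>2)"
      using 1[of "\<lambda>x. x\<^sup>2"] by simp
    also have "(\<Sum>a\<in>S. \<Sum>b\<in>S. (?f a * \<theta> a) * (?f b * \<theta> b)) = mean i \<theta> * mean i \<theta>"
      using 1[of "\<lambda>x. x"] by (simp add: sum_product[symmetric] mean_def)
    finally show ?thesis by (simp add: var_eq[OF i] power2_eq_square)
  qed
  have "quad_form (flow_cov N k F p) S \<theta> = (\<Sum>a\<in>S. \<Sum>b\<in>S. \<Sum>i\<in>{1..N}. real (k i) *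
      (\<theta> a * ((if a = b then flow_row k F p i a else 0) - flow_row k F p i a * flow_row k F p i b) * \<theta> b))"
    unfolding quad_form_def flow_cov_def sum_distrib_left sum_distrib_right
    by (intro sum.cong refl) (simp only: mult_ac)
  also have "\<dots> = (\<Sum>i\<in>{1..N}. real (k i) * (\<Sum>a\<in>S. \<Sum>b\<in>S.
      \<theta> a * ((if a = b then flow_row k F p i a else 0) - flow_row k F p i a * flow_row k F p i b) * \<theta> b))"
    unfolding sum_distrib_left by (simp only: sum.swap[of _ "{1..N}" S])
  also have "\<dots> = (\<Sum>i\<in>{1..N}. real (k i) * var i \<theta>)" by (intro sum.cong refl) (simp only: row)
  finally show ?thesis .
qed

lemma var_nonneg: "0 \<le> var i \<theta>"
  unfolding var_def using q_pos by (intro sum_nonneg mult_nonneg_nonneg) (auto simp: in_nbrs_def less_imp_le)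

text \<open>If all variances vanish, the extension of \<open>v\<close> by zero equals the mean \<open>mean i v\<close> at every
  in-neighbour of \<open>i\<close>, so it is constant on components. It vanishes at the deleted vertices, of
  which every component has one.\<close>

lemma cov_pos_definite:
  assumes "\<exists>a\<in>S. v a \<noteq> 0"
  shows "0 < quad_form (flow_cov N k F p) S v"
proof (rule ccontr)
  assume "\<not> ?thesis"
  then have "(\<Sum>i\<in>{1..N}. real (k i) * var i v) \<le> 0" by (simp add: quad_form_cov)
  moreover have nn: "0 \<le> real (k i) * var i v" for i using var_nonneg by simp
  ultimately have "(\<Sum>i\<in>{1..N}. real (k i) * var i v) = 0" by (intro antisym sum_nonneg)
  then have "\<forall>i\<in>{1..N}. real (k i) * var i v = 0" using nn by (simp add: sum_nonneg_eq_0_iff)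
  then have var0: "var i v = 0" if "i \<in> {1..N}" for i
  proof -
    have "real (k i) * var i v = 0" using \<open>\<forall>i\<in>{1..N}. _ i = 0\<close> that by blast
    then show ?thesis using k_pos[OF that] by simp
  qed
  define g where "g = case_sum (\<lambda>i. mean i v) (ext0 v)"
  have edge: "g (Inl i) = g (Inr j)" if ji: "(j, i) \<in> F" for j i
  proof -
    have nn: "0 \<le> q i l * (ext0 v l - mean i v)\<^sup>2" if "l \<in> in_nbrs F i" for l
      using q_pos[of l i] that by (simp add: in_nbrs_def)
    have "(\<Sum>l\<in>in_nbrs F i. q i l * (ext0 v l - mean i v)\<^sup>2) = 0"
      using var0[of i] F_range[OF ji] by (simp add: var_def)
    moreover have "(\<Sum>l\<in>in_nbrs F i. q i l * (ext0 v l - mean i v)\<^sup>2) = 0 \<longleftrightarrow>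
        (\<forall>l\<in>in_nbrs F i. q i l * (ext0 v l - mean i v)\<^sup>2 = 0)"
      by (rule sum_nonneg_eq_0_iff[OF finite_in_nbrs]) (rule nn)
    ultimately have "q i j * (ext0 v j - mean i v)\<^sup>2 = 0" using ji by (simp add: in_nbrs_def)
    then show ?thesis using q_pos[OF ji] by (simp add: g_def)
  qed
  obtain a where a: "a \<in> S" "v a \<noteq> 0" using assms by blast
  obtain r where r: "r \<in> R" "(Inr r, Inr a) \<in> bip_rel" using root_exists[of a] a(1) by (auto simp: S_def)
  have "g (Inr r) = g (Inr a)" by (rule component_invariant[OF edge r(2)])
  then show False using a r(1) by (simp add: g_def ext0_def S_def)
qed

lemma ext0_scale: "ext0 (\<lambda>i\<in>S. \<theta> i / t) j = ext0 \<theta> j / t"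
  by (simp add: ext0_def)

text \<open>The expected counts are the \<open>k j\<close>; this is the stationarity of the minimizer.\<close>

lemma sum_k_mean: "(\<Sum>i\<in>{1..N}. real (k i) * mean i \<theta>) = (\<Sum>j\<in>S. real (k j) * \<theta> j)"
proof -
  have "(\<Sum>i\<in>{1..N}. real (k i) * mean i \<theta>) = (\<Sum>i\<in>{1..N}. \<Sum>j\<in>in_nbrs F i. real (k i) * q i j * ext0 \<theta> j)"
    by (simp add: mean_def sum_distrib_left mult.assoc)
  also have "\<dots> = (\<Sum>j\<in>{1..N}. \<Sum>i\<in>out_nbrs F j. real (k i) * q i j * ext0 \<theta> j)"
    by (simp only: sum_in_nbrs sum_out_nbrs)
  also have "\<dots> = (\<Sum>j\<in>{1..N}. real (k j) * ext0 \<theta> j)"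
    by (intro sum.cong refl) (simp add: sum_distrib_right[symmetric] sum_kq)
  also have "\<dots> = (\<Sum>j\<in>S. real (k j) * \<theta> j)"
    by (rule sum.mono_neutral_cong_right) (auto simp: S_def ext0_def)
  finally show ?thesis .
qed

lemma \<phi>_centred:
  "\<phi> (\<lambda>i\<in>S. \<theta> i / t) = (\<Prod>i\<in>{1..N}. (\<Sum>j\<in>in_nbrs F i. of_real (q i j) * cis ((ext0 \<theta> j - mean i \<theta>) / t)) ^ k i)"
proof -
  have "(\<Sum>j\<in>S. real (k j) * (\<lambda>i\<in>S. \<theta> i / t) j) = (\<Sum>i\<in>{1..N}. real (k i) * (mean i \<theta> / t))"
    using sum_k_mean[of \<theta>] by (simp add: sum_divide_distrib[symmetric] times_divide_eq_right)
  then have "cis (- (\<Sum>j\<in>S. real (k j) * (\<lambda>i\<in>S. \<theta> i / t) j)) = cis (\<Sum>i\<in>{1..N}. real (k i) * (- (mean i \<theta> / t)))"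
    by (simp add: sum_negf)
  also have "\<dots> = (\<Prod>i\<in>{1..N}. cis (- (mean i \<theta> / t)) ^ k i)"
    by (simp only: cis_sum[OF finite_atLeastAtMost] Complex.DeMoivre)
  finally have 1: "cis (- (\<Sum>j\<in>S. real (k j) * (\<lambda>i\<in>S. \<theta> i / t) j)) = (\<Prod>i\<in>{1..N}. cis (- (mean i \<theta> / t)) ^ k i)" .
  have 2: "ch i (\<lambda>i\<in>S. \<theta> i / t) * cis (- (mean i \<theta> / t)) =
      (\<Sum>j\<in>in_nbrs F i. of_real (q i j) * cis ((ext0 \<theta> j - mean i \<theta>) / t))" for i
    unfolding ch_def ext0_scale sum_distrib_right mult.assoc cis_mult by (simp add: diff_divide_distrib)
  show ?thesis unfolding \<phi>_def 1 prod.distrib[symmetric] power_mult_distrib[symmetric] 2 ..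
qed

lemma \<phi>_limit:
  "(\<lambda>m. \<phi> (\<lambda>i\<in>S. \<theta> i / sqrt (real m)) ^ m) \<longlonglongrightarrow>
    complex_of_real (exp (- quad_form (flow_cov N k F p) S \<theta> / 2))"
proof -
  let ?c = "\<lambda>i m. \<Sum>j\<in>in_nbrs F i. of_real (q i j) * cis ((ext0 \<theta> j - mean i \<theta>) / sqrt (real m))"
  have "(\<lambda>m. ?c i m ^ m) \<longlonglongrightarrow> complex_of_real (exp (- var i \<theta> / 2))" if i: "i \<in> {1..N}" for i
    unfolding var_def
  proof (rule cis_power_limit)
    show "(\<Sum>j\<in>in_nbrs F i. q i j * (ext0 \<theta> j - mean i \<theta>)) = 0"
      using sum_q[OF i] by (simp add: right_diff_distrib sum_subtractf sum_distrib_right[symmetric] mean_def)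
    show "(\<Sum>j\<in>in_nbrs F i. q i j) = 1" by (rule sum_q[OF i])
  qed (use q_pos in \<open>auto simp: mem_in_nbrs less_imp_le\<close>)
  then have "(\<lambda>m. \<Prod>i\<in>{1..N}. (?c i m ^ m) ^ k i) \<longlonglongrightarrow> (\<Prod>i\<in>{1..N}. complex_of_real (exp (- var i \<theta> / 2)) ^ k i)"
    by (intro tendsto_prod tendsto_power)
  moreover have "\<phi> (\<lambda>i\<in>S. \<theta> i / sqrt (real m)) ^ m = (\<Prod>i\<in>{1..N}. (?c i m ^ m) ^ k i)" for m
    by (simp add: \<phi>_centred prod_power_distrib power_mult[symmetric] mult.commute)
  moreover have "(\<Prod>i\<in>{1..N}. complex_of_real (exp (- var i \<theta> / 2)) ^ k i) =
      complex_of_real (exp (- quad_form (flow_cov N k F p) S \<theta> / 2))"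
  proof -
    have "(\<Prod>i\<in>{1..N}. exp (- var i \<theta> / 2) ^ k i) = exp (\<Sum>i\<in>{1..N}. real (k i) * (- var i \<theta> / 2))"
      by (simp only: exp_sum[OF finite_atLeastAtMost] exp_of_nat_mult)
    also have "(\<Sum>i\<in>{1..N}. real (k i) * (- var i \<theta> / 2)) = - quad_form (flow_cov N k F p) S \<theta> / 2"
      by (simp add: quad_form_cov sum_negf sum_divide_distrib)
    finally show ?thesis by (simp flip: of_real_power of_real_prod)
  qed
  ultimately show ?thesis by simp
qed

text \<open>The exponent supplied by \<open>norm_convex_cis_le\<close>. It is small only if \<open>\<theta>\<close> is nearly constant,
  modulo the period, on each set of in-neighbours.\<close>

definition \<Psi> :: "(nat \<Rightarrow> real) \<Rightarrow> real" where
  "\<Psi> \<theta> = (\<Sum>i\<in>{1..N}. real (k i) * (\<Sum>j\<in>in_nbrs F i. \<Sum>l\<in>in_nbrs F i. q i j * q i l * (sin ((ext0 \<theta> j - ext0 \<theta> l) / 2))\<^sup>2))"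

lemma norm_\<phi>_le: "cmod (\<phi> \<theta>) \<le> exp (- \<Psi> \<theta>)"
proof -
  let ?s = "\<lambda>i. \<Sum>j\<in>in_nbrs F i. \<Sum>l\<in>in_nbrs F i. q i j * q i l * (sin ((ext0 \<theta> j - ext0 \<theta> l) / 2))\<^sup>2"
  have "cmod (\<phi> \<theta>) = (\<Prod>i\<in>{1..N}. cmod (ch i \<theta>) ^ k i)"
    by (simp add: \<phi>_def norm_mult prod_norm[symmetric] norm_power)
  also have "\<dots> \<le> (\<Prod>i\<in>{1..N}. exp (- ?s i) ^ k i)"
  proof (intro prod_mono conjI power_mono)
    fix i assume i: "i \<in> {1..N}"
    show "cmod (ch i \<theta>) \<le> exp (- ?s i)"
      unfolding ch_def using q_pos
      by (intro norm_convex_cis_le) (auto simp: sum_q[OF i] mem_in_nbrs less_imp_le)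
  qed auto
  also have "\<dots> = exp (\<Sum>i\<in>{1..N}. real (k i) * (- ?s i))"
    by (simp only: exp_sum[OF finite_atLeastAtMost] exp_of_nat_mult)
  also have "(\<Sum>i\<in>{1..N}. real (k i) * (- ?s i)) = - \<Psi> \<theta>" by (simp add: \<Psi>_def sum_negf)
  finally show ?thesis .
qed

lemma \<Psi>_edge_bound:
  obtains \<kappa> where "\<kappa> > 0"
    "\<And>\<theta> i j l. (j, i) \<in> F \<Longrightarrow> (l, i) \<in> F \<Longrightarrow> \<kappa> * (sin ((ext0 \<theta> j - ext0 \<theta> l) / 2))\<^sup>2 \<le> \<Psi> \<theta>"
proof -
  define T where "T = {(i, j, l). (j, i) \<in> F \<and> (l, i) \<in> F}"
  have "T \<subseteq> {1..N} \<times> {1..N} \<times> {1..N}" using F_range by (auto simp: T_def)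
  then have T: "finite T" by (rule finite_subset) auto
  define w where "w t = (case t of (i, j, l) \<Rightarrow> real (k i) * q i j * q i l)" for t
  define \<kappa> where "\<kappa> = Min (insert 1 (w ` T))"
  have w: "0 < w t" if "t \<in> T" for t
    using that q_pos k_pos F_range by (auto simp: T_def w_def intro!: mult_pos_pos)
  then have "0 < \<kappa>" unfolding \<kappa>_def using T by (subst Min_gr_iff) auto
  moreover have "\<kappa> * (sin ((ext0 \<theta> j - ext0 \<theta> l) / 2))\<^sup>2 \<le> \<Psi> \<theta>" if ji: "(j, i) \<in> F" and li: "(l, i) \<in> F" for \<theta> i j l
  proof -
    let ?t = "\<lambda>i j l. q i j * q i l * (sin ((ext0 \<theta> j - ext0 \<theta> l) / 2))\<^sup>2"
    have nn: "0 \<le> ?t i j l" if "j \<in> in_nbrs F i" "l \<in> in_nbrs F i" for i j l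
      using q_pos that by (auto simp: in_nbrs_def less_imp_le intro!: mult_nonneg_nonneg)
    have j: "j \<in> in_nbrs F i" and l: "l \<in> in_nbrs F i" using ji li by (auto simp: in_nbrs_def)
    have "\<kappa> \<le> w (i, j, l)" unfolding \<kappa>_def using T ji li by (intro Min_le) (auto simp: T_def)
    then have "\<kappa> * (sin ((ext0 \<theta> j - ext0 \<theta> l) / 2))\<^sup>2 \<le> real (k i) * q i j * q i l * (sin ((ext0 \<theta> j - ext0 \<theta> l) / 2))\<^sup>2"
      unfolding w_def by (intro mult_right_mono) auto
    also have "\<dots> = real (k i) * ?t i j l" by simp
    also have "?t i j l \<le> (\<Sum>l\<in>in_nbrs F i. ?t i j l)"
      using l nn[OF j] by (intro member_le_sum[of l _ "\<lambda>l. ?t i j l"]) auto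
    also have "\<dots> \<le> (\<Sum>j\<in>in_nbrs F i. \<Sum>l\<in>in_nbrs F i. ?t i j l)"
      using j nn by (intro member_le_sum[of j _ "\<lambda>j. \<Sum>l\<in>in_nbrs F i. ?t i j l"]) (auto intro!: sum_nonneg)
    also have "real (k i) * (\<Sum>j\<in>in_nbrs F i. \<Sum>l\<in>in_nbrs F i. ?t i j l) \<le> \<Psi> \<theta>"
      unfolding \<Psi>_def using F_range[OF ji] q_pos
      by (intro member_le_sum[of i _ "\<lambda>i. real (k i) * (\<Sum>j\<in>in_nbrs F i. \<Sum>l\<in>in_nbrs F i. ?t i j l)"])
        (auto intro!: sum_nonneg mult_nonneg_nonneg simp: mem_in_nbrs less_imp_le)
    finally show ?thesis by (simp add: mult_left_mono)
  qed
  ultimately show ?thesis using that by blast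
qed

text \<open>If \<open>\<Psi> \<theta>\<close> is small, the functions \<open>|sin ((\<theta> j - \<theta> l)/2)|\<close> are small for \<open>j, l\<close> with a common
  out-neighbour. They satisfy the triangle inequality, so by \<open>path_bound\<close> they are small
  throughout a component. Taking \<open>l\<close> to be the deleted vertex, where \<open>\<theta>\<close> is zero, bounds
  \<open>|sin (\<theta> j / 2)|\<close> and thus \<open>|\<theta> j|\<close> on the cube.\<close>

lemma \<phi>_gaussian_bound:
  obtains c where "c > 0" "\<And>\<theta>. (\<And>i. i \<in> S \<Longrightarrow> \<bar>\<theta> i\<bar> \<le> pi) \<Longrightarrow> cmod (\<phi> \<theta>) \<le> exp (- c * (\<Sum>i\<in>S. (\<theta> i)\<^sup>2))"
proof -
  obtain \<kappa> where \<kappa>: "\<kappa> > 0"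
    "\<And>\<theta> i j l. (j, i) \<in> F \<Longrightarrow> (l, i) \<in> F \<Longrightarrow> \<kappa> * (sin ((ext0 \<theta> j - ext0 \<theta> l) / 2))\<^sup>2 \<le> \<Psi> \<theta>"
    using \<Psi>_edge_bound by blast
  obtain B where B: "B > 0"
    "\<And>(d :: nat + nat \<Rightarrow> nat + nat \<Rightarrow> real) u v. (\<And>v. d v v = 0) \<Longrightarrow> (\<And>u v w. d u w \<le> d u v + d v w) \<Longrightarrow>
      (\<And>u v. (u, v) \<in> bip_adj F \<Longrightarrow> d u v \<le> 1) \<Longrightarrow> (u, v) \<in> bip_rel \<Longrightarrow> d u v \<le> B"
    using path_bound by blast
  define nb where "nb i = (SOME j. j \<in> in_nbrs F i)" for i
  have nb: "(nb i, i) \<in> F" if "i \<in> {1..N}" for i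
    using in_nbrs_nonempty[OF that] some_in_eq[of "in_nbrs F i"] by (simp add: nb_def in_nbrs_def)
  have \<Psi>_nonneg: "0 \<le> \<Psi> \<theta>" for \<theta>
    unfolding \<Psi>_def using q_pos
    by (intro sum_nonneg mult_nonneg_nonneg) (auto simp: in_nbrs_def less_imp_le)
  have coord: "\<bar>\<theta> j\<bar> / 4 \<le> B * \<delta>" if \<theta>: "\<bar>\<theta> j\<bar> \<le> pi" and j: "j \<in> S" and \<delta>: "\<delta> > 0" "\<Psi> \<theta> \<le> \<kappa> * \<delta>\<^sup>2" for \<theta> j \<delta>
  proof -
    \<comment> \<open>A left vertex inherits the angle of one of its in-neighbours, so that all edges are short.\<close>
    define h where "h = case_sum (\<lambda>i. ext0 \<theta> (nb i)) (ext0 \<theta>)"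
    define d where "d u v = \<bar>sin ((h u - h v) / 2)\<bar> / \<delta>" for u v
    have edge: "\<bar>sin ((ext0 \<theta> j - ext0 \<theta> l) / 2)\<bar> \<le> \<delta>" if "(j, i) \<in> F" "(l, i) \<in> F" for i j l
    proof -
      have "\<kappa> * (sin ((ext0 \<theta> j - ext0 \<theta> l) / 2))\<^sup>2 \<le> \<kappa> * \<delta>\<^sup>2"
        using \<kappa>(2)[OF that, of \<theta>] \<delta>(2) by simp
      then have "\<bar>sin ((ext0 \<theta> j - ext0 \<theta> l) / 2)\<bar>\<^sup>2 \<le> \<delta>\<^sup>2" using \<kappa>(1) by simp
      then show ?thesis by (rule power2_le_imp_le) (use \<delta>(1) in simp)
    qed
    have dB: "d u v \<le> B" if "(u, v) \<in> bip_rel" for u v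
    proof (rule B(2)[OF _ _ _ that])
      show "d v v = 0" for v by (simp add: d_def)
      show "d u w \<le> d u v + d v w" for u v w
      proof -
        have "\<bar>sin ((h u - h v) / 2 + (h v - h w) / 2)\<bar> \<le> \<bar>sin ((h u - h v) / 2)\<bar> + \<bar>sin ((h v - h w) / 2)\<bar>"
          by (rule abs_sin_add_le)
        then have "\<bar>sin ((h u - h w) / 2)\<bar> \<le> \<bar>sin ((h u - h v) / 2)\<bar> + \<bar>sin ((h v - h w) / 2)\<bar>"
          by (simp add: add_divide_distrib[symmetric])
        then show ?thesis using \<delta>(1) unfolding d_def add_divide_distrib[symmetric] by (intro divide_right_mono) auto
      qed
      show "d u v \<le> 1" if adj: "(u, v) \<in> bip_adj F" for u v
      proof -
        have "\<bar>sin ((h u - h v) / 2)\<bar> \<le> \<delta>"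
        proof -
          obtain j i where ji: "(j, i) \<in> F" and uv: "(u, v) = (Inl i, Inr j) \<or> (u, v) = (Inr j, Inl i)"
            using adj unfolding bip_adj_def by blast
          have "(nb i, i) \<in> F" using nb F_range[OF ji] by blast
          then show ?thesis using uv edge[OF _ ji, of "nb i"] edge[OF ji, of "nb i"] by (auto simp: h_def)
        qed
        then show ?thesis using \<delta>(1) by (simp add: d_def)
      qed
    qed
    obtain r where r: "r \<in> R" "(Inr r, Inr j) \<in> bip_rel" using root_exists[of j] j by (auto simp: S_def)
    have "d (Inr r) (Inr j) = \<bar>sin (\<theta> j / 2)\<bar> / \<delta>"
      using r(1) j by (simp add: d_def h_def ext0_def S_def)
    then have "\<bar>sin (\<theta> j / 2)\<bar> \<le> B * \<delta>" using mult_left_mono[OF dB[OF r(2)], of \<delta>] \<delta>(1) by (simp add: mult.commute)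
    then show ?thesis using abs_le_sin_half[OF \<theta>] by simp
  qed
  have sq: "\<kappa> / (16 * B\<^sup>2) * (\<theta> j)\<^sup>2 \<le> \<Psi> \<theta>" if \<theta>: "\<bar>\<theta> j\<bar> \<le> pi" and j: "j \<in> S" for \<theta> j
  proof (rule ccontr)
    assume neg: "\<not> ?thesis"
    define t where "t = sqrt (\<Psi> \<theta> / \<kappa>)"
    have t: "0 \<le> t" "\<kappa> * t\<^sup>2 = \<Psi> \<theta>" using \<Psi>_nonneg[of \<theta>] \<kappa>(1) by (auto simp: t_def)
    have lt: "t < \<bar>\<theta> j\<bar> / (4 * B)"
    proof (rule power2_less_imp_less)
      have "\<kappa> * t\<^sup>2 < \<kappa> * (\<bar>\<theta> j\<bar> / (4 * B))\<^sup>2"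
        using neg by (simp add: t(2) power_divide power_mult_distrib)
      then show "t\<^sup>2 < (\<bar>\<theta> j\<bar> / (4 * B))\<^sup>2" using \<kappa>(1) by simp
    qed (use B(1) in auto)
    \<comment> \<open>A number strictly between the two, as \<open>coord\<close> needs a positive bound and \<open>t\<close> may be zero.\<close>
    define \<epsilon> where "\<epsilon> = (t + \<bar>\<theta> j\<bar> / (4 * B)) / 2"
    have e: "t < \<epsilon>" "\<epsilon> < \<bar>\<theta> j\<bar> / (4 * B)" using lt by (auto simp: \<epsilon>_def)
    have "\<kappa> * t\<^sup>2 \<le> \<kappa> * \<epsilon>\<^sup>2" using e(1) t(1) \<kappa>(1) by (intro mult_left_mono power_mono) auto
    then have "\<bar>\<theta> j\<bar> / 4 \<le> B * \<epsilon>" using coord[of \<theta> j \<epsilon>] \<theta> j e(1) t by simp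
    moreover have "B * \<epsilon> < \<bar>\<theta> j\<bar> / 4" using e(2) B(1) by (simp add: field_simps)
    ultimately show False by simp
  qed
  \<comment> \<open>Averaging over \<open>S\<close>; the summand \<open>1\<close> covers the case that \<open>S\<close> is empty.\<close>
  define c where "c = \<kappa> / (16 * B\<^sup>2) / (1 + card S)"
  have "c > 0" using \<kappa>(1) B(1) by (simp add: c_def)
  moreover have "cmod (\<phi> \<theta>) \<le> exp (- c * (\<Sum>i\<in>S. (\<theta> i)\<^sup>2))" if \<theta>: "\<And>i. i \<in> S \<Longrightarrow> \<bar>\<theta> i\<bar> \<le> pi" for \<theta>
  proof -
    have "\<kappa> / (16 * B\<^sup>2) * (\<Sum>i\<in>S. (\<theta> i)\<^sup>2) \<le> (\<Sum>i\<in>S. \<Psi> \<theta>)"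
      unfolding sum_distrib_left using \<theta> by (intro sum_mono sq) auto
    also have "\<dots> \<le> (1 + card S) * \<Psi> \<theta>" using \<Psi>_nonneg[of \<theta>] by (simp add: algebra_simps)
    finally have "\<kappa> / (16 * B\<^sup>2) * (\<Sum>i\<in>S. (\<theta> i)\<^sup>2) / (1 + card S) \<le> \<Psi> \<theta>"
      by (subst pos_divide_le_eq) (auto simp: mult.commute)
    then have "c * (\<Sum>i\<in>S. (\<theta> i)\<^sup>2) \<le> \<Psi> \<theta>" by (simp add: c_def)
    then show ?thesis using norm_\<phi>_le[of \<theta>] by (smt (verit) exp_le_cancel_iff mult_minus_left)
  qed
  ultimately show ?thesis using that by blast
qed

lemma \<phi>_measurable: "\<phi> \<in> borel_measurable (Pi\<^sub>M S (\<lambda>_. lborel))"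
proof -
  have e: "(\<lambda>\<theta>. ext0 \<theta> j) \<in> borel_measurable (Pi\<^sub>M S (\<lambda>_. lborel))" for j
    by (cases "j \<in> S") (simp_all add: ext0_def)
  have cis_m: "cis \<in> borel_measurable borel"
    by (intro borel_measurable_continuous_onI continuous_intros)
  have c: "(\<lambda>\<theta>. cis (g \<theta>)) \<in> borel_measurable (Pi\<^sub>M S (\<lambda>_. lborel))"
    if "g \<in> borel_measurable (Pi\<^sub>M S (\<lambda>_. lborel))" for g
    by (rule measurable_compose[OF that cis_m])
  show ?thesis unfolding \<phi>_def[abs_def] ch_def
    by (intro borel_measurable_times borel_measurable_prod borel_measurable_power borel_measurable_sum
        borel_measurable_const c e borel_measurable_uminus) auto
qed

lemma list_mat_reduced_cov:
  "list_mat (flow_cov N k F p) (sorted_list_of_set S) = reduced_cov N k F p R"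
  by (simp add: list_mat_def reduced_cov_def principal_submatrix_def S_def)

lemma cov_sym: "flow_cov N k F p j l = flow_cov N k F p l j"
  unfolding flow_cov_def by (intro sum.cong refl) (auto simp: mult.commute)

lemma reduced_cov_det_pos: "0 < reduced_cov_det N k F p R"
  unfolding reduced_cov_det_def list_mat_reduced_cov[symmetric]
  using nn_integral_gaussian[of "sorted_list_of_set S" "flow_cov N k F p"] cov_sym cov_pos_definite by auto

text \<open>The number of balanced assignments is the integral of \<open>fourier_inversion\<close>, whose asymptotics
  \<open>laplace_principle\<close> gives.\<close>

theorem local_limit:
  "(\<lambda>m. real (card (bal m)) / cap ^ m * sqrt (2 * pi * real m) ^ card S) \<longlonglongrightarrow>
    1 / sqrt (reduced_cov_det N k F p R)"
proof -
  obtain c where c: "c > 0" "\<And>\<theta>. (\<And>i. i \<in> S \<Longrightarrow> \<bar>\<theta> i\<bar> \<le> pi) \<Longrightarrow> cmod (\<phi> \<theta>) \<le> exp (- c * (\<Sum>i\<in>S. (\<theta> i)\<^sup>2))"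
    using \<phi>_gaussian_bound by blast
  have "(\<lambda>m. complex_of_real (sqrt (real m) ^ card S) *
      (\<integral>\<theta>. indicator {\<theta>. \<forall>i\<in>S. \<bar>\<theta> i\<bar> \<le> pi} \<theta> *\<^sub>R \<phi> \<theta> ^ m \<partial>Pi\<^sub>M S (\<lambda>_. lborel))) \<longlonglongrightarrow>
    complex_of_real (sqrt (2 * pi) ^ card S / sqrt (Determinant.det (list_mat (flow_cov N k F p) (sorted_list_of_set S))))"
    by (rule laplace_principle[OF _ _ cov_sym cov_pos_definite \<phi>_measurable c _ \<phi>_limit]) auto
  then have "(\<lambda>m. complex_of_real (sqrt (real m) ^ card S * ((2 * pi) ^ card S * (real (card (bal m)) / cap ^ m)))) \<longlonglongrightarrow>
    complex_of_real (sqrt (2 * pi) ^ card S / sqrt (reduced_cov_det N k F p R))"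
    unfolding fourier_inversion list_mat_reduced_cov reduced_cov_det_def[symmetric] of_real_mult[symmetric] .
  then have "(\<lambda>m. sqrt (real m) ^ card S * ((2 * pi) ^ card S * (real (card (bal m)) / cap ^ m))) \<longlonglongrightarrow>
    sqrt (2 * pi) ^ card S / sqrt (reduced_cov_det N k F p R)"
    by (simp only: tendsto_of_real_iff)
  then have "(\<lambda>m. sqrt (real m) ^ card S * ((2 * pi) ^ card S * (real (card (bal m)) / cap ^ m)) / sqrt (2 * pi) ^ card S) \<longlonglongrightarrow>
    sqrt (2 * pi) ^ card S / sqrt (reduced_cov_det N k F p R) / sqrt (2 * pi) ^ card S"
    by (intro tendsto_divide tendsto_const) auto
  moreover have "sqrt (real m) ^ card S * ((2 * pi) ^ card S * D) / sqrt (2 * pi) ^ card S =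
      D * sqrt (2 * pi * real m) ^ card S" for m and D :: real
  proof -
    have "(2 * pi) ^ card S = sqrt (2 * pi) ^ card S * sqrt (2 * pi) ^ card S"
      unfolding power_mult_distrib[symmetric] by (rule arg_cong[where f = "\<lambda>x. x ^ card S"]) simp
    then show ?thesis by (simp add: real_sqrt_mult power_mult_distrib)
  qed
  ultimately have "(\<lambda>m. real (card (bal m)) / cap ^ m * sqrt (2 * pi * real m) ^ card S) \<longlonglongrightarrow>
      sqrt (2 * pi) ^ card S / sqrt (reduced_cov_det N k F p R) / sqrt (2 * pi) ^ card S"
    by (simp only:)
  then show ?thesis by simp
qed

end

section \<open>Exact-support factors as assignments\<close>

lemma fact_prod_decrement:
  assumes "finite J" "j \<in> J" "0 < a j"
  shows "(\<Prod>l\<in>J. fact (a l) :: real) = real (a j) * (\<Prod>l\<in>J. fact ((a(j := a j - 1)) l))"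
proof -
  have "(\<Prod>l\<in>J - {j}. fact (a l) :: real) = (\<Prod>l\<in>J - {j}. fact ((a(j := a j - 1)) l))"
    by (intro prod.cong) auto
  moreover have "fact (a j) = real (a j) * fact (a j - 1)" using assms(3) by (rule fact_reduce)
  ultimately show ?thesis using assms(1,2) by (simp add: prod.remove[of J j])
qed

text \<open>The multinomial coefficient. Fixing the value \<open>j\<close> of one more argument lowers \<open>a j\<close> by one,
  which changes the multinomial coefficient by a factor proportional to \<open>a j\<close>.\<close>

lemma card_functions_with_fibre_sizes:
  assumes "finite A" "finite J" "(\<Sum>j\<in>J. a j) = card A"
  shows "real (card {\<sigma> \<in> A \<rightarrow>\<^sub>E J. \<forall>j\<in>J. card {s \<in> A. \<sigma> s = j} = a j}) =
    fact (card A) / (\<Prod>j\<in>J. fact (a j))"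
  using assms(1,3)
proof (induction A arbitrary: a rule: finite_induct)
  case empty
  then have "\<forall>j\<in>J. a j = 0" using assms(2) by simp
  then show ?case by simp
next
  case (insert e A)
  let ?X = "{\<sigma> \<in> insert e A \<rightarrow>\<^sub>E J. \<forall>j\<in>J. card {s \<in> insert e A. \<sigma> s = j} = a j}"
  let ?Y = "\<lambda>a. {\<sigma> \<in> A \<rightarrow>\<^sub>E J. \<forall>j\<in>J. card {s \<in> A. \<sigma> s = j} = a j}"
  have fin: "finite ?X" using insert.hyps(1) assms(2) by (intro finite_subset[OF _ finite_PiE[of "insert e A" "\<lambda>_. J"]]) auto
  have part: "real (card {\<sigma> \<in> ?X. \<sigma> e = j}) = fact (card A) * real (a j) / (\<Prod>l\<in>J. fact (a l))"
    if j: "j \<in> J" for j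
  proof -
    have fib: "card {s \<in> insert e A. \<sigma> s = l} = (if \<sigma> e = l then 1 else 0) + card {s \<in> A. \<sigma> s = l}" for \<sigma> :: "'a \<Rightarrow> 'b" and l
    proof -
      have "{s \<in> insert e A. \<sigma> s = l} = (if \<sigma> e = l then insert e {s \<in> A. \<sigma> s = l} else {s \<in> A. \<sigma> s = l})"
        by auto
      then show ?thesis using insert.hyps by simp
    qed
    show ?thesis
    proof (cases "a j = 0")
      case True
      have "{\<sigma> \<in> ?X. \<sigma> e = j} = {}"
      proof (rule equals0I)
        fix \<sigma> assume s: "\<sigma> \<in> {\<sigma> \<in> ?X. \<sigma> e = j}"
        then have "card {s \<in> insert e A. \<sigma> s = j} = a j" using j by blast
        moreover have "\<sigma> e = j" using s by blast
        ultimately show False using fib[of \<sigma> j] True by simp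
      qed
      then show ?thesis using True by (simp only: card.empty)
    next
      case False
      let ?b = "a(j := a j - 1)"
      have "bij_betw (\<lambda>\<sigma>. restrict \<sigma> A) {\<sigma> \<in> ?X. \<sigma> e = j} (?Y ?b)"
      proof (rule bij_betw_byWitness[where f' = "\<lambda>\<sigma>. \<sigma>(e := j)"])
        show "\<forall>\<sigma>\<in>{\<sigma> \<in> ?X. \<sigma> e = j}. (restrict \<sigma> A)(e := j) = \<sigma>"
          by (auto simp: fun_eq_iff PiE_def extensional_def)
        show "\<forall>\<sigma>\<in>?Y ?b. restrict (\<sigma>(e := j)) A = \<sigma>"
          using insert.hyps(2) by (auto simp: fun_eq_iff PiE_def extensional_def)
        show "(\<lambda>\<sigma>. restrict \<sigma> A) ` {\<sigma> \<in> ?X. \<sigma> e = j} \<subseteq> ?Y ?b"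
        proof (rule image_subsetI)
          fix \<sigma> assume s: "\<sigma> \<in> {\<sigma> \<in> ?X. \<sigma> e = j}"
          have "card {s \<in> A. restrict \<sigma> A s = l} = ?b l" if l: "l \<in> J" for l
          proof -
            have "{s \<in> A. restrict \<sigma> A s = l} = {s \<in> A. \<sigma> s = l}" by auto
            moreover have "card {s \<in> insert e A. \<sigma> s = l} = a l" using s l by blast
            moreover have "\<sigma> e = j" using s by blast
            ultimately show ?thesis using fib[of \<sigma> l] by auto
          qed
          moreover have "restrict \<sigma> A \<in> A \<rightarrow>\<^sub>E J" using s by (auto simp: PiE_def Pi_def)
          ultimately show "restrict \<sigma> A \<in> ?Y ?b" by blast
        qed
        show "(\<lambda>\<sigma>. \<sigma>(e := j)) ` ?Y ?b \<subseteq> {\<sigma> \<in> ?X. \<sigma> e = j}"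
        proof (rule image_subsetI)
          fix \<sigma> assume s: "\<sigma> \<in> ?Y ?b"
          have "card {s \<in> insert e A. (\<sigma>(e := j)) s = l} = a l" if l: "l \<in> J" for l
          proof -
            have "{s \<in> A. (\<sigma>(e := j)) s = l} = {s \<in> A. \<sigma> s = l}" using insert.hyps(2) by auto
            moreover have "card {s \<in> A. \<sigma> s = l} = ?b l" using s l by blast
            ultimately show ?thesis using fib[of "\<sigma>(e := j)" l] False by (auto split: if_splits)
          qed
          moreover have "\<sigma>(e := j) \<in> insert e A \<rightarrow>\<^sub>E J" using s j by (intro PiE_fun_upd) auto
          ultimately show "\<sigma>(e := j) \<in> {\<sigma> \<in> ?X. \<sigma> e = j}" by simp
        qed
      qed
      then have "card {\<sigma> \<in> ?X. \<sigma> e = j} = card (?Y ?b)" by (rule bij_betw_same_card)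
      moreover have "(\<Sum>l\<in>J. ?b l) = card A"
      proof -
        note sum.remove[OF assms(2) j, of a] sum.remove[OF assms(2) j, of ?b]
        moreover have "(\<Sum>l\<in>J - {j}. ?b l) = (\<Sum>l\<in>J - {j}. a l)" by (intro sum.cong) auto
        ultimately show ?thesis using insert.prems insert.hyps False by simp
      qed
      then have "real (card (?Y ?b)) = fact (card A) / (\<Prod>l\<in>J. fact (?b l))" by (rule insert.IH)
      ultimately show ?thesis
        using fact_prod_decrement[OF assms(2) j, of a] False by simp
    qed
  qed
  have "card ?X = (\<Sum>j\<in>J. card {\<sigma> \<in> ?X. \<sigma> e = j})"
  proof -
    have "(\<Sum>j\<in>J. \<Sum>\<sigma>\<in>{\<sigma> \<in> ?X. \<sigma> e = j}. 1::nat) = (\<Sum>\<sigma>\<in>?X. 1)"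
      by (rule sum.group[OF fin assms(2)]) auto
    then show ?thesis by (simp only: card_eq_sum)
  qed
  then have "real (card ?X) = (\<Sum>j\<in>J. fact (card A) * real (a j) / (\<Prod>l\<in>J. fact (a l)))"
    using part by simp
  also have "\<dots> = fact (card A) * real (\<Sum>j\<in>J. a j) / (\<Prod>l\<in>J. fact (a l))"
    by (simp add: sum_distrib_left sum_divide_distrib)
  also have "\<dots> = fact (card (insert e A)) / (\<Prod>l\<in>J. fact (a l))"
    using insert.hyps insert.prems by (simp add: mult.commute)
  finally show ?case .
qed

text \<open>A function on pairs is a family of functions, one for each first component, and the
  conditions for different first components are independent.\<close>

lemma card_functions_with_fibre_table:
  fixes A :: "'i \<Rightarrow> 's set" and a :: "'j \<Rightarrow> 'i \<Rightarrow> nat"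
  assumes "finite I" "\<And>i. i \<in> I \<Longrightarrow> finite (A i)" "finite J" "\<And>i. i \<in> I \<Longrightarrow> (\<Sum>j\<in>J. a j i) = card (A i)"
  shows "real (card {\<sigma> \<in> (SIGMA i:I. A i) \<rightarrow>\<^sub>E J. \<forall>i\<in>I. \<forall>j\<in>J. card {s \<in> A i. \<sigma> (i, s) = j} = a j i}) =
    (\<Prod>i\<in>I. fact (card (A i)) / (\<Prod>j\<in>J. fact (a j i)))"
proof -
  let ?X = "{\<sigma> \<in> (SIGMA i:I. A i) \<rightarrow>\<^sub>E J. \<forall>i\<in>I. \<forall>j\<in>J. card {s \<in> A i. \<sigma> (i, s) = j} = a j i}"
  let ?Y = "\<lambda>i. {\<sigma> \<in> A i \<rightarrow>\<^sub>E J. \<forall>j\<in>J. card {s \<in> A i. \<sigma> s = j} = a j i}"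
  let ?c = "\<lambda>\<sigma>. \<lambda>i\<in>I. \<lambda>s\<in>A i. \<sigma> (i, s)"
  let ?u = "\<lambda>f. \<lambda>e\<in>(SIGMA i:I. A i). f (fst e) (snd e)"
  have "bij_betw ?c ?X (\<Pi>\<^sub>E i\<in>I. ?Y i)"
  proof (rule bij_betw_byWitness[where f' = ?u])
    show "\<forall>\<sigma>\<in>?X. ?u (?c \<sigma>) = \<sigma>"
      by (auto simp: fun_eq_iff PiE_def extensional_def)
    show "\<forall>f\<in>(\<Pi>\<^sub>E i\<in>I. ?Y i). ?c (?u f) = f"
    proof
      fix f assume f: "f \<in> (\<Pi>\<^sub>E i\<in>I. ?Y i)"
      have in_I: "f i s = undefined" if "i \<in> I" "s \<notin> A i" for i s
        using PiE_mem[OF f that(1)] that(2) by (auto simp: PiE_def extensional_def)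
      have out_I: "f i = undefined" if "i \<notin> I" for i using f that by (auto simp: PiE_def extensional_def)
      show "?c (?u f) = f" by (intro ext) (auto simp: in_I out_I)
    qed
    show "?c ` ?X \<subseteq> (\<Pi>\<^sub>E i\<in>I. ?Y i)"
    proof (rule image_subsetI)
      fix \<sigma> assume s: "\<sigma> \<in> ?X"
      have "(\<lambda>s\<in>A i. \<sigma> (i, s)) \<in> ?Y i" if i: "i \<in> I" for i
      proof -
        have "{s \<in> A i. (\<lambda>s\<in>A i. \<sigma> (i, s)) s = j} = {s \<in> A i. \<sigma> (i, s) = j}" for j by auto
        moreover have "(\<lambda>s\<in>A i. \<sigma> (i, s)) \<in> A i \<rightarrow>\<^sub>E J" using s i by (auto simp: PiE_def Pi_def)
        ultimately show ?thesis using s i by simp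
      qed
      then show "?c \<sigma> \<in> (\<Pi>\<^sub>E i\<in>I. ?Y i)" by (intro restrict_PiE_iff[THEN iffD2] ballI)
    qed
    show "?u ` (\<Pi>\<^sub>E i\<in>I. ?Y i) \<subseteq> ?X"
    proof (rule image_subsetI)
      fix f assume f: "f \<in> (\<Pi>\<^sub>E i\<in>I. ?Y i)"
      have fi: "f i \<in> ?Y i" if "i \<in> I" for i using f that by (rule PiE_mem)
      have "{s \<in> A i. ?u f (i, s) = j} = {s \<in> A i. f i s = j}" if "i \<in> I" for i j using that by auto
      then have "\<forall>i\<in>I. \<forall>j\<in>J. card {s \<in> A i. ?u f (i, s) = j} = a j i" using fi by simp
      moreover have "?u f \<in> (SIGMA i:I. A i) \<rightarrow>\<^sub>E J"
        using fi by (auto simp: PiE_def Pi_def)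
      ultimately show "?u f \<in> ?X" by blast
    qed
  qed
  then have "card ?X = card (\<Pi>\<^sub>E i\<in>I. ?Y i)" by (rule bij_betw_same_card)
  also have "\<dots> = (\<Prod>i\<in>I. card (?Y i))" by (rule card_PiE[OF assms(1)])
  finally have "real (card ?X) = (\<Prod>i\<in>I. real (card (?Y i)))" by simp
  also have "\<dots> = (\<Prod>i\<in>I. fact (card (A i)) / (\<Prod>j\<in>J. fact (a j i)))"
    by (intro prod.cong refl card_functions_with_fibre_sizes assms)
  finally show ?thesis .
qed

context game
begin

text \<open>How many factors \<open>L\<^sub>i\<close> choose the variable \<open>z\<^sub>j\<close>.\<close>

definition cell :: "(nat \<times> nat \<Rightarrow> nat) \<Rightarrow> nat \<Rightarrow> nat \<Rightarrow> nat" where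
  "cell \<sigma> j i = card {s \<in> {1..k i}. \<sigma> (i, s) = j}"

definition covering :: "(nat \<times> nat \<Rightarrow> nat) set" where
  "covering = {\<sigma> \<in> balanced. \<forall>(j, i)\<in>F. 0 < cell \<sigma> j i}"

lemma E_Sigma: "E = (SIGMA i:{1..N}. {1..k i})"
  by (auto simp: unknowns_def)

lemma card_fibre: "card (fibre \<sigma> j) = (\<Sum>i\<in>{1..N}. cell \<sigma> j i)"
proof -
  have "fibre \<sigma> j = (SIGMA i:{1..N}. {s \<in> {1..k i}. \<sigma> (i, s) = j})"
    by (auto simp: fibre_def E_Sigma)
  then show ?thesis by (simp add: cell_def)
qed

lemma assignments_edge: "\<sigma> \<in> assignments \<Longrightarrow> i \<in> {1..N} \<Longrightarrow> s \<in> {1..k i} \<Longrightarrow> (\<sigma> (i, s), i) \<in> F"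
  using PiE_mem[of \<sigma> E nbrs "(i, s)"] by (simp add: assignments_def unknowns_def in_nbrs_def)

lemma cell_outside:
  assumes "\<sigma> \<in> assignments" "i \<in> {1..N}" "(j, i) \<notin> F"
  shows "cell \<sigma> j i = 0"
  using assignments_edge[OF assms(1,2)] assms(3) by (auto simp: cell_def)

lemma sum_cell:
  assumes "\<sigma> \<in> assignments" "i \<in> {1..N}"
  shows "(\<Sum>j\<in>{1..N}. cell \<sigma> j i) = k i"
proof -
  have "(\<Sum>j\<in>{1..N}. \<Sum>s\<in>{s \<in> {1..k i}. \<sigma> (i, s) = j}. 1::nat) = (\<Sum>s\<in>{1..k i}. 1)"
  proof (rule sum.group)
    show "(\<lambda>s. \<sigma> (i, s)) ` {1..k i} \<subseteq> {1..N}"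
      using assignments_edge[OF assms] F unfolding arcs_def by blast
  qed auto
  then have "(\<Sum>j\<in>{1..N}. card {s \<in> {1..k i}. \<sigma> (i, s) = j}) = card {1..k i}" by (simp only: card_eq_sum)
  then show ?thesis by (simp add: cell_def)
qed

lemma finite_balanced_factors: "finite (balanced_factors N k)"
proof (rule finite_subset)
  have fin: "finite (arcs N)" by (rule finite_subset[of _ "{1..N} \<times> {1..N}"]) (auto simp: arcs_def)
  show "finite (\<Pi>\<^sub>E e\<in>arcs N. {..k (snd e)})" using fin by (intro finite_PiE) auto
  show "balanced_factors N k \<subseteq> (\<Pi>\<^sub>E e\<in>arcs N. {..k (snd e)})"
  proof
    fix a assume a: "a \<in> balanced_factors N k"
    have "a e \<le> k (snd e)" if e: "e \<in> arcs N" for e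
    proof -
      have "a (fst e, snd e) \<le> (\<Sum>j\<in>{1..N} - {snd e}. a (j, snd e))"
        using e by (intro member_le_sum[of "fst e" _ "\<lambda>j. a (j, snd e)"]) (auto simp: arcs_def)
      also have "\<dots> = k (snd e)" using a e by (auto simp: balanced_factors_def arcs_def)
      finally show ?thesis by simp
    qed
    moreover have "a \<in> extensional (arcs N)" using a by (simp add: balanced_factors_def PiE_def)
    ultimately show "a \<in> (\<Pi>\<^sub>E e\<in>arcs N. {..k (snd e)})" by (simp add: PiE_iff)
  qed
qed

text \<open>The tables \<open>cell \<sigma>\<close> of the balanced assignments \<open>\<sigma>\<close> are balanced factors, and
  \<open>factor_weight\<close>, a product of multinomial coefficients, counts the assignments with a given
  table. The support of the table is \<open>F\<close> exactly if every arc of \<open>F\<close> is used.\<close>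

theorem exact_support_weight_eq: "exact_support_weight N k F = real (card covering)"
proof -
  let ?A = "{a \<in> balanced_factors N k. {e \<in> arcs N. 0 < a e} = F}"
  define tab where "tab \<sigma> = (\<lambda>(j, i)\<in>arcs N. cell \<sigma> j i)" for \<sigma>
  have diag: "(i, i) \<notin> F" for i using F by (auto simp: arcs_def)
  have cov: "\<sigma> \<in> assignments" "\<And>j. j \<in> {1..N} \<Longrightarrow> (\<Sum>i\<in>{1..N}. cell \<sigma> j i) = k j"
    "\<And>j i. (j, i) \<in> F \<Longrightarrow> 0 < cell \<sigma> j i" if "\<sigma> \<in> covering" for \<sigma>
    using that by (auto simp: covering_def balanced_def card_fibre)
  have tab_in: "tab \<sigma> \<in> ?A" if s: "\<sigma> \<in> covering" for \<sigma>
  proof -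
    have "(\<Sum>j\<in>{1..N} - {i}. tab \<sigma> (j, i)) = k i" if i: "i \<in> {1..N}" for i
    proof -
      have "(\<Sum>j\<in>{1..N} - {i}. tab \<sigma> (j, i)) = (\<Sum>j\<in>{1..N}. cell \<sigma> j i)"
        by (rule sum.mono_neutral_cong_left)
          (use i cell_outside[OF cov(1)[OF s] i diag] in \<open>auto simp: tab_def arcs_def\<close>)
      then show ?thesis using sum_cell[OF cov(1)[OF s] i] by simp
    qed
    moreover have "(\<Sum>i\<in>{1..N} - {j}. tab \<sigma> (j, i)) = k j" if j: "j \<in> {1..N}" for j
    proof -
      have "(\<Sum>i\<in>{1..N} - {j}. tab \<sigma> (j, i)) = (\<Sum>i\<in>{1..N}. cell \<sigma> j i)"
        by (rule sum.mono_neutral_cong_left)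
          (use j cell_outside[OF cov(1)[OF s] j diag] in \<open>auto simp: tab_def arcs_def\<close>)
      then show ?thesis using cov(2)[OF s j] by simp
    qed
    moreover have "{e \<in> arcs N. 0 < tab \<sigma> e} = F"
    proof -
      have "e \<in> {e \<in> arcs N. 0 < tab \<sigma> e} \<longleftrightarrow> e \<in> F" for e
      proof -
        obtain j i where e: "e = (j, i)" by (cases e)
        show ?thesis
        proof (cases "e \<in> F")
          case True
          then show ?thesis using F cov(3)[OF s, of j i] e by (auto simp: tab_def)
        next
          case False
          then show ?thesis using cell_outside[OF cov(1)[OF s], of i j] e by (auto simp: tab_def arcs_def)
        qed
      qed
      then show ?thesis by blast
    qed
    ultimately show ?thesis by (auto simp: balanced_factors_def tab_def)
  qed
  have fibre_card: "real (card {\<sigma> \<in> covering. tab \<sigma> = a}) = factor_weight N k a" if a: "a \<in> ?A" for a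
  proof -
    \<comment> \<open>The table \<open>a\<close> completed by a zero diagonal.\<close>
    define b where "b j i = (if j = i then 0 else a (j, i))" for j i
    have a_row: "(\<Sum>j\<in>{1..N} - {i}. a (j, i)) = k i" and a_col: "(\<Sum>j\<in>{1..N} - {i}. a (i, j)) = k i"
      if "i \<in> {1..N}" for i using a that by (auto simp: balanced_factors_def)
    have supp: "0 < a e \<longleftrightarrow> e \<in> F" if "e \<in> arcs N" for e using a that by blast
    have row: "(\<Sum>j\<in>{1..N}. b j i) = k i" if i: "i \<in> {1..N}" for i
      unfolding a_row[OF i, symmetric]
      by (rule sum.mono_neutral_cong_right) (use i in \<open>auto simp: b_def\<close>)
    have col: "(\<Sum>i\<in>{1..N}. b j i) = k j" if j: "j \<in> {1..N}" for j
      unfolding a_col[OF j, symmetric]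
      by (rule sum.mono_neutral_cong_right) (use j in \<open>auto simp: b_def\<close>)
    have "{\<sigma> \<in> covering. tab \<sigma> = a} = {\<sigma> \<in> (SIGMA i:{1..N}. {1..k i}) \<rightarrow>\<^sub>E {1..N}.
        \<forall>i\<in>{1..N}. \<forall>j\<in>{1..N}. card {s \<in> {1..k i}. \<sigma> (i, s) = j} = b j i}" (is "?L = ?R")
    proof (intro equalityI subsetI)
      fix \<sigma> assume s: "\<sigma> \<in> ?L"
      then have \<sigma>: "\<sigma> \<in> assignments" and eq: "tab \<sigma> = a" using cov(1) by auto
      have "cell \<sigma> j i = b j i" if ij: "i \<in> {1..N}" "j \<in> {1..N}" for i j
      proof (cases "j = i")
        case True
        then show ?thesis using cell_outside[OF \<sigma> ij(1) diag] by (simp add: b_def)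
      next
        case False
        then show ?thesis using fun_cong[OF eq, of "(j, i)"] ij by (simp add: b_def tab_def arcs_def)
      qed
      moreover have "\<sigma> \<in> E \<rightarrow>\<^sub>E {1..N}"
        using \<sigma> in_nbrs_subset unfolding assignments_def by (rule PiE_mono[THEN subsetD, rotated])
      ultimately show "\<sigma> \<in> ?R" by (simp add: cell_def E_Sigma)
    next
      fix \<sigma> assume s: "\<sigma> \<in> ?R"
      then have ext: "\<sigma> \<in> E \<rightarrow>\<^sub>E {1..N}" by (simp add: E_Sigma)
      have c: "cell \<sigma> j i = b j i" if "i \<in> {1..N}" "j \<in> {1..N}" for i j using s that by (simp add: cell_def)
      have edge: "(\<sigma> (i, t), i) \<in> F" if i: "i \<in> {1..N}" and t: "t \<in> {1..k i}" for i t
      proof -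
        have j: "\<sigma> (i, t) \<in> {1..N}" using PiE_mem[OF ext, of "(i, t)"] i t by (simp add: unknowns_def)
        have "t \<in> {s \<in> {1..k i}. \<sigma> (i, s) = \<sigma> (i, t)}" using t by simp
        then have "0 < cell \<sigma> (\<sigma> (i, t)) i" unfolding cell_def by (subst card_gt_0_iff) auto
        then have "0 < b (\<sigma> (i, t)) i" using c[OF i j] by simp
        then show ?thesis using supp[of "(\<sigma> (i, t), i)"] i j by (auto simp: b_def arcs_def split: if_splits)
      qed
      have \<sigma>: "\<sigma> \<in> assignments"
        using ext edge by (auto simp: assignments_def PiE_iff unknowns_def in_nbrs_def)
      have bal: "\<sigma> \<in> balanced" using \<sigma> c col by (simp add: balanced_def card_fibre)
      have "0 < cell \<sigma> j i" if ji: "(j, i) \<in> F" for j i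
        using F supp[of "(j, i)"] c[of i j] ji by (auto simp: arcs_def b_def)
      then have "\<sigma> \<in> covering" using bal by (auto simp: covering_def)
      moreover have "tab \<sigma> = a"
      proof (rule extensionalityI[of _ "arcs N"])
        show "a \<in> extensional (arcs N)" using a by (simp add: balanced_factors_def PiE_def)
        fix e assume e: "e \<in> arcs N"
        then show "tab \<sigma> e = a e" using c[of "snd e" "fst e"] by (auto simp: tab_def arcs_def b_def)
      qed (simp add: tab_def)
      ultimately show "\<sigma> \<in> ?L" by simp
    qed
    then have "real (card {\<sigma> \<in> covering. tab \<sigma> = a}) = (\<Prod>i\<in>{1..N}. fact (k i) / (\<Prod>j\<in>{1..N}. fact (b j i)))"
      using card_functions_with_fibre_table[of "{1..N}" "\<lambda>i. {1..k i}" "{1..N}" b] row by simp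
    also have "\<dots> = factor_weight N k a"
      unfolding factor_weight_def
    proof (rule prod.cong[OF refl])
      fix i assume i: "i \<in> {1..N}"
      have "(\<Prod>j\<in>{1..N}. fact (b j i) :: real) = (\<Prod>j\<in>{1..N} - {i}. fact (a (j, i)))"
        by (rule prod.mono_neutral_cong_right) (use i in \<open>auto simp: b_def\<close>)
      then show "fact (k i) / (\<Prod>j\<in>{1..N}. fact (b j i) :: real) = fact (k i) / (\<Prod>j\<in>{1..N} - {i}. fact (a (j, i)))"
        by simp
    qed
    finally show ?thesis .
  qed
  have fc: "finite covering" by (rule finite_subset[OF _ finite_assignments]) (auto simp: covering_def balanced_def)
  have fA: "finite ?A" using finite_balanced_factors by simp
  have "(\<Sum>a\<in>?A. \<Sum>\<sigma>\<in>{\<sigma> \<in> covering. tab \<sigma> = a}. 1::real) = (\<Sum>\<sigma>\<in>covering. 1)"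
    by (rule sum.group[OF fc fA]) (use tab_in in blast)
  then have "(\<Sum>a\<in>?A. real (card {\<sigma> \<in> covering. tab \<sigma> = a})) = real (card covering)" by simp
  moreover have "(\<Sum>a\<in>?A. real (card {\<sigma> \<in> covering. tab \<sigma> = a})) = (\<Sum>a\<in>?A. factor_weight N k a)"
    by (intro sum.cong refl fibre_card)
  ultimately show ?thesis by (simp add: exact_support_weight_def)
qed

end

section \<open>Asymptotics of the degree and of the exact-support weight\<close>

lemma sqrt_power_times_geometric:
  fixes \<rho> c :: real
  assumes "0 \<le> \<rho>" "\<rho> < 1" "0 < c"
  shows "(\<lambda>m. sqrt (c * real m) ^ n * \<rho> ^ m) \<longlonglongrightarrow> 0"
proof (cases "\<rho> = 0")
  case True
  then have "\<forall>\<^sub>F m in sequentially. sqrt (c * real m) ^ n * \<rho> ^ m = 0"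
    by (intro eventually_mono[OF eventually_gt_at_top[of 0]]) simp
  then show ?thesis by (rule tendsto_eventually)
next
  case False
  define d where "d = - ln \<rho>"
  have d: "0 < d" using assms False by (simp add: d_def ln_less_zero)
  have \<rho>: "\<rho> ^ m = 1 / exp (d * real m)" for m
  proof -
    have "\<rho> ^ m = exp (ln \<rho>) ^ m" using assms False by simp
    also have "\<dots> = exp (- (d * real m))" by (simp add: d_def exp_of_nat2_mult)
    finally show ?thesis by (simp add: exp_minus divide_inverse)
  qed
  have "(\<lambda>m. (d * real m) ^ n / exp (d * real m)) \<longlonglongrightarrow> 0"
    by (rule filterlim_compose[OF tendsto_power_div_exp_0])
      (intro filterlim_tendsto_pos_mult_at_top[OF tendsto_const d] filterlim_real_sequentially)
  then have "(\<lambda>m. ((c + 1) / d) ^ n * ((d * real m) ^ n / exp (d * real m))) \<longlonglongrightarrow> ((c + 1) / d) ^ n * 0"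
    by (intro tendsto_mult tendsto_const)
  then have lim: "(\<lambda>m. ((c + 1) / d) ^ n * ((d * real m) ^ n / exp (d * real m))) \<longlonglongrightarrow> 0" by simp
  have le: "sqrt (c * real m) ^ n * \<rho> ^ m \<le> ((c + 1) / d) ^ n * ((d * real m) ^ n / exp (d * real m))"
    if "0 < m" for m
  proof -
    have "sqrt (c * real m) \<le> (c + 1) * real m"
    proof (rule real_le_lsqrt)
      have "c * real m \<le> (c + 1) * real m" by (simp add: mult_right_mono)
      also have "\<dots> \<le> ((c + 1) * real m) ^ 2"
      proof -
        have "1 * 1 \<le> (c + 1) * real m" using assms(3) that by (intro mult_mono) auto
        then show ?thesis using mult_left_mono[of 1 "(c + 1) * real m" "(c + 1) * real m"] by (simp add: power2_eq_square)
      qed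
      finally show "c * real m \<le> ((c + 1) * real m)\<^sup>2" .
    qed (use assms(3) in auto)
    then have "sqrt (c * real m) ^ n \<le> ((c + 1) * real m) ^ n" using assms(3) by (intro power_mono) auto
    also have "\<dots> = ((c + 1) / d) ^ n * (d * real m) ^ n"
      unfolding power_mult_distrib[symmetric] using d by simp
    finally have "sqrt (c * real m) ^ n * (1 / exp (d * real m)) \<le>
        ((c + 1) / d) ^ n * (d * real m) ^ n * (1 / exp (d * real m))"
      by (intro mult_right_mono) auto
    then show ?thesis by (simp add: \<rho>)
  qed
  show ?thesis
  proof (rule tendsto_sandwich[OF _ _ tendsto_const lim])
    show "\<forall>\<^sub>F m in sequentially. 0 \<le> sqrt (c * real m) ^ n * \<rho> ^ m" using assms by simp
    show "\<forall>\<^sub>F m in sequentially. sqrt (c * real m) ^ n * \<rho> ^ m \<le>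
        ((c + 1) / d) ^ n * ((d * real m) ^ n / exp (d * real m))"
      using eventually_gt_at_top[of "0::nat"] by eventually_elim (rule le)
  qed
qed

context flow_min
begin

abbreviation deg :: "nat \<Rightarrow> nat" where
  "deg m \<equiv> algebraic_degree N (\<lambda>i. m * k i) F"

lemma deg_eq: "deg m = card (bal m)"
  by (rule game.algebraic_degree_eq_card_balanced[OF scaled_game])

lemma powr_half_eq:
  assumes "0 < m"
  shows "(2 * pi * real m) powr ((real N - real (num_components N F)) / 2) = sqrt (2 * pi * real m) ^ card S"
proof -
  have "(2 * pi * real m) powr ((real N - real (num_components N F)) / 2) =
      ((2 * pi * real m) powr (1 / 2)) powr real (card S)"
    unfolding powr_powr by (simp add: card_S)
  also have "\<dots> = sqrt (2 * pi * real m) powr real (card S)" by (simp add: powr_half_sqrt)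
  also have "\<dots> = sqrt (2 * pi * real m) ^ card S" using assms by (intro powr_realpow) simp
  finally show ?thesis .
qed

theorem degree_asymptotics:
  "(\<lambda>m. real (deg m)) \<sim>[sequentially]
   (\<lambda>m. cap ^ m / ((2 * pi * real m) powr ((real N - real (num_components N F)) / 2) *
      sqrt (reduced_cov_det N k F p R)))"
proof (rule asymp_equivI')
  let ?d = "sqrt (reduced_cov_det N k F p R)"
  have d: "0 < ?d" using reduced_cov_det_pos by simp
  have "(\<lambda>m. real (card (bal m)) / cap ^ m * sqrt (2 * pi * real m) ^ card S * ?d) \<longlonglongrightarrow> 1 / ?d * ?d"
    by (intro tendsto_mult local_limit tendsto_const)
  then have "(\<lambda>m. real (card (bal m)) / cap ^ m * sqrt (2 * pi * real m) ^ card S * ?d) \<longlonglongrightarrow> 1"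
    using d by simp
  moreover have "\<forall>\<^sub>F m in sequentially. real (card (bal m)) / cap ^ m * sqrt (2 * pi * real m) ^ card S * ?d =
      real (deg m) / (cap ^ m / ((2 * pi * real m) powr ((real N - real (num_components N F)) / 2) * ?d))"
    using eventually_gt_at_top[of "0::nat"] by eventually_elim (simp add: powr_half_eq deg_eq)
  ultimately show "(\<lambda>m. real (deg m) /
      (cap ^ m / ((2 * pi * real m) powr ((real N - real (num_components N F)) / 2) * ?d))) \<longlonglongrightarrow> 1"
    by (rule Lim_transform_eventually)
qed

text \<open>This is \<open>cov_pos_definite\<close>, read in the enumeration of \<open>S\<close>.\<close>

theorem reduced_cov_pos_definite: "pos_definite (reduced_cov N k F p R)"
proof -
  let ?A = "flow_cov N k F p" and ?xs = "sorted_list_of_set S"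
  let ?M = "reduced_cov N k F p R" and ?n = "card S"
  have M: "?M \<in> carrier_mat ?n ?n" "\<And>a b. a < ?n \<Longrightarrow> b < ?n \<Longrightarrow> ?M $$ (a, b) = ?A (?xs ! a) (?xs ! b)"
    by (auto simp: list_mat_reduced_cov[symmetric] list_mat_def)
  have "transpose_mat ?M = ?M"
    by (rule eq_matI) (use M in \<open>auto simp: cov_sym\<close>)
  moreover have "0 < scalar_prod v (?M *\<^sub>v v)" if v: "v \<in> carrier_vec ?n" "v \<noteq> 0\<^sub>v ?n" for v
  proof -
    have bij: "bij_betw (\<lambda>a. ?xs ! a) {..<?n} S"
      using bij_betw_nth[of ?xs "{..<?n}" S] by simp
    define w where "w j = v $ (the_inv_into {..<?n} (\<lambda>a. ?xs ! a) j)" for j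
    have w: "w (?xs ! a) = v $ a" if "a < ?n" for a
      using the_inv_into_f_f[OF bij_betw_imp_inj_on[OF bij], of a] that by (simp add: w_def)
    have "quad_form ?A S w = (\<Sum>a<?n. \<Sum>b<?n. w (?xs ! a) * ?A (?xs ! a) (?xs ! b) * w (?xs ! b))"
      unfolding quad_form_def by (simp add: sum.reindex_bij_betw[OF bij, symmetric])
    also have "\<dots> = (\<Sum>a<?n. v $ a * (\<Sum>b<?n. ?M $$ (a, b) * v $ b))"
      by (intro sum.cong refl) (simp add: w M(2) sum_distrib_left mult.assoc)
    also have "\<dots> = scalar_prod v (?M *\<^sub>v v)"
      using v(1) M(1) by (auto simp: scalar_prod_def lessThan_atLeast0 intro!: sum.cong)
    finally have eq: "quad_form ?A S w = scalar_prod v (?M *\<^sub>v v)" .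
    have "\<exists>a<?n. v $ a \<noteq> 0"
    proof (rule ccontr)
      assume "\<not> ?thesis"
      then have "v = 0\<^sub>v ?n" using v(1) by (intro eq_vecI) auto
      then show False using v(2) by simp
    qed
    then obtain a where a: "a < ?n" "v $ a \<noteq> 0" by blast
    have "?xs ! a \<in> S" using bij a(1) by (auto simp: bij_betw_def)
    then have "0 < quad_form ?A S w" using a w by (intro cov_pos_definite bexI[of _ "?xs ! a"]) auto
    then show ?thesis by (simp add: eq)
  qed
  ultimately show ?thesis using M(1) by (auto simp: pos_definite_def)
qed

abbreviation full :: "nat \<Rightarrow> (nat \<times> nat \<Rightarrow> nat) set" where
  "full m \<equiv> game.covering N (\<lambda>i. m * k i) F"

text \<open>All \<open>m k\<^sub>i\<close> independent choices of the factors \<open>L\<^sub>i\<close> must avoid \<open>z\<^sub>j\<close>, and \<open>k\<^sub>i \<ge> 1\<close>.\<close>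

lemma avoiding_bound:
  assumes "(j, i) \<in> F"
  shows "real (card {\<sigma> \<in> bal m. game.cell (\<lambda>i. m * k i) \<sigma> j i = 0}) / cap ^ m \<le> (1 - q i j) ^ m"
proof -
  let ?B = "{\<sigma> \<in> bal m. game.cell (\<lambda>i. m * k i) \<sigma> j i = 0}"
  let ?nb = "\<lambda>i'. in_nbrs F i' - (if i' = i then {j} else {})"
  have i: "i \<in> {1..N}" using F_range[OF assms] by simp
  have "real (card ?B) / cap ^ m = (\<Sum>\<sigma>\<in>?B. weight m \<sigma>)" by (simp add: weight_bal)
  also have "\<dots> \<le> (\<Sum>\<sigma>\<in>(\<Pi>\<^sub>E e\<in>Em m. ?nb (fst e)). weight m \<sigma>)"
  proof (rule sum_mono2)
    show "finite (\<Pi>\<^sub>E e\<in>Em m. ?nb (fst e))" by (intro finite_PiE) auto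
    show "?B \<subseteq> (\<Pi>\<^sub>E e\<in>Em m. ?nb (fst e))"
    proof
      fix \<sigma> assume \<sigma>: "\<sigma> \<in> ?B"
      then have as: "\<sigma> \<in> assignments_m m" by (simp add: bal_iff)
      have "\<sigma> e \<in> ?nb (fst e)" if e: "e \<in> Em m" for e
      proof -
        have "\<sigma> e \<noteq> j" if "fst e = i"
        proof
          assume "\<sigma> e = j"
          then have "snd e \<in> {s \<in> {1..m * k i}. \<sigma> (i, s) = j}" using e \<open>fst e = i\<close> by (auto simp: Em_Sigma)
          moreover have "{s \<in> {1..m * k i}. \<sigma> (i, s) = j} = {}"
            using \<sigma> by (simp add: game.cell_def[OF scaled_game])
          ultimately show False by blast
        qed
        then show ?thesis using assignments_m_range[OF as e] by auto
      qed
      moreover have "\<sigma> \<in> extensional (Em m)" using as by (simp add: assignments_m_def PiE_def)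
      ultimately show "\<sigma> \<in> (\<Pi>\<^sub>E e\<in>Em m. ?nb (fst e))" by (simp add: PiE_iff)
    qed
    fix \<sigma> assume "\<sigma> \<in> (\<Pi>\<^sub>E e\<in>Em m. ?nb (fst e)) - ?B"
    then have "\<sigma> \<in> (\<Pi>\<^sub>E e\<in>Em m. ?nb (fst e))" by (rule DiffD1)
    then have "\<sigma> \<in> assignments_m m"
      unfolding assignments_m_def by (rule PiE_mono[THEN subsetD, rotated]) auto
    then show "0 \<le> weight m \<sigma>" by (rule weight_nonneg)
  qed
  also have "\<dots> = (\<Prod>e\<in>Em m. \<Sum>l\<in>?nb (fst e). q (fst e) l)"
    unfolding weight_def by (rule prod_sum_PiE[symmetric]) auto
  also have "\<dots> = (\<Prod>i'\<in>{1..N}. (\<Sum>l\<in>?nb i'. q i' l) ^ (m * k i'))"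
    by (rule prod_Em[of "\<lambda>i'. \<Sum>l\<in>?nb i'. q i' l"])
  also have "\<dots> = (\<Prod>i'\<in>{1..N}. if i' = i then (1 - q i j) ^ (m * k i) else 1)"
  proof (rule prod.cong[OF refl])
    fix i' assume i': "i' \<in> {1..N}"
    show "(\<Sum>l\<in>?nb i'. q i' l) ^ (m * k i') = (if i' = i then (1 - q i j) ^ (m * k i) else 1)"
      using sum_q[OF i'] sum_diff1[of "in_nbrs F i" "q i" j] assms by (auto simp: in_nbrs_def[of F i, symmetric] mem_in_nbrs)
  qed
  also have "\<dots> = (1 - q i j) ^ (m * k i)" using i by simp
  also have "\<dots> \<le> (1 - q i j) ^ m"
  proof (rule power_decreasing)
    show "m \<le> m * k i" using k_pos[OF i] by simp
    have "q i j \<le> (\<Sum>l\<in>in_nbrs F i. q i l)"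
      using assms q_pos by (intro member_le_sum) (auto simp: mem_in_nbrs less_imp_le)
    then show "0 \<le> 1 - q i j" using sum_q[OF i] by simp
    show "1 - q i j \<le> 1" using q_pos[OF assms] by simp
  qed
  finally show ?thesis .
qed

text \<open>By the union bound over the arcs, the balanced assignments missing an arc have exponentially
  small total probability, whereas \<open>local_limit\<close> shows that all balanced assignments together have
  probability of order \<open>m\<^bsup>-card S/2\<^esup>\<close>.\<close>

theorem exact_support_dominates:
  "(\<lambda>m. exact_support_weight N (\<lambda>i. m * k i) F / real (deg m)) \<longlonglongrightarrow> 1"
proof -
  let ?d = "sqrt (reduced_cov_det N k F p R)" and ?s = "\<lambda>m. sqrt (2 * pi * real m) ^ card S"
  have d: "0 < ?d" using reduced_cov_det_pos by simp
  have miss: "bal m - full m \<subseteq> (\<Union>(j, i)\<in>F. {\<sigma> \<in> bal m. game.cell (\<lambda>i. m * k i) \<sigma> j i = 0})" for m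
    by (auto simp: game.covering_def[OF scaled_game])
  have sub: "full m \<subseteq> bal m" for m by (auto simp: game.covering_def[OF scaled_game])
  have bound: "real (card (bal m - full m)) / cap ^ m * ?s m \<le> (\<Sum>(j, i)\<in>F. ?s m * (1 - q i j) ^ m)" for m
  proof -
    have "card (bal m - full m) \<le> card (\<Union>(j, i)\<in>F. {\<sigma> \<in> bal m. game.cell (\<lambda>i. m * k i) \<sigma> j i = 0})"
      by (rule card_mono[OF _ miss]) (auto intro!: finite_UN_I)
    also have "\<dots> \<le> (\<Sum>e\<in>F. card (case e of (j, i) \<Rightarrow> {\<sigma> \<in> bal m. game.cell (\<lambda>i. m * k i) \<sigma> j i = 0}))"
      by (rule card_UN_le[OF finite_F])
    finally have "real (card (bal m - full m)) / cap ^ m \<le>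
        real (\<Sum>e\<in>F. card (case e of (j, i) \<Rightarrow> {\<sigma> \<in> bal m. game.cell (\<lambda>i. m * k i) \<sigma> j i = 0})) / cap ^ m"
      using cap_pos by (intro divide_right_mono) (simp_all only: of_nat_le_iff, simp)
    also have "\<dots> \<le> (\<Sum>(j, i)\<in>F. (1 - q i j) ^ m)"
      unfolding of_nat_sum sum_divide_distrib using avoiding_bound by (intro sum_mono) auto
    finally have "real (card (bal m - full m)) / cap ^ m * ?s m \<le> (\<Sum>(j, i)\<in>F. (1 - q i j) ^ m) * ?s m"
      by (intro mult_right_mono) auto
    then show ?thesis by (simp add: sum_distrib_right case_prod_unfold mult.commute)
  qed
  have "(\<lambda>m. \<Sum>(j, i)\<in>F. ?s m * (1 - q i j) ^ m) \<longlonglongrightarrow> (\<Sum>(j, i)\<in>F. 0)"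
  proof (intro tendsto_sum, clarsimp)
    fix j i assume ji: "(j, i) \<in> F"
    have i: "i \<in> {1..N}" using F_range[OF ji] by simp
    have "q i j \<le> (\<Sum>l\<in>in_nbrs F i. q i l)"
      using ji q_pos by (intro member_le_sum) (auto simp: mem_in_nbrs less_imp_le)
    then show "(\<lambda>m. ?s m * (1 - q i j) ^ m) \<longlonglongrightarrow> 0"
      using sum_q[OF i] q_pos[OF ji] by (intro sqrt_power_times_geometric) auto
  qed
  then have upper: "(\<lambda>m. \<Sum>(j, i)\<in>F. ?s m * (1 - q i j) ^ m) \<longlonglongrightarrow> 0" by (simp add: case_prod_unfold)
  have "(\<lambda>m. real (card (bal m - full m)) / cap ^ m * ?s m) \<longlonglongrightarrow> 0"
    by (rule tendsto_sandwich[OF _ _ tendsto_const upper]) (use bound cap_pos in auto)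
  then have "(\<lambda>m. 1 - (real (card (bal m - full m)) / cap ^ m * ?s m) / (real (card (bal m)) / cap ^ m * ?s m)) \<longlonglongrightarrow>
      1 - 0 / (1 / ?d)"
    using d by (intro tendsto_diff tendsto_const tendsto_divide local_limit) auto
  then have lim: "(\<lambda>m. 1 - (real (card (bal m - full m)) / cap ^ m * ?s m) / (real (card (bal m)) / cap ^ m * ?s m)) \<longlonglongrightarrow> 1"
    by simp
  have "\<forall>\<^sub>F m in sequentially. 0 < real (card (bal m)) / cap ^ m * ?s m"
    using local_limit d by (intro order_tendstoD(1)[OF local_limit]) auto
  then have "\<forall>\<^sub>F m in sequentially. 1 - (real (card (bal m - full m)) / cap ^ m * ?s m) / (real (card (bal m)) / cap ^ m * ?s m) =
      exact_support_weight N (\<lambda>i. m * k i) F / real (deg m)"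
  proof eventually_elim
    case (elim m)
    have s: "?s m \<noteq> 0" using elim by (intro notI) (simp only: mult_zero_right less_irrefl)
    have D: "real (card (bal m)) \<noteq> 0" using elim by (intro notI) (simp only: div_0 mult_zero_left less_irrefl)
    have "card (full m) \<le> card (bal m)" by (rule card_mono[OF finite_bal sub])
    then have c: "real (card (bal m - full m)) = real (card (bal m)) - real (card (full m))"
      using card_Diff_subset[OF finite_subset[OF sub finite_bal] sub] by simp
    have "(real (card (bal m - full m)) / cap ^ m * ?s m) / (real (card (bal m)) / cap ^ m * ?s m) =
        real (card (bal m - full m)) / real (card (bal m))" using s D cap_pos by simp
    then show ?case
      using D unfolding c deg_eq game.exact_support_weight_eq[OF scaled_game] by (simp add: diff_divide_distrib)
  qed
  with lim show ?thesis by (rule Lim_transform_eventually)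
qed

end

context flow
begin

lemma right_transversal_exists: "\<exists>R. right_transversal N F R"
proof -
  define r where "r C = (SOME j. j \<in> {1..N} \<and> Inr j \<in> C)" for C :: "(nat + nat) set"
  have r: "r C \<in> {1..N} \<and> Inr (r C) \<in> C" if "C \<in> bip_components N F" for C
    unfolding r_def using component_has_right_vertex[OF that] by (intro someI_ex[of "\<lambda>j. j \<in> {1..N} \<and> Inr j \<in> C"]) blast
  have uniq: "C = D" if "C \<in> bip_components N F" "D \<in> bip_components N F" "v \<in> C" "v \<in> D" for C D v
    using component_eq_comp(1)[OF that(1,3)] component_eq_comp(1)[OF that(2,4)] by simp
  have "\<exists>!j. j \<in> r ` bip_components N F \<and> Inr j \<in> C" if C: "C \<in> bip_components N F" for C
  proof (rule ex1I[of _ "r C"])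
    fix j assume "j \<in> r ` bip_components N F \<and> Inr j \<in> C"
    then obtain D where "D \<in> bip_components N F" "j = r D" "Inr (r D) \<in> C" by blast
    then show "j = r C" using uniq[OF C, of D "Inr (r D)"] r by blast
  qed (use C r in blast)
  then have "right_transversal N F (r ` bip_components N F)"
    unfolding right_transversal_def using r by blast
  then show ?thesis ..
qed

end

theorem theorem6p6:
  fixes N :: nat and k :: "nat \<Rightarrow> nat" and F :: "(nat \<times> nat) set"
  assumes "2 \<le> N"
    and "\<forall>i\<in>{1..N}. 0 < k i"
    and "F \<subseteq> arcs N"
    and "\<exists>a\<in>flow_polytope N k F. \<forall>e\<in>F. 0 < a e"
  shows "\<exists>p.
    \<comment> \<open>(i)\<close>
    is_arg_max (flow_entropy N k F) (\<lambda>a. a \<in> flow_polytope N k F) p \<and>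
    (\<forall>p'. is_arg_max (flow_entropy N k F) (\<lambda>a. a \<in> flow_polytope N k F) p' \<longrightarrow> p' = p) \<and>
    0 < capacity N k F \<and>
    ln (capacity N k F) = flow_entropy N k F p \<and>
    (\<forall>e\<in>F. 0 < p e) \<and>
    (\<exists>z. cap_minimizer N k F z) \<and>
    (\<forall>z. cap_minimizer N k F z \<longrightarrow>
      (\<forall>z'. cap_minimizer N k F z' \<longleftrightarrow> component_rescaling N F z z') \<and>
      (\<forall>(j, i)\<in>F. p (j, i) = real (k i) * z j / lin_form F z i)) \<and>
    \<comment> \<open>(ii)\<close>
    (\<forall>R. right_transversal N F R \<longrightarrow>
      pos_definite (reduced_cov N k F p R) \<and>
      (\<forall>R'. right_transversal N F R' \<longrightarrow>
        reduced_cov_det N k F p R' = reduced_cov_det N k F p R) \<and>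
      (\<lambda>m. real (algebraic_degree N (\<lambda>i. m * k i) F)) \<sim>[sequentially]
      (\<lambda>m. capacity N k F ^ m /
         ((2 * pi * real m) powr ((real N - real (num_components N F)) / 2) *
          sqrt (reduced_cov_det N k F p R)))) \<and>
    \<comment> \<open>(iii)\<close>
    (\<lambda>m. exact_support_weight N (\<lambda>i. m * k i) F /
         real (algebraic_degree N (\<lambda>i. m * k i) F)) \<longlonglongrightarrow> 1"
proof -
  interpret flow N k F by unfold_locales (use assms in auto)
  obtain z where z: "cap_minimizer N k F z" using cap_minimizer_exists by blast
  have zp: "z \<in> pos_vectors N" using z by (simp add: cap_minimizer_def)
  let ?p = "gibbs_flow z"
  have fm: "flow_min N k F z R" if "right_transversal N F R" for R
    by unfold_locales (use z that in auto)
  have det: "reduced_cov_det N k F ?p R' = reduced_cov_det N k F ?p R"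
    if R: "right_transversal N F R" and R': "right_transversal N F R'" for R R'
  proof -
    have "real (card (flow_min.S N R')) = real (card (flow_min.S N R))"
      by (simp only: flow_min.card_S[OF fm[OF R]] flow_min.card_S[OF fm[OF R']])
    then have c: "card (flow_min.S N R') = card (flow_min.S N R)" by simp
    have "1 / sqrt (reduced_cov_det N k F ?p R') = 1 / sqrt (reduced_cov_det N k F ?p R)"
      using flow_min.local_limit[OF fm[OF R']] flow_min.local_limit[OF fm[OF R]] unfolding c by (rule LIMSEQ_unique)
    then show ?thesis by simp
  qed
  obtain R0 where R0: "right_transversal N F R0" using right_transversal_exists by blast
  show ?thesis
  proof (intro exI[of _ ?p] conjI allI impI)
    show "is_arg_max (flow_entropy N k F) (\<lambda>a. a \<in> flow_polytope N k F) ?p"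
      by (simp add: maximum_entropy_duality(1)[OF z])
    show "p' = ?p" if "is_arg_max (flow_entropy N k F) (\<lambda>a. a \<in> flow_polytope N k F) p'" for p'
      using that by (simp add: maximum_entropy_duality(1)[OF z])
    show "0 < capacity N k F" using capacity_eq[OF z] by simp
    show "ln (capacity N k F) = flow_entropy N k F ?p" by (rule maximum_entropy_duality(2)[OF z])
    show "\<forall>e\<in>F. 0 < ?p e" using gibbs_flow_pos[OF zp] by blast
    show "\<exists>z. cap_minimizer N k F z" using z by blast
    show "cap_minimizer N k F z'' \<longleftrightarrow> component_rescaling N F z' z''" if "cap_minimizer N k F z'" for z' z''
      by (rule minimizer_iff_rescaling[OF that])
    show "\<forall>(j, i)\<in>F. ?p (j, i) = real (k i) * z' j / lin_form F z' i" if z': "cap_minimizer N k F z'" for z'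
      unfolding gibbs_flow_unique[OF z' z] by (auto simp: gibbs_flow_def)
    show "pos_definite (reduced_cov N k F ?p R)" if "right_transversal N F R" for R
      by (rule flow_min.reduced_cov_pos_definite[OF fm[OF that]])
    show "reduced_cov_det N k F ?p R' = reduced_cov_det N k F ?p R"
      if "right_transversal N F R" "right_transversal N F R'" for R R'
      by (rule det[OF that])
    show "(\<lambda>m. real (algebraic_degree N (\<lambda>i. m * k i) F)) \<sim>[sequentially]
      (\<lambda>m. capacity N k F ^ m / ((2 * pi * real m) powr ((real N - real (num_components N F)) / 2) *
          sqrt (reduced_cov_det N k F ?p R)))" if "right_transversal N F R" for R
      by (rule flow_min.degree_asymptotics[OF fm[OF that]])
    show "(\<lambda>m. exact_support_weight N (\<lambda>i. m * k i) F /
         real (algebraic_degree N (\<lambda>i. m * k i) F)) \<longlonglongrightarrow> 1"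
      by (rule flow_min.exact_support_dominates[OF fm[OF R0]])
  qed
qed

end
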